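(* Let $A$ be a basic finite dimensional algebra over a field $K$ and let $e$ be an idempotent of $A$ such that $\operatorname{add}A\cap\operatorname{add}DA=\operatorname{add}(1-e)A$. If $\operatorname{Hom}_A(DA,eA)=0$, then for every $m\ge1$ the $m$-th SGC extension $A^{[m]}$ of $A$ is Morita equivalent to the idempotent truncation \[e^{[m]}A^{(m)}e^{[m]}=\begin{pmatrix} eAe&0&0&\cdots&0&0\\ e(DA)e&eAe&0&&&0\\ 0&\ddots&\ddots&&&\vdots\\ \vdots&&\ddots&\ddots&&\vdots\\ 0&&&e(DA)e&eAe&0\\ 0&0&\cdots&0&(DA)e&A\end{pmatrix}\] of the $m$-th replicated algebra $A^{(m)}$, where $e^{[m]}$ is the $(m+1)\times(m+1)$ diagonal matrix with entries $(e,e,\dots,e,1)$. In particular, $A^{[m]}$ is Morita equivalent to \[\begin{pmatrix}(eAe)^{(m)}&0\\ [(1-e)Ae]_m&(1-e)A(1-e)\end{pmatrix}.\]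
   Context: Modules are finite dimensional right modules; $D=\operatorname{Hom}_K(-,K)$. SGC extensions: $A^{[0]}:=A$, $A^{[m+1]}:=\operatorname{End}_{A^{[m]}}(A^{[m]}\oplus DA^{[m]})$. Replicated algebra: for an algebra $B$, $B^{(m)}$ is the algebra of $(m+1)\times(m+1)$ matrices (indexed by $0,\dots,m$) with entries $(i,i)$ in $B$, entries $(i,i-1)$ in the bimodule $DB$ for $1\le i\le m$, and zero elsewhere; multiplication is matrix multiplication with products of two elements of $DB$ set to zero. $[(1-e)Ae]_m$ denotes the row vector with $m+1$ entries (indexed $0,\dots,m$) whose $m$-th entry is $(1-e)Ae$ and all other entries zero, viewed in the obvious way as a $(1-e)A(1-e)$-$(eAe)^{(m)}$-bimodule ($(eAe)^{(m)}$ acts through its $(m,m)$ diagonal entry $eAe$). *)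

theory Defs
  imports "HOL-Algebra.QuotRing" "Jordan_Normal_Form.VS_Connect"
begin

section \<open>Finite dimensional algebras and right modules\<close>

text \<open>
  The ground field is a type \<open>'k::field\<close>, seen as a ring record through \<open>class_ring\<close>.
  An algebra is a record of type \<open>('k, 'a) module\<close>, which provides both the ring operations
  and the scalar multiplication. (The locale \<open>algebra\<close> of HOL-Algebra is restricted to
  commutative algebras.) The zero algebra is allowed.
\<close>

locale fd_algebra = vs: vectorspace class_ring A + ring A
  for A :: "('k::field, 'a) module" (structure) +
  assumes fin_dim: "vs.fin_dim"
    and smult_mult_left:
      "x \<in> carrier A \<Longrightarrow> y \<in> carrier A \<Longrightarrow> (c \<odot> x) \<otimes> y = c \<odot> (x \<otimes> y)"
    and smult_mult_right:
      "x \<in> carrier A \<Longrightarrow> y \<in> carrier A \<Longrightarrow> x \<otimes> (c \<odot> y) = c \<odot> (x \<otimes> y)"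

definition alg_isomorphic :: "('k::field, 'a) module \<Rightarrow> ('k, 'b) module \<Rightarrow> bool" where
  "alg_isomorphic A B \<longleftrightarrow> (\<exists>h \<in> ring_iso A B. h \<in> LinearCombinations.module_hom class_ring A B)"

text \<open>The fields \<open>mult\<close> and \<open>one\<close>, which a module inherits from the record type, carry no meaning.\<close>

record ('k, 'm, 'a) rmodule = "('k, 'm) module" +
  ract :: "'m \<Rightarrow> 'a \<Rightarrow> 'm" (infixl \<open>\<lhd>\<index>\<close> 70)

record ('k, 'm, 'a, 'b) bimodule = "('k, 'm, 'a) rmodule" +
  lact :: "'b \<Rightarrow> 'm \<Rightarrow> 'm"

locale fd_rmodule = A: fd_algebra A + vs: vectorspace class_ring M
  for A :: "('k::field, 'a) module" and M :: "('k, 'm, 'a, 'z) rmodule_scheme" (structure) +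
  assumes fin_dim: "vs.fin_dim"
    and ract_closed: "x \<in> carrier M \<Longrightarrow> a \<in> carrier A \<Longrightarrow> x \<lhd> a \<in> carrier M"
    and ract_one: "x \<in> carrier M \<Longrightarrow> x \<lhd> \<one>\<^bsub>A\<^esub> = x"
    and ract_mult: "x \<in> carrier M \<Longrightarrow> a \<in> carrier A \<Longrightarrow> b \<in> carrier A \<Longrightarrow>
      x \<lhd> (a \<otimes>\<^bsub>A\<^esub> b) = (x \<lhd> a) \<lhd> b"
    and ract_add_left: "x \<in> carrier M \<Longrightarrow> y \<in> carrier M \<Longrightarrow> a \<in> carrier A \<Longrightarrow>
      (x \<oplus> y) \<lhd> a = (x \<lhd> a) \<oplus> (y \<lhd> a)"
    and ract_add_right: "x \<in> carrier M \<Longrightarrow> a \<in> carrier A \<Longrightarrow> b \<in> carrier A \<Longrightarrow>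
      x \<lhd> (a \<oplus>\<^bsub>A\<^esub> b) = (x \<lhd> a) \<oplus> (x \<lhd> b)"
    and ract_smult_left: "x \<in> carrier M \<Longrightarrow> a \<in> carrier A \<Longrightarrow> (c \<odot> x) \<lhd> a = c \<odot> (x \<lhd> a)"
    and ract_smult_right: "x \<in> carrier M \<Longrightarrow> a \<in> carrier A \<Longrightarrow> x \<lhd> (c \<odot>\<^bsub>A\<^esub> a) = c \<odot> (x \<lhd> a)"

text \<open>Homomorphisms are extensional on the carrier, so that equality of functions is
  equality of homomorphisms.\<close>

definition rmod_hom ::
  "('k::field, 'a) module \<Rightarrow> ('k, 'm, 'a, 'y) rmodule_scheme \<Rightarrow> ('k, 'n, 'a, 'z) rmodule_scheme
    \<Rightarrow> ('m \<Rightarrow> 'n) set" where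
  "rmod_hom A M N = {f \<in> LinearCombinations.module_hom class_ring M N \<inter> extensional (carrier M).
     \<forall>x\<in>carrier M. \<forall>a\<in>carrier A. f (x \<lhd>\<^bsub>M\<^esub> a) = f x \<lhd>\<^bsub>N\<^esub> a}"

definition rmod_isomorphic ::
  "('k::field, 'a) module \<Rightarrow> ('k, 'm, 'a, 'y) rmodule_scheme \<Rightarrow> ('k, 'n, 'a, 'z) rmodule_scheme
    \<Rightarrow> bool" where
  "rmod_isomorphic A M N \<longleftrightarrow> (\<exists>f \<in> rmod_hom A M N. bij_betw f (carrier M) (carrier N))"

definition End_alg ::
  "('k::field, 'a) module \<Rightarrow> ('k, 'm, 'a, 'z) rmodule_scheme \<Rightarrow> ('k, 'm \<Rightarrow> 'm) module" where
  "End_alg A M = \<lparr>carrier = rmod_hom A M M,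
     mult = compose (carrier M),
     one = (\<lambda>x\<in>carrier M. x),
     zero = (\<lambda>x\<in>carrier M. \<zero>\<^bsub>M\<^esub>),
     add = (\<lambda>f g. \<lambda>x\<in>carrier M. f x \<oplus>\<^bsub>M\<^esub> g x),
     smult = (\<lambda>c f. \<lambda>x\<in>carrier M. c \<odot>\<^bsub>M\<^esub> f x)\<rparr>"

definition with_ract :: "('k, 'm, 'z) module_scheme \<Rightarrow> ('m \<Rightarrow> 'a \<Rightarrow> 'm) \<Rightarrow> ('k, 'm, 'a) rmodule" where
  "with_ract V r = \<lparr>carrier = carrier V, mult = mult V, one = one V, zero = zero V, add = add V,
     smult = smult V, ract = r\<rparr>"

definition reg_mod :: "('k::field, 'a) module \<Rightarrow> ('k, 'a, 'a) rmodule" where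
  "reg_mod A = with_ract A (mult A)"

definition principal_mod :: "('k::field, 'a) module \<Rightarrow> 'a \<Rightarrow> ('k, 'a, 'a) rmodule" where
  "principal_mod A e = (reg_mod A)\<lparr>carrier := (\<lambda>x. e \<otimes>\<^bsub>A\<^esub> x) ` carrier A\<rparr>"

text \<open>The \<open>A\<close>-\<open>A\<close>-bimodule \<open>DA = Hom\<^sub>K(A, K)\<close>, with \<open>(a f b)(x) = f (b x a)\<close>.\<close>

definition dual_mod :: "('k::field, 'a) module \<Rightarrow> ('k, 'a \<Rightarrow> 'k, 'a, 'a) bimodule" where
  "dual_mod A = \<lparr>
     carrier = {f \<in> extensional (carrier A).
       (\<forall>x\<in>carrier A. \<forall>y\<in>carrier A. f (x \<oplus>\<^bsub>A\<^esub> y) = f x + f y) \<and>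
       (\<forall>c. \<forall>x\<in>carrier A. f (c \<odot>\<^bsub>A\<^esub> x) = c * f x)},
     mult = (\<lambda>f g. undefined),
     one = undefined,
     zero = (\<lambda>x\<in>carrier A. 0),
     add = (\<lambda>f g. \<lambda>x\<in>carrier A. f x + g x),
     smult = (\<lambda>c f. \<lambda>x\<in>carrier A. c * f x),
     ract = (\<lambda>f b. \<lambda>x\<in>carrier A. f (b \<otimes>\<^bsub>A\<^esub> x)),
     lact = (\<lambda>a f. \<lambda>x\<in>carrier A. f (x \<otimes>\<^bsub>A\<^esub> a))\<rparr>"

definition dsum_mod ::
  "('k, 'm, 'a, 'y) rmodule_scheme \<Rightarrow> ('k, 'n, 'a, 'z) rmodule_scheme \<Rightarrow> ('k, 'm \<times> 'n, 'a) rmodule" where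
  "dsum_mod M N = with_ract (direct_sum M N) (\<lambda>v a. (fst v \<lhd>\<^bsub>M\<^esub> a, snd v \<lhd>\<^bsub>N\<^esub> a))"

definition power_mod :: "('k, 'm, 'a, 'z) rmodule_scheme \<Rightarrow> nat \<Rightarrow> ('k, nat \<Rightarrow> 'm, 'a) rmodule" where
  "power_mod M n = \<lparr>carrier = {..<n} \<rightarrow>\<^sub>E carrier M,
     mult = (\<lambda>v w. undefined),
     one = undefined,
     zero = (\<lambda>i\<in>{..<n}. \<zero>\<^bsub>M\<^esub>),
     add = (\<lambda>v w. \<lambda>i\<in>{..<n}. v i \<oplus>\<^bsub>M\<^esub> w i),
     smult = (\<lambda>c v. \<lambda>i\<in>{..<n}. c \<odot>\<^bsub>M\<^esub> v i),
     ract = (\<lambda>v a. \<lambda>i\<in>{..<n}. v i \<lhd>\<^bsub>M\<^esub> a)\<rparr>"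

definition rsubmodule :: "('k::field, 'a) module \<Rightarrow> 'm set \<Rightarrow> ('k, 'm, 'a, 'z) rmodule_scheme \<Rightarrow> bool" where
  "rsubmodule A U M \<longleftrightarrow> VectorSpace.subspace class_ring U M \<and>
     (\<forall>u\<in>U. \<forall>a\<in>carrier A. u \<lhd>\<^bsub>M\<^esub> a \<in> U)"

definition direct_summand :: "('k::field, 'a) module \<Rightarrow> 'm set \<Rightarrow> ('k, 'm, 'a, 'z) rmodule_scheme \<Rightarrow> bool" where
  "direct_summand A U M \<longleftrightarrow> rsubmodule A U M \<and>
     (\<exists>V. rsubmodule A V M \<and> U \<inter> V = {\<zero>\<^bsub>M\<^esub>} \<and>
       (\<forall>x\<in>carrier M. \<exists>u\<in>U. \<exists>v\<in>V. x = u \<oplus>\<^bsub>M\<^esub> v))"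

text \<open>
  The category of finite dimensional right \<open>A\<close>-modules. A set of objects needs a fixed type of
  elements; \<open>nat \<Rightarrow> 'k\<close> contains a copy of every finite dimensional vector space, and the
  operations of a module on a subset of \<open>nat \<Rightarrow> 'k\<close> are arbitrary, so every finite
  dimensional right \<open>A\<close>-module is isomorphic to one in \<open>mod_cat A\<close>.
\<close>

definition mod_cat :: "('k::field, 'a) module \<Rightarrow> ('k, nat \<Rightarrow> 'k, 'a) rmodule set" where
  "mod_cat A = {M. fd_rmodule A M}"

definition add_cat ::
  "('k::field, 'a) module \<Rightarrow> ('k, 'm, 'a, 'z) rmodule_scheme \<Rightarrow> ('k, nat \<Rightarrow> 'k, 'a) rmodule set" where
  "add_cat A M = {X \<in> mod_cat A. \<exists>n U. direct_summand A U (power_mod M n) \<and>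
     rmod_isomorphic A X ((power_mod M n)\<lparr>carrier := U\<rparr>)}"

section \<open>Idempotents and basic algebras\<close>

definition is_idempotent :: "('k::field, 'a) module \<Rightarrow> 'a \<Rightarrow> bool" where
  "is_idempotent A e \<longleftrightarrow> e \<in> carrier A \<and> e \<otimes>\<^bsub>A\<^esub> e = e"

definition orthogonal_idempotents :: "('k::field, 'a) module \<Rightarrow> 'a \<Rightarrow> 'a \<Rightarrow> bool" where
  "orthogonal_idempotents A e f \<longleftrightarrow> e \<otimes>\<^bsub>A\<^esub> f = \<zero>\<^bsub>A\<^esub> \<and> f \<otimes>\<^bsub>A\<^esub> e = \<zero>\<^bsub>A\<^esub>"

definition primitive_idempotent :: "('k::field, 'a) module \<Rightarrow> 'a \<Rightarrow> bool" where
  "primitive_idempotent A e \<longleftrightarrow> is_idempotent A e \<and> e \<noteq> \<zero>\<^bsub>A\<^esub> \<and>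
     \<not> (\<exists>f g. is_idempotent A f \<and> is_idempotent A g \<and> f \<noteq> \<zero>\<^bsub>A\<^esub> \<and> g \<noteq> \<zero>\<^bsub>A\<^esub> \<and>
          orthogonal_idempotents A f g \<and> e = f \<oplus>\<^bsub>A\<^esub> g)"

definition basic_algebra :: "('k::field, 'a) module \<Rightarrow> bool" where
  "basic_algebra A \<longleftrightarrow> (\<exists>E. finite E \<and> (\<forall>e\<in>E. primitive_idempotent A e) \<and>
     (\<forall>e\<in>E. \<forall>f\<in>E. e \<noteq> f \<longrightarrow> orthogonal_idempotents A e f) \<and>
     (\<Oplus>\<^bsub>A\<^esub>e\<in>E. e) = \<one>\<^bsub>A\<^esub> \<and>
     (\<forall>e\<in>E. \<forall>f\<in>E. e \<noteq> f \<longrightarrow> \<not> rmod_isomorphic A (principal_mod A e) (principal_mod A f)))"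

definition corner :: "('k::field, 'a) module \<Rightarrow> 'a \<Rightarrow> ('k, 'a) module" where
  "corner A e = A\<lparr>carrier := {e \<otimes>\<^bsub>A\<^esub> x \<otimes>\<^bsub>A\<^esub> e | x. x \<in> carrier A}, one := e\<rparr>"

section \<open>Morita equivalence\<close>

text \<open>\<open>K\<close>-linear functors \<open>mod A \<rightarrow> mod B\<close>: \<open>F\<close> acts on objects, \<open>\<Phi> M N\<close> maps
  \<open>Hom(M, N)\<close> to \<open>Hom(F M, F N)\<close>.\<close>

definition klinear_functor ::
  "('k::field, 'a) module \<Rightarrow> ('k, 'b) module \<Rightarrow>
   (('k, nat \<Rightarrow> 'k, 'a) rmodule \<Rightarrow> ('k, nat \<Rightarrow> 'k, 'b) rmodule) \<Rightarrow>
   (('k, nat \<Rightarrow> 'k, 'a) rmodule \<Rightarrow> ('k, nat \<Rightarrow> 'k, 'a) rmodule \<Rightarrow>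
      ((nat \<Rightarrow> 'k) \<Rightarrow> (nat \<Rightarrow> 'k)) \<Rightarrow> ((nat \<Rightarrow> 'k) \<Rightarrow> (nat \<Rightarrow> 'k))) \<Rightarrow> bool" where
  "klinear_functor A B F \<Phi> \<longleftrightarrow>
     (\<forall>M\<in>mod_cat A. F M \<in> mod_cat B) \<and>
     (\<forall>M\<in>mod_cat A. \<forall>N\<in>mod_cat A. \<forall>f\<in>rmod_hom A M N. \<Phi> M N f \<in> rmod_hom B (F M) (F N)) \<and>
     (\<forall>M\<in>mod_cat A. \<Phi> M M (\<lambda>x\<in>carrier M. x) = (\<lambda>x\<in>carrier (F M). x)) \<and>
     (\<forall>L\<in>mod_cat A. \<forall>M\<in>mod_cat A. \<forall>N\<in>mod_cat A. \<forall>f\<in>rmod_hom A L M. \<forall>g\<in>rmod_hom A M N.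
        \<Phi> L N (compose (carrier L) g f) = compose (carrier (F L)) (\<Phi> M N g) (\<Phi> L M f)) \<and>
     (\<forall>M\<in>mod_cat A. \<forall>N\<in>mod_cat A. \<forall>f\<in>rmod_hom A M N. \<forall>g\<in>rmod_hom A M N.
        \<Phi> M N (\<lambda>x\<in>carrier M. f x \<oplus>\<^bsub>N\<^esub> g x) =
        (\<lambda>x\<in>carrier (F M). \<Phi> M N f x \<oplus>\<^bsub>F N\<^esub> \<Phi> M N g x)) \<and>
     (\<forall>M\<in>mod_cat A. \<forall>N\<in>mod_cat A. \<forall>c. \<forall>f\<in>rmod_hom A M N.
        \<Phi> M N (\<lambda>x\<in>carrier M. c \<odot>\<^bsub>N\<^esub> f x) = (\<lambda>x\<in>carrier (F M). c \<odot>\<^bsub>F N\<^esub> \<Phi> M N f x))"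

text \<open>\<open>\<eta>\<close> is a natural isomorphism from the identity of \<open>mod A\<close> to the endofunctor \<open>(H, \<Psi>)\<close>.\<close>

definition nat_iso_from_id ::
  "('k::field, 'a) module \<Rightarrow>
   (('k, nat \<Rightarrow> 'k, 'a) rmodule \<Rightarrow> ('k, nat \<Rightarrow> 'k, 'a) rmodule) \<Rightarrow>
   (('k, nat \<Rightarrow> 'k, 'a) rmodule \<Rightarrow> ('k, nat \<Rightarrow> 'k, 'a) rmodule \<Rightarrow>
      ((nat \<Rightarrow> 'k) \<Rightarrow> (nat \<Rightarrow> 'k)) \<Rightarrow> ((nat \<Rightarrow> 'k) \<Rightarrow> (nat \<Rightarrow> 'k))) \<Rightarrow>
   (('k, nat \<Rightarrow> 'k, 'a) rmodule \<Rightarrow> ((nat \<Rightarrow> 'k) \<Rightarrow> (nat \<Rightarrow> 'k))) \<Rightarrow> bool" where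
  "nat_iso_from_id A H \<Psi> \<eta> \<longleftrightarrow>
     (\<forall>M\<in>mod_cat A. \<eta> M \<in> rmod_hom A M (H M) \<and> bij_betw (\<eta> M) (carrier M) (carrier (H M))) \<and>
     (\<forall>M\<in>mod_cat A. \<forall>N\<in>mod_cat A. \<forall>f\<in>rmod_hom A M N.
        compose (carrier M) (\<eta> N) f = compose (carrier M) (\<Psi> M N f) (\<eta> M))"

definition morita_equivalent :: "('k::field, 'a) module \<Rightarrow> ('k, 'b) module \<Rightarrow> bool" where
  "morita_equivalent A B \<longleftrightarrow> fd_algebra A \<and> fd_algebra B \<and>
     (\<exists>F \<Phi> G \<Gamma> \<eta> \<epsilon>. klinear_functor A B F \<Phi> \<and> klinear_functor B A G \<Gamma> \<and>
        nat_iso_from_id A (\<lambda>M. G (F M)) (\<lambda>M N f. \<Gamma> (F M) (F N) (\<Phi> M N f)) \<eta> \<and>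
        nat_iso_from_id B (\<lambda>M. F (G M)) (\<lambda>M N f. \<Phi> (G M) (G N) (\<Gamma> M N f)) \<epsilon>)"

section \<open>SGC extensions\<close>

text \<open>
  Forming \<open>End\<^sub>A(A \<oplus> DA)\<close> changes the type of the elements, so before the construction can be
  iterated each algebra is replaced by an isomorphic one with elements in \<open>nat \<Rightarrow> 'k\<close>; it
  exists by \<open>coord_copy\<close> below. Thus \<open>sgc A m\<close> is \<open>A\<^bsup>[m]\<^esup>\<close> up to isomorphism of algebras.
\<close>

definition coord_copy :: "('k::field, 'a) module \<Rightarrow> ('k, nat \<Rightarrow> 'k) module" where
  "coord_copy A = (SOME B. fd_algebra B \<and> alg_isomorphic A B)"

lemma transport_algebra:
  fixes A :: "('k::field, 'a) module" and h :: "'a \<Rightarrow> 'b"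
  assumes A: "fd_algebra A" and inj: "inj_on h (carrier A)"
  shows "\<exists>B :: ('k, 'b) module. fd_algebra B \<and> alg_isomorphic A B"
proof -
  interpret A: fd_algebra A by (rule A)
  define g where "g = the_inv_into (carrier A) h"
  have gh [simp]: "x \<in> carrier A \<Longrightarrow> g (h x) = x" for x
    by (simp add: g_def the_inv_into_f_f inj)
  define B :: "('k, 'b) module" where "B = \<lparr>carrier = h ` carrier A,
     mult = (\<lambda>x y. h (g x \<otimes>\<^bsub>A\<^esub> g y)), one = h \<one>\<^bsub>A\<^esub>, zero = h \<zero>\<^bsub>A\<^esub>,
     add = (\<lambda>x y. h (g x \<oplus>\<^bsub>A\<^esub> g y)), smult = (\<lambda>c x. h (c \<odot>\<^bsub>A\<^esub> g x))\<rparr>"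
  have B_simps [simp]: "carrier B = h ` carrier A" "mult B = (\<lambda>x y. h (g x \<otimes>\<^bsub>A\<^esub> g y))"
    "one B = h \<one>\<^bsub>A\<^esub>" "zero B = h \<zero>\<^bsub>A\<^esub>" "add B = (\<lambda>x y. h (g x \<oplus>\<^bsub>A\<^esub> g y))"
    "smult B = (\<lambda>c x. h (c \<odot>\<^bsub>A\<^esub> g x))"
    by (simp_all add: B_def)
  have sc [simp]: "x \<in> carrier A \<Longrightarrow> c \<odot>\<^bsub>A\<^esub> x \<in> carrier A" for c x
    using A.vs.smult_closed[of c x] by simp
  have VA: "vectorspace class_ring A" by (rule A.vs.vectorspace_axioms)
  have add_inv: "\<exists>w\<in>carrier A. h (x \<oplus>\<^bsub>A\<^esub> w) = h \<zero>\<^bsub>A\<^esub>" if "x \<in> carrier A" for x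
    using that by (intro bexI[of _ "\<ominus>\<^bsub>A\<^esub> x"]) (simp_all add: A.vs.r_neg)
  have VB: "vectorspace class_ring B"
  proof (rule vs_criteria)
    show "field (class_ring :: 'k ring)" by (rule class_field.field_axioms)
  qed (use add_inv in \<open>auto simp: A.vs.a_ac A.vs.smult_r_distr
        A.vs.smult_l_distr[simplified] A.vs.smult_assoc1[simplified]
        A.vs.smult_one[simplified]\<close>)
  interpret VB: vectorspace class_ring B by (rule VB)
  have hom: "h \<in> LinearCombinations.module_hom class_ring A B"
    by (auto simp: LinearCombinations.module_hom_def)
  have "linear_map class_ring A B h"
    using VA VB hom
    by (auto simp: linear_map_def mod_hom_def mod_hom_axioms_def vectorspace_def)
  hence fin: "VB.fin_dim"
    by (rule linear_map.rank_nullity_main(2)[OF _ A.fin_dim]) simp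
  have ringB: "ring B"
  proof (rule ringI)
    show "abelian_group B"
      by (rule VB.abelian_group_axioms)
    show "monoid B"
      by (rule monoidI) (auto simp: A.m_assoc)
  qed (auto simp: A.l_distr A.r_distr)
  have "fd_algebra B"
    by (intro fd_algebra.intro VB ringB fd_algebra_axioms.intro fin)
      (auto simp: A.smult_mult_left A.smult_mult_right)
  moreover have "h \<in> ring_iso A B"
    using inj by (auto simp: ring_iso_def Ring.ring_hom_def bij_betw_def)
  ultimately show ?thesis using hom unfolding alg_isomorphic_def by blast
qed

lemma coord_copy:
  fixes A :: "('k::field, 'a) module"
  assumes A: "fd_algebra A"
  shows "fd_algebra (coord_copy A)" "alg_isomorphic A (coord_copy A)"
proof -
  interpret A: fd_algebra A by (rule A)
  obtain S where S: "finite S" "S \<subseteq> carrier A" "A.vs.span S = carrier A"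
    using A.fin_dim unfolding A.vs.fin_dim_def by blast
  have span: "\<exists>a. A.vs.lincomb a S = x" if "x \<in> carrier A" for x
  proof -
    have "x \<in> {A.vs.lincomb a S | a. a \<in> S \<rightarrow> carrier class_ring}"
      using that S(3) A.vs.finite_span[OF S(1,2)] by simp
    thus ?thesis by blast
  qed
  then obtain c where c: "\<And>x. x \<in> carrier A \<Longrightarrow> A.vs.lincomb (c x) S = x" by metis
  obtain en :: "nat \<Rightarrow> 'a" and n where en: "S = en ` {i. i < n}"
    using S(1) by (metis finite_imp_nat_seg_image_inj_on)
  have "inj_on (\<lambda>x i. c x (en i)) (carrier A)"
  proof (rule inj_onI)
    fix x y
    assume xy: "x \<in> carrier A" "y \<in> carrier A" "(\<lambda>i. c x (en i)) = (\<lambda>i. c y (en i))"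
    have "A.vs.lincomb (c x) S = A.vs.lincomb (c y) S"
      using S xy(3) by (intro A.vs.lincomb_cong) (auto simp: en fun_eq_iff)
    thus "x = y" using c xy by metis
  qed
  from transport_algebra[OF A this]
  have "\<exists>B :: ('k, nat \<Rightarrow> 'k) module. fd_algebra B \<and> alg_isomorphic A B" .
  from someI_ex[OF this]
  show "fd_algebra (coord_copy A)" "alg_isomorphic A (coord_copy A)"
    by (simp_all add: coord_copy_def)
qed

primrec sgc :: "('k::field, 'a) module \<Rightarrow> nat \<Rightarrow> ('k, nat \<Rightarrow> 'k) module" where
  "sgc A 0 = coord_copy A"
| "sgc A (Suc m) =
     coord_copy (End_alg (sgc A m) (dsum_mod (reg_mod (sgc A m)) (dual_mod (sgc A m))))"

section \<open>Replicated algebras and triangular matrix algebras\<close>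

text \<open>
  A matrix in the replicated algebra \<open>B\<^bsup>(m)\<^esup>\<close> is encoded as the pair \<open>(d, l)\<close> of its diagonal
  \<open>d i \<in> B\<close> at \<open>(i, i)\<close> for \<open>0 \<le> i \<le> m\<close> and its subdiagonal \<open>l i \<in> DB\<close> at \<open>(i, i - 1)\<close>
  for \<open>1 \<le> i \<le> m\<close>. In a product, the entry at \<open>(i, i - 1)\<close> is \<open>l i d' (i - 1) + d i l' i\<close>, and
  the entry at \<open>(i, i - 2)\<close> is a product of two elements of \<open>DB\<close>, hence zero.
\<close>

definition replicated ::
  "('k::field, 'b) module \<Rightarrow> nat \<Rightarrow> ('k, (nat \<Rightarrow> 'b) \<times> (nat \<Rightarrow> 'b \<Rightarrow> 'k)) module" where
  "replicated B m = \<lparr>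
     carrier = ({0..m} \<rightarrow>\<^sub>E carrier B) \<times> ({1..m} \<rightarrow>\<^sub>E carrier (dual_mod B)),
     mult = (\<lambda>(d, l) (d', l').
       (\<lambda>i\<in>{0..m}. d i \<otimes>\<^bsub>B\<^esub> d' i,
        \<lambda>i\<in>{1..m}. ract (dual_mod B) (l i) (d' (i - 1)) \<oplus>\<^bsub>dual_mod B\<^esub> lact (dual_mod B) (d i) (l' i))),
     one = (\<lambda>i\<in>{0..m}. \<one>\<^bsub>B\<^esub>, \<lambda>i\<in>{1..m}. \<zero>\<^bsub>dual_mod B\<^esub>),
     zero = (\<lambda>i\<in>{0..m}. \<zero>\<^bsub>B\<^esub>, \<lambda>i\<in>{1..m}. \<zero>\<^bsub>dual_mod B\<^esub>),
     add = (\<lambda>(d, l) (d', l').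
       (\<lambda>i\<in>{0..m}. d i \<oplus>\<^bsub>B\<^esub> d' i, \<lambda>i\<in>{1..m}. l i \<oplus>\<^bsub>dual_mod B\<^esub> l' i)),
     smult = (\<lambda>c (d, l).
       (\<lambda>i\<in>{0..m}. c \<odot>\<^bsub>B\<^esub> d i, \<lambda>i\<in>{1..m}. c \<odot>\<^bsub>dual_mod B\<^esub> l i))\<rparr>"

definition diag_idem ::
  "('k::field, 'a) module \<Rightarrow> 'a \<Rightarrow> nat \<Rightarrow> (nat \<Rightarrow> 'a) \<times> (nat \<Rightarrow> 'a \<Rightarrow> 'k)" where
  "diag_idem A e m =
     (\<lambda>i\<in>{0..m}. if i < m then e else \<one>\<^bsub>A\<^esub>, \<lambda>i\<in>{1..m}. \<zero>\<^bsub>dual_mod A\<^esub>)"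

definition truncated_matrices ::
  "('k::field, 'a) module \<Rightarrow> 'a \<Rightarrow> nat \<Rightarrow> ((nat \<Rightarrow> 'a) \<times> (nat \<Rightarrow> 'a \<Rightarrow> 'k)) set" where
  "truncated_matrices A e m =
     (\<Pi>\<^sub>E i\<in>{0..m}. if i < m then {e \<otimes>\<^bsub>A\<^esub> x \<otimes>\<^bsub>A\<^esub> e | x. x \<in> carrier A} else carrier A) \<times>
     (\<Pi>\<^sub>E i\<in>{1..m}.
        if i < m then {lact (dual_mod A) e (ract (dual_mod A) f e) | f. f \<in> carrier (dual_mod A)}
        else {ract (dual_mod A) f e | f. f \<in> carrier (dual_mod A)})"

text \<open>The algebra of matrices with rows \<open>(r, 0)\<close> and \<open>(x, s)\<close>, for an \<open>S\<close>-\<open>R\<close>-bimodule \<open>X\<close>,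
  encoded as triples \<open>(r, x, s)\<close>.\<close>

definition lower_tri ::
  "('k::field, 'r) module \<Rightarrow> ('k, 'x, 'r, 's) bimodule \<Rightarrow> ('k, 's) module \<Rightarrow> ('k, 'r \<times> 'x \<times> 's) module" where
  "lower_tri R X S = \<lparr>
     carrier = carrier R \<times> carrier X \<times> carrier S,
     mult = (\<lambda>(r, x, s) (r', x', s').
       (r \<otimes>\<^bsub>R\<^esub> r', ract X x r' \<oplus>\<^bsub>X\<^esub> lact X s x', s \<otimes>\<^bsub>S\<^esub> s')),
     one = (\<one>\<^bsub>R\<^esub>, \<zero>\<^bsub>X\<^esub>, \<one>\<^bsub>S\<^esub>),
     zero = (\<zero>\<^bsub>R\<^esub>, \<zero>\<^bsub>X\<^esub>, \<zero>\<^bsub>S\<^esub>),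
     add = (\<lambda>(r, x, s) (r', x', s'). (r \<oplus>\<^bsub>R\<^esub> r', x \<oplus>\<^bsub>X\<^esub> x', s \<oplus>\<^bsub>S\<^esub> s')),
     smult = (\<lambda>c (r, x, s). (c \<odot>\<^bsub>R\<^esub> r, c \<odot>\<^bsub>X\<^esub> x, c \<odot>\<^bsub>S\<^esub> s))\<rparr>"

text \<open>The \<open>(1-e)A(1-e)\<close>-\<open>(eAe)\<^bsup>(m)\<^esup>\<close>-bimodule \<open>[(1-e)Ae]\<^sub>m\<close> of row vectors;
  \<open>(eAe)\<^bsup>(m)\<^esup>\<close> acts through its entry at \<open>(m, m)\<close>.\<close>

definition row_bimod ::
  "('k::field, 'a) module \<Rightarrow> 'a \<Rightarrow> nat
    \<Rightarrow> ('k, nat \<Rightarrow> 'a, (nat \<Rightarrow> 'a) \<times> (nat \<Rightarrow> 'a \<Rightarrow> 'k), 'a) bimodule" where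
  "row_bimod A e m = \<lparr>
     carrier = (\<Pi>\<^sub>E i\<in>{0..m}.
       if i = m then {(\<one>\<^bsub>A\<^esub> \<ominus>\<^bsub>A\<^esub> e) \<otimes>\<^bsub>A\<^esub> x \<otimes>\<^bsub>A\<^esub> e | x. x \<in> carrier A} else {\<zero>\<^bsub>A\<^esub>}),
     mult = (\<lambda>v w. undefined),
     one = undefined,
     zero = (\<lambda>i\<in>{0..m}. \<zero>\<^bsub>A\<^esub>),
     add = (\<lambda>v w. \<lambda>i\<in>{0..m}. v i \<oplus>\<^bsub>A\<^esub> w i),
     smult = (\<lambda>c v. \<lambda>i\<in>{0..m}. c \<odot>\<^bsub>A\<^esub> v i),
     ract = (\<lambda>v (d, l). \<lambda>i\<in>{0..m}. if i = m then v m \<otimes>\<^bsub>A\<^esub> d m else \<zero>\<^bsub>A\<^esub>),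
     lact = (\<lambda>s v. \<lambda>i\<in>{0..m}. s \<otimes>\<^bsub>A\<^esub> v i)\<rparr>"

end

theory Submission
  imports Defs
begin

text \<open>
  Call an idempotent full if every two-sided ideal containing it is the whole algebra. A full
  corner \<open>eAe\<close> is Morita equivalent to \<open>A\<close> through \<open>M \<mapsto> Me\<close> and \<open>N \<mapsto> Hom(Ae, N)\<close>, so it is
  enough to exhibit the truncation \<open>A\<^bsub>m\<^esub> = e\<^bsup>[m]\<^esup>A\<^bsup>(m)\<^esup>e\<^bsup>[m]\<^esup>\<close> as a full corner of \<open>A\<^bsup>[m]\<^esup>\<close>.

  If \<open>B\<close> is a full corner of \<open>C\<close>, cut out by \<open>e\<close>, then \<open>End\<^sub>B(B \<oplus> DB)\<close> is a full corner of
  \<open>End\<^sub>C(C \<oplus> DC)\<close>, cut out by left multiplication with \<open>e\<close>; hence one SGC extension of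
  \<open>A\<^bsup>[m]\<^esup>\<close> may be replaced by one of \<open>A\<^bsub>m\<^esub>\<close>.

  For an idempotent \<open>e\<close> of \<open>B\<close> let (T) say that \<open>e\<close> together with the trace of \<open>DB\<close> in \<open>B\<close>
  generates the unit ideal, and that \<open>Hom(DB, eB) = 0\<close>. Under (T) the algebra \<open>End(eB \<oplus> DB)\<close> is
  a full corner of \<open>End(B \<oplus> DB)\<close>, and it is the algebra \<open>T\<close> of lower triangular matrices with
  diagonal \<open>eBe, B\<close> and corner \<open>(DB)e\<close>. The idempotent \<open>diag(e, 0)\<close> of \<open>T\<close> satisfies (T) again, and
  if \<open>B = A\<^bsub>m\<^esub>\<close> with \<open>diag(e, 0, \<dots>, 0)\<close>, then \<open>T\<close> is \<open>A\<^bsub>m+1\<^esub>\<close> with \<open>diag(e, 0, \<dots>, 0)\<close>.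

  The hypotheses on \<open>A\<close> give (T) for \<open>e\<close>, and also \<open>eA(1-e) = 0\<close>, because \<open>1-e\<close> lies in the trace
  of \<open>DA\<close>; this yields the second description of \<open>A\<^bsub>m\<^esub>\<close>.
\<close>

text \<open>The induction carries full corners instead of Morita equivalences because a pair of
  functors gives no direct hold on \<open>End(A \<oplus> DA)\<close>, whereas an explicit embedding
  \<open>k\<close> transports \<open>A\<close> and \<open>DA\<close> at once. The relation is
  directed: the SGC extension is always the big algebra, every step cuts it down, and the cuts
  compose by transitivity. Condition (T) is phrased with ideals and homomorphisms out of the dual
  only. In this form it passes to the triangular algebra \<open>T\<close>, so no analogue of the
  hypothesis on additive closures has to be found there. The new row is added at the top. Put
  \<open>g = diag(e, 0, ..., 0)\<close> in \<open>B = A_m\<close>. The first row \<open>gB\<close>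
  has no entry besides the one at (0,0), so a form in \<open>(DB)g\<close>, which depends on
  \<open>gB\<close> only, sees just that entry. Hence \<open>(DB)g\<close> is \<open>e(DA)e\<close>
  (or \<open>(DA)e\<close> if \<open>m = 0\<close>) and \<open>gBg = eAe\<close>, exactly the new
  entries of \<open>A_{m+1}\<close>. This is why, for positive \<open>m\<close>, the idempotent of
  (T) sits in the corner opposite to the entry 1 of the truncating idempotent.\<close>

definition lin_form :: "('k::field, 'm, 'z) module_scheme \<Rightarrow> ('m \<Rightarrow> 'k) \<Rightarrow> bool" where
  "lin_form V \<phi> \<longleftrightarrow> (\<forall>x\<in>carrier V. \<forall>y\<in>carrier V. \<phi> (x \<oplus>\<^bsub>V\<^esub> y) = \<phi> x + \<phi> y) \<and>
     (\<forall>c. \<forall>x\<in>carrier V. \<phi> (c \<odot>\<^bsub>V\<^esub> x) = c * \<phi> x)"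

definition fdvs :: "('k::field, 'm, 'z) module_scheme \<Rightarrow> bool" where
  "fdvs V \<longleftrightarrow> vectorspace class_ring V \<and> vectorspace.fin_dim class_ring V"

text \<open>Induction on the forms: a finite \<open>S\<close> is built whose span attains every
  tuple of values that the forms in \<open>G\<close> take on \<open>V\<close>. One further form
  costs at most one further vector. For all of \<open>F\<close>, vectors with equal values coincide,
  so the span is everything.\<close>

lemma fin_dim_separating:
  fixes V :: "('k::field, 'm, 'z) module_scheme"
  assumes V: "vectorspace class_ring V" and fin: "finite F"
    and lin: "\<And>\<phi>. \<phi> \<in> F \<Longrightarrow> lin_form V \<phi>"
    and sep: "\<And>x y. x \<in> carrier V \<Longrightarrow> y \<in> carrier V \<Longrightarrow> (\<And>\<phi>. \<phi> \<in> F \<Longrightarrow> \<phi> x = \<phi> y) \<Longrightarrow> x = y"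
  shows "vectorspace.fin_dim class_ring V"
proof -
  interpret V: vectorspace class_ring V by (rule V)
  have "\<exists>S. finite S \<and> S \<subseteq> carrier V \<and> (\<forall>x\<in>carrier V. \<exists>y\<in>V.span S. \<forall>\<phi>\<in>G. \<phi> x = \<phi> y)"
    if "finite G" "G \<subseteq> F" for G using that
  proof (induction G)
    case empty
    have "\<zero>\<^bsub>V\<^esub> \<in> V.span {}" using V.span_is_submodule[of "{}"] by (simp add: submodule_def)
    then show ?case by (intro exI[of _ "{}"]) auto
  next
    case (insert \<phi> G)
    then obtain S where S: "finite S" "S \<subseteq> carrier V"
      "\<forall>x\<in>carrier V. \<exists>y\<in>V.span S. \<forall>\<phi>\<in>G. \<phi> x = \<phi> y" by auto
    have linG: "lin_form V \<psi>" if "\<psi> \<in> insert \<phi> G" for \<psi> using insert.prems lin that by auto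
    show ?case
    proof (cases "\<exists>x0\<in>carrier V. (\<forall>\<psi>\<in>G. \<psi> x0 = 0) \<and> \<phi> x0 \<noteq> 0")
      case True
      \<comment> \<open>\<open>x0\<close> is invisible to the forms in \<open>G\<close>, so a
        multiple of it corrects the value of \<open>\<phi>\<close> without disturbing the values
        already attained.\<close>
      then obtain x0 where x0: "x0 \<in> carrier V" "\<forall>\<psi>\<in>G. \<psi> x0 = 0" "\<phi> x0 \<noteq> 0" by blast
      let ?S = "insert x0 S"
      have sub: "submodule class_ring (V.span ?S) V"
        using V.span_is_submodule[of ?S] S x0 by simp
      have "\<exists>y\<in>V.span ?S. \<forall>\<psi>\<in>insert \<phi> G. \<psi> x = \<psi> y" if x: "x \<in> carrier V" for x
      proof -
        obtain y where y: "y \<in> V.span S" "\<forall>\<psi>\<in>G. \<psi> x = \<psi> y" using S x by blast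
        have yV: "y \<in> carrier V" using y S V.span_is_subset2 by blast
        have y': "y \<in> V.span ?S" using y V.span_is_monotone[of S ?S] by blast
        have x0': "x0 \<in> V.span ?S" using V.in_own_span[of ?S] S x0 by blast
        let ?c = "(\<phi> x - \<phi> y) / \<phi> x0"
        have m: "?c \<odot>\<^bsub>V\<^esub> x0 \<in> V.span ?S"
          using sub x0' by (simp add: submodule_def)
        have "y \<oplus>\<^bsub>V\<^esub> ?c \<odot>\<^bsub>V\<^esub> x0 \<in> V.span ?S"
          using sub y' m unfolding submodule_def by simp
        moreover have cx: "?c \<odot>\<^bsub>V\<^esub> x0 \<in> carrier V" using V.smult_closed[of ?c x0] x0 by simp
        have ev: "\<psi> (y \<oplus>\<^bsub>V\<^esub> ?c \<odot>\<^bsub>V\<^esub> x0) = \<psi> y + ?c * \<psi> x0" if "\<psi> \<in> insert \<phi> G" for \<psi>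
          using linG[OF that] yV x0 cx unfolding lin_form_def by simp
        then have "\<forall>\<psi>\<in>insert \<phi> G. \<psi> x = \<psi> (y \<oplus>\<^bsub>V\<^esub> ?c \<odot>\<^bsub>V\<^esub> x0)"
          using y x0 by (auto simp: ev)
        ultimately show ?thesis by blast
      qed
      then show ?thesis using S x0 by (intro exI[of _ ?S]) simp
    next
      case False
      \<comment> \<open>Now \<open>\<phi>\<close> vanishes wherever all of \<open>G\<close> does.
        Applied to the difference of \<open>x\<close> and \<open>y\<close>, this says that the old
        \<open>y\<close> already has the right value under \<open>\<phi>\<close>.\<close>
      have "\<exists>y\<in>V.span S. \<forall>\<psi>\<in>insert \<phi> G. \<psi> x = \<psi> y" if x: "x \<in> carrier V" for x
      proof -
        obtain y where y: "y \<in> V.span S" "\<forall>\<psi>\<in>G. \<psi> x = \<psi> y" using S x by blast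
        have yV: "y \<in> carrier V" using y S V.span_is_subset2 by blast
        let ?z = "x \<oplus>\<^bsub>V\<^esub> (- 1) \<odot>\<^bsub>V\<^esub> y"
        have my: "(- 1) \<odot>\<^bsub>V\<^esub> y \<in> carrier V" using V.smult_closed[of "- 1" y] yV by simp
        have z: "?z \<in> carrier V" using my x by simp
        have ev: "\<psi> ?z = \<psi> x - \<psi> y" if "\<psi> \<in> insert \<phi> G" for \<psi>
          using linG[OF that] x yV my unfolding lin_form_def by simp
        then have "\<forall>\<psi>\<in>G. \<psi> ?z = 0" using ev[OF insertI2] y by (metis diff_self)
        then have "\<phi> ?z = 0" using False z by blast
        then have "\<phi> x = \<phi> y" using ev[OF insertI1] by simp
        then show ?thesis using y by auto
      qed
      then show ?thesis using S by (intro exI[of _ S]) simp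
    qed
  qed
  from this[OF fin subset_refl] obtain S where S: "finite S" "S \<subseteq> carrier V"
    "\<forall>x\<in>carrier V. \<exists>y\<in>V.span S. \<forall>\<phi>\<in>F. \<phi> x = \<phi> y" by blast
  have "x \<in> V.span S" if x: "x \<in> carrier V" for x
  proof -
    obtain y where y: "y \<in> V.span S" "\<forall>\<phi>\<in>F. \<phi> x = \<phi> y" using S x by blast
    have yV: "y \<in> carrier V" using y S V.span_is_subset2 by blast
    show ?thesis using sep[OF x yV] y by blast
  qed
  then have "V.span S = carrier V" using V.span_is_subset2[of S] S by blast
  then show ?thesis unfolding V.fin_dim_def using S by blast
qed

text \<open>Every vector space axiom is an equation between elements, and such an equation holds
  once each form of a separating family confirms it in the field. The value at zero is a separate
  premise, because linearity does not yield it before the axioms are known.\<close>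

lemma fdvsI:
  fixes V :: "('k::field, 'm, 'z) module_scheme"
  assumes zero: "\<zero>\<^bsub>V\<^esub> \<in> carrier V"
    and add: "\<And>x y. x \<in> carrier V \<Longrightarrow> y \<in> carrier V \<Longrightarrow> x \<oplus>\<^bsub>V\<^esub> y \<in> carrier V"
    and smult: "\<And>c x. x \<in> carrier V \<Longrightarrow> c \<odot>\<^bsub>V\<^esub> x \<in> carrier V"
    and fin: "finite F"
    and lin: "\<And>\<phi>. \<phi> \<in> F \<Longrightarrow> lin_form V \<phi> \<and> \<phi> \<zero>\<^bsub>V\<^esub> = 0"
    and sep: "\<And>x y. x \<in> carrier V \<Longrightarrow> y \<in> carrier V \<Longrightarrow> (\<And>\<phi>. \<phi> \<in> F \<Longrightarrow> \<phi> x = \<phi> y) \<Longrightarrow> x = y"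
  shows "fdvs V"
proof -
  have l: "\<phi> (x \<oplus>\<^bsub>V\<^esub> y) = \<phi> x + \<phi> y" "\<phi> (c \<odot>\<^bsub>V\<^esub> x) = c * \<phi> x" "\<phi> \<zero>\<^bsub>V\<^esub> = 0"
    if "\<phi> \<in> F" "x \<in> carrier V" "y \<in> carrier V" for \<phi> x y c
    using lin[OF that(1)] that unfolding lin_form_def by auto
  have V: "vectorspace class_ring V"
  proof (rule vs_criteria)
    show "field (class_ring :: 'k ring)" by (rule class_field.field_axioms)
    show "\<forall>v\<in>carrier V. \<exists>w\<in>carrier V. v \<oplus>\<^bsub>V\<^esub> w = \<zero>\<^bsub>V\<^esub>"
    proof
      fix v assume v: "v \<in> carrier V"
      have "v \<oplus>\<^bsub>V\<^esub> (- 1) \<odot>\<^bsub>V\<^esub> v = \<zero>\<^bsub>V\<^esub>"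
      proof (rule sep)
        fix \<phi> assume F: "\<phi> \<in> F"
        show "\<phi> (v \<oplus>\<^bsub>V\<^esub> (- 1) \<odot>\<^bsub>V\<^esub> v) = \<phi> \<zero>\<^bsub>V\<^esub>"
          using l(1)[OF F v smult[OF v]] l(2,3)[OF F v v] by simp
      qed (auto simp: zero add smult v)
      then show "\<exists>w\<in>carrier V. v \<oplus>\<^bsub>V\<^esub> w = \<zero>\<^bsub>V\<^esub>" using smult[OF v] by blast
    qed
    show "\<forall>v w. v \<in> carrier V \<and> w \<in> carrier V \<longrightarrow> v \<oplus>\<^bsub>V\<^esub> w = w \<oplus>\<^bsub>V\<^esub> v"
      by (intro allI impI sep) (auto simp: add l)
    show "\<forall>v w x. v \<in> carrier V \<and> w \<in> carrier V \<and> x \<in> carrier V \<longrightarrow>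
        v \<oplus>\<^bsub>V\<^esub> w \<oplus>\<^bsub>V\<^esub> x = v \<oplus>\<^bsub>V\<^esub> (w \<oplus>\<^bsub>V\<^esub> x)"
      by (intro allI impI sep) (auto simp: add l)
    show "\<forall>v\<in>carrier V. v \<oplus>\<^bsub>V\<^esub> \<zero>\<^bsub>V\<^esub> = v"
      by (intro ballI sep) (auto simp: add l zero)
    show "\<forall>a b v. a \<in> carrier class_ring \<and> b \<in> carrier class_ring \<and> v \<in> carrier V \<longrightarrow>
        a \<otimes>\<^bsub>class_ring\<^esub> b \<odot>\<^bsub>V\<^esub> v = a \<odot>\<^bsub>V\<^esub> (b \<odot>\<^bsub>V\<^esub> v)"
      by (intro allI impI sep) (auto simp: smult l)
    show "\<forall>v\<in>carrier V. \<one>\<^bsub>class_ring\<^esub> \<odot>\<^bsub>V\<^esub> v = v"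
      by (intro ballI sep) (auto simp: smult l)
    show "\<forall>a b v. a \<in> carrier class_ring \<and> b \<in> carrier class_ring \<and> v \<in> carrier V \<longrightarrow>
        (a \<oplus>\<^bsub>class_ring\<^esub> b) \<odot>\<^bsub>V\<^esub> v = a \<odot>\<^bsub>V\<^esub> v \<oplus>\<^bsub>V\<^esub> b \<odot>\<^bsub>V\<^esub> v"
      by (intro allI impI sep) (auto simp: smult add l algebra_simps)
    show "\<forall>a v w. a \<in> carrier class_ring \<and> v \<in> carrier V \<and> w \<in> carrier V \<longrightarrow>
        a \<odot>\<^bsub>V\<^esub> (v \<oplus>\<^bsub>V\<^esub> w) = a \<odot>\<^bsub>V\<^esub> v \<oplus>\<^bsub>V\<^esub> a \<odot>\<^bsub>V\<^esub> w"
      by (intro allI impI sep) (auto simp: smult add l algebra_simps)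
  qed (auto simp: zero add smult)
  with fin_dim_separating[OF V fin _ sep] lin show ?thesis unfolding fdvs_def by blast
qed

context
  fixes V :: "('k::field, 'm, 'z) module_scheme"
  assumes V: "fdvs V"
begin

interpretation V: vectorspace class_ring V using V by (simp add: fdvs_def)

lemma fdvs_zero: "\<zero>\<^bsub>V\<^esub> \<in> carrier V"
  and fdvs_add: "x \<in> carrier V \<Longrightarrow> y \<in> carrier V \<Longrightarrow> x \<oplus>\<^bsub>V\<^esub> y \<in> carrier V"
  and fdvs_smult: "x \<in> carrier V \<Longrightarrow> c \<odot>\<^bsub>V\<^esub> x \<in> carrier V"
  and fdvs_assoc: "x \<in> carrier V \<Longrightarrow> y \<in> carrier V \<Longrightarrow> z \<in> carrier V \<Longrightarrow>
    x \<oplus>\<^bsub>V\<^esub> y \<oplus>\<^bsub>V\<^esub> z = x \<oplus>\<^bsub>V\<^esub> (y \<oplus>\<^bsub>V\<^esub> z)"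
  and fdvs_lcomm: "x \<in> carrier V \<Longrightarrow> y \<in> carrier V \<Longrightarrow> z \<in> carrier V \<Longrightarrow>
    x \<oplus>\<^bsub>V\<^esub> (y \<oplus>\<^bsub>V\<^esub> z) = y \<oplus>\<^bsub>V\<^esub> (x \<oplus>\<^bsub>V\<^esub> z)"
  and fdvs_r_zero: "x \<in> carrier V \<Longrightarrow> x \<oplus>\<^bsub>V\<^esub> \<zero>\<^bsub>V\<^esub> = x"
  and fdvs_l_zero: "x \<in> carrier V \<Longrightarrow> \<zero>\<^bsub>V\<^esub> \<oplus>\<^bsub>V\<^esub> x = x"
  and fdvs_smult_add: "x \<in> carrier V \<Longrightarrow> y \<in> carrier V \<Longrightarrow> c \<odot>\<^bsub>V\<^esub> (x \<oplus>\<^bsub>V\<^esub> y) = c \<odot>\<^bsub>V\<^esub> x \<oplus>\<^bsub>V\<^esub> c \<odot>\<^bsub>V\<^esub> y"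
  and fdvs_smult_smult: "x \<in> carrier V \<Longrightarrow> (c * d) \<odot>\<^bsub>V\<^esub> x = c \<odot>\<^bsub>V\<^esub> (d \<odot>\<^bsub>V\<^esub> x)"
  and fdvs_zero_smult: "x \<in> carrier V \<Longrightarrow> 0 \<odot>\<^bsub>V\<^esub> x = \<zero>\<^bsub>V\<^esub>"
  and fdvs_smult_zero: "c \<odot>\<^bsub>V\<^esub> \<zero>\<^bsub>V\<^esub> = \<zero>\<^bsub>V\<^esub>"
proof -
  show "x \<in> carrier V \<Longrightarrow> 0 \<odot>\<^bsub>V\<^esub> x = \<zero>\<^bsub>V\<^esub>" for x using V.lmult_0[of x] by simp
  show "x \<in> carrier V \<Longrightarrow> c \<odot>\<^bsub>V\<^esub> x \<in> carrier V" for c x using V.smult_closed[of c x] by simp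
  show "x \<in> carrier V \<Longrightarrow> y \<in> carrier V \<Longrightarrow> c \<odot>\<^bsub>V\<^esub> (x \<oplus>\<^bsub>V\<^esub> y) = c \<odot>\<^bsub>V\<^esub> x \<oplus>\<^bsub>V\<^esub> c \<odot>\<^bsub>V\<^esub> y" for c x y
    using V.smult_r_distr[of c x y] by simp
  show "x \<in> carrier V \<Longrightarrow> (c * d) \<odot>\<^bsub>V\<^esub> x = c \<odot>\<^bsub>V\<^esub> (d \<odot>\<^bsub>V\<^esub> x)" for c d x
    using V.smult_assoc1[of c d x] by simp
  show "c \<odot>\<^bsub>V\<^esub> \<zero>\<^bsub>V\<^esub> = \<zero>\<^bsub>V\<^esub>" using V.rmult_0[of c] by simp
qed (auto simp: V.a_ac)

lemma lin_form_zero: "lin_form V \<phi> \<Longrightarrow> \<phi> \<zero>\<^bsub>V\<^esub> = 0"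
  using fdvs_zero_smult[OF fdvs_zero] fdvs_zero unfolding lin_form_def by (metis mult_zero_left)

text \<open>A basis \<open>S\<close> with its coordinate forms \<open>c s\<close>, phrased through
  values of linear forms, so that later arguments compute with sums in the field and never with
  \<open>lincomb\<close>. The last clause prescribes coordinates: \<open>x\<close> is the
  combination with coefficients \<open>a\<close>, described by its pairing with all forms.\<close>

lemma dual_basis:
  obtains S c where "finite S" "S \<subseteq> carrier V" "\<And>s. s \<in> S \<Longrightarrow> lin_form V (c s)"
    "\<And>x \<phi>. x \<in> carrier V \<Longrightarrow> lin_form V \<phi> \<Longrightarrow> \<phi> x = (\<Sum>s\<in>S. c s x * \<phi> s)"
    "\<And>x y. x \<in> carrier V \<Longrightarrow> y \<in> carrier V \<Longrightarrow> (\<And>s. s \<in> S \<Longrightarrow> c s x = c s y) \<Longrightarrow> x = y"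
    "\<And>a. \<exists>x\<in>carrier V. \<forall>\<phi>. lin_form V \<phi> \<longrightarrow> \<phi> x = (\<Sum>s\<in>S. a s * \<phi> s)"
proof -
  have "V.fin_dim" using V by (simp add: fdvs_def)
  from V.finite_basis_exists[OF this] obtain S where S: "finite S" "V.basis S" by blast
  have SV: "S \<subseteq> carrier V" using S by (simp add: V.basis_def)
  have ex1: "\<exists>!a. a \<in> S \<rightarrow>\<^sub>E UNIV \<and> V.lincomb a S = x" if "x \<in> carrier V" for x
    using S V.basis_criterion[OF S(1) SV] that by simp
  define c where "c = (\<lambda>x. THE a. a \<in> S \<rightarrow>\<^sub>E UNIV \<and> V.lincomb a S = x)"
  have c: "c x \<in> S \<rightarrow>\<^sub>E UNIV" "V.lincomb (c x) S = x" if "x \<in> carrier V" for x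
    using theI'[OF ex1[OF that]] unfolding c_def by auto
  \<comment> \<open>Coordinates are unique among functions extensional on \<open>S\<close>;
    restricting an arbitrary coefficient function makes it comparable with \<open>c x\<close>.
    Linearity of the coordinate forms is read off from this.\<close>
  have cu: "a s = c x s" if "x \<in> carrier V" "V.lincomb a S = x" "s \<in> S" for a x s
  proof -
    have "V.lincomb (restrict a S) S = x"
      unfolding that(2)[symmetric] by (rule V.lincomb_cong) (auto simp: SV)
    then have "restrict a S = c x" using ex1[OF that(1)] c[OF that(1)] by auto
    then show ?thesis using that(3) by (metis restrict_apply')
  qed
  have lc: "\<phi> (V.lincomb a T) = (\<Sum>s\<in>T. a s * \<phi> s)" if "finite T" "T \<subseteq> S" "lin_form V \<phi>" for a T \<phi>
    using that(1,2)
  proof (induction T)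
    case empty
    have "V.lincomb a {} = \<zero>\<^bsub>V\<^esub>" by (simp add: V.lincomb_def)
    then show ?case using lin_form_zero[OF that(3)] by simp
  next
    case (insert s T)
    have TV: "T \<subseteq> carrier V" "s \<in> carrier V" using insert SV by auto
    have "V.lincomb a (insert s T) = a s \<odot>\<^bsub>V\<^esub> s \<oplus>\<^bsub>V\<^esub> V.lincomb a T"
      using V.lincomb_insert[OF insert(1), of a s] insert TV by simp
    moreover have "V.lincomb a T \<in> carrier V" using TV by (intro V.lincomb_closed) auto
    ultimately show ?case using insert TV that(3) fdvs_smult by (simp add: lin_form_def)
  qed
  show thesis
  proof
    show "finite S" "S \<subseteq> carrier V" using S SV by auto
    show "lin_form V (\<lambda>x. c x s)" if "s \<in> S" for s
    proof -
      have "c (x \<oplus>\<^bsub>V\<^esub> y) s = c x s + c y s" if "x \<in> carrier V" "y \<in> carrier V" for x y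
        using cu[of "x \<oplus>\<^bsub>V\<^esub> y" "\<lambda>v. c x v + c y v" s]
          V.lincomb_sum[OF S(1) SV, of "c x" "c y"] c that \<open>s \<in> S\<close> by simp
      moreover have "c (d \<odot>\<^bsub>V\<^esub> x) s = d * c x s" if "x \<in> carrier V" for d x
        using cu[of "d \<odot>\<^bsub>V\<^esub> x" "\<lambda>v. d * c x v" s]
          V.lincomb_smult[OF SV, of "c x" d] c that \<open>s \<in> S\<close> fdvs_smult by simp
      ultimately show ?thesis by (simp add: lin_form_def)
    qed
    show "\<phi> x = (\<Sum>s\<in>S. c x s * \<phi> s)" if "x \<in> carrier V" "lin_form V \<phi>" for x \<phi>
      using lc[OF S(1) _ that(2), of "c x"] c[OF that(1)] by simp
    show "x = y" if "x \<in> carrier V" "y \<in> carrier V" "\<And>s. s \<in> S \<Longrightarrow> c x s = c y s" for x y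
    proof -
      have "c x = c y" using c(1)[OF that(1)] c(1)[OF that(2)] that(3)
        by (intro PiE_ext[of "c x" S "\<lambda>_. UNIV" "c y"]) auto
      then show ?thesis using c(2) that by metis
    qed
    show "\<exists>x\<in>carrier V. \<forall>\<phi>. lin_form V \<phi> \<longrightarrow> \<phi> x = (\<Sum>s\<in>S. a s * \<phi> s)" for a
      using lc[OF S(1) subset_refl] V.lincomb_closed[OF SV, of a] by (intro bexI[of _ "V.lincomb a S"]) auto
  qed
qed

lemma lin_forms_separate:
  assumes "x \<in> carrier V" "y \<in> carrier V" "\<And>\<phi>. lin_form V \<phi> \<Longrightarrow> \<phi> x = \<phi> y"
  shows "x = y"
  using dual_basis assms by metis

text \<open>An enumeration of a basis turns coordinates into sequences. This is what puts a copy of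
  any module into the element type that \<open>mod_cat\<close> demands.\<close>

lemma exists_inj_coordinates: "\<exists>\<tau> :: 'm \<Rightarrow> nat \<Rightarrow> 'k. inj_on \<tau> (carrier V)"
proof (rule dual_basis)
  fix S and c :: "'m \<Rightarrow> 'm \<Rightarrow> 'k"
  assume S: "finite S" and sep: "\<And>x y. x \<in> carrier V \<Longrightarrow> y \<in> carrier V \<Longrightarrow>
    (\<And>s. s \<in> S \<Longrightarrow> c s x = c s y) \<Longrightarrow> x = y"
  obtain en :: "nat \<Rightarrow> 'm" and n where en: "S = en ` {i. i < n}"
    using S by (metis finite_imp_nat_seg_image_inj_on)
  have "inj_on (\<lambda>x i. c (en i) x) (carrier V)"
  proof (rule inj_onI)
    fix x y assume xy: "x \<in> carrier V" "y \<in> carrier V" "(\<lambda>i. c (en i) x) = (\<lambda>i. c (en i) y)"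
    show "x = y" by (rule sep[OF xy(1,2)]) (auto simp: en fun_cong[OF xy(3)])
  qed
  then show ?thesis by blast
qed

end

lemma fdvs_separating_forms:
  assumes "fdvs V"
  obtains F where "finite F" "\<And>\<phi>. \<phi> \<in> F \<Longrightarrow> lin_form V \<phi> \<and> \<phi> \<zero>\<^bsub>V\<^esub> = 0"
    "\<And>x y. x \<in> carrier V \<Longrightarrow> y \<in> carrier V \<Longrightarrow> (\<And>\<phi>. \<phi> \<in> F \<Longrightarrow> \<phi> x = \<phi> y) \<Longrightarrow> x = y"
proof (rule dual_basis[OF assms])
  fix S c
  assume *: "finite S" "\<And>s. s \<in> S \<Longrightarrow> lin_form V (c s)"
    "\<And>x y. x \<in> carrier V \<Longrightarrow> y \<in> carrier V \<Longrightarrow> (\<And>s. s \<in> S \<Longrightarrow> c s x = c s y) \<Longrightarrow> x = y"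
  show thesis
    by (rule that[of "c ` S"]) (use * lin_form_zero[OF assms] in auto)
qed

text \<open>The separating forms of \<open>V\<close>, composed with \<open>j\<close>, separate the
  elements of \<open>W\<close>. Thus \<open>W\<close> inherits all axioms from closure and
  compatibility with \<open>j\<close>, without a single computation in \<open>W\<close>.\<close>

lemma fdvs_pullback:
  fixes V :: "('k::field, 'm, 'z) module_scheme" and W :: "('k, 'n, 'y) module_scheme"
  assumes V: "fdvs V" and inj: "inj_on j (carrier W)"
    and j: "\<And>x. x \<in> carrier W \<Longrightarrow> j x \<in> carrier V"
    and zero: "\<zero>\<^bsub>W\<^esub> \<in> carrier W" "j \<zero>\<^bsub>W\<^esub> = \<zero>\<^bsub>V\<^esub>"
    and add: "\<And>x y. x \<in> carrier W \<Longrightarrow> y \<in> carrier W \<Longrightarrow>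
      x \<oplus>\<^bsub>W\<^esub> y \<in> carrier W \<and> j (x \<oplus>\<^bsub>W\<^esub> y) = j x \<oplus>\<^bsub>V\<^esub> j y"
    and smult: "\<And>c x. x \<in> carrier W \<Longrightarrow> c \<odot>\<^bsub>W\<^esub> x \<in> carrier W \<and> j (c \<odot>\<^bsub>W\<^esub> x) = c \<odot>\<^bsub>V\<^esub> j x"
  shows "fdvs W"
proof (rule fdvs_separating_forms[OF V])
  fix F
  assume F: "finite F" "\<And>\<phi>. \<phi> \<in> F \<Longrightarrow> lin_form V \<phi> \<and> \<phi> \<zero>\<^bsub>V\<^esub> = 0"
    "\<And>x y. x \<in> carrier V \<Longrightarrow> y \<in> carrier V \<Longrightarrow> (\<And>\<phi>. \<phi> \<in> F \<Longrightarrow> \<phi> x = \<phi> y) \<Longrightarrow> x = y"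
  show ?thesis
  proof (rule fdvsI)
    show "finite ((\<lambda>\<phi> x. \<phi> (j x)) ` F)" using F by simp
    show "lin_form W \<psi> \<and> \<psi> \<zero>\<^bsub>W\<^esub> = 0" if "\<psi> \<in> (\<lambda>\<phi> x. \<phi> (j x)) ` F" for \<psi>
      using that F(2) by (auto simp: lin_form_def zero add smult j)
    show "x = y" if "x \<in> carrier W" "y \<in> carrier W"
      "\<And>\<psi>. \<psi> \<in> (\<lambda>\<phi> x. \<phi> (j x)) ` F \<Longrightarrow> \<psi> x = \<psi> y" for x y
      using F(3)[of "j x" "j y"] inj that j by (auto dest: inj_onD)
  qed (auto simp: zero add smult)
qed

section \<open>Algebra and module axioms pulled back along injections\<close>

context fd_algebra
begin

lemma fdvs: "fdvs A"
  using fin_dim vs.vectorspace_axioms by (simp add: fdvs_def)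

lemmas smult_carrier = fdvs_smult[OF fdvs]

text \<open>Negatives are covered by the absorption premise: they are products with
  \<open>\<ominus> \<one>\<close>.\<close>

lemma idealI':
  assumes "I \<subseteq> carrier A" "\<zero> \<in> I" "\<And>x y. x \<in> I \<Longrightarrow> y \<in> I \<Longrightarrow> x \<oplus> y \<in> I"
    and l: "\<And>a x. a \<in> carrier A \<Longrightarrow> x \<in> I \<Longrightarrow> a \<otimes> x \<in> I"
    and "\<And>a x. a \<in> carrier A \<Longrightarrow> x \<in> I \<Longrightarrow> x \<otimes> a \<in> I"
  shows "ideal I A"
proof (rule idealI)
  show "subgroup I (add_monoid A)"
  proof (rule group.subgroupI[OF vs.a_group])
    show "inv\<^bsub>add_monoid A\<^esub> a \<in> I" if "a \<in> I" for a
      using l[of "\<ominus> \<one>" a] that assms(1) by (auto simp: l_minus a_inv_def[symmetric])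
  qed (use assms in auto)
qed (use assms ring_axioms in auto)

end

lemma fd_algebraI:
  assumes "fdvs A" "\<one>\<^bsub>A\<^esub> \<in> carrier A"
    "\<And>x y. x \<in> carrier A \<Longrightarrow> y \<in> carrier A \<Longrightarrow> x \<otimes>\<^bsub>A\<^esub> y \<in> carrier A"
    "\<And>x. x \<in> carrier A \<Longrightarrow> \<one>\<^bsub>A\<^esub> \<otimes>\<^bsub>A\<^esub> x = x"
    "\<And>x. x \<in> carrier A \<Longrightarrow> x \<otimes>\<^bsub>A\<^esub> \<one>\<^bsub>A\<^esub> = x"
    "\<And>x y z. x \<in> carrier A \<Longrightarrow> y \<in> carrier A \<Longrightarrow> z \<in> carrier A \<Longrightarrow>
      x \<otimes>\<^bsub>A\<^esub> y \<otimes>\<^bsub>A\<^esub> z = x \<otimes>\<^bsub>A\<^esub> (y \<otimes>\<^bsub>A\<^esub> z)"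
    "\<And>x y z. x \<in> carrier A \<Longrightarrow> y \<in> carrier A \<Longrightarrow> z \<in> carrier A \<Longrightarrow>
      (x \<oplus>\<^bsub>A\<^esub> y) \<otimes>\<^bsub>A\<^esub> z = x \<otimes>\<^bsub>A\<^esub> z \<oplus>\<^bsub>A\<^esub> y \<otimes>\<^bsub>A\<^esub> z"
    "\<And>x y z. x \<in> carrier A \<Longrightarrow> y \<in> carrier A \<Longrightarrow> z \<in> carrier A \<Longrightarrow>
      z \<otimes>\<^bsub>A\<^esub> (x \<oplus>\<^bsub>A\<^esub> y) = z \<otimes>\<^bsub>A\<^esub> x \<oplus>\<^bsub>A\<^esub> z \<otimes>\<^bsub>A\<^esub> y"
    "\<And>c x y. x \<in> carrier A \<Longrightarrow> y \<in> carrier A \<Longrightarrow> (c \<odot>\<^bsub>A\<^esub> x) \<otimes>\<^bsub>A\<^esub> y = c \<odot>\<^bsub>A\<^esub> (x \<otimes>\<^bsub>A\<^esub> y)"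
    "\<And>c x y. x \<in> carrier A \<Longrightarrow> y \<in> carrier A \<Longrightarrow> x \<otimes>\<^bsub>A\<^esub> (c \<odot>\<^bsub>A\<^esub> y) = c \<odot>\<^bsub>A\<^esub> (x \<otimes>\<^bsub>A\<^esub> y)"
  shows "fd_algebra A"
proof -
  interpret V: vectorspace class_ring A using assms(1) by (simp add: fdvs_def)
  have "ring A"
    by (rule ringI) (use assms V.abelian_group_axioms in \<open>auto intro!: monoidI\<close>)
  then show ?thesis
    by (intro fd_algebra.intro fd_algebra_axioms.intro V.vectorspace_axioms)
      (use assms in \<open>auto simp: fdvs_def\<close>)
qed

text \<open>\<open>j\<close> is not asked to preserve the unit, only \<open>j \<one>\<close> has to
  act as a unit on the image. This covers corners, whose unit is an idempotent of the big algebra,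
  and triangular matrices inside an endomorphism algebra.\<close>

lemma fd_algebra_pullback:
  fixes A :: "('k::field, 'a) module" and B :: "('k, 'b) module"
  assumes A: "fd_algebra A" and inj: "inj_on j (carrier B)"
    and j: "\<And>x. x \<in> carrier B \<Longrightarrow> j x \<in> carrier A"
    and zero: "\<zero>\<^bsub>B\<^esub> \<in> carrier B" "j \<zero>\<^bsub>B\<^esub> = \<zero>\<^bsub>A\<^esub>"
    and one: "\<one>\<^bsub>B\<^esub> \<in> carrier B"
      "\<And>x. x \<in> carrier B \<Longrightarrow> j \<one>\<^bsub>B\<^esub> \<otimes>\<^bsub>A\<^esub> j x = j x \<and> j x \<otimes>\<^bsub>A\<^esub> j \<one>\<^bsub>B\<^esub> = j x"
    and add: "\<And>x y. x \<in> carrier B \<Longrightarrow> y \<in> carrier B \<Longrightarrow>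
      x \<oplus>\<^bsub>B\<^esub> y \<in> carrier B \<and> j (x \<oplus>\<^bsub>B\<^esub> y) = j x \<oplus>\<^bsub>A\<^esub> j y"
    and mult: "\<And>x y. x \<in> carrier B \<Longrightarrow> y \<in> carrier B \<Longrightarrow>
      x \<otimes>\<^bsub>B\<^esub> y \<in> carrier B \<and> j (x \<otimes>\<^bsub>B\<^esub> y) = j x \<otimes>\<^bsub>A\<^esub> j y"
    and smult: "\<And>c x. x \<in> carrier B \<Longrightarrow> c \<odot>\<^bsub>B\<^esub> x \<in> carrier B \<and> j (c \<odot>\<^bsub>B\<^esub> x) = c \<odot>\<^bsub>A\<^esub> j x"
  shows "fd_algebra B"
proof -
  interpret A: fd_algebra A by (rule A)
  have eqI: "x = y" if "j x = j y" "x \<in> carrier B" "y \<in> carrier B" for x y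
    using inj that by (auto dest: inj_onD)
  show ?thesis
  proof (rule fd_algebraI)
    show "fdvs B" by (rule fdvs_pullback[OF A.fdvs inj]) (use j zero add smult in auto)
  qed (auto intro!: eqI simp: assms A.m_assoc A.l_distr A.r_distr A.smult_mult_left A.smult_mult_right)
qed

context fd_rmodule
begin

lemma fdvs: "fdvs M"
  using fin_dim vs.vectorspace_axioms by (simp add: fdvs_def)

lemmas zero_carrier = fdvs_zero[OF fdvs]
lemmas add_carrier = fdvs_add[OF fdvs]
lemmas smult_carrier = fdvs_smult[OF fdvs]

lemma zero_ract: "a \<in> carrier A \<Longrightarrow> \<zero> \<lhd> a = \<zero>"
  using ract_smult_left[of "\<zero>" a 0] fdvs_zero_smult[OF fdvs] zero_carrier ract_closed by metis

lemma ract_zero: "x \<in> carrier M \<Longrightarrow> x \<lhd> \<zero>\<^bsub>A\<^esub> = \<zero>"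
  using ract_smult_right[of x "\<zero>\<^bsub>A\<^esub>" 0] fdvs_zero_smult[OF fdvs] fdvs_zero_smult[OF A.fdvs]
  by (simp add: ract_closed)

end

lemma fd_rmoduleI:
  assumes "fd_algebra A" "fdvs M"
    "\<And>x a. x \<in> carrier M \<Longrightarrow> a \<in> carrier A \<Longrightarrow> x \<lhd>\<^bsub>M\<^esub> a \<in> carrier M"
    "\<And>x. x \<in> carrier M \<Longrightarrow> x \<lhd>\<^bsub>M\<^esub> \<one>\<^bsub>A\<^esub> = x"
    "\<And>x a b. x \<in> carrier M \<Longrightarrow> a \<in> carrier A \<Longrightarrow> b \<in> carrier A \<Longrightarrow>
      x \<lhd>\<^bsub>M\<^esub> (a \<otimes>\<^bsub>A\<^esub> b) = (x \<lhd>\<^bsub>M\<^esub> a) \<lhd>\<^bsub>M\<^esub> b"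
    "\<And>x y a. x \<in> carrier M \<Longrightarrow> y \<in> carrier M \<Longrightarrow> a \<in> carrier A \<Longrightarrow>
      (x \<oplus>\<^bsub>M\<^esub> y) \<lhd>\<^bsub>M\<^esub> a = (x \<lhd>\<^bsub>M\<^esub> a) \<oplus>\<^bsub>M\<^esub> (y \<lhd>\<^bsub>M\<^esub> a)"
    "\<And>x a b. x \<in> carrier M \<Longrightarrow> a \<in> carrier A \<Longrightarrow> b \<in> carrier A \<Longrightarrow>
      x \<lhd>\<^bsub>M\<^esub> (a \<oplus>\<^bsub>A\<^esub> b) = (x \<lhd>\<^bsub>M\<^esub> a) \<oplus>\<^bsub>M\<^esub> (x \<lhd>\<^bsub>M\<^esub> b)"
    "\<And>c x a. x \<in> carrier M \<Longrightarrow> a \<in> carrier A \<Longrightarrow> (c \<odot>\<^bsub>M\<^esub> x) \<lhd>\<^bsub>M\<^esub> a = c \<odot>\<^bsub>M\<^esub> (x \<lhd>\<^bsub>M\<^esub> a)"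
    "\<And>c x a. x \<in> carrier M \<Longrightarrow> a \<in> carrier A \<Longrightarrow> x \<lhd>\<^bsub>M\<^esub> (c \<odot>\<^bsub>A\<^esub> a) = c \<odot>\<^bsub>M\<^esub> (x \<lhd>\<^bsub>M\<^esub> a)"
  shows "fd_rmodule A M"
  using assms by (auto simp: fdvs_def fd_rmodule_def fd_rmodule_axioms_def)

text \<open>Pulls back along \<open>j\<close> on modules and \<open>k\<close> on algebras
  simultaneously. With \<open>k\<close> a corner embedding it yields \<open>Me\<close>, and for that
  reason \<open>k \<one>\<close> is only required to fix the image of \<open>j\<close>; with
  \<open>k\<close> the identity it yields submodules and transported copies.\<close>

lemma fd_rmodule_pullback:
  assumes M: "fd_rmodule A M" and B: "fd_algebra B" and inj: "inj_on j (carrier N)"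
    and j: "\<And>x. x \<in> carrier N \<Longrightarrow> j x \<in> carrier M"
    and zero: "\<zero>\<^bsub>N\<^esub> \<in> carrier N" "j \<zero>\<^bsub>N\<^esub> = \<zero>\<^bsub>M\<^esub>"
    and add: "\<And>x y. x \<in> carrier N \<Longrightarrow> y \<in> carrier N \<Longrightarrow>
      x \<oplus>\<^bsub>N\<^esub> y \<in> carrier N \<and> j (x \<oplus>\<^bsub>N\<^esub> y) = j x \<oplus>\<^bsub>M\<^esub> j y"
    and smult: "\<And>c x. x \<in> carrier N \<Longrightarrow> c \<odot>\<^bsub>N\<^esub> x \<in> carrier N \<and> j (c \<odot>\<^bsub>N\<^esub> x) = c \<odot>\<^bsub>M\<^esub> j x"
    and k: "\<And>b. b \<in> carrier B \<Longrightarrow> k b \<in> carrier A"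
      "\<And>a b. a \<in> carrier B \<Longrightarrow> b \<in> carrier B \<Longrightarrow> k (a \<otimes>\<^bsub>B\<^esub> b) = k a \<otimes>\<^bsub>A\<^esub> k b"
      "\<And>a b. a \<in> carrier B \<Longrightarrow> b \<in> carrier B \<Longrightarrow> k (a \<oplus>\<^bsub>B\<^esub> b) = k a \<oplus>\<^bsub>A\<^esub> k b"
      "\<And>c b. b \<in> carrier B \<Longrightarrow> k (c \<odot>\<^bsub>B\<^esub> b) = c \<odot>\<^bsub>A\<^esub> k b"
    and unit: "\<And>x. x \<in> carrier N \<Longrightarrow> j x \<lhd>\<^bsub>M\<^esub> k \<one>\<^bsub>B\<^esub> = j x"
    and ract: "\<And>x b. x \<in> carrier N \<Longrightarrow> b \<in> carrier B \<Longrightarrow>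
      x \<lhd>\<^bsub>N\<^esub> b \<in> carrier N \<and> j (x \<lhd>\<^bsub>N\<^esub> b) = j x \<lhd>\<^bsub>M\<^esub> k b"
  shows "fd_rmodule B N"
proof -
  interpret M: fd_rmodule A M by (rule M)
  interpret B: fd_algebra B by (rule B)
  have eqI: "x = y" if "j x = j y" "x \<in> carrier N" "y \<in> carrier N" for x y
    using inj that by (auto dest: inj_onD)
  show ?thesis
  proof (rule fd_rmoduleI[OF B])
    show "fdvs N" by (rule fdvs_pullback[OF M.fdvs inj]) (use j zero add smult in auto)
  qed (auto intro!: eqI simp: j zero add smult k unit ract B.smult_carrier M.ract_closed
      M.ract_mult M.ract_add_left M.ract_add_right M.ract_smult_left M.ract_smult_right)
qed

lemma rmod_homI:
  assumes "f \<in> extensional (carrier M)" "\<And>x. x \<in> carrier M \<Longrightarrow> f x \<in> carrier N"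
    "\<And>x y. x \<in> carrier M \<Longrightarrow> y \<in> carrier M \<Longrightarrow> f (x \<oplus>\<^bsub>M\<^esub> y) = f x \<oplus>\<^bsub>N\<^esub> f y"
    "\<And>c x. x \<in> carrier M \<Longrightarrow> f (c \<odot>\<^bsub>M\<^esub> x) = c \<odot>\<^bsub>N\<^esub> f x"
    "\<And>x a. x \<in> carrier M \<Longrightarrow> a \<in> carrier A \<Longrightarrow> f (x \<lhd>\<^bsub>M\<^esub> a) = f x \<lhd>\<^bsub>N\<^esub> a"
  shows "f \<in> rmod_hom A M N"
  using assms by (auto simp: rmod_hom_def LinearCombinations.module_hom_def)

lemma
  assumes "f \<in> rmod_hom A M N"
  shows rmod_hom_ext: "f \<in> extensional (carrier M)"
    and rmod_hom_closed: "x \<in> carrier M \<Longrightarrow> f x \<in> carrier N"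
    and rmod_hom_add: "x \<in> carrier M \<Longrightarrow> y \<in> carrier M \<Longrightarrow> f (x \<oplus>\<^bsub>M\<^esub> y) = f x \<oplus>\<^bsub>N\<^esub> f y"
    and rmod_hom_smult: "x \<in> carrier M \<Longrightarrow> f (c \<odot>\<^bsub>M\<^esub> x) = c \<odot>\<^bsub>N\<^esub> f x"
    and rmod_hom_ract: "x \<in> carrier M \<Longrightarrow> a \<in> carrier A \<Longrightarrow> f (x \<lhd>\<^bsub>M\<^esub> a) = f x \<lhd>\<^bsub>N\<^esub> a"
  using assms by (auto simp: rmod_hom_def LinearCombinations.module_hom_def)

lemma rmod_hom_compose:
  assumes "fd_rmodule A L" "f \<in> rmod_hom A L M" "g \<in> rmod_hom A M N"
  shows "compose (carrier L) g f \<in> rmod_hom A L N"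
proof -
  interpret L: fd_rmodule A L by (rule assms)
  note f = rmod_hom_closed[OF assms(2)] rmod_hom_add[OF assms(2)] rmod_hom_smult[OF assms(2)]
    rmod_hom_ract[OF assms(2)]
  note g = rmod_hom_closed[OF assms(3)] rmod_hom_add[OF assms(3)] rmod_hom_smult[OF assms(3)]
    rmod_hom_ract[OF assms(3)]
  show ?thesis
    by (rule rmod_homI)
      (auto simp: compose_def L.add_carrier L.smult_carrier L.ract_closed f g)
qed

lemma rmod_hom_id:
  assumes "fd_rmodule A M"
  shows "(\<lambda>x\<in>carrier M. x) \<in> rmod_hom A M M"
proof -
  interpret M: fd_rmodule A M by (rule assms)
  show ?thesis by (rule rmod_homI) (auto simp: M.add_carrier M.smult_carrier M.ract_closed)
qed

section \<open>The standard modules\<close>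

lemma with_ract_simps [simp]:
  "carrier (with_ract V r) = carrier V" "zero (with_ract V r) = zero V" "add (with_ract V r) = add V"
  "smult (with_ract V r) = smult V" "ract (with_ract V r) = r"
  by (simp_all add: with_ract_def)

lemma reg_mod_simps [simp]:
  "carrier (reg_mod A) = carrier A" "zero (reg_mod A) = zero A" "add (reg_mod A) = add A"
  "smult (reg_mod A) = smult A" "ract (reg_mod A) = mult A"
  by (simp_all add: reg_mod_def)

lemma dsum_mod_simps [simp]:
  "carrier (dsum_mod M N) = carrier M \<times> carrier N" "zero (dsum_mod M N) = (zero M, zero N)"
  "add (dsum_mod M N) = (\<lambda>v w. (fst v \<oplus>\<^bsub>M\<^esub> fst w, snd v \<oplus>\<^bsub>N\<^esub> snd w))"
  "smult (dsum_mod M N) = (\<lambda>c v. (c \<odot>\<^bsub>M\<^esub> fst v, c \<odot>\<^bsub>N\<^esub> snd v))"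
  "ract (dsum_mod M N) = (\<lambda>v a. (fst v \<lhd>\<^bsub>M\<^esub> a, snd v \<lhd>\<^bsub>N\<^esub> a))"
  by (auto simp: dsum_mod_def direct_sum_def)

lemma dual_carrier: "f \<in> carrier (dual_mod A) \<longleftrightarrow> f \<in> extensional (carrier A) \<and> lin_form A f"
  by (auto simp: dual_mod_def lin_form_def)

lemma dual_mod_simps:
  "zero (dual_mod A) = (\<lambda>x\<in>carrier A. 0)" "add (dual_mod A) = (\<lambda>f g. \<lambda>x\<in>carrier A. f x + g x)"
  "smult (dual_mod A) = (\<lambda>c f. \<lambda>x\<in>carrier A. c * f x)"
  "ract (dual_mod A) = (\<lambda>f b. \<lambda>x\<in>carrier A. f (b \<otimes>\<^bsub>A\<^esub> x))"
  "lact (dual_mod A) = (\<lambda>a f. \<lambda>x\<in>carrier A. f (x \<otimes>\<^bsub>A\<^esub> a))"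
  by (simp_all add: dual_mod_def)

context fd_algebra
begin

lemma reg_mod: "fd_rmodule A (reg_mod A)"
proof (rule fd_rmoduleI[OF fd_algebra_axioms])
  show "fdvs (reg_mod A)"
    by (rule fdvs_pullback[OF fdvs, of "\<lambda>x. x"]) (auto simp: smult_carrier)
qed (auto simp: m_assoc l_distr r_distr smult_mult_left smult_mult_right)

lemma dual_eqI:
  assumes "f \<in> carrier (dual_mod A)" "g \<in> carrier (dual_mod A)" "\<And>x. x \<in> carrier A \<Longrightarrow> f x = g x"
  shows "f = g"
  using assms by (auto simp: dual_carrier intro: extensionalityI)

lemma dual_add: "f \<in> carrier (dual_mod A) \<Longrightarrow> x \<in> carrier A \<Longrightarrow> y \<in> carrier A \<Longrightarrow> f (x \<oplus> y) = f x + f y"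
  and dual_smult: "f \<in> carrier (dual_mod A) \<Longrightarrow> x \<in> carrier A \<Longrightarrow> f (c \<odot> x) = c * f x"
  by (simp_all add: dual_carrier lin_form_def)

lemma dual_zero: "f \<in> carrier (dual_mod A) \<Longrightarrow> f \<zero> = 0"
  by (simp add: dual_carrier lin_form_zero[OF fdvs])

lemma dualI:
  assumes "\<And>x y. x \<in> carrier A \<Longrightarrow> y \<in> carrier A \<Longrightarrow> f (x \<oplus> y) = f x + f y"
    "\<And>c x. x \<in> carrier A \<Longrightarrow> f (c \<odot> x) = c * f x"
  shows "(\<lambda>x\<in>carrier A. f x) \<in> carrier (dual_mod A)"
  using assms by (auto simp: dual_carrier lin_form_def smult_carrier)

lemma dual_lact_closed: "f \<in> carrier (dual_mod A) \<Longrightarrow> a \<in> carrier A \<Longrightarrow> lact (dual_mod A) a f \<in> carrier (dual_mod A)"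
  unfolding dual_mod_simps by (rule dualI) (simp_all add: l_distr smult_mult_left dual_add dual_smult)

lemma dual_mod: "fd_rmodule A (dual_mod A)"
proof (rule fd_rmoduleI[OF fd_algebra_axioms])
  show "fdvs (dual_mod A)"
  proof (rule dual_basis[OF fdvs])
    fix S c assume S: "finite S" "S \<subseteq> carrier A"
      "\<And>x \<phi>. x \<in> carrier A \<Longrightarrow> lin_form A \<phi> \<Longrightarrow> \<phi> x = (\<Sum>s\<in>S. c s x * \<phi> s)"
    show ?thesis
    proof (rule fdvsI)
      \<comment> \<open>The separating forms on the dual are the evaluations at the finite set
        \<open>S\<close>: a form on \<open>A\<close> is determined by its values there.\<close>
      show "finite ((\<lambda>s f. f s) ` S)" using S by simp
      show "x = y" if x: "x \<in> carrier (dual_mod A)" and y: "y \<in> carrier (dual_mod A)"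
        and xy: "\<And>\<phi>. \<phi> \<in> (\<lambda>s f. f s) ` S \<Longrightarrow> \<phi> x = \<phi> y" for x y
      proof (rule dual_eqI[OF x y])
        have "x s = y s" if "s \<in> S" for s using xy[of "\<lambda>f. f s"] that by auto
        then show "x a = y a" if "a \<in> carrier A" for a
          using S(3)[OF that, of x] S(3)[OF that, of y] x y by (simp add: dual_carrier)
      qed
      show "\<zero>\<^bsub>dual_mod A\<^esub> \<in> carrier (dual_mod A)"
        unfolding dual_mod_simps by (rule dualI) simp_all
      show "f \<oplus>\<^bsub>dual_mod A\<^esub> g \<in> carrier (dual_mod A)"
        if "f \<in> carrier (dual_mod A)" "g \<in> carrier (dual_mod A)" for f g
        unfolding dual_mod_simps
        by (rule dualI) (simp_all add: that[THEN dual_add] that[THEN dual_smult] distrib_left)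
      show "c \<odot>\<^bsub>dual_mod A\<^esub> f \<in> carrier (dual_mod A)" if "f \<in> carrier (dual_mod A)" for c f
        unfolding dual_mod_simps
        by (rule dualI) (simp_all add: that[THEN dual_add] that[THEN dual_smult] distrib_left)
      show "lin_form (dual_mod A) \<phi> \<and> \<phi> \<zero>\<^bsub>dual_mod A\<^esub> = 0" if \<phi>: "\<phi> \<in> (\<lambda>s f. f s) ` S" for \<phi>
      proof -
        obtain s where "\<phi> = (\<lambda>f. f s)" "s \<in> carrier A" using \<phi> S(2) by blast
        then show ?thesis by (simp add: lin_form_def dual_mod_simps)
      qed
    qed
  qed
next
  fix f g a b c
  assume f: "f \<in> carrier (dual_mod A)" and a: "a \<in> carrier A"
  note fs = dual_add[OF f] dual_smult[OF f]
  show "f \<lhd>\<^bsub>dual_mod A\<^esub> a \<in> carrier (dual_mod A)"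
    unfolding dual_mod_simps using a by (intro dualI) (simp_all add: r_distr smult_mult_right fs smult_carrier)
  show "(c \<odot>\<^bsub>dual_mod A\<^esub> f) \<lhd>\<^bsub>dual_mod A\<^esub> a = c \<odot>\<^bsub>dual_mod A\<^esub> (f \<lhd>\<^bsub>dual_mod A\<^esub> a)"
    unfolding dual_mod_simps by (rule restrict_ext) (simp add: a)
  show "f \<lhd>\<^bsub>dual_mod A\<^esub> (c \<odot> a) = c \<odot>\<^bsub>dual_mod A\<^esub> (f \<lhd>\<^bsub>dual_mod A\<^esub> a)"
    unfolding dual_mod_simps by (rule restrict_ext) (simp add: a smult_mult_left fs)
  show "(f \<oplus>\<^bsub>dual_mod A\<^esub> g) \<lhd>\<^bsub>dual_mod A\<^esub> a =
      f \<lhd>\<^bsub>dual_mod A\<^esub> a \<oplus>\<^bsub>dual_mod A\<^esub> g \<lhd>\<^bsub>dual_mod A\<^esub> a"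
    unfolding dual_mod_simps by (rule restrict_ext) (simp add: a)
  assume b: "b \<in> carrier A"
  show "f \<lhd>\<^bsub>dual_mod A\<^esub> (a \<otimes> b) = (f \<lhd>\<^bsub>dual_mod A\<^esub> a) \<lhd>\<^bsub>dual_mod A\<^esub> b"
    unfolding dual_mod_simps by (rule restrict_ext) (simp add: a b m_assoc)
  show "f \<lhd>\<^bsub>dual_mod A\<^esub> (a \<oplus> b) = f \<lhd>\<^bsub>dual_mod A\<^esub> a \<oplus>\<^bsub>dual_mod A\<^esub> f \<lhd>\<^bsub>dual_mod A\<^esub> b"
    unfolding dual_mod_simps by (rule restrict_ext) (simp add: a b l_distr fs)
next
  fix f assume f: "f \<in> carrier (dual_mod A)"
  show "f \<lhd>\<^bsub>dual_mod A\<^esub> \<one> = f"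
    unfolding dual_mod_simps
    by (rule extensionalityI[where A = "carrier A"]) (use f in \<open>auto simp: dual_carrier\<close>)
qed

end

lemma dsum_mod:
  assumes "fd_rmodule A M" "fd_rmodule A N"
  shows "fd_rmodule A (dsum_mod M N)"
proof -
  interpret M: fd_rmodule A M by (rule assms)
  interpret N: fd_rmodule A N by (rule assms)
  show ?thesis
  proof (rule fd_rmoduleI[OF M.A.fd_algebra_axioms])
    show "fdvs (dsum_mod M N)"
    proof (rule fdvs_separating_forms[OF M.fdvs], rule fdvs_separating_forms[OF N.fdvs])
      fix F G
      assume F: "finite F" "\<And>\<phi>. \<phi> \<in> F \<Longrightarrow> lin_form M \<phi> \<and> \<phi> \<zero>\<^bsub>M\<^esub> = 0"
        "\<And>x y. x \<in> carrier M \<Longrightarrow> y \<in> carrier M \<Longrightarrow> (\<And>\<phi>. \<phi> \<in> F \<Longrightarrow> \<phi> x = \<phi> y) \<Longrightarrow> x = y"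
      assume G: "finite G" "\<And>\<phi>. \<phi> \<in> G \<Longrightarrow> lin_form N \<phi> \<and> \<phi> \<zero>\<^bsub>N\<^esub> = 0"
        "\<And>x y. x \<in> carrier N \<Longrightarrow> y \<in> carrier N \<Longrightarrow> (\<And>\<phi>. \<phi> \<in> G \<Longrightarrow> \<phi> x = \<phi> y) \<Longrightarrow> x = y"
      show ?thesis
      proof (rule fdvsI)
        show "finite ((\<lambda>\<phi> v. \<phi> (fst v)) ` F \<union> (\<lambda>\<phi> v. \<phi> (snd v)) ` G)" using F G by simp
        show "lin_form (dsum_mod M N) \<psi> \<and> \<psi> \<zero>\<^bsub>dsum_mod M N\<^esub> = 0"
          if "\<psi> \<in> (\<lambda>\<phi> v. \<phi> (fst v)) ` F \<union> (\<lambda>\<phi> v. \<phi> (snd v)) ` G" for \<psi>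
          using that F(2) G(2) by (auto simp: lin_form_def)
        show "x = y" if "x \<in> carrier (dsum_mod M N)" "y \<in> carrier (dsum_mod M N)"
          "\<And>\<psi>. \<psi> \<in> (\<lambda>\<phi> v. \<phi> (fst v)) ` F \<union> (\<lambda>\<phi> v. \<phi> (snd v)) ` G \<Longrightarrow> \<psi> x = \<psi> y" for x y
          using that F(3)[of "fst x" "fst y"] G(3)[of "snd x" "snd y"]
          by (auto simp: image_iff prod_eq_iff mem_Times_iff)
      qed (auto simp: M.zero_carrier N.zero_carrier M.add_carrier N.add_carrier
          M.smult_carrier N.smult_carrier)
    qed
  qed (auto simp: M.ract_closed M.ract_one M.ract_mult M.ract_add_left M.ract_add_right
      M.ract_smult_left M.ract_smult_right N.ract_closed N.ract_one N.ract_mult N.ract_add_left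
      N.ract_add_right N.ract_smult_left N.ract_smult_right)
qed

lemma End_alg_simps [simp]:
  "carrier (End_alg A M) = rmod_hom A M M" "mult (End_alg A M) = compose (carrier M)"
  "one (End_alg A M) = (\<lambda>x\<in>carrier M. x)" "zero (End_alg A M) = (\<lambda>x\<in>carrier M. \<zero>\<^bsub>M\<^esub>)"
  "add (End_alg A M) = (\<lambda>f g. \<lambda>x\<in>carrier M. f x \<oplus>\<^bsub>M\<^esub> g x)"
  "smult (End_alg A M) = (\<lambda>c f. \<lambda>x\<in>carrier M. c \<odot>\<^bsub>M\<^esub> f x)"
  by (simp_all add: End_alg_def)

lemma rmod_hom_pointwise:
  assumes "fd_rmodule A M" "fd_rmodule A N"
  shows "(\<lambda>x\<in>carrier M. \<zero>\<^bsub>N\<^esub>) \<in> rmod_hom A M N"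
    and "f \<in> rmod_hom A M N \<Longrightarrow> g \<in> rmod_hom A M N \<Longrightarrow> (\<lambda>x\<in>carrier M. f x \<oplus>\<^bsub>N\<^esub> g x) \<in> rmod_hom A M N"
    and "f \<in> rmod_hom A M N \<Longrightarrow> (\<lambda>x\<in>carrier M. c \<odot>\<^bsub>N\<^esub> f x) \<in> rmod_hom A M N"
proof -
  interpret M: fd_rmodule A M by (rule assms)
  interpret N: fd_rmodule A N by (rule assms)
  note cl = M.zero_carrier N.zero_carrier M.add_carrier N.add_carrier M.smult_carrier N.smult_carrier
    M.ract_closed N.ract_closed
  show "(\<lambda>x\<in>carrier M. \<zero>\<^bsub>N\<^esub>) \<in> rmod_hom A M N"
    by (rule rmod_homI) (auto simp: cl N.zero_ract fdvs_r_zero[OF N.fdvs] fdvs_smult_zero[OF N.fdvs])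
  {
    assume f: "f \<in> rmod_hom A M N"
    note fs = rmod_hom_closed[OF f] rmod_hom_add[OF f] rmod_hom_smult[OF f] rmod_hom_ract[OF f]
    show "(\<lambda>x\<in>carrier M. c \<odot>\<^bsub>N\<^esub> f x) \<in> rmod_hom A M N"
      by (rule rmod_homI)
        (auto simp: cl fs fdvs_smult_add[OF N.fdvs] N.ract_smult_left
          fdvs_smult_smult[OF N.fdvs, symmetric] mult.commute)
    assume g: "g \<in> rmod_hom A M N"
    note gs = rmod_hom_closed[OF g] rmod_hom_add[OF g] rmod_hom_smult[OF g] rmod_hom_ract[OF g]
    show "(\<lambda>x\<in>carrier M. f x \<oplus>\<^bsub>N\<^esub> g x) \<in> rmod_hom A M N"
      by (rule rmod_homI)
        (auto simp: cl fs gs fdvs_smult_add[OF N.fdvs] N.ract_add_left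
          fdvs_assoc[OF N.fdvs] fdvs_lcomm[OF N.fdvs])
  }
qed

lemma rmod_hom_eqI:
  assumes "f \<in> rmod_hom A M N" "g \<in> rmod_hom A M N" "\<And>x. x \<in> carrier M \<Longrightarrow> f x = g x"
  shows "f = g"
  using assms rmod_hom_ext by (metis extensionalityI)

text \<open>The separating forms are \<open>f \<mapsto> \<phi> (f s)\<close> for \<open>s\<close> in
  a basis of \<open>M\<close> and \<open>\<phi>\<close> in a separating family on \<open>N\<close>.
  Since \<open>W\<close> is any record with the pointwise operations, the result serves both
  \<open>End_alg\<close> and \<open>hom_mod\<close>.\<close>

lemma fdvs_rmod_hom:
  fixes W :: "('k::field, 'm \<Rightarrow> 'n, 'z) module_scheme"
    and M :: "('k, 'm, 'a, 'y) rmodule_scheme" and N :: "('k, 'n, 'a, 'x) rmodule_scheme"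
  assumes M: "fd_rmodule A M" and N: "fd_rmodule A N"
    and W: "carrier W = rmod_hom A M N" "zero W = (\<lambda>x\<in>carrier M. \<zero>\<^bsub>N\<^esub>)"
      "add W = (\<lambda>f g. \<lambda>x\<in>carrier M. f x \<oplus>\<^bsub>N\<^esub> g x)" "smult W = (\<lambda>c f. \<lambda>x\<in>carrier M. c \<odot>\<^bsub>N\<^esub> f x)"
  shows "fdvs W"
proof -
  interpret M: fd_rmodule A M by (rule M)
  interpret N: fd_rmodule A N by (rule N)
  show ?thesis
  proof (rule dual_basis[OF M.fdvs], rule fdvs_separating_forms[OF N.fdvs])
    fix S and c :: "'m \<Rightarrow> 'm \<Rightarrow> 'k" and F
    assume S: "finite S" "S \<subseteq> carrier M"
      "\<And>x \<phi>. x \<in> carrier M \<Longrightarrow> lin_form M \<phi> \<Longrightarrow> \<phi> x = (\<Sum>s\<in>S. c s x * \<phi> s)"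
    assume F: "finite F" "\<And>\<phi>. \<phi> \<in> F \<Longrightarrow> lin_form N \<phi> \<and> \<phi> \<zero>\<^bsub>N\<^esub> = 0"
        "\<And>x y. x \<in> carrier N \<Longrightarrow> y \<in> carrier N \<Longrightarrow> (\<And>\<phi>. \<phi> \<in> F \<Longrightarrow> \<phi> x = \<phi> y) \<Longrightarrow> x = y"
    let ?H = "(\<lambda>(s, \<phi>) f. \<phi> (f s)) ` (S \<times> F)"
    show ?thesis
    proof (rule fdvsI)
      show "finite ?H" using S F by simp
      show "lin_form W \<psi> \<and> \<psi> \<zero>\<^bsub>W\<^esub> = 0" if H: "\<psi> \<in> ?H" for \<psi>
      proof -
        obtain s \<phi> where \<psi>: "\<psi> = (\<lambda>f. \<phi> (f s))" "s \<in> carrier M" "\<phi> \<in> F" using H S(2) by auto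
        show ?thesis using F(2)[OF \<psi>(3)] \<psi>(2) unfolding \<psi>(1) lin_form_def W
          by (simp add: rmod_hom_closed[OF _ \<psi>(2)])
      qed
      show "f = g" if f: "f \<in> carrier W" and g: "g \<in> carrier W" and fg: "\<And>\<psi>. \<psi> \<in> ?H \<Longrightarrow> \<psi> f = \<psi> g" for f g
      proof (rule rmod_hom_eqI)
        show f': "f \<in> rmod_hom A M N" and g': "g \<in> rmod_hom A M N" using f g W by auto
        fix x assume x: "x \<in> carrier M"
        show "f x = g x"
        proof (rule F(3))
          fix \<phi> assume \<phi>: "\<phi> \<in> F"
          \<comment> \<open>Composed with a homomorphism, \<open>\<phi>\<close> is a linear form on
            \<open>M\<close>, hence determined by its values on the basis.\<close>
          have "lin_form M (\<lambda>x. \<phi> (h x))" if h: "h \<in> rmod_hom A M N" for h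
            using F(2)[OF \<phi>] rmod_hom_closed[OF h] by (simp add: lin_form_def rmod_hom_add[OF h] rmod_hom_smult[OF h])
          moreover have "\<phi> (f s) = \<phi> (g s)" if "s \<in> S" for s
            by (rule fg[of "\<lambda>f. \<phi> (f s)"]) (use that \<phi> in force)
          ultimately show "\<phi> (f x) = \<phi> (g x)"
            using S(3)[OF x, of "\<lambda>x. \<phi> (f x)"] S(3)[OF x, of "\<lambda>x. \<phi> (g x)"] f' g' by simp
        qed (use x rmod_hom_closed[OF f'] rmod_hom_closed[OF g'] in auto)
      qed
    qed (auto simp: W rmod_hom_pointwise[OF M N])
  qed
qed

lemma End_alg:
  assumes M: "fd_rmodule A M"
  shows "fd_algebra (End_alg A M)"
proof -
  interpret M: fd_rmodule A M by (rule M)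
  show ?thesis
  proof (rule fd_algebraI)
    show "fdvs (End_alg A M)" by (rule fdvs_rmod_hom[OF M M]) auto
  next
    fix f g h c
    assume f: "f \<in> carrier (End_alg A M)" and g: "g \<in> carrier (End_alg A M)"
    note cl = rmod_hom_closed[OF f[simplified]] rmod_hom_closed[OF g[simplified]]
    show "f \<otimes>\<^bsub>End_alg A M\<^esub> g \<in> carrier (End_alg A M)"
      using rmod_hom_compose[OF M] f g by simp
    show "(c \<odot>\<^bsub>End_alg A M\<^esub> f) \<otimes>\<^bsub>End_alg A M\<^esub> g = c \<odot>\<^bsub>End_alg A M\<^esub> (f \<otimes>\<^bsub>End_alg A M\<^esub> g)"
      unfolding End_alg_simps compose_def by (rule restrict_ext) (simp add: cl)
    show "f \<otimes>\<^bsub>End_alg A M\<^esub> (c \<odot>\<^bsub>End_alg A M\<^esub> g) = c \<odot>\<^bsub>End_alg A M\<^esub> (f \<otimes>\<^bsub>End_alg A M\<^esub> g)"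
      unfolding End_alg_simps compose_def
      by (rule restrict_ext) (simp add: cl rmod_hom_smult[OF f[simplified]])
    assume h: "h \<in> carrier (End_alg A M)"
    note cl = cl rmod_hom_closed[OF h[simplified]]
    show "f \<otimes>\<^bsub>End_alg A M\<^esub> g \<otimes>\<^bsub>End_alg A M\<^esub> h = f \<otimes>\<^bsub>End_alg A M\<^esub> (g \<otimes>\<^bsub>End_alg A M\<^esub> h)"
      unfolding End_alg_simps compose_def by (rule restrict_ext) (simp add: cl)
    show "(f \<oplus>\<^bsub>End_alg A M\<^esub> g) \<otimes>\<^bsub>End_alg A M\<^esub> h =
        f \<otimes>\<^bsub>End_alg A M\<^esub> h \<oplus>\<^bsub>End_alg A M\<^esub> g \<otimes>\<^bsub>End_alg A M\<^esub> h"
      unfolding End_alg_simps compose_def by (rule restrict_ext) (simp add: cl)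
    show "h \<otimes>\<^bsub>End_alg A M\<^esub> (f \<oplus>\<^bsub>End_alg A M\<^esub> g) =
        h \<otimes>\<^bsub>End_alg A M\<^esub> f \<oplus>\<^bsub>End_alg A M\<^esub> h \<otimes>\<^bsub>End_alg A M\<^esub> g"
      unfolding End_alg_simps compose_def
      by (rule restrict_ext) (simp add: cl rmod_hom_add[OF h[simplified]])
  next
    fix f assume "f \<in> carrier (End_alg A M)"
    then have f: "f \<in> carrier M \<rightarrow> carrier M" "f \<in> extensional (carrier M)"
      using rmod_hom_closed rmod_hom_ext by auto
    show "\<one>\<^bsub>End_alg A M\<^esub> \<otimes>\<^bsub>End_alg A M\<^esub> f = f" "f \<otimes>\<^bsub>End_alg A M\<^esub> \<one>\<^bsub>End_alg A M\<^esub> = f"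
      using Id_compose[OF f] compose_Id[OF f] by auto
  qed (auto simp: rmod_hom_id[OF M])
qed

section \<open>Copies of modules in the space of sequences\<close>

text \<open>An arbitrary injection of the carrier, chosen without linearity:
  \<open>coord_mod\<close> transports the operations along it, which makes it a module isomorphism
  by construction.\<close>

definition coord :: "('k::field, 'm, 'z) module_scheme \<Rightarrow> 'm \<Rightarrow> nat \<Rightarrow> 'k" where
  "coord H = (SOME t. inj_on t (carrier H))"

definition uncoord :: "('k::field, 'm, 'z) module_scheme \<Rightarrow> (nat \<Rightarrow> 'k) \<Rightarrow> 'm" where
  "uncoord H = the_inv_into (carrier H) (coord H)"

definition coord_mod :: "('k::field, 'm, 'a, 'z) rmodule_scheme \<Rightarrow> ('k, nat \<Rightarrow> 'k, 'a) rmodule" where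
  "coord_mod H = \<lparr>carrier = coord H ` carrier H, mult = undefined, one = undefined,
     zero = coord H \<zero>\<^bsub>H\<^esub>, add = (\<lambda>x y. coord H (uncoord H x \<oplus>\<^bsub>H\<^esub> uncoord H y)),
     smult = (\<lambda>c x. coord H (c \<odot>\<^bsub>H\<^esub> uncoord H x)), ract = (\<lambda>x a. coord H (uncoord H x \<lhd>\<^bsub>H\<^esub> a))\<rparr>"

lemma coord_mod_simps [simp]:
  "carrier (coord_mod H) = coord H ` carrier H" "zero (coord_mod H) = coord H \<zero>\<^bsub>H\<^esub>"
  "add (coord_mod H) = (\<lambda>x y. coord H (uncoord H x \<oplus>\<^bsub>H\<^esub> uncoord H y))"
  "smult (coord_mod H) = (\<lambda>c x. coord H (c \<odot>\<^bsub>H\<^esub> uncoord H x))"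
  "ract (coord_mod H) = (\<lambda>x a. coord H (uncoord H x \<lhd>\<^bsub>H\<^esub> a))"
  by (simp_all add: coord_mod_def)

lemma coord_inj: "fdvs H \<Longrightarrow> inj_on (coord H) (carrier H)"
  using exists_inj_coordinates[of H] someI_ex[of "\<lambda>t. inj_on t (carrier H)"] by (auto simp: coord_def)

lemma uncoord_coord [simp]: "fdvs H \<Longrightarrow> f \<in> carrier H \<Longrightarrow> uncoord H (coord H f) = f"
  by (simp add: uncoord_def the_inv_into_f_f coord_inj)

lemma coord_mod:
  assumes "fd_rmodule A H"
  shows "fd_rmodule A (coord_mod H)"
proof -
  interpret H: fd_rmodule A H by (rule assms)
  note [simp] = uncoord_coord[OF H.fdvs] H.zero_carrier H.add_carrier H.smult_carrier H.ract_closed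
  have "inj_on (uncoord H) (carrier (coord_mod H))"
    by (auto intro!: inj_onI)
  then show ?thesis
    by (rule fd_rmodule_pullback[OF assms H.A.fd_algebra_axioms, where k = "\<lambda>a. a"])
      (auto simp: H.ract_one)
qed

section \<open>Full corners\<close>

text \<open>\<open>k\<close> identifies \<open>B\<close> with \<open>eAe\<close>, where \<open>e = k 1\<close>; the map \<open>p\<close> below is \<open>x \<mapsto> k\<^sup>-\<^sup>1(exe)\<close>.\<close>

locale corner_emb = A: fd_algebra A + B: fd_algebra B
  for A :: "('k::field, 'a) module" and B :: "('k, 'b) module" +
  fixes k :: "'b \<Rightarrow> 'a"
  assumes k_closed: "b \<in> carrier B \<Longrightarrow> k b \<in> carrier A"
    and k_add: "b \<in> carrier B \<Longrightarrow> c \<in> carrier B \<Longrightarrow> k (b \<oplus>\<^bsub>B\<^esub> c) = k b \<oplus>\<^bsub>A\<^esub> k c"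
    and k_mult: "b \<in> carrier B \<Longrightarrow> c \<in> carrier B \<Longrightarrow> k (b \<otimes>\<^bsub>B\<^esub> c) = k b \<otimes>\<^bsub>A\<^esub> k c"
    and k_smult: "b \<in> carrier B \<Longrightarrow> k (r \<odot>\<^bsub>B\<^esub> b) = r \<odot>\<^bsub>A\<^esub> k b"
    and k_inj: "inj_on k (carrier B)"
    and k_surj: "x \<in> carrier A \<Longrightarrow> k \<one>\<^bsub>B\<^esub> \<otimes>\<^bsub>A\<^esub> x \<otimes>\<^bsub>A\<^esub> k \<one>\<^bsub>B\<^esub> \<in> k ` carrier B"
    and full: "ideal I A \<Longrightarrow> k \<one>\<^bsub>B\<^esub> \<in> I \<Longrightarrow> \<one>\<^bsub>A\<^esub> \<in> I"
begin

abbreviation e where "e \<equiv> k \<one>\<^bsub>B\<^esub>"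

lemma e_closed: "e \<in> carrier A" by (simp add: k_closed)

lemma e_k: "b \<in> carrier B \<Longrightarrow> e \<otimes>\<^bsub>A\<^esub> k b = k b"
  and k_e: "b \<in> carrier B \<Longrightarrow> k b \<otimes>\<^bsub>A\<^esub> e = k b"
  by (simp_all add: k_mult[symmetric])

lemma e_idem: "e \<otimes>\<^bsub>A\<^esub> e = e" by (simp add: e_k)

lemma k_zero: "k \<zero>\<^bsub>B\<^esub> = \<zero>\<^bsub>A\<^esub>"
  using k_smult[of "\<zero>\<^bsub>B\<^esub>" 0] by (simp add: fdvs_zero_smult A.fdvs B.fdvs k_closed)

definition p where "p x = the_inv_into (carrier B) k (e \<otimes>\<^bsub>A\<^esub> x \<otimes>\<^bsub>A\<^esub> e)"

lemma p_closed: "x \<in> carrier A \<Longrightarrow> p x \<in> carrier B"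
  using the_inv_into_into[OF k_inj k_surj subset_refl] by (simp add: p_def)

lemma k_p: "x \<in> carrier A \<Longrightarrow> k (p x) = e \<otimes>\<^bsub>A\<^esub> x \<otimes>\<^bsub>A\<^esub> e"
  using f_the_inv_into_f[OF k_inj k_surj] by (simp add: p_def)

lemma k_eqI: "k b = k c \<Longrightarrow> b \<in> carrier B \<Longrightarrow> c \<in> carrier B \<Longrightarrow> b = c"
  using k_inj by (auto dest: inj_onD)

lemma p_k: "b \<in> carrier B \<Longrightarrow> p (k b) = b"
  by (rule k_eqI) (simp_all add: p_closed k_p k_closed e_k k_e)

lemma p_add: "x \<in> carrier A \<Longrightarrow> y \<in> carrier A \<Longrightarrow> p (x \<oplus>\<^bsub>A\<^esub> y) = p x \<oplus>\<^bsub>B\<^esub> p y"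
  by (rule k_eqI) (simp_all add: p_closed k_p k_add e_closed A.l_distr A.r_distr)

lemma p_smult: "x \<in> carrier A \<Longrightarrow> p (c \<odot>\<^bsub>A\<^esub> x) = c \<odot>\<^bsub>B\<^esub> p x"
  by (rule k_eqI) (simp_all add: p_closed k_p k_smult e_closed A.smult_mult_left A.smult_mult_right
      A.smult_carrier B.smult_carrier)

lemma p_k_mult: "x \<in> carrier A \<Longrightarrow> b \<in> carrier B \<Longrightarrow> p (k b \<otimes>\<^bsub>A\<^esub> x) = b \<otimes>\<^bsub>B\<^esub> p x"
  and p_mult_k: "x \<in> carrier A \<Longrightarrow> b \<in> carrier B \<Longrightarrow> p (x \<otimes>\<^bsub>A\<^esub> k b) = p x \<otimes>\<^bsub>B\<^esub> b"
  by (rule k_eqI; simp add: p_closed k_p k_mult e_closed k_closed k_e e_k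
      A.m_assoc[symmetric]; simp add: A.m_assoc e_closed k_closed k_e e_k)+

text \<open>The elements \<open>c\<close> with \<open>x(bc) = y(bc)\<close> for every
  \<open>b\<close> form a two-sided ideal; the quantifier over \<open>b\<close> is what makes it
  stable under left multiplication. It contains \<open>e\<close>, so by fullness it contains
  \<open>\<one>\<close>. In other words, no nonzero element of a module is killed by all of
  \<open>Ae\<close>.\<close>

lemma ann_corner:
  assumes M: "fd_rmodule A M" and xy: "x \<in> carrier M" "y \<in> carrier M"
    and eq: "\<And>a. a \<in> carrier A \<Longrightarrow> x \<lhd>\<^bsub>M\<^esub> (a \<otimes>\<^bsub>A\<^esub> e) = y \<lhd>\<^bsub>M\<^esub> (a \<otimes>\<^bsub>A\<^esub> e)"
  shows "x = y"
proof -
  interpret M: fd_rmodule A M by (rule M)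
  let ?I = "{c \<in> carrier A. \<forall>b\<in>carrier A. x \<lhd>\<^bsub>M\<^esub> (b \<otimes>\<^bsub>A\<^esub> c) = y \<lhd>\<^bsub>M\<^esub> (b \<otimes>\<^bsub>A\<^esub> c)}"
  have "ideal ?I A"
  proof (rule A.idealI')
    show "c \<otimes>\<^bsub>A\<^esub> a \<in> ?I" if "a \<in> carrier A" "c \<in> ?I" for a c
      using that xy by (auto simp: A.m_assoc[symmetric] M.ract_mult)
    show "a \<otimes>\<^bsub>A\<^esub> c \<in> ?I" if "a \<in> carrier A" "c \<in> ?I" for a c
      using that xy by (auto simp: A.m_assoc[symmetric])
  qed (use xy in \<open>auto simp: M.ract_zero A.r_distr M.ract_add_right\<close>)
  then have "\<one>\<^bsub>A\<^esub> \<in> ?I" by (rule full) (use eq e_closed in auto)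
  then show ?thesis using xy by (auto dest!: bspec[of _ _ "\<one>\<^bsub>A\<^esub>"] simp: M.ract_one)
qed

text \<open>Every homomorphism of right \<open>eAe\<close>-modules \<open>Ae \<rightarrow> M\<close> is left multiplication by an element
  of \<open>M\<close>: the \<open>c\<close> for which all \<open>y \<mapsto> f(bcy)\<close> have this form are a two-sided ideal containing \<open>e\<close>.\<close>

lemma hom_from_Ae:
  assumes M: "fd_rmodule A M"
    and closed: "\<And>y. y \<in> carrier A \<Longrightarrow> y \<otimes>\<^bsub>A\<^esub> e = y \<Longrightarrow> f y \<in> carrier M"
    and add: "\<And>y z. y \<in> carrier A \<Longrightarrow> y \<otimes>\<^bsub>A\<^esub> e = y \<Longrightarrow> z \<in> carrier A \<Longrightarrow> z \<otimes>\<^bsub>A\<^esub> e = z \<Longrightarrow>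
      f (y \<oplus>\<^bsub>A\<^esub> z) = f y \<oplus>\<^bsub>M\<^esub> f z"
    and ract: "\<And>y b. y \<in> carrier A \<Longrightarrow> y \<otimes>\<^bsub>A\<^esub> e = y \<Longrightarrow> b \<in> carrier B \<Longrightarrow>
      f (y \<otimes>\<^bsub>A\<^esub> k b) = f y \<lhd>\<^bsub>M\<^esub> k b"
  obtains w where "w \<in> carrier M" "\<And>y. y \<in> carrier A \<Longrightarrow> y \<otimes>\<^bsub>A\<^esub> e = y \<Longrightarrow> f y = w \<lhd>\<^bsub>M\<^esub> y"
proof -
  interpret M: fd_rmodule A M by (rule M)
  let ?Ae = "{y \<in> carrier A. y \<otimes>\<^bsub>A\<^esub> e = y}"
  let ?I = "{c \<in> carrier A. \<forall>b\<in>carrier A. \<exists>w\<in>carrier M. \<forall>y\<in>?Ae. f (b \<otimes>\<^bsub>A\<^esub> c \<otimes>\<^bsub>A\<^esub> y) = w \<lhd>\<^bsub>M\<^esub> y}"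
  have Ae: "a \<otimes>\<^bsub>A\<^esub> y \<in> ?Ae" if "a \<in> carrier A" "y \<in> ?Ae" for a y
    using that e_closed by (auto simp: A.m_assoc)
  have I: "ideal ?I A"
  proof (rule A.idealI')
    have "f \<zero>\<^bsub>A\<^esub> = \<zero>\<^bsub>M\<^esub>"
      using ract[of "\<zero>\<^bsub>A\<^esub>" "\<zero>\<^bsub>B\<^esub>"] closed[of "\<zero>\<^bsub>A\<^esub>"] e_closed by (simp add: k_zero M.ract_zero)
    then show "\<zero>\<^bsub>A\<^esub> \<in> ?I"
      using M.zero_carrier by (auto intro!: bexI[of _ "\<zero>\<^bsub>M\<^esub>"] simp: M.zero_ract)
    show "c \<oplus>\<^bsub>A\<^esub> d \<in> ?I" if c: "c \<in> ?I" and d: "d \<in> ?I" for c d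
    proof -
      have "\<exists>w\<in>carrier M. \<forall>y\<in>?Ae. f (b \<otimes>\<^bsub>A\<^esub> (c \<oplus>\<^bsub>A\<^esub> d) \<otimes>\<^bsub>A\<^esub> y) = w \<lhd>\<^bsub>M\<^esub> y"
        if b: "b \<in> carrier A" for b
      proof -
        obtain w where w: "w \<in> carrier M" "\<And>y. y \<in> ?Ae \<Longrightarrow> f (b \<otimes>\<^bsub>A\<^esub> c \<otimes>\<^bsub>A\<^esub> y) = w \<lhd>\<^bsub>M\<^esub> y"
          using c b by blast
        obtain v where v: "v \<in> carrier M" "\<And>y. y \<in> ?Ae \<Longrightarrow> f (b \<otimes>\<^bsub>A\<^esub> d \<otimes>\<^bsub>A\<^esub> y) = v \<lhd>\<^bsub>M\<^esub> y"
          using d b by blast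
        have "f (b \<otimes>\<^bsub>A\<^esub> (c \<oplus>\<^bsub>A\<^esub> d) \<otimes>\<^bsub>A\<^esub> y) = (w \<oplus>\<^bsub>M\<^esub> v) \<lhd>\<^bsub>M\<^esub> y" if y: "y \<in> ?Ae" for y
        proof -
          have "b \<otimes>\<^bsub>A\<^esub> (c \<oplus>\<^bsub>A\<^esub> d) \<otimes>\<^bsub>A\<^esub> y = b \<otimes>\<^bsub>A\<^esub> c \<otimes>\<^bsub>A\<^esub> y \<oplus>\<^bsub>A\<^esub> b \<otimes>\<^bsub>A\<^esub> d \<otimes>\<^bsub>A\<^esub> y"
            using b c d y by (simp add: A.l_distr A.r_distr)
          then show ?thesis
            using add Ae[of "b \<otimes>\<^bsub>A\<^esub> c" y] Ae[of "b \<otimes>\<^bsub>A\<^esub> d" y] b c d y w v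
            by (simp add: M.ract_add_left)
        qed
        then show ?thesis using w v M.add_carrier by blast
      qed
      then show ?thesis using c d by auto
    qed
    show "c \<otimes>\<^bsub>A\<^esub> a \<in> ?I" if a: "a \<in> carrier A" and c: "c \<in> ?I" for a c
    proof -
      have "\<exists>w\<in>carrier M. \<forall>y\<in>?Ae. f (b \<otimes>\<^bsub>A\<^esub> (c \<otimes>\<^bsub>A\<^esub> a) \<otimes>\<^bsub>A\<^esub> y) = w \<lhd>\<^bsub>M\<^esub> y"
        if b: "b \<in> carrier A" for b
      proof -
        obtain w where w: "w \<in> carrier M" "\<And>y. y \<in> ?Ae \<Longrightarrow> f (b \<otimes>\<^bsub>A\<^esub> c \<otimes>\<^bsub>A\<^esub> y) = w \<lhd>\<^bsub>M\<^esub> y"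
          using c b by blast
        have "f (b \<otimes>\<^bsub>A\<^esub> (c \<otimes>\<^bsub>A\<^esub> a) \<otimes>\<^bsub>A\<^esub> y) = (w \<lhd>\<^bsub>M\<^esub> a) \<lhd>\<^bsub>M\<^esub> y" if y: "y \<in> ?Ae" for y
          using w(2)[OF Ae[OF a y]] a b c y w(1) by (simp add: A.m_assoc M.ract_mult)
        then show ?thesis using w(1) a M.ract_closed by blast
      qed
      then show ?thesis using a c by auto
    qed
    show "a \<otimes>\<^bsub>A\<^esub> c \<in> ?I" if "a \<in> carrier A" "c \<in> ?I" for a c
      using that by (auto simp: A.m_assoc[symmetric])
  qed auto
  \<comment> \<open>For \<open>c = e\<close> the multiplier is \<open>f (be)\<close>: as
    \<open>y = ye\<close>, one has \<open>bey = (be)(eye)\<close> with \<open>eye\<close> in the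
    image of \<open>k\<close>, over which \<open>f\<close> is linear.\<close>
  have "f (b \<otimes>\<^bsub>A\<^esub> e \<otimes>\<^bsub>A\<^esub> y) = f (b \<otimes>\<^bsub>A\<^esub> e) \<lhd>\<^bsub>M\<^esub> y" if b: "b \<in> carrier A" and y: "y \<in> ?Ae" for b y
  proof -
    have be: "b \<otimes>\<^bsub>A\<^esub> e \<in> ?Ae" using b e_closed e_idem by (simp add: A.m_assoc)
    have "b \<otimes>\<^bsub>A\<^esub> e \<otimes>\<^bsub>A\<^esub> y = b \<otimes>\<^bsub>A\<^esub> e \<otimes>\<^bsub>A\<^esub> k (p y)"
      using b y e_closed by (simp add: k_p) (metis A.m_assoc A.m_closed e_idem)
    moreover have "f (b \<otimes>\<^bsub>A\<^esub> e) \<lhd>\<^bsub>M\<^esub> y = f (b \<otimes>\<^bsub>A\<^esub> e) \<lhd>\<^bsub>M\<^esub> e \<lhd>\<^bsub>M\<^esub> y"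
      using ract[of "b \<otimes>\<^bsub>A\<^esub> e" "\<one>\<^bsub>B\<^esub>"] be by simp
    moreover have "\<dots> = f (b \<otimes>\<^bsub>A\<^esub> e) \<lhd>\<^bsub>M\<^esub> k (p y)"
      using y e_closed closed be by (simp add: k_p A.m_assoc M.ract_mult)
    ultimately show ?thesis using ract[of "b \<otimes>\<^bsub>A\<^esub> e" "p y"] be y p_closed by simp
  qed
  then have "e \<in> ?I"
    using closed e_closed e_idem by (auto intro!: bexI[of _ "f (_ \<otimes>\<^bsub>A\<^esub> e)"] simp: A.m_assoc)
  from full[OF I this] obtain w where "w \<in> carrier M"
    "\<And>y. y \<in> ?Ae \<Longrightarrow> f (\<one>\<^bsub>A\<^esub> \<otimes>\<^bsub>A\<^esub> \<one>\<^bsub>A\<^esub> \<otimes>\<^bsub>A\<^esub> y) = w \<lhd>\<^bsub>M\<^esub> y" by blast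
  with that show thesis by auto
qed

end

definition full_corner :: "('k::field, 'a) module \<Rightarrow> ('k, 'b) module \<Rightarrow> bool" where
  "full_corner A B \<longleftrightarrow> (\<exists>k. corner_emb A B k)"

text \<open>Fullness composes by pulling back. The preimage under \<open>k\<close> of an ideal of
  \<open>A\<close> is an ideal of \<open>B\<close>; if it contains the idempotent of
  \<open>C\<close>, it contains the unit of \<open>B\<close>, so the given ideal contains the
  idempotent that cuts out \<open>B\<close>.\<close>

lemma full_corner_trans [trans]:
  assumes "full_corner A B" "full_corner B C"
  shows "full_corner A C"
proof -
  obtain k l where "corner_emb A B k" "corner_emb B C l" using assms by (auto simp: full_corner_def)
  then interpret k: corner_emb A B k + l: corner_emb B C l by simp_all
  have "corner_emb A C (\<lambda>x. k (l x))"
  proof unfold_locales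
    show "inj_on (\<lambda>x. k (l x)) (carrier C)"
      using comp_inj_on[OF l.k_inj inj_on_subset[OF k.k_inj]] l.k_closed by (auto simp: comp_def)
    show "k l.e \<otimes>\<^bsub>A\<^esub> x \<otimes>\<^bsub>A\<^esub> k l.e \<in> (\<lambda>x. k (l x)) ` carrier C" if x: "x \<in> carrier A" for x
    proof -
      have "k l.e \<otimes>\<^bsub>A\<^esub> x \<otimes>\<^bsub>A\<^esub> k l.e = (k l.e \<otimes>\<^bsub>A\<^esub> k.e) \<otimes>\<^bsub>A\<^esub> x \<otimes>\<^bsub>A\<^esub> (k.e \<otimes>\<^bsub>A\<^esub> k l.e)"
        using l.e_closed by (simp add: k.e_k k.k_e)
      also have "\<dots> = k (l.e \<otimes>\<^bsub>B\<^esub> k.p x \<otimes>\<^bsub>B\<^esub> l.e)"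
        using x l.e_closed k.e_closed k.k_closed
        by (simp add: k.k_mult k.p_closed k.k_p k.A.m_assoc)
      also have "\<dots> = k (l (l.p (k.p x)))"
        using x by (simp add: l.k_p k.p_closed)
      finally show ?thesis using x k.p_closed l.p_closed by auto
    qed
    show "\<one>\<^bsub>A\<^esub> \<in> I" if I: "ideal I A" and e: "k l.e \<in> I" for I
    proof -
      interpret I: ideal I A by (rule I)
      let ?J = "{b \<in> carrier B. k b \<in> I}"
      have "ideal ?J B"
        by (rule k.B.idealI')
          (auto simp: k.k_zero k.k_add k.k_mult k.k_closed I.I_l_closed I.I_r_closed)
      then have "\<one>\<^bsub>B\<^esub> \<in> ?J" by (rule l.full) (use e l.e_closed in auto)
      then show ?thesis using k.full[OF I] by auto
    qed
  qed (auto simp: k.k_closed l.k_closed k.k_add l.k_add k.k_mult l.k_mult k.k_smult l.k_smult)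
  then show ?thesis by (auto simp: full_corner_def)
qed

section \<open>Algebra isomorphisms\<close>

locale alg_iso = A: fd_algebra A + B: fd_algebra B
  for A :: "('k::field, 'a) module" and B :: "('k, 'b) module" +
  fixes h :: "'a \<Rightarrow> 'b"
  assumes h_bij: "bij_betw h (carrier A) (carrier B)"
    and h_add: "x \<in> carrier A \<Longrightarrow> y \<in> carrier A \<Longrightarrow> h (x \<oplus>\<^bsub>A\<^esub> y) = h x \<oplus>\<^bsub>B\<^esub> h y"
    and h_mult: "x \<in> carrier A \<Longrightarrow> y \<in> carrier A \<Longrightarrow> h (x \<otimes>\<^bsub>A\<^esub> y) = h x \<otimes>\<^bsub>B\<^esub> h y"
    and h_smult: "x \<in> carrier A \<Longrightarrow> h (r \<odot>\<^bsub>A\<^esub> x) = r \<odot>\<^bsub>B\<^esub> h x"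
begin

lemma h_closed: "x \<in> carrier A \<Longrightarrow> h x \<in> carrier B"
  using h_bij by (auto simp: bij_betw_def)

lemma h_surj: "y \<in> carrier B \<Longrightarrow> \<exists>x\<in>carrier A. y = h x"
  using h_bij by (auto simp: bij_betw_def)

lemma h_zero: "h \<zero>\<^bsub>A\<^esub> = \<zero>\<^bsub>B\<^esub>"
  using h_smult[of "\<zero>\<^bsub>A\<^esub>" 0] by (simp add: fdvs_zero_smult A.fdvs B.fdvs h_closed)

text \<open>Follows from surjectivity: for a preimage \<open>u\<close> of the unit of
  \<open>B\<close>, the element \<open>h \<one> = h \<one> h u = h u\<close> is that unit.\<close>

lemma h_one: "h \<one>\<^bsub>A\<^esub> = \<one>\<^bsub>B\<^esub>"
proof -
  obtain u where u: "u \<in> carrier A" "\<one>\<^bsub>B\<^esub> = h u" using h_surj B.one_closed by blast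
  then have "h \<one>\<^bsub>A\<^esub> = h (\<one>\<^bsub>A\<^esub> \<otimes>\<^bsub>A\<^esub> u)"
    using h_mult[of "\<one>\<^bsub>A\<^esub>" u] by (simp add: u(2)[symmetric] h_closed)
  with u show ?thesis by simp
qed

lemma inverse: "alg_iso B A (the_inv_into (carrier A) h)"
proof unfold_locales
  let ?g = "the_inv_into (carrier A) h"
  have g: "?g (h x) = x" if "x \<in> carrier A" for x
    using that h_bij by (simp add: bij_betw_def the_inv_into_f_f)
  show "bij_betw ?g (carrier B) (carrier A)" by (rule bij_betw_the_inv_into[OF h_bij])
  fix x y r assume "x \<in> carrier B"
  then obtain x' where x: "x' \<in> carrier A" "x = h x'" using h_surj by blast
  show "?g (r \<odot>\<^bsub>B\<^esub> x) = r \<odot>\<^bsub>A\<^esub> ?g x"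
    using x by (simp add: h_smult[symmetric] g A.smult_carrier)
  assume "y \<in> carrier B"
  then obtain y' where y: "y' \<in> carrier A" "y = h y'" using h_surj by blast
  show "?g (x \<oplus>\<^bsub>B\<^esub> y) = ?g x \<oplus>\<^bsub>A\<^esub> ?g y" "?g (x \<otimes>\<^bsub>B\<^esub> y) = ?g x \<otimes>\<^bsub>A\<^esub> ?g y"
    using x y by (simp_all add: h_add[symmetric] h_mult[symmetric] g)
qed

text \<open>An isomorphism is the corner embedding for the idempotent \<open>\<one>\<close>, where
  fullness is trivial. The target \<open>B\<close> takes the role of the big algebra.\<close>

lemma full_corner: "full_corner B A"
proof -
  have "corner_emb B A h"
  proof unfold_locales
    show "inj_on h (carrier A)" using h_bij by (simp add: bij_betw_def)
  qed (use h_bij in \<open>auto simp: h_closed h_add h_mult h_smult h_one bij_betw_def\<close>)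
  then show ?thesis by (auto simp: full_corner_def)
qed

end

lemma alg_isoI:
  assumes "alg_isomorphic A B" "fd_algebra A" "fd_algebra B"
  obtains h where "alg_iso A B h"
proof -
  obtain h where "h \<in> ring_iso A B" "h \<in> LinearCombinations.module_hom class_ring A B"
    using assms(1) by (auto simp: alg_isomorphic_def)
  with assms(2,3) have "alg_iso A B h"
    unfolding alg_iso_def alg_iso_axioms_def
    by (auto simp: ring_iso_def Ring.ring_hom_def LinearCombinations.module_hom_def)
  then show thesis by (rule that)
qed

section \<open>Full corners are Morita equivalent\<close>

context corner_emb
begin

text \<open>The module \<open>Me\<close>, given as the fixed points of the action of
  \<open>e\<close>. For the regular module it is \<open>Ae\<close> as a right
  \<open>eAe\<close>-module.\<close>

definition restr_mod :: "('k, 'm, 'a, 'z) rmodule_scheme \<Rightarrow> ('k, 'm, 'b) rmodule" where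
  "restr_mod M = with_ract (M\<lparr>carrier := {x \<in> carrier M. x \<lhd>\<^bsub>M\<^esub> e = x}\<rparr>) (\<lambda>x b. x \<lhd>\<^bsub>M\<^esub> k b)"

text \<open>\<open>Hom(Ae, N)\<close> over \<open>B\<close>: left multiplication of \<open>A\<close>
  on \<open>Ae\<close> turns into a right action on homomorphisms, as precomposition reverses the
  order.\<close>

definition hom_mod :: "('k, 'n, 'b, 'z) rmodule_scheme \<Rightarrow> ('k, 'a \<Rightarrow> 'n, 'a) rmodule" where
  "hom_mod N = \<lparr>carrier = rmod_hom B (restr_mod (reg_mod A)) N, mult = undefined, one = undefined,
     zero = (\<lambda>y\<in>carrier (restr_mod (reg_mod A)). \<zero>\<^bsub>N\<^esub>),
     add = (\<lambda>f g. \<lambda>y\<in>carrier (restr_mod (reg_mod A)). f y \<oplus>\<^bsub>N\<^esub> g y),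
     smult = (\<lambda>c f. \<lambda>y\<in>carrier (restr_mod (reg_mod A)). c \<odot>\<^bsub>N\<^esub> f y),
     ract = (\<lambda>f a. \<lambda>y\<in>carrier (restr_mod (reg_mod A)). f (a \<otimes>\<^bsub>A\<^esub> y))\<rparr>"

lemma restr_mod_simps [simp]:
  "carrier (restr_mod M) = {x \<in> carrier M. x \<lhd>\<^bsub>M\<^esub> e = x}" "zero (restr_mod M) = zero M"
  "add (restr_mod M) = add M" "smult (restr_mod M) = smult M"
  "ract (restr_mod M) = (\<lambda>x b. x \<lhd>\<^bsub>M\<^esub> k b)"
  by (simp_all add: restr_mod_def)

lemma restr_mod:
  assumes M: "fd_rmodule A M"
  shows "fd_rmodule B (restr_mod M)"
proof -
  interpret M: fd_rmodule A M by (rule M)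
  show ?thesis
  proof (rule fd_rmodule_pullback[OF M B.fd_algebra_axioms, where j = "\<lambda>x. x" and k = k])
    show "x \<lhd>\<^bsub>restr_mod M\<^esub> b \<in> carrier (restr_mod M) \<and> x \<lhd>\<^bsub>restr_mod M\<^esub> b = x \<lhd>\<^bsub>M\<^esub> k b"
      if "x \<in> carrier (restr_mod M)" "b \<in> carrier B" for x b
      using that e_closed k_closed by (simp add: M.ract_closed M.ract_mult[symmetric] k_e)
  qed (auto simp: k_closed k_add k_mult k_smult M.zero_carrier M.zero_ract e_closed M.add_carrier
      M.ract_add_left M.smult_carrier M.ract_smult_left)
qed

lemma restr_hom:
  assumes M: "fd_rmodule A M" and f: "f \<in> rmod_hom A M N"
  shows "restrict f (carrier (restr_mod M)) \<in> rmod_hom B (restr_mod M) (restr_mod N)"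
proof -
  interpret M: fd_rmodule A M by (rule M)
  interpret FM: fd_rmodule B "restr_mod M" by (rule restr_mod[OF M])
  show ?thesis
    by (rule rmod_homI)
      (use FM.add_carrier FM.smult_carrier FM.ract_closed e_closed k_closed in
        \<open>auto simp: rmod_hom_closed[OF f] rmod_hom_add[OF f] rmod_hom_smult[OF f] rmod_hom_ract[OF f, symmetric]\<close>)
qed

abbreviation Ae where "Ae \<equiv> {y \<in> carrier A. y \<otimes>\<^bsub>A\<^esub> e = y}"

lemma hom_mod_simps [simp]:
  "carrier (hom_mod N) = rmod_hom B (restr_mod (reg_mod A)) N" "zero (hom_mod N) = (\<lambda>y\<in>Ae. \<zero>\<^bsub>N\<^esub>)"
  "add (hom_mod N) = (\<lambda>f g. \<lambda>y\<in>Ae. f y \<oplus>\<^bsub>N\<^esub> g y)"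
  "smult (hom_mod N) = (\<lambda>c f. \<lambda>y\<in>Ae. c \<odot>\<^bsub>N\<^esub> f y)"
  "ract (hom_mod N) = (\<lambda>f a. \<lambda>y\<in>Ae. f (a \<otimes>\<^bsub>A\<^esub> y))"
  by (simp_all add: hom_mod_def)

lemma Ae_mult: "a \<in> carrier A \<Longrightarrow> y \<in> carrier A \<Longrightarrow> y \<otimes>\<^bsub>A\<^esub> e = y \<Longrightarrow> a \<otimes>\<^bsub>A\<^esub> y \<otimes>\<^bsub>A\<^esub> e = a \<otimes>\<^bsub>A\<^esub> y"
  by (simp add: A.m_assoc e_closed)

lemma hom_ract_closed:
  assumes f: "f \<in> rmod_hom B (restr_mod (reg_mod A)) N" and a: "a \<in> carrier A"
  shows "(\<lambda>y\<in>Ae. f (a \<otimes>\<^bsub>A\<^esub> y)) \<in> rmod_hom B (restr_mod (reg_mod A)) N"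
proof -
  interpret V: fd_rmodule B "restr_mod (reg_mod A)" by (rule restr_mod[OF A.reg_mod])
  show ?thesis
  proof (rule rmod_homI)
    fix y z b c
    assume y: "y \<in> carrier (restr_mod (reg_mod A))"
    have ay: "a \<otimes>\<^bsub>A\<^esub> y \<in> carrier (restr_mod (reg_mod A))" using y a by (simp add: Ae_mult)
    show "(\<lambda>y\<in>Ae. f (a \<otimes>\<^bsub>A\<^esub> y)) y \<in> carrier N" using y rmod_hom_closed[OF f ay] by simp
    show "(\<lambda>y\<in>Ae. f (a \<otimes>\<^bsub>A\<^esub> y)) (c \<odot>\<^bsub>restr_mod (reg_mod A)\<^esub> y) = c \<odot>\<^bsub>N\<^esub> (\<lambda>y\<in>Ae. f (a \<otimes>\<^bsub>A\<^esub> y)) y"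
      using V.smult_carrier[OF y, of c] y a rmod_hom_smult[OF f ay, of c] by (simp add: A.smult_mult_right)
    show "(\<lambda>y\<in>Ae. f (a \<otimes>\<^bsub>A\<^esub> y)) (y \<oplus>\<^bsub>restr_mod (reg_mod A)\<^esub> z) =
        (\<lambda>y\<in>Ae. f (a \<otimes>\<^bsub>A\<^esub> y)) y \<oplus>\<^bsub>N\<^esub> (\<lambda>y\<in>Ae. f (a \<otimes>\<^bsub>A\<^esub> y)) z"
      if z: "z \<in> carrier (restr_mod (reg_mod A))"
    proof -
      have az: "a \<otimes>\<^bsub>A\<^esub> z \<in> carrier (restr_mod (reg_mod A))" using z a by (simp add: Ae_mult)
      show ?thesis using V.add_carrier[OF y z] y z a rmod_hom_add[OF f ay az] by (simp add: A.r_distr)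
    qed
    show "(\<lambda>y\<in>Ae. f (a \<otimes>\<^bsub>A\<^esub> y)) (y \<lhd>\<^bsub>restr_mod (reg_mod A)\<^esub> b) = (\<lambda>y\<in>Ae. f (a \<otimes>\<^bsub>A\<^esub> y)) y \<lhd>\<^bsub>N\<^esub> b"
      if b: "b \<in> carrier B"
      using V.ract_closed[OF y b] y a b rmod_hom_ract[OF f ay b] by (simp add: A.m_assoc k_closed)
  qed auto
qed

lemma hom_mod:
  assumes N: "fd_rmodule B N"
  shows "fd_rmodule A (hom_mod N)"
proof -
  interpret N: fd_rmodule B N by (rule N)
  note V = restr_mod[OF A.reg_mod]
  interpret V: fd_rmodule B "restr_mod (reg_mod A)" by (rule V)
  have Aem: "a \<otimes>\<^bsub>A\<^esub> y \<in> carrier (restr_mod (reg_mod A))"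
    if "a \<in> carrier A" "y \<in> Ae" for a y using that by (simp add: Ae_mult)
  show ?thesis
  proof (rule fd_rmoduleI[OF A.fd_algebra_axioms])
    show "fdvs (hom_mod N)" by (rule fdvs_rmod_hom[OF V N]) simp_all
  next
    fix f g a b c
    assume "f \<in> carrier (hom_mod N)" and a: "a \<in> carrier A"
    then have f: "f \<in> rmod_hom B (restr_mod (reg_mod A)) N" by simp
    show "f \<lhd>\<^bsub>hom_mod N\<^esub> a \<in> carrier (hom_mod N)" using hom_ract_closed[OF f a] by simp
    show "(c \<odot>\<^bsub>hom_mod N\<^esub> f) \<lhd>\<^bsub>hom_mod N\<^esub> a = c \<odot>\<^bsub>hom_mod N\<^esub> (f \<lhd>\<^bsub>hom_mod N\<^esub> a)"
      unfolding hom_mod_simps by (rule restrict_ext) (simp add: a Ae_mult)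
    show "(f \<oplus>\<^bsub>hom_mod N\<^esub> g) \<lhd>\<^bsub>hom_mod N\<^esub> a = f \<lhd>\<^bsub>hom_mod N\<^esub> a \<oplus>\<^bsub>hom_mod N\<^esub> g \<lhd>\<^bsub>hom_mod N\<^esub> a"
      unfolding hom_mod_simps by (rule restrict_ext) (simp add: a Ae_mult)
    show "f \<lhd>\<^bsub>hom_mod N\<^esub> (c \<odot>\<^bsub>A\<^esub> a) = c \<odot>\<^bsub>hom_mod N\<^esub> (f \<lhd>\<^bsub>hom_mod N\<^esub> a)"
      unfolding hom_mod_simps
    proof (rule restrict_ext)
      fix y assume y: "y \<in> Ae"
      show "f (c \<odot>\<^bsub>A\<^esub> a \<otimes>\<^bsub>A\<^esub> y) = c \<odot>\<^bsub>N\<^esub> (\<lambda>y\<in>Ae. f (a \<otimes>\<^bsub>A\<^esub> y)) y"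
        using rmod_hom_smult[OF f Aem[OF a y], of c] y a by (simp add: A.smult_mult_left)
    qed
    assume b: "b \<in> carrier A"
    show "f \<lhd>\<^bsub>hom_mod N\<^esub> (a \<otimes>\<^bsub>A\<^esub> b) = (f \<lhd>\<^bsub>hom_mod N\<^esub> a) \<lhd>\<^bsub>hom_mod N\<^esub> b"
      unfolding hom_mod_simps by (rule restrict_ext) (simp add: a b Ae_mult A.m_assoc)
    show "f \<lhd>\<^bsub>hom_mod N\<^esub> (a \<oplus>\<^bsub>A\<^esub> b) = f \<lhd>\<^bsub>hom_mod N\<^esub> a \<oplus>\<^bsub>hom_mod N\<^esub> f \<lhd>\<^bsub>hom_mod N\<^esub> b"
      unfolding hom_mod_simps
    proof (rule restrict_ext)
      fix y assume y: "y \<in> Ae"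
      show "f ((a \<oplus>\<^bsub>A\<^esub> b) \<otimes>\<^bsub>A\<^esub> y) = (\<lambda>y\<in>Ae. f (a \<otimes>\<^bsub>A\<^esub> y)) y \<oplus>\<^bsub>N\<^esub> (\<lambda>y\<in>Ae. f (b \<otimes>\<^bsub>A\<^esub> y)) y"
        using rmod_hom_add[OF f Aem[OF a y] Aem[OF b y]] y a b by (simp add: A.l_distr)
    qed
  next
    fix f assume "f \<in> carrier (hom_mod N)"
    then show "f \<lhd>\<^bsub>hom_mod N\<^esub> \<one>\<^bsub>A\<^esub> = f"
      using rmod_hom_ext[of f B "restr_mod (reg_mod A)" N]
      by (auto intro: extensionalityI[where A = Ae])
  qed
qed

text \<open>The elements of \<open>hom_mod N\<close> are functions on \<open>Ae\<close>, of the
  wrong type for \<open>mod_cat\<close>. Therefore the functor takes values in coordinate copies,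
  and on morphisms it is postcomposition conjugated by \<open>coord\<close>.\<close>

abbreviation ind_mod where "ind_mod N \<equiv> coord_mod (hom_mod N)"

abbreviation ind_map where
  "ind_map N N' g \<equiv> \<lambda>z\<in>carrier (ind_mod N). coord (hom_mod N') (compose Ae g (uncoord (hom_mod N) z))"

lemma compose_hom_mod:
  assumes "g \<in> rmod_hom B N N'" "f \<in> carrier (hom_mod N)"
  shows "compose Ae g f \<in> carrier (hom_mod N')"
  using rmod_hom_compose[OF restr_mod[OF A.reg_mod] _ assms(1), of f] assms(2) by simp

text \<open>Postcomposition with \<open>g\<close> acts on values and the algebra acts on arguments,
  so the two commute; the coordinates only transport this.\<close>

lemma ind_map:
  assumes N: "fd_rmodule B N" and N': "fd_rmodule B N'" and g: "g \<in> rmod_hom B N N'"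
  shows "ind_map N N' g \<in> rmod_hom A (ind_mod N) (ind_mod N')"
proof -
  interpret H: fd_rmodule A "hom_mod N" by (rule hom_mod[OF N])
  interpret H': fd_rmodule A "hom_mod N'" by (rule hom_mod[OF N'])
  note unc = uncoord_coord[OF H.fdvs] uncoord_coord[OF H'.fdvs]
  note cg = compose_hom_mod[OF g]
  have cl: "y \<in> Ae \<Longrightarrow> f y \<in> carrier N" if "f \<in> carrier (hom_mod N)" for f y
    using that rmod_hom_closed[of f B "restr_mod (reg_mod A)" N] by simp
  have add: "compose Ae g (f \<oplus>\<^bsub>hom_mod N\<^esub> f') = compose Ae g f \<oplus>\<^bsub>hom_mod N'\<^esub> compose Ae g f'"
    if "f \<in> carrier (hom_mod N)" "f' \<in> carrier (hom_mod N)" for f f'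
    unfolding hom_mod_simps compose_def by (rule restrict_ext) (use that cl in \<open>simp add: rmod_hom_add[OF g]\<close>)
  have smult: "compose Ae g (c \<odot>\<^bsub>hom_mod N\<^esub> f) = c \<odot>\<^bsub>hom_mod N'\<^esub> compose Ae g f"
    if "f \<in> carrier (hom_mod N)" for f c
    unfolding hom_mod_simps compose_def by (rule restrict_ext) (use that cl in \<open>simp add: rmod_hom_smult[OF g]\<close>)
  have ract: "compose Ae g (f \<lhd>\<^bsub>hom_mod N\<^esub> a) = compose Ae g f \<lhd>\<^bsub>hom_mod N'\<^esub> a"
    if "f \<in> carrier (hom_mod N)" "a \<in> carrier A" for f a
    unfolding hom_mod_simps compose_def by (rule restrict_ext) (use that in \<open>simp add: Ae_mult\<close>)
  show ?thesis
  proof (rule rmod_homI)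
    fix z z' a c
    assume "z \<in> carrier (ind_mod N)"
    then obtain f where f: "f \<in> carrier (hom_mod N)" "z = coord (hom_mod N) f" by (auto simp del: hom_mod_simps)
    show "ind_map N N' g z \<in> carrier (ind_mod N')"
      using f by (simp add: unc cg del: hom_mod_simps)
    show "ind_map N N' g (c \<odot>\<^bsub>ind_mod N\<^esub> z) = c \<odot>\<^bsub>ind_mod N'\<^esub> ind_map N N' g z"
      using f by (simp add: unc cg smult H.smult_carrier del: hom_mod_simps)
    show "ind_map N N' g (z \<oplus>\<^bsub>ind_mod N\<^esub> z') = ind_map N N' g z \<oplus>\<^bsub>ind_mod N'\<^esub> ind_map N N' g z'"
      if z': "z' \<in> carrier (ind_mod N)"
    proof -
      obtain f' where f': "f' \<in> carrier (hom_mod N)" "z' = coord (hom_mod N) f'"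
        using z' by (auto simp del: hom_mod_simps)
      show ?thesis using f f' by (simp add: unc cg add H.add_carrier del: hom_mod_simps)
    qed
    show "ind_map N N' g (z \<lhd>\<^bsub>ind_mod N\<^esub> a) = ind_map N N' g z \<lhd>\<^bsub>ind_mod N'\<^esub> a"
      if "a \<in> carrier A"
      using f that by (simp add: unc cg ract H.ract_closed del: hom_mod_simps)
  qed auto
qed

lemma restr_functor: "klinear_functor A B restr_mod (\<lambda>M N f. restrict f (carrier (restr_mod M)))"
  unfolding klinear_functor_def mod_cat_def
proof (intro conjI ballI allI; (simp only: mem_Collect_eq)?)
  fix L M N :: "('k, nat \<Rightarrow> 'k, 'a) rmodule" and f g c
  assume M: "fd_rmodule A M"
  interpret M: fd_rmodule A M by (rule M)
  show "fd_rmodule B (restr_mod M)" by (rule restr_mod[OF M])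
  show "restrict (\<lambda>x\<in>carrier M. x) (carrier (restr_mod M)) = (\<lambda>x\<in>carrier (restr_mod M). x)"
    by (rule restrict_ext) simp
  show "restrict (\<lambda>x\<in>carrier M. c \<odot>\<^bsub>N\<^esub> f x) (carrier (restr_mod M)) =
      (\<lambda>x\<in>carrier (restr_mod M). c \<odot>\<^bsub>restr_mod N\<^esub> restrict f (carrier (restr_mod M)) x)"
    by (rule restrict_ext) simp
  show "restrict (\<lambda>x\<in>carrier M. f x \<oplus>\<^bsub>N\<^esub> g x) (carrier (restr_mod M)) =
      (\<lambda>x\<in>carrier (restr_mod M). restrict f (carrier (restr_mod M)) x \<oplus>\<^bsub>restr_mod N\<^esub>
        restrict g (carrier (restr_mod M)) x)"
    by (rule restrict_ext) simp
  show "restrict f (carrier (restr_mod M)) \<in> rmod_hom B (restr_mod M) (restr_mod N)"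
    if "f \<in> rmod_hom A M N" by (rule restr_hom[OF M that])
next
  fix L M N :: "('k, nat \<Rightarrow> 'k, 'a) rmodule" and f g
  assume f: "f \<in> rmod_hom A L M"
  have "f x \<lhd>\<^bsub>M\<^esub> e = f x" if "x \<in> carrier L" "x \<lhd>\<^bsub>L\<^esub> e = x" for x
    using rmod_hom_ract[OF f that(1) e_closed] that by simp
  then show "restrict (compose (carrier L) g f) (carrier (restr_mod L)) =
      compose (carrier (restr_mod L)) (restrict g (carrier (restr_mod M))) (restrict f (carrier (restr_mod L)))"
    unfolding compose_def
    by (intro restrict_ext) (auto simp: rmod_hom_closed[OF f])
qed

lemma ind_functor: "klinear_functor B A ind_mod ind_map"
  unfolding klinear_functor_def mod_cat_def
proof (intro conjI ballI allI; (simp only: mem_Collect_eq)?)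
  fix M N :: "('k, nat \<Rightarrow> 'k, 'b) rmodule" and f g c
  assume M: "fd_rmodule B M"
  interpret H: fd_rmodule A "hom_mod M" by (rule hom_mod[OF M])
  note unc = uncoord_coord[OF H.fdvs]
  show "fd_rmodule A (ind_mod M)" by (rule coord_mod[OF hom_mod[OF M]])
  show "ind_map M M (\<lambda>x\<in>carrier M. x) = (\<lambda>x\<in>carrier (ind_mod M). x)"
  proof (rule restrict_ext)
    fix z assume "z \<in> carrier (ind_mod M)"
    then obtain h where h: "h \<in> carrier (hom_mod M)" "z = coord (hom_mod M) h" by (auto simp del: hom_mod_simps)
    have "compose Ae (\<lambda>x\<in>carrier M. x) h = h"
      using h rmod_hom_ext[of h B "restr_mod (reg_mod A)" M] rmod_hom_closed[of h B "restr_mod (reg_mod A)" M]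
      by (intro Id_compose) auto
    then show "coord (hom_mod M) (compose Ae (\<lambda>x\<in>carrier M. x) (uncoord (hom_mod M) z)) = z"
      using h by (simp add: unc del: hom_mod_simps)
  qed
  assume N: "fd_rmodule B N"
  interpret H': fd_rmodule A "hom_mod N" by (rule hom_mod[OF N])
  note unc = unc uncoord_coord[OF H'.fdvs]
  assume f: "f \<in> rmod_hom B M N"
  show "ind_map M N f \<in> rmod_hom A (ind_mod M) (ind_mod N)" by (rule ind_map[OF M N f])
  show "ind_map M N (\<lambda>x\<in>carrier M. c \<odot>\<^bsub>N\<^esub> f x) =
      (\<lambda>x\<in>carrier (ind_mod M). c \<odot>\<^bsub>ind_mod N\<^esub> ind_map M N f x)"
  proof (rule restrict_ext)
    fix z assume z: "z \<in> carrier (ind_mod M)"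
    then obtain h where h: "h \<in> carrier (hom_mod M)" "z = coord (hom_mod M) h" by (auto simp del: hom_mod_simps)
    have "compose Ae (\<lambda>x\<in>carrier M. c \<odot>\<^bsub>N\<^esub> f x) h = c \<odot>\<^bsub>hom_mod N\<^esub> compose Ae f h"
      unfolding hom_mod_simps compose_def
      by (rule restrict_ext) (use h rmod_hom_closed[of h B "restr_mod (reg_mod A)" M] in auto)
    then show "coord (hom_mod N) (compose Ae (\<lambda>x\<in>carrier M. c \<odot>\<^bsub>N\<^esub> f x) (uncoord (hom_mod M) z)) =
        c \<odot>\<^bsub>ind_mod N\<^esub> ind_map M N f z"
      using h z compose_hom_mod[OF f] by (simp add: unc del: hom_mod_simps)
  qed
  assume g: "g \<in> rmod_hom B M N"
  show "ind_map M N (\<lambda>x\<in>carrier M. f x \<oplus>\<^bsub>N\<^esub> g x) =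
      (\<lambda>x\<in>carrier (ind_mod M). ind_map M N f x \<oplus>\<^bsub>ind_mod N\<^esub> ind_map M N g x)"
  proof (rule restrict_ext)
    fix z assume z: "z \<in> carrier (ind_mod M)"
    then obtain h where h: "h \<in> carrier (hom_mod M)" "z = coord (hom_mod M) h" by (auto simp del: hom_mod_simps)
    have "compose Ae (\<lambda>x\<in>carrier M. f x \<oplus>\<^bsub>N\<^esub> g x) h = compose Ae f h \<oplus>\<^bsub>hom_mod N\<^esub> compose Ae g h"
      unfolding hom_mod_simps compose_def
      by (rule restrict_ext) (use h rmod_hom_closed[of h B "restr_mod (reg_mod A)" M] in auto)
    then show "coord (hom_mod N) (compose Ae (\<lambda>x\<in>carrier M. f x \<oplus>\<^bsub>N\<^esub> g x) (uncoord (hom_mod M) z)) =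
        ind_map M N f z \<oplus>\<^bsub>ind_mod N\<^esub> ind_map M N g z"
      using h z compose_hom_mod[OF f] compose_hom_mod[OF g] by (simp add: unc del: hom_mod_simps)
  qed
next
  fix L M N :: "('k, nat \<Rightarrow> 'k, 'b) rmodule" and f g
  assume L: "fd_rmodule B L" and M: "fd_rmodule B M" and f: "f \<in> rmod_hom B L M"
  interpret HL: fd_rmodule A "hom_mod L" by (rule hom_mod[OF L])
  interpret HM: fd_rmodule A "hom_mod M" by (rule hom_mod[OF M])
  show "ind_map L N (compose (carrier L) g f) = compose (carrier (ind_mod L)) (ind_map M N g) (ind_map L M f)"
    unfolding compose_def[of "carrier (ind_mod L)"]
  proof (rule restrict_ext)
    fix z assume z: "z \<in> carrier (ind_mod L)"
    then obtain h where h: "h \<in> carrier (hom_mod L)" "z = coord (hom_mod L) h" by (auto simp del: hom_mod_simps)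
    have "compose Ae (compose (carrier L) g f) h = compose Ae g (compose Ae f h)"
      unfolding compose_def
      by (rule restrict_ext) (use h rmod_hom_closed[of h B "restr_mod (reg_mod A)" L] in auto)
    then show "coord (hom_mod N) (compose Ae (compose (carrier L) g f) (uncoord (hom_mod L) z)) =
        ind_map M N g (ind_map L M f z)"
      using h z compose_hom_mod[OF f]
      by (simp add: uncoord_coord[OF HL.fdvs] uncoord_coord[OF HM.fdvs] del: hom_mod_simps)
  qed
qed

text \<open>The component at \<open>M\<close> sends \<open>x\<close> to
  \<open>y \<mapsto> xy\<close>, a map from \<open>Ae\<close> to \<open>Me\<close>. It is injective
  by \<open>ann_corner\<close> and onto by \<open>hom_from_Ae\<close>, applied to a homomorphism
  into \<open>Me\<close> regarded as taking values in \<open>M\<close>.\<close>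

lemma unit_iso:
  "nat_iso_from_id A (\<lambda>M. ind_mod (restr_mod M))
     (\<lambda>M N f. ind_map (restr_mod M) (restr_mod N) (restrict f (carrier (restr_mod M))))
     (\<lambda>M. \<lambda>x\<in>carrier M. coord (hom_mod (restr_mod M)) (\<lambda>y\<in>Ae. x \<lhd>\<^bsub>M\<^esub> y))"
  unfolding nat_iso_from_id_def mod_cat_def
proof (intro conjI ballI; (simp only: mem_Collect_eq)?)
  fix M :: "('k, nat \<Rightarrow> 'k, 'a) rmodule"
  assume M: "fd_rmodule A M"
  interpret M: fd_rmodule A M by (rule M)
  let ?H = "hom_mod (restr_mod M)"
  note H = hom_mod[OF restr_mod[OF M]]
  interpret H: fd_rmodule A ?H by (rule H)
  note unc = uncoord_coord[OF H.fdvs]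
  let ?\<eta> = "\<lambda>x\<in>carrier M. coord ?H (\<lambda>y\<in>Ae. x \<lhd>\<^bsub>M\<^esub> y)"
  interpret V: fd_rmodule B "restr_mod (reg_mod A)" by (rule restr_mod[OF A.reg_mod])
  have cl: "(\<lambda>y\<in>Ae. x \<lhd>\<^bsub>M\<^esub> y) \<in> carrier ?H" if x: "x \<in> carrier M" for x
    unfolding hom_mod_simps
    by (rule rmod_homI)
      (use x V.add_carrier V.smult_carrier V.ract_closed e_closed k_closed in
        \<open>auto simp: M.ract_closed M.ract_mult[symmetric] M.ract_add_right M.ract_smult_right\<close>)
  show "?\<eta> \<in> rmod_hom A M (ind_mod (restr_mod M))"
  proof (rule rmod_homI)
    fix x y c a
    assume x: "x \<in> carrier M"
    show "?\<eta> x \<in> carrier (ind_mod (restr_mod M))" using x cl by (simp del: hom_mod_simps)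
    have "(\<lambda>z\<in>Ae. (c \<odot>\<^bsub>M\<^esub> x) \<lhd>\<^bsub>M\<^esub> z) = c \<odot>\<^bsub>?H\<^esub> (\<lambda>y\<in>Ae. x \<lhd>\<^bsub>M\<^esub> y)"
      unfolding hom_mod_simps by (rule restrict_ext) (simp add: x M.ract_smult_left)
    then show "?\<eta> (c \<odot>\<^bsub>M\<^esub> x) = c \<odot>\<^bsub>ind_mod (restr_mod M)\<^esub> ?\<eta> x"
      using x cl by (simp add: M.smult_carrier unc del: hom_mod_simps)
    show "?\<eta> (x \<oplus>\<^bsub>M\<^esub> y) = ?\<eta> x \<oplus>\<^bsub>ind_mod (restr_mod M)\<^esub> ?\<eta> y" if y: "y \<in> carrier M"
    proof -
      have "(\<lambda>z\<in>Ae. (x \<oplus>\<^bsub>M\<^esub> y) \<lhd>\<^bsub>M\<^esub> z) = (\<lambda>z\<in>Ae. x \<lhd>\<^bsub>M\<^esub> z) \<oplus>\<^bsub>?H\<^esub> (\<lambda>z\<in>Ae. y \<lhd>\<^bsub>M\<^esub> z)"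
        unfolding hom_mod_simps by (rule restrict_ext) (simp add: x y M.ract_add_left)
      then show ?thesis
        using x y cl by (simp add: M.add_carrier unc del: hom_mod_simps)
    qed
    show "?\<eta> (x \<lhd>\<^bsub>M\<^esub> a) = ?\<eta> x \<lhd>\<^bsub>ind_mod (restr_mod M)\<^esub> a" if a: "a \<in> carrier A"
    proof -
      have "(\<lambda>z\<in>Ae. (x \<lhd>\<^bsub>M\<^esub> a) \<lhd>\<^bsub>M\<^esub> z) = (\<lambda>z\<in>Ae. x \<lhd>\<^bsub>M\<^esub> z) \<lhd>\<^bsub>?H\<^esub> a"
        unfolding hom_mod_simps by (rule restrict_ext) (simp add: x a Ae_mult M.ract_mult)
      then show ?thesis
        using x a cl by (simp add: M.ract_closed unc del: hom_mod_simps)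
    qed
  qed auto
  show "bij_betw ?\<eta> (carrier M) (carrier (ind_mod (restr_mod M)))"
  proof (rule bij_betw_imageI)
    show "inj_on ?\<eta> (carrier M)"
    proof (rule inj_onI)
      fix x y assume x: "x \<in> carrier M" and y: "y \<in> carrier M" and eq: "?\<eta> x = ?\<eta> y"
      have eq': "(\<lambda>z\<in>Ae. x \<lhd>\<^bsub>M\<^esub> z) = (\<lambda>z\<in>Ae. y \<lhd>\<^bsub>M\<^esub> z)"
        using arg_cong[OF eq[unfolded restrict_apply'[OF x] restrict_apply'[OF y]], of "uncoord ?H"]
        by (simp only: unc[OF cl[OF x]] unc[OF cl[OF y]])
      show "x = y"
      proof (rule ann_corner[OF M x y])
        fix a assume "a \<in> carrier A"
        then have ae: "a \<otimes>\<^bsub>A\<^esub> e \<in> Ae" using e_closed e_idem by (simp add: A.m_assoc)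
        show "x \<lhd>\<^bsub>M\<^esub> (a \<otimes>\<^bsub>A\<^esub> e) = y \<lhd>\<^bsub>M\<^esub> (a \<otimes>\<^bsub>A\<^esub> e)"
          by (rule fun_cong[OF eq', of "a \<otimes>\<^bsub>A\<^esub> e", unfolded restrict_apply'[OF ae]])
      qed
    qed
    show "?\<eta> ` carrier M = carrier (ind_mod (restr_mod M))"
    proof
      show "?\<eta> ` carrier M \<subseteq> carrier (ind_mod (restr_mod M))" using cl by (auto simp del: hom_mod_simps)
      show "carrier (ind_mod (restr_mod M)) \<subseteq> ?\<eta> ` carrier M"
      proof
        fix z assume "z \<in> carrier (ind_mod (restr_mod M))"
        then obtain f where f: "f \<in> rmod_hom B (restr_mod (reg_mod A)) (restr_mod M)" "z = coord ?H f" by auto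
        obtain w where w: "w \<in> carrier M"
          "\<And>y. y \<in> carrier A \<Longrightarrow> y \<otimes>\<^bsub>A\<^esub> e = y \<Longrightarrow> f y = w \<lhd>\<^bsub>M\<^esub> y"
          by (rule hom_from_Ae[OF M, of f])
            (use rmod_hom_closed[OF f(1)] rmod_hom_add[OF f(1)] rmod_hom_ract[OF f(1)] in auto)
        have "f = (\<lambda>y\<in>Ae. w \<lhd>\<^bsub>M\<^esub> y)"
          by (rule extensionalityI[where A = Ae]) (use rmod_hom_ext[OF f(1)] w in auto)
        then show "z \<in> ?\<eta> ` carrier M" using w f by auto
      qed
    qed
  qed
  fix N :: "('k, nat \<Rightarrow> 'k, 'a) rmodule" and f
  assume N: "fd_rmodule A N" and f: "f \<in> rmod_hom A M N"
  show "compose (carrier M) (\<lambda>x\<in>carrier N. coord (hom_mod (restr_mod N)) (\<lambda>y\<in>Ae. x \<lhd>\<^bsub>N\<^esub> y)) f =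
    compose (carrier M) (ind_map (restr_mod M) (restr_mod N) (restrict f (carrier (restr_mod M)))) ?\<eta>"
    unfolding compose_def[of "carrier M"]
  proof (rule restrict_ext)
    fix x assume x: "x \<in> carrier M"
    have "(\<lambda>y\<in>Ae. f x \<lhd>\<^bsub>N\<^esub> y) = compose Ae (restrict f (carrier (restr_mod M))) (\<lambda>y\<in>Ae. x \<lhd>\<^bsub>M\<^esub> y)"
      unfolding compose_def
      by (rule restrict_ext)
        (use x e_closed in \<open>simp add: M.ract_mult[symmetric] M.ract_closed rmod_hom_ract[OF f]\<close>)
    moreover have "coord ?H (\<lambda>y\<in>Ae. x \<lhd>\<^bsub>M\<^esub> y) \<in> carrier (ind_mod (restr_mod M))"
      using cl[OF x] by (simp del: hom_mod_simps)
    ultimately show "(\<lambda>x\<in>carrier N. coord (hom_mod (restr_mod N)) (\<lambda>y\<in>Ae. x \<lhd>\<^bsub>N\<^esub> y)) (f x) =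
      ind_map (restr_mod M) (restr_mod N) (restrict f (carrier (restr_mod M))) (?\<eta> x)"
      by (simp only: restrict_apply'[OF x] restrict_apply'[OF rmod_hom_closed[OF f x]]
          restrict_apply' unc[OF cl[OF x]])
  qed
qed

text \<open>The component at \<open>N\<close> sends \<open>n\<close> to
  \<open>y \<mapsto> n (eye)\<close>, with \<open>eye\<close> read in \<open>B\<close> through
  \<open>p\<close>. An element \<open>f\<close> of \<open>Hom(Ae, N)e\<close> satisfies
  \<open>f (ey) = f y\<close>, hence \<open>f y = f (e (ey)) = f e (eye)\<close>: evaluation at
  \<open>e\<close> is the inverse.\<close>

lemma counit_iso:
  "nat_iso_from_id B (\<lambda>N. restr_mod (ind_mod N))
     (\<lambda>N N' g. restrict (ind_map N N' g) (carrier (restr_mod (ind_mod N))))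
     (\<lambda>N. \<lambda>n\<in>carrier N. coord (hom_mod N) (\<lambda>y\<in>Ae. n \<lhd>\<^bsub>N\<^esub> p y))"
  unfolding nat_iso_from_id_def mod_cat_def
proof (intro conjI ballI; (simp only: mem_Collect_eq)?)
  fix N :: "('k, nat \<Rightarrow> 'k, 'b) rmodule"
  assume N: "fd_rmodule B N"
  interpret N: fd_rmodule B N by (rule N)
  note H = hom_mod[OF N]
  interpret H: fd_rmodule A "hom_mod N" by (rule H)
  note unc = uncoord_coord[OF H.fdvs]
  let ?\<epsilon> = "\<lambda>n\<in>carrier N. coord (hom_mod N) (\<lambda>y\<in>Ae. n \<lhd>\<^bsub>N\<^esub> p y)"
  interpret V: fd_rmodule B "restr_mod (reg_mod A)" by (rule restr_mod[OF A.reg_mod])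
  have pe: "p (e \<otimes>\<^bsub>A\<^esub> y) = p y" if "y \<in> carrier A" for y
    using p_k_mult[OF that B.one_closed] that by (simp add: p_closed)
  have cl: "(\<lambda>y\<in>Ae. n \<lhd>\<^bsub>N\<^esub> p y) \<in> carrier (hom_mod N)" if n: "n \<in> carrier N" for n
    unfolding hom_mod_simps
    by (rule rmod_homI)
      (use n V.add_carrier V.smult_carrier V.ract_closed e_closed k_closed in
        \<open>auto simp: N.ract_closed p_closed p_add p_smult p_mult_k N.ract_mult N.ract_add_right N.ract_smult_right\<close>)
  have cl': "coord (hom_mod N) (\<lambda>y\<in>Ae. n \<lhd>\<^bsub>N\<^esub> p y) \<in> carrier (restr_mod (ind_mod N))"
    if n: "n \<in> carrier N" for n
  proof -
    have "(\<lambda>y\<in>Ae. n \<lhd>\<^bsub>N\<^esub> p y) \<lhd>\<^bsub>hom_mod N\<^esub> e = (\<lambda>y\<in>Ae. n \<lhd>\<^bsub>N\<^esub> p y)"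
      unfolding hom_mod_simps by (rule restrict_ext) (simp add: pe Ae_mult e_closed)
    then show ?thesis using cl[OF n] by (simp add: unc del: hom_mod_simps)
  qed
  show "?\<epsilon> \<in> rmod_hom B N (restr_mod (ind_mod N))"
  proof (rule rmod_homI)
    fix x y c b
    assume x: "x \<in> carrier N"
    show "?\<epsilon> x \<in> carrier (restr_mod (ind_mod N))" using x cl' by (simp del: hom_mod_simps restr_mod_simps)
    have "(\<lambda>z\<in>Ae. (c \<odot>\<^bsub>N\<^esub> x) \<lhd>\<^bsub>N\<^esub> p z) = c \<odot>\<^bsub>hom_mod N\<^esub> (\<lambda>z\<in>Ae. x \<lhd>\<^bsub>N\<^esub> p z)"
      unfolding hom_mod_simps by (rule restrict_ext) (simp add: x p_closed N.ract_smult_left)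
    then show "?\<epsilon> (c \<odot>\<^bsub>N\<^esub> x) = c \<odot>\<^bsub>restr_mod (ind_mod N)\<^esub> ?\<epsilon> x"
      using x cl by (simp add: N.smult_carrier unc del: hom_mod_simps)
    show "?\<epsilon> (x \<oplus>\<^bsub>N\<^esub> y) = ?\<epsilon> x \<oplus>\<^bsub>restr_mod (ind_mod N)\<^esub> ?\<epsilon> y" if y: "y \<in> carrier N"
    proof -
      have "(\<lambda>z\<in>Ae. (x \<oplus>\<^bsub>N\<^esub> y) \<lhd>\<^bsub>N\<^esub> p z) = (\<lambda>z\<in>Ae. x \<lhd>\<^bsub>N\<^esub> p z) \<oplus>\<^bsub>hom_mod N\<^esub> (\<lambda>z\<in>Ae. y \<lhd>\<^bsub>N\<^esub> p z)"
        unfolding hom_mod_simps by (rule restrict_ext) (simp add: x y p_closed N.ract_add_left)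
      then show ?thesis
        using x y cl by (simp add: N.add_carrier unc del: hom_mod_simps)
    qed
    show "?\<epsilon> (x \<lhd>\<^bsub>N\<^esub> b) = ?\<epsilon> x \<lhd>\<^bsub>restr_mod (ind_mod N)\<^esub> b" if b: "b \<in> carrier B"
    proof -
      have "(\<lambda>z\<in>Ae. (x \<lhd>\<^bsub>N\<^esub> b) \<lhd>\<^bsub>N\<^esub> p z) = (\<lambda>z\<in>Ae. x \<lhd>\<^bsub>N\<^esub> p z) \<lhd>\<^bsub>hom_mod N\<^esub> k b"
        unfolding hom_mod_simps
        by (rule restrict_ext) (simp add: x b k_closed p_closed Ae_mult N.ract_mult p_k_mult)
      then show ?thesis
        using x b cl by (simp add: N.ract_closed unc del: hom_mod_simps)
    qed
  qed auto
  show "bij_betw ?\<epsilon> (carrier N) (carrier (restr_mod (ind_mod N)))"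
  proof (rule bij_betw_imageI)
    show "inj_on ?\<epsilon> (carrier N)"
    proof (rule inj_onI)
      fix x y assume x: "x \<in> carrier N" and y: "y \<in> carrier N" and eq: "?\<epsilon> x = ?\<epsilon> y"
      have "(\<lambda>z\<in>Ae. x \<lhd>\<^bsub>N\<^esub> p z) = (\<lambda>z\<in>Ae. y \<lhd>\<^bsub>N\<^esub> p z)"
        using arg_cong[OF eq[unfolded restrict_apply'[OF x] restrict_apply'[OF y]], of "uncoord (hom_mod N)"]
        by (simp only: unc[OF cl[OF x]] unc[OF cl[OF y]])
      then have "(\<lambda>z\<in>Ae. x \<lhd>\<^bsub>N\<^esub> p z) e = (\<lambda>z\<in>Ae. y \<lhd>\<^bsub>N\<^esub> p z) e" by simp
      then show "x = y" using x y e_closed e_idem by (simp add: p_k N.ract_one)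
    qed
    show "?\<epsilon> ` carrier N = carrier (restr_mod (ind_mod N))"
    proof
      show "?\<epsilon> ` carrier N \<subseteq> carrier (restr_mod (ind_mod N))"
        using cl' by (auto simp del: hom_mod_simps restr_mod_simps)
      show "carrier (restr_mod (ind_mod N)) \<subseteq> ?\<epsilon> ` carrier N"
      proof
        fix z assume z: "z \<in> carrier (restr_mod (ind_mod N))"
        then obtain f where f': "f \<in> carrier (hom_mod N)" "z = coord (hom_mod N) f"
          by (auto simp del: hom_mod_simps)
        have f: "f \<in> rmod_hom B (restr_mod (reg_mod A)) N" using f' by simp
        have "coord (hom_mod N) (f \<lhd>\<^bsub>hom_mod N\<^esub> e) = coord (hom_mod N) f"
          using z f' by (simp add: unc del: hom_mod_simps)
        then have fe: "f \<lhd>\<^bsub>hom_mod N\<^esub> e = f"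
          using unc[OF f'(1)] unc[OF H.ract_closed[OF f'(1) e_closed]] by metis
        have fe': "f (e \<otimes>\<^bsub>A\<^esub> y) = f y" if "y \<in> Ae" for y
          using fun_cong[OF fe, of y] that by simp
        have eA: "e \<in> carrier (restr_mod (reg_mod A))" using e_closed e_idem by simp
        have n: "f e \<in> carrier N" by (rule rmod_hom_closed[OF f eA])
        have "f y = f e \<lhd>\<^bsub>N\<^esub> p y" if y: "y \<in> Ae" for y
        proof -
          have "k (p y) = e \<otimes>\<^bsub>A\<^esub> y" using y e_closed by (simp add: k_p A.m_assoc)
          moreover have "e \<otimes>\<^bsub>A\<^esub> (e \<otimes>\<^bsub>A\<^esub> y) = e \<otimes>\<^bsub>A\<^esub> y"
            using y e_closed by (simp add: A.m_assoc[symmetric] e_idem)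
          ultimately show ?thesis using rmod_hom_ract[OF f eA p_closed[of y]] fe'[OF y] y by simp
        qed
        then have "f = (\<lambda>y\<in>Ae. f e \<lhd>\<^bsub>N\<^esub> p y)"
          by (intro extensionalityI[where A = Ae]) (use rmod_hom_ext[OF f] in auto)
        then have "z = ?\<epsilon> (f e)" using f' n by simp
        then show "z \<in> ?\<epsilon> ` carrier N" using n by blast
      qed
    qed
  qed
  fix N' :: "('k, nat \<Rightarrow> 'k, 'b) rmodule" and f
  assume N': "fd_rmodule B N'" and f: "f \<in> rmod_hom B N N'"
  show "compose (carrier N) (\<lambda>n\<in>carrier N'. coord (hom_mod N') (\<lambda>y\<in>Ae. n \<lhd>\<^bsub>N'\<^esub> p y)) f =
    compose (carrier N) (restrict (ind_map N N' f) (carrier (restr_mod (ind_mod N)))) ?\<epsilon>"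
    unfolding compose_def[of "carrier N"]
  proof (rule restrict_ext)
    fix x assume x: "x \<in> carrier N"
    have "(\<lambda>y\<in>Ae. f x \<lhd>\<^bsub>N'\<^esub> p y) = compose Ae f (\<lambda>y\<in>Ae. x \<lhd>\<^bsub>N\<^esub> p y)"
      unfolding compose_def
      by (rule restrict_ext) (use x in \<open>simp add: p_closed rmod_hom_ract[OF f]\<close>)
    moreover have "coord (hom_mod N) (\<lambda>y\<in>Ae. x \<lhd>\<^bsub>N\<^esub> p y) \<in> carrier (ind_mod N)"
      using cl[OF x] by (simp del: hom_mod_simps)
    ultimately show "(\<lambda>n\<in>carrier N'. coord (hom_mod N') (\<lambda>y\<in>Ae. n \<lhd>\<^bsub>N'\<^esub> p y)) (f x) =
      restrict (ind_map N N' f) (carrier (restr_mod (ind_mod N))) (?\<epsilon> x)"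
      by (simp only: restrict_apply'[OF x] restrict_apply'[OF rmod_hom_closed[OF f x]]
          restrict_apply'[OF cl'[OF x]] restrict_apply' unc[OF cl[OF x]])
  qed
qed

lemma morita: "morita_equivalent A B"
  unfolding morita_equivalent_def
  using A.fd_algebra_axioms B.fd_algebra_axioms restr_functor ind_functor unit_iso counit_iso by blast

end

lemma full_corner_morita: "full_corner A B \<Longrightarrow> morita_equivalent A B"
  using corner_emb.morita by (auto simp: full_corner_def)

section \<open>Endomorphism algebras over full corners\<close>

context corner_emb
begin

text \<open>The data say that \<open>\<kappa>\<close> identifies \<open>N\<close> with
  \<open>\<epsilon>Me\<close>, compatibly with \<open>k\<close>, where \<open>\<epsilon>\<close> is
  an idempotent endomorphism that generates the unit ideal of \<open>End(M)\<close>. Two cuts are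
  made at once: \<open>e\<close> changes the base algebra and \<open>\<epsilon>\<close> the module.
  They make \<open>End(N)\<close> a full corner of \<open>End(M)\<close>.\<close>

context
  fixes M :: "('k, 'm, 'a, 'y) rmodule_scheme" and N :: "('k, 'n, 'b, 'z) rmodule_scheme"
    and \<kappa> :: "'n \<Rightarrow> 'm" and \<epsilon> :: "'m \<Rightarrow> 'm"
  assumes M: "fd_rmodule A M" and N: "fd_rmodule B N"
    and \<kappa>_closed: "\<And>n. n \<in> carrier N \<Longrightarrow> \<kappa> n \<in> carrier M"
    and \<kappa>_inj: "inj_on \<kappa> (carrier N)"
    and \<kappa>_add: "\<And>n n'. n \<in> carrier N \<Longrightarrow> n' \<in> carrier N \<Longrightarrow> \<kappa> (n \<oplus>\<^bsub>N\<^esub> n') = \<kappa> n \<oplus>\<^bsub>M\<^esub> \<kappa> n'"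
    and \<kappa>_smult: "\<And>c n. n \<in> carrier N \<Longrightarrow> \<kappa> (c \<odot>\<^bsub>N\<^esub> n) = c \<odot>\<^bsub>M\<^esub> \<kappa> n"
    and \<kappa>_ract: "\<And>n b. n \<in> carrier N \<Longrightarrow> b \<in> carrier B \<Longrightarrow> \<kappa> (n \<lhd>\<^bsub>N\<^esub> b) = \<kappa> n \<lhd>\<^bsub>M\<^esub> k b"
    and \<epsilon>: "\<epsilon> \<in> rmod_hom A M M"
    and \<epsilon>_idem: "\<And>x. x \<in> carrier M \<Longrightarrow> \<epsilon> (\<epsilon> x) = \<epsilon> x"
    and \<kappa>_image: "\<And>x. x \<in> carrier M \<Longrightarrow> \<epsilon> x = x \<Longrightarrow> x \<lhd>\<^bsub>M\<^esub> e = x \<Longrightarrow> x \<in> \<kappa> ` carrier N"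
    and \<epsilon>_\<kappa>: "\<And>n. n \<in> carrier N \<Longrightarrow> \<epsilon> (\<kappa> n) = \<kappa> n"
    and \<epsilon>_full: "\<And>I. ideal I (End_alg A M) \<Longrightarrow> \<epsilon> \<in> I \<Longrightarrow> \<one>\<^bsub>End_alg A M\<^esub> \<in> I"
begin

interpretation M: fd_rmodule A M by (rule M)
interpretation N: fd_rmodule B N by (rule N)

definition \<iota> where "\<iota> = the_inv_into (carrier N) \<kappa>"

lemma \<iota>_\<kappa>: "n \<in> carrier N \<Longrightarrow> \<iota> (\<kappa> n) = n"
  by (simp add: \<iota>_def the_inv_into_f_f[OF \<kappa>_inj])

lemma \<kappa>_\<epsilon>_Ae:
  assumes x: "x \<in> carrier M" and y: "y \<in> Ae"
  obtains n where "n \<in> carrier N" "\<epsilon> x \<lhd>\<^bsub>M\<^esub> y = \<kappa> n"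
proof -
  have "\<epsilon> x \<lhd>\<^bsub>M\<^esub> y \<in> \<kappa> ` carrier N"
    using x y e_closed
    by (intro \<kappa>_image)
      (simp_all add: M.ract_closed rmod_hom_closed[OF \<epsilon>] M.ract_mult[symmetric] rmod_hom_ract[OF \<epsilon>] \<epsilon>_idem)
  then show thesis using that by blast
qed

lemma \<kappa>_e: "n \<in> carrier N \<Longrightarrow> \<kappa> n \<lhd>\<^bsub>M\<^esub> e = \<kappa> n"
  using \<kappa>_ract[of n "\<one>\<^bsub>B\<^esub>"] by (simp add: N.ract_one)

text \<open>The extension of \<open>f \<in> End(N)\<close> to \<open>M\<close>: the value at \<open>x\<close> is determined by its products with
  \<open>Ae\<close>, and these lie in \<open>\<epsilon>Me\<close>, where \<open>f\<close> is defined.\<close>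

definition ext_rel where
  "ext_rel f x w \<longleftrightarrow> w \<in> carrier M \<and> (\<forall>y\<in>Ae. w \<lhd>\<^bsub>M\<^esub> y = \<kappa> (f (\<iota> (\<epsilon> x \<lhd>\<^bsub>M\<^esub> y))))"

lemma ext_rel_unique:
  assumes "ext_rel f x w" "ext_rel f x w'"
  shows "w = w'"
proof (rule ann_corner[OF M])
  fix a assume "a \<in> carrier A"
  then have "a \<otimes>\<^bsub>A\<^esub> e \<in> Ae" using e_closed e_idem by (simp add: A.m_assoc)
  then show "w \<lhd>\<^bsub>M\<^esub> (a \<otimes>\<^bsub>A\<^esub> e) = w' \<lhd>\<^bsub>M\<^esub> (a \<otimes>\<^bsub>A\<^esub> e)" using assms by (simp add: ext_rel_def)
qed (use assms in \<open>auto simp: ext_rel_def\<close>)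

text \<open>By \<open>hom_from_Ae\<close>: the prescribed products with \<open>Ae\<close> depend
  additively on \<open>y\<close> and linearly over the corner, because \<open>\<kappa>\<close> and
  \<open>f\<close> respect both structures, so a single element of \<open>M\<close> realises
  them.\<close>

lemma ext_rel_ex:
  assumes f: "f \<in> rmod_hom B N N" and x: "x \<in> carrier M"
  shows "\<exists>w. ext_rel f x w"
proof -
  note \<epsilon>x = rmod_hom_closed[OF \<epsilon> x]
  show ?thesis
  proof (rule hom_from_Ae[OF M, of "\<lambda>y. \<kappa> (f (\<iota> (\<epsilon> x \<lhd>\<^bsub>M\<^esub> y)))"])
    fix y assume y: "y \<in> carrier A" "y \<otimes>\<^bsub>A\<^esub> e = y"
    then obtain n where n: "n \<in> carrier N" "\<epsilon> x \<lhd>\<^bsub>M\<^esub> y = \<kappa> n" using \<kappa>_\<epsilon>_Ae[OF x, of y] by auto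
    show "\<kappa> (f (\<iota> (\<epsilon> x \<lhd>\<^bsub>M\<^esub> y))) \<in> carrier M"
      using n by (simp add: \<iota>_\<kappa> rmod_hom_closed[OF f] \<kappa>_closed)
    show "\<kappa> (f (\<iota> (\<epsilon> x \<lhd>\<^bsub>M\<^esub> (y \<otimes>\<^bsub>A\<^esub> k b)))) = \<kappa> (f (\<iota> (\<epsilon> x \<lhd>\<^bsub>M\<^esub> y))) \<lhd>\<^bsub>M\<^esub> k b" if b: "b \<in> carrier B" for b
    proof -
      have "\<epsilon> x \<lhd>\<^bsub>M\<^esub> (y \<otimes>\<^bsub>A\<^esub> k b) = \<kappa> (n \<lhd>\<^bsub>N\<^esub> b)"
        using n b y \<epsilon>x by (simp add: M.ract_mult k_closed \<kappa>_ract)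
      then have "\<iota> (\<epsilon> x \<lhd>\<^bsub>M\<^esub> (y \<otimes>\<^bsub>A\<^esub> k b)) = n \<lhd>\<^bsub>N\<^esub> b"
        using n b N.ract_closed \<iota>_\<kappa> by metis
      then show ?thesis
        using n b by (simp add: \<iota>_\<kappa> N.ract_closed rmod_hom_ract[OF f] rmod_hom_closed[OF f] \<kappa>_ract)
    qed
    fix z assume z: "z \<in> carrier A" "z \<otimes>\<^bsub>A\<^esub> e = z"
    then obtain n' where n': "n' \<in> carrier N" "\<epsilon> x \<lhd>\<^bsub>M\<^esub> z = \<kappa> n'" using \<kappa>_\<epsilon>_Ae[OF x, of z] by auto
    have "\<epsilon> x \<lhd>\<^bsub>M\<^esub> (y \<oplus>\<^bsub>A\<^esub> z) = \<kappa> (n \<oplus>\<^bsub>N\<^esub> n')"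
      using n n' y z \<epsilon>x by (simp add: M.ract_add_right \<kappa>_add)
    then have "\<iota> (\<epsilon> x \<lhd>\<^bsub>M\<^esub> (y \<oplus>\<^bsub>A\<^esub> z)) = n \<oplus>\<^bsub>N\<^esub> n'"
      using n n' N.add_carrier \<iota>_\<kappa> by metis
    then show "\<kappa> (f (\<iota> (\<epsilon> x \<lhd>\<^bsub>M\<^esub> (y \<oplus>\<^bsub>A\<^esub> z)))) = \<kappa> (f (\<iota> (\<epsilon> x \<lhd>\<^bsub>M\<^esub> y))) \<oplus>\<^bsub>M\<^esub> \<kappa> (f (\<iota> (\<epsilon> x \<lhd>\<^bsub>M\<^esub> z)))"
      using n n' by (simp add: \<iota>_\<kappa> N.add_carrier rmod_hom_add[OF f] rmod_hom_closed[OF f] \<kappa>_add)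
  next
    fix w assume "w \<in> carrier M" "\<And>y. y \<in> carrier A \<Longrightarrow> y \<otimes>\<^bsub>A\<^esub> e = y \<Longrightarrow> \<kappa> (f (\<iota> (\<epsilon> x \<lhd>\<^bsub>M\<^esub> y))) = w \<lhd>\<^bsub>M\<^esub> y"
    then show "\<exists>w. ext_rel f x w" by (auto simp: ext_rel_def)
  qed
qed

definition extend where "extend f = (\<lambda>x\<in>carrier M. THE w. ext_rel f x w)"

lemma extend_eqI: "x \<in> carrier M \<Longrightarrow> ext_rel f x w \<Longrightarrow> extend f x = w"
  by (simp add: extend_def) (rule the_equality, auto intro: ext_rel_unique)

lemma extend_rel: "f \<in> rmod_hom B N N \<Longrightarrow> x \<in> carrier M \<Longrightarrow> ext_rel f x (extend f x)"
  using ext_rel_ex extend_eqI by metis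

lemma extend_closed: "f \<in> rmod_hom B N N \<Longrightarrow> x \<in> carrier M \<Longrightarrow> extend f x \<in> carrier M"
  using extend_rel by (simp add: ext_rel_def)

lemma extend_ract: "f \<in> rmod_hom B N N \<Longrightarrow> x \<in> carrier M \<Longrightarrow> y \<in> Ae \<Longrightarrow>
    extend f x \<lhd>\<^bsub>M\<^esub> y = \<kappa> (f (\<iota> (\<epsilon> x \<lhd>\<^bsub>M\<^esub> y)))"
  using extend_rel by (simp add: ext_rel_def)

lemma extend_\<kappa>:
  assumes f: "f \<in> rmod_hom B N N" and x: "x \<in> carrier M" "y \<in> Ae" "n \<in> carrier N" "\<epsilon> x \<lhd>\<^bsub>M\<^esub> y = \<kappa> n"
  shows "extend f x \<lhd>\<^bsub>M\<^esub> y = \<kappa> (f n)"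
  using extend_ract[OF f x(1,2)] x by (simp add: \<iota>_\<kappa>)

lemma extend_hom:
  assumes f: "f \<in> rmod_hom B N N"
  shows "extend f \<in> rmod_hom A M M"
proof (rule rmod_homI)
  show "extend f \<in> extensional (carrier M)" by (simp add: extend_def)
  fix x x' c a assume x: "x \<in> carrier M"
  note cl = rmod_hom_closed[OF \<epsilon>] extend_closed[OF f] rmod_hom_closed[OF f] M.add_carrier M.smult_carrier
    M.ract_closed N.add_carrier N.smult_carrier N.ract_closed
  show "extend f x \<in> carrier M" using extend_closed[OF f x] .
  show "extend f (c \<odot>\<^bsub>M\<^esub> x) = c \<odot>\<^bsub>M\<^esub> extend f x"
  proof (rule extend_eqI)
    have "(c \<odot>\<^bsub>M\<^esub> extend f x) \<lhd>\<^bsub>M\<^esub> y = \<kappa> (f (\<iota> (\<epsilon> (c \<odot>\<^bsub>M\<^esub> x) \<lhd>\<^bsub>M\<^esub> y)))" if y: "y \<in> Ae" for y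
    proof -
      obtain n where n: "n \<in> carrier N" "\<epsilon> x \<lhd>\<^bsub>M\<^esub> y = \<kappa> n" using \<kappa>_\<epsilon>_Ae[OF x y] by blast
      have "\<epsilon> (c \<odot>\<^bsub>M\<^esub> x) \<lhd>\<^bsub>M\<^esub> y = \<kappa> (c \<odot>\<^bsub>N\<^esub> n)"
        using n x y by (simp add: rmod_hom_smult[OF \<epsilon>] M.ract_smult_left cl \<kappa>_smult)
      then have "\<iota> (\<epsilon> (c \<odot>\<^bsub>M\<^esub> x) \<lhd>\<^bsub>M\<^esub> y) = c \<odot>\<^bsub>N\<^esub> n"
        using n N.smult_carrier \<iota>_\<kappa> by metis
      then show ?thesis
        using extend_\<kappa>[OF f x y n] n x y
        by (simp add: \<iota>_\<kappa> cl M.ract_smult_left rmod_hom_smult[OF f] \<kappa>_smult)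
    qed
    then show "ext_rel f (c \<odot>\<^bsub>M\<^esub> x) (c \<odot>\<^bsub>M\<^esub> extend f x)" using x by (simp add: ext_rel_def cl)
  qed (simp add: x cl)
  show "extend f (x \<lhd>\<^bsub>M\<^esub> a) = extend f x \<lhd>\<^bsub>M\<^esub> a" if a: "a \<in> carrier A"
  proof (rule extend_eqI)
    have "(extend f x \<lhd>\<^bsub>M\<^esub> a) \<lhd>\<^bsub>M\<^esub> y = \<kappa> (f (\<iota> (\<epsilon> (x \<lhd>\<^bsub>M\<^esub> a) \<lhd>\<^bsub>M\<^esub> y)))" if y: "y \<in> Ae" for y
    proof -
      have "a \<otimes>\<^bsub>A\<^esub> y \<in> Ae" using a y Ae_mult by simp
      from extend_ract[OF f x this] show ?thesis
        using x a y by (simp add: cl M.ract_mult rmod_hom_ract[OF \<epsilon>])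
    qed
    then show "ext_rel f (x \<lhd>\<^bsub>M\<^esub> a) (extend f x \<lhd>\<^bsub>M\<^esub> a)" using x a by (simp add: ext_rel_def cl)
  qed (simp add: x a cl)
  show "extend f (x \<oplus>\<^bsub>M\<^esub> x') = extend f x \<oplus>\<^bsub>M\<^esub> extend f x'" if x': "x' \<in> carrier M"
  proof (rule extend_eqI)
    have "(extend f x \<oplus>\<^bsub>M\<^esub> extend f x') \<lhd>\<^bsub>M\<^esub> y = \<kappa> (f (\<iota> (\<epsilon> (x \<oplus>\<^bsub>M\<^esub> x') \<lhd>\<^bsub>M\<^esub> y)))" if y: "y \<in> Ae" for y
    proof -
      obtain n where n: "n \<in> carrier N" "\<epsilon> x \<lhd>\<^bsub>M\<^esub> y = \<kappa> n" using \<kappa>_\<epsilon>_Ae[OF x y] by blast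
      obtain n' where n': "n' \<in> carrier N" "\<epsilon> x' \<lhd>\<^bsub>M\<^esub> y = \<kappa> n'" using \<kappa>_\<epsilon>_Ae[OF x' y] by blast
      have "\<epsilon> (x \<oplus>\<^bsub>M\<^esub> x') \<lhd>\<^bsub>M\<^esub> y = \<kappa> (n \<oplus>\<^bsub>N\<^esub> n')"
        using n n' x x' y by (simp add: rmod_hom_add[OF \<epsilon>] M.ract_add_left cl \<kappa>_add)
      then have "\<iota> (\<epsilon> (x \<oplus>\<^bsub>M\<^esub> x') \<lhd>\<^bsub>M\<^esub> y) = n \<oplus>\<^bsub>N\<^esub> n'"
        using n n' N.add_carrier \<iota>_\<kappa> by metis
      then show ?thesis
        using extend_\<kappa>[OF f x y n] extend_\<kappa>[OF f x' y n'] n n' x x' y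
        by (simp add: \<iota>_\<kappa> cl M.ract_add_left rmod_hom_add[OF f] \<kappa>_add)
    qed
    then show "ext_rel f (x \<oplus>\<^bsub>M\<^esub> x') (extend f x \<oplus>\<^bsub>M\<^esub> extend f x')"
      using x x' by (simp add: ext_rel_def cl)
  qed (simp add: x x' cl)
qed

text \<open>Extension does not preserve units: \<open>extend f\<close> depends on \<open>x\<close>
  through \<open>\<epsilon> x\<close> only, and the unit of the corner is \<open>\<epsilon>\<close>.
  Hence fullness of the corner is precisely the assumption \<open>\<epsilon>_full\<close>.\<close>

lemma extend_one: "extend (\<lambda>x\<in>carrier N. x) = \<epsilon>"
proof (rule extensionalityI[where A = "carrier M"])
  fix x assume x: "x \<in> carrier M"
  have "\<epsilon> x \<lhd>\<^bsub>M\<^esub> y = \<kappa> ((\<lambda>x\<in>carrier N. x) (\<iota> (\<epsilon> x \<lhd>\<^bsub>M\<^esub> y)))" if y: "y \<in> Ae" for y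
  proof -
    obtain n where "n \<in> carrier N" "\<epsilon> x \<lhd>\<^bsub>M\<^esub> y = \<kappa> n" using \<kappa>_\<epsilon>_Ae[OF x y] by blast
    then show ?thesis by (simp add: \<iota>_\<kappa>)
  qed
  then have "ext_rel (\<lambda>x\<in>carrier N. x) x (\<epsilon> x)"
    unfolding ext_rel_def using rmod_hom_closed[OF \<epsilon> x] by blast
  then show "extend (\<lambda>x\<in>carrier N. x) x = \<epsilon> x" by (rule extend_eqI[OF x])
qed (use rmod_hom_ext[OF \<epsilon>] in \<open>auto simp: extend_def\<close>)

lemma corner_emb_End: "corner_emb (End_alg A M) (End_alg B N) extend"
proof (intro corner_emb.intro corner_emb_axioms.intro End_alg[OF M] End_alg[OF N])
  fix f g c
  assume "f \<in> carrier (End_alg B N)"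
  then have f: "f \<in> rmod_hom B N N" by simp
  show "extend f \<in> carrier (End_alg A M)" using extend_hom[OF f] by simp
  show "extend (c \<odot>\<^bsub>End_alg B N\<^esub> f) = c \<odot>\<^bsub>End_alg A M\<^esub> extend f"
  proof (rule extensionalityI[where A = "carrier M"])
    fix x assume x: "x \<in> carrier M"
    have "(c \<odot>\<^bsub>M\<^esub> extend f x) \<lhd>\<^bsub>M\<^esub> y = \<kappa> ((\<lambda>n\<in>carrier N. c \<odot>\<^bsub>N\<^esub> f n) (\<iota> (\<epsilon> x \<lhd>\<^bsub>M\<^esub> y)))"
      if y: "y \<in> Ae" for y
    proof -
      obtain n where n: "n \<in> carrier N" "\<epsilon> x \<lhd>\<^bsub>M\<^esub> y = \<kappa> n" using \<kappa>_\<epsilon>_Ae[OF x y] by blast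
      then show ?thesis
        using extend_\<kappa>[OF f x y n] x y extend_closed[OF f x]
        by (simp add: \<iota>_\<kappa> M.ract_smult_left \<kappa>_smult rmod_hom_closed[OF f])
    qed
    then have "ext_rel (\<lambda>n\<in>carrier N. c \<odot>\<^bsub>N\<^esub> f n) x (c \<odot>\<^bsub>M\<^esub> extend f x)"
      unfolding ext_rel_def using M.smult_carrier extend_closed[OF f x] by blast
    from extend_eqI[OF x this] x show "extend (c \<odot>\<^bsub>End_alg B N\<^esub> f) x = (c \<odot>\<^bsub>End_alg A M\<^esub> extend f) x" by simp
  qed (auto simp: extend_def)
  assume "g \<in> carrier (End_alg B N)"
  then have g: "g \<in> rmod_hom B N N" by simp
  show "extend (f \<oplus>\<^bsub>End_alg B N\<^esub> g) = extend f \<oplus>\<^bsub>End_alg A M\<^esub> extend g"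
  proof (rule extensionalityI[where A = "carrier M"])
    fix x assume x: "x \<in> carrier M"
    have "(extend f x \<oplus>\<^bsub>M\<^esub> extend g x) \<lhd>\<^bsub>M\<^esub> y = \<kappa> ((\<lambda>n\<in>carrier N. f n \<oplus>\<^bsub>N\<^esub> g n) (\<iota> (\<epsilon> x \<lhd>\<^bsub>M\<^esub> y)))"
      if y: "y \<in> Ae" for y
    proof -
      obtain n where n: "n \<in> carrier N" "\<epsilon> x \<lhd>\<^bsub>M\<^esub> y = \<kappa> n" using \<kappa>_\<epsilon>_Ae[OF x y] by blast
      then show ?thesis
        using extend_\<kappa>[OF f x y n] extend_\<kappa>[OF g x y n] x y extend_closed[OF f x] extend_closed[OF g x]
        by (simp add: \<iota>_\<kappa> M.ract_add_left \<kappa>_add rmod_hom_closed[OF f] rmod_hom_closed[OF g])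
    qed
    then have "ext_rel (\<lambda>n\<in>carrier N. f n \<oplus>\<^bsub>N\<^esub> g n) x (extend f x \<oplus>\<^bsub>M\<^esub> extend g x)"
      unfolding ext_rel_def using M.add_carrier extend_closed[OF f x] extend_closed[OF g x] by blast
    from extend_eqI[OF x this] x
    show "extend (f \<oplus>\<^bsub>End_alg B N\<^esub> g) x = (extend f \<oplus>\<^bsub>End_alg A M\<^esub> extend g) x" by simp
  qed (auto simp: extend_def)
  show "extend (f \<otimes>\<^bsub>End_alg B N\<^esub> g) = extend f \<otimes>\<^bsub>End_alg A M\<^esub> extend g"
  proof (rule extensionalityI[where A = "carrier M"])
    fix x assume x: "x \<in> carrier M"
    have "extend f (extend g x) \<lhd>\<^bsub>M\<^esub> y = \<kappa> (compose (carrier N) f g (\<iota> (\<epsilon> x \<lhd>\<^bsub>M\<^esub> y)))"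
      if y: "y \<in> Ae" for y
    proof -
      obtain n where n: "n \<in> carrier N" "\<epsilon> x \<lhd>\<^bsub>M\<^esub> y = \<kappa> n" using \<kappa>_\<epsilon>_Ae[OF x y] by blast
      \<comment> \<open>Products of \<open>extend g x\<close> with \<open>Ae\<close> lie in the
        image of \<open>\<kappa>\<close>, which \<open>\<epsilon>\<close> fixes; so the outer
        extension sees \<open>g n\<close> itself.\<close>
      have "\<epsilon> (extend g x) \<lhd>\<^bsub>M\<^esub> y = \<epsilon> (extend g x \<lhd>\<^bsub>M\<^esub> y)"
        using extend_closed[OF g x] y by (simp add: rmod_hom_ract[OF \<epsilon>])
      also have "\<dots> = \<kappa> (g n)" using extend_\<kappa>[OF g x y n] n by (simp add: \<epsilon>_\<kappa> rmod_hom_closed[OF g])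
      finally show ?thesis
        using extend_\<kappa>[OF f extend_closed[OF g x] y, of "g n"] n by (simp add: \<iota>_\<kappa> rmod_hom_closed[OF g] compose_def)
    qed
    then have "ext_rel (compose (carrier N) f g) x (extend f (extend g x))"
      unfolding ext_rel_def using extend_closed[OF f extend_closed[OF g x]] by blast
    from extend_eqI[OF x this] x
    show "extend (f \<otimes>\<^bsub>End_alg B N\<^esub> g) x = (extend f \<otimes>\<^bsub>End_alg A M\<^esub> extend g) x" by (simp add: compose_def)
  qed (auto simp: extend_def)
next
  show "inj_on extend (carrier (End_alg B N))"
  proof (rule inj_onI)
    fix f g assume "f \<in> carrier (End_alg B N)" "g \<in> carrier (End_alg B N)" and eq: "extend f = extend g"
    then have f: "f \<in> rmod_hom B N N" and g: "g \<in> rmod_hom B N N" by simp_all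
    show "f = g"
    proof (rule rmod_hom_eqI[OF f g])
      fix n assume n: "n \<in> carrier N"
      have eA: "e \<in> Ae" using e_closed e_idem by simp
      have "\<epsilon> (\<kappa> n) \<lhd>\<^bsub>M\<^esub> e = \<kappa> n" using n by (simp add: \<epsilon>_\<kappa> \<kappa>_e)
      then have "\<kappa> (f n) = \<kappa> (g n)"
        using extend_\<kappa>[OF f \<kappa>_closed[OF n] eA n] extend_\<kappa>[OF g \<kappa>_closed[OF n] eA n] eq by simp
      then show "f n = g n"
        using \<kappa>_inj n rmod_hom_closed[OF f] rmod_hom_closed[OF g] by (auto dest: inj_onD)
    qed
  qed
next
  fix u assume "u \<in> carrier (End_alg A M)"
  then have u: "u \<in> rmod_hom A M M" by simp
  note cl = rmod_hom_closed[OF u] rmod_hom_closed[OF \<epsilon>]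
  \<comment> \<open>\<open>\<epsilon> u\<close> maps \<open>\<epsilon>Me\<close> into itself, since
    both maps commute with the action of \<open>e\<close>. The induced endomorphism \<open>h\<close>
    of \<open>N\<close> has \<open>\<epsilon> u \<epsilon>\<close> as its extension.\<close>
  have "\<exists>m\<in>carrier N. \<epsilon> (u (\<kappa> n)) = \<kappa> m" if n: "n \<in> carrier N" for n
  proof -
    have "\<epsilon> (u (\<kappa> n)) \<lhd>\<^bsub>M\<^esub> e = \<epsilon> (u (\<kappa> n \<lhd>\<^bsub>M\<^esub> e))"
      using n e_closed by (simp add: cl rmod_hom_ract[OF u] rmod_hom_ract[OF \<epsilon>] \<kappa>_closed)
    then show ?thesis
      using \<kappa>_image[of "\<epsilon> (u (\<kappa> n))"] n by (auto simp: cl \<kappa>_closed \<kappa>_e \<epsilon>_idem)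
  qed
  then obtain h where h: "\<And>n. n \<in> carrier N \<Longrightarrow> h n \<in> carrier N"
    "\<And>n. n \<in> carrier N \<Longrightarrow> \<epsilon> (u (\<kappa> n)) = \<kappa> (h n)" by metis
  have eqI: "m = m'" if "\<kappa> m = \<kappa> m'" "m \<in> carrier N" "m' \<in> carrier N" for m m'
    using \<kappa>_inj that by (auto dest: inj_onD)
  have f: "(\<lambda>n\<in>carrier N. h n) \<in> rmod_hom B N N"
  proof (rule rmod_homI)
    fix n m c b assume n: "n \<in> carrier N"
    show "(\<lambda>n\<in>carrier N. h n) n \<in> carrier N" using n h by simp
    show "(\<lambda>n\<in>carrier N. h n) (c \<odot>\<^bsub>N\<^esub> n) = c \<odot>\<^bsub>N\<^esub> (\<lambda>n\<in>carrier N. h n) n"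
      by (rule eqI) (simp_all add: n h N.smult_carrier \<kappa>_smult flip: h(2),
          simp add: n \<kappa>_smult cl \<kappa>_closed rmod_hom_smult[OF u] rmod_hom_smult[OF \<epsilon>])
    show "(\<lambda>n\<in>carrier N. h n) (n \<oplus>\<^bsub>N\<^esub> m) = (\<lambda>n\<in>carrier N. h n) n \<oplus>\<^bsub>N\<^esub> (\<lambda>n\<in>carrier N. h n) m"
      if m: "m \<in> carrier N"
      by (rule eqI) (simp_all add: n m h N.add_carrier \<kappa>_add flip: h(2),
          simp add: n m \<kappa>_add cl \<kappa>_closed rmod_hom_add[OF u] rmod_hom_add[OF \<epsilon>])
    show "(\<lambda>n\<in>carrier N. h n) (n \<lhd>\<^bsub>N\<^esub> b) = (\<lambda>n\<in>carrier N. h n) n \<lhd>\<^bsub>N\<^esub> b" if b: "b \<in> carrier B"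
      by (rule eqI) (simp_all add: n b h N.ract_closed \<kappa>_ract flip: h(2),
          simp add: n b k_closed \<kappa>_ract cl \<kappa>_closed rmod_hom_ract[OF u] rmod_hom_ract[OF \<epsilon>])
  qed simp
  have "\<epsilon> \<otimes>\<^bsub>End_alg A M\<^esub> u \<otimes>\<^bsub>End_alg A M\<^esub> \<epsilon> = extend (\<lambda>n\<in>carrier N. h n)"
  proof (rule extensionalityI[where A = "carrier M"])
    fix x assume x: "x \<in> carrier M"
    have "\<epsilon> (u (\<epsilon> x)) \<lhd>\<^bsub>M\<^esub> y = \<kappa> ((\<lambda>n\<in>carrier N. h n) (\<iota> (\<epsilon> x \<lhd>\<^bsub>M\<^esub> y)))" if y: "y \<in> Ae" for y
    proof -
      obtain n where n: "n \<in> carrier N" "\<epsilon> x \<lhd>\<^bsub>M\<^esub> y = \<kappa> n" using \<kappa>_\<epsilon>_Ae[OF x y] by blast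
      have "\<epsilon> (u (\<epsilon> x)) \<lhd>\<^bsub>M\<^esub> y = \<epsilon> (u (\<epsilon> x \<lhd>\<^bsub>M\<^esub> y))"
        using x y by (simp add: cl rmod_hom_ract[OF u] rmod_hom_ract[OF \<epsilon>])
      then show ?thesis using n by (simp add: h \<iota>_\<kappa>)
    qed
    then have "ext_rel (\<lambda>n\<in>carrier N. h n) x (\<epsilon> (u (\<epsilon> x)))" unfolding ext_rel_def using cl x by blast
    from extend_eqI[OF x this] x
    show "(\<epsilon> \<otimes>\<^bsub>End_alg A M\<^esub> u \<otimes>\<^bsub>End_alg A M\<^esub> \<epsilon>) x = extend (\<lambda>n\<in>carrier N. h n) x"
      by (simp add: compose_def cl)
  qed (auto simp: extend_def compose_def)
  then show "extend \<one>\<^bsub>End_alg B N\<^esub> \<otimes>\<^bsub>End_alg A M\<^esub> u \<otimes>\<^bsub>End_alg A M\<^esub> extend \<one>\<^bsub>End_alg B N\<^esub> \<in> extend ` carrier (End_alg B N)"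
    using f by (simp add: extend_one)
next
  show "\<one>\<^bsub>End_alg A M\<^esub> \<in> I" if "ideal I (End_alg A M)" "extend \<one>\<^bsub>End_alg B N\<^esub> \<in> I" for I
    using \<epsilon>_full that by (simp add: extend_one)
qed

end

end

section \<open>One SGC extension\<close>

abbreviation sgc_mod where "sgc_mod A \<equiv> dsum_mod (reg_mod A) (dual_mod A)"
abbreviation sgc_alg where "sgc_alg A \<equiv> End_alg A (sgc_mod A)"

text \<open>Left multiplication commutes with the right action, so this maps \<open>A\<close> into
  \<open>End(A \<oplus> DA)\<close>; for an idempotent it is the projection onto
  \<open>eA \<oplus> e(DA)\<close>.\<close>

definition left_mult :: "('k::field, 'a) module \<Rightarrow> 'a \<Rightarrow> 'a \<times> ('a \<Rightarrow> 'k) \<Rightarrow> 'a \<times> ('a \<Rightarrow> 'k)" where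
  "left_mult A c = (\<lambda>v\<in>carrier (sgc_mod A). (c \<otimes>\<^bsub>A\<^esub> fst v, lact (dual_mod A) c (snd v)))"

context fd_algebra
begin

lemma sgc_mod: "fd_rmodule A (sgc_mod A)"
  by (rule dsum_mod[OF reg_mod dual_mod])

lemma lact_rules:
  assumes a: "a \<in> carrier A"
  shows "f \<in> carrier (dual_mod A) \<Longrightarrow> g \<in> carrier (dual_mod A) \<Longrightarrow>
      lact (dual_mod A) a (f \<oplus>\<^bsub>dual_mod A\<^esub> g) = lact (dual_mod A) a f \<oplus>\<^bsub>dual_mod A\<^esub> lact (dual_mod A) a g"
    and "f \<in> carrier (dual_mod A) \<Longrightarrow> lact (dual_mod A) a (c \<odot>\<^bsub>dual_mod A\<^esub> f) = c \<odot>\<^bsub>dual_mod A\<^esub> lact (dual_mod A) a f"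
    and "f \<in> carrier (dual_mod A) \<Longrightarrow> b \<in> carrier A \<Longrightarrow>
      lact (dual_mod A) a (f \<lhd>\<^bsub>dual_mod A\<^esub> b) = lact (dual_mod A) a f \<lhd>\<^bsub>dual_mod A\<^esub> b"
    and "f \<in> carrier (dual_mod A) \<Longrightarrow> b \<in> carrier A \<Longrightarrow>
      lact (dual_mod A) (a \<oplus> b) f = lact (dual_mod A) a f \<oplus>\<^bsub>dual_mod A\<^esub> lact (dual_mod A) b f"
    and "f \<in> carrier (dual_mod A) \<Longrightarrow> b \<in> carrier A \<Longrightarrow>
      lact (dual_mod A) (a \<otimes> b) f = lact (dual_mod A) a (lact (dual_mod A) b f)"
  unfolding dual_mod_simps
  by (rule restrict_ext; use a in \<open>simp add: m_assoc r_distr dual_add\<close>)+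

lemma left_mult_hom:
  assumes c: "c \<in> carrier A"
  shows "left_mult A c \<in> rmod_hom A (sgc_mod A) (sgc_mod A)"
proof -
  interpret D: fd_rmodule A "dual_mod A" by (rule dual_mod)
  show ?thesis
    by (rule rmod_homI)
      (use c in \<open>auto simp: left_mult_def dual_lact_closed smult_carrier D.add_carrier D.smult_carrier
        D.ract_closed lact_rules r_distr m_assoc smult_mult_right\<close>)
qed

text \<open>The preimage of an ideal under the ring homomorphism \<open>left_mult A\<close>.
  Consequently, if \<open>e\<close> is full in \<open>A\<close>, then \<open>left_mult A e\<close>
  is full in the endomorphism algebra.\<close>

lemma left_mult_full:
  assumes I: "ideal I (sgc_alg A)"
  shows "ideal {c \<in> carrier A. left_mult A c \<in> I} A"
proof -
  interpret E: fd_algebra "sgc_alg A" by (rule End_alg[OF sgc_mod])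
  interpret I: ideal I "sgc_alg A" by (rule I)
  have left_mult_carrier: "left_mult A c \<in> carrier (sgc_alg A)" if "c \<in> carrier A" for c
    using left_mult_hom[OF that] by simp
  have add: "left_mult A (c \<oplus> d) = left_mult A c \<oplus>\<^bsub>sgc_alg A\<^esub> left_mult A d"
    if "c \<in> carrier A" "d \<in> carrier A" for c d
    unfolding End_alg_simps left_mult_def
    by (rule restrict_ext) (use that in \<open>auto simp: lact_rules l_distr\<close>)
  have mult: "left_mult A (c \<otimes> d) = left_mult A c \<otimes>\<^bsub>sgc_alg A\<^esub> left_mult A d"
    if "c \<in> carrier A" "d \<in> carrier A" for c d
    unfolding End_alg_simps left_mult_def compose_def
    by (rule restrict_ext) (use that in \<open>auto simp: lact_rules m_assoc dual_lact_closed\<close>)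
  have zero: "left_mult A \<zero> = \<zero>\<^bsub>sgc_alg A\<^esub>"
    unfolding End_alg_simps left_mult_def
    by (rule restrict_ext) (auto simp: dual_mod_simps dual_zero intro!: restrict_ext)
  show ?thesis
    by (rule idealI')
      (auto simp: add mult zero I.I_l_closed I.I_r_closed left_mult_carrier simp del: End_alg_simps)
qed

lemma left_mult_one: "left_mult A \<one> = \<one>\<^bsub>sgc_alg A\<^esub>"
  unfolding End_alg_simps left_mult_def
  by (rule restrict_ext) (auto simp: dual_mod_simps intro!: dual_eqI dualI simp: dual_add dual_smult)

end

text \<open>For \<open>M = A \<oplus> DA\<close> and \<open>\<epsilon>\<close> the left
  multiplication with \<open>e\<close>, the cut \<open>\<epsilon>Me\<close> is
  \<open>eAe \<oplus> e(DA)e\<close>, and \<open>e(DA)e\<close> is the dual of \<open>eAe\<close>.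
  So \<open>B \<oplus> DB\<close> fits the role of \<open>N\<close> in
  \<open>corner_emb_End\<close>.\<close>

lemma full_corner_sgc:
  fixes A :: "('k::field, 'a) module" and B :: "('k, 'b) module"
  assumes "full_corner A B"
  shows "full_corner (sgc_alg A) (sgc_alg B)"
proof -
  obtain k where "corner_emb A B k" using assms by (auto simp: full_corner_def)
  then interpret corner_emb A B k .
  \<comment> \<open>A form on \<open>B\<close> becomes a form on \<open>A\<close> by precomposition
    with the compression \<open>p\<close>; these are the forms in \<open>e(DA)e\<close>.\<close>
  define \<kappa> :: "'b \<times> ('b \<Rightarrow> 'k) \<Rightarrow> 'a \<times> ('a \<Rightarrow> 'k)" where "\<kappa> = (\<lambda>(b, \<psi>). (k b, \<lambda>x\<in>carrier A. \<psi> (p x)))"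
  have pull: "(\<lambda>x\<in>carrier A. \<psi> (p x)) \<in> carrier (dual_mod A)" if "\<psi> \<in> carrier (dual_mod B)" for \<psi>
    by (rule A.dualI) (simp_all add: p_add p_smult p_closed B.dual_add[OF that] B.dual_smult[OF that])
  have "\<exists>K. corner_emb (sgc_alg A) (sgc_alg B) K"
  proof (rule exI, rule corner_emb_End[where \<kappa> = \<kappa> and \<epsilon> = "left_mult A e", OF A.sgc_mod B.sgc_mod])
    fix n n' b c assume n: "n \<in> carrier (sgc_mod B)"
    obtain b1 \<psi> where n1: "n = (b1, \<psi>)" "b1 \<in> carrier B" "\<psi> \<in> carrier (dual_mod B)" using n by auto
    show "\<kappa> n \<in> carrier (sgc_mod A)" using n1 by (simp add: \<kappa>_def k_closed pull)
    show "left_mult A e (\<kappa> n) = \<kappa> n"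
      using n1 e_closed p_k_mult[OF _ B.one_closed] p_mult_k[OF _ B.one_closed]
      by (auto simp: \<kappa>_def left_mult_def k_closed pull e_k dual_mod_simps p_closed intro!: restrict_ext)
    show "\<kappa> (c \<odot>\<^bsub>sgc_mod B\<^esub> n) = c \<odot>\<^bsub>sgc_mod A\<^esub> \<kappa> n"
      using n1 by (auto simp: \<kappa>_def k_smult dual_mod_simps p_closed intro!: restrict_ext)
    show "\<kappa> (n \<lhd>\<^bsub>sgc_mod B\<^esub> b) = \<kappa> n \<lhd>\<^bsub>sgc_mod A\<^esub> k b" if "b \<in> carrier B"
      using n1 that by (auto simp: \<kappa>_def k_mult k_closed dual_mod_simps p_closed p_k_mult intro!: restrict_ext)
    show "\<kappa> (n \<oplus>\<^bsub>sgc_mod B\<^esub> n') = \<kappa> n \<oplus>\<^bsub>sgc_mod A\<^esub> \<kappa> n'" if "n' \<in> carrier (sgc_mod B)"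
      using n1 that by (auto simp: \<kappa>_def k_add dual_mod_simps p_closed intro!: restrict_ext)
  next
    show "inj_on \<kappa> (carrier (sgc_mod B))"
    proof (rule inj_onI)
      fix v w assume v: "v \<in> carrier (sgc_mod B)" and w: "w \<in> carrier (sgc_mod B)" and eq: "\<kappa> v = \<kappa> w"
      have "snd v = snd w"
      proof (rule B.dual_eqI)
        fix b assume b: "b \<in> carrier B"
        have "snd (\<kappa> v) (k b) = snd (\<kappa> w) (k b)" using eq by simp
        then show "snd v b = snd w b" using b by (simp add: \<kappa>_def split_beta k_closed p_k)
      qed (use v w in auto)
      moreover have "fst v = fst w"
        using eq v w by (intro k_eqI) (auto simp: \<kappa>_def)
      ultimately show "v = w" by (simp add: prod_eq_iff)
    qed
  next
    show "left_mult A e \<in> rmod_hom A (sgc_mod A) (sgc_mod A)" by (rule A.left_mult_hom[OF e_closed])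
    show "left_mult A e (left_mult A e x) = left_mult A e x" if "x \<in> carrier (sgc_mod A)" for x
      using that e_closed e_idem
      by (auto simp: left_mult_def A.dual_lact_closed A.m_assoc[symmetric] A.lact_rules(5)[symmetric])
    show "x \<in> \<kappa> ` carrier (sgc_mod B)"
      if x: "x \<in> carrier (sgc_mod A)" "left_mult A e x = x" "x \<lhd>\<^bsub>sgc_mod A\<^esub> e = x" for x
    proof -
      obtain a \<phi> where ax: "x = (a, \<phi>)" "a \<in> carrier A" "\<phi> \<in> carrier (dual_mod A)" using x by auto
      have a: "e \<otimes>\<^bsub>A\<^esub> a = a" "a \<otimes>\<^bsub>A\<^esub> e = a" and \<phi>: "lact (dual_mod A) e \<phi> = \<phi>" "\<phi> \<lhd>\<^bsub>dual_mod A\<^esub> e = \<phi>"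
        using x ax by (auto simp: left_mult_def)
      have \<phi>': "\<phi> (y \<otimes>\<^bsub>A\<^esub> e) = \<phi> y" "\<phi> (e \<otimes>\<^bsub>A\<^esub> y) = \<phi> y" if "y \<in> carrier A" for y
        using fun_cong[OF \<phi>(1), of y] fun_cong[OF \<phi>(2), of y] that by (auto simp: dual_mod_simps)
      \<comment> \<open>Conversely, a form fixed by \<open>e\<close> on both sides factors through
        \<open>x \<mapsto> exe\<close>, so its restriction along \<open>k\<close> determines
        it.\<close>
      have "x = \<kappa> (p a, \<lambda>b\<in>carrier B. \<phi> (k b))"
        using ax a \<phi>' e_closed
        by (auto simp: \<kappa>_def k_p p_closed dual_carrier A.m_assoc intro!: extensionalityI[where A = "carrier A"])
      moreover have "(\<lambda>b\<in>carrier B. \<phi> (k b)) \<in> carrier (dual_mod B)"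
        by (rule B.dualI) (simp_all add: k_add k_smult k_closed A.dual_add[OF ax(3)] A.dual_smult[OF ax(3)])
      ultimately show ?thesis using p_closed[OF ax(2)] by auto
    qed
    show "\<one>\<^bsub>sgc_alg A\<^esub> \<in> I" if I: "ideal I (sgc_alg A)" "left_mult A e \<in> I" for I
      using full[OF A.left_mult_full[OF I(1)]] I(2) e_closed A.left_mult_one by simp
  qed
  then show ?thesis by (simp add: full_corner_def)
qed

section \<open>The one-step description of an SGC extension\<close>

lemma corner_simps [simp]:
  "mult (corner A e) = mult A" "one (corner A e) = e" "zero (corner A e) = zero A"
  "add (corner A e) = add A" "smult (corner A e) = smult A"
  by (simp_all add: corner_def)

text \<open>A description of \<open>eAe\<close> by fixed-point equations, which replaces the
  existential in the definition of \<open>corner\<close> from here on.\<close>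

lemma (in fd_algebra) corner_carrier:
  assumes "is_idempotent A e"
  shows "x \<in> carrier (corner A e) \<longleftrightarrow> x \<in> carrier A \<and> e \<otimes> x = x \<and> x \<otimes> e = x"
proof -
  have e: "e \<in> carrier A" "e \<otimes> e = e" using assms by (auto simp: is_idempotent_def)
  have "e \<otimes> (e \<otimes> y \<otimes> e) = e \<otimes> y \<otimes> e" "e \<otimes> y \<otimes> e \<otimes> e = e \<otimes> y \<otimes> e" if "y \<in> carrier A" for y
    using e that by (simp_all add: m_assoc) (simp add: m_assoc[symmetric])
  then show ?thesis using e by (auto simp: corner_def) metis
qed

section \<open>The dual of an algebra: separation, biduality and endomorphisms\<close>

context fd_algebra
begin

lemma dual_app:
  assumes "x \<in> carrier A"
  shows "(f \<oplus>\<^bsub>dual_mod A\<^esub> g) x = f x + g x" "(c \<odot>\<^bsub>dual_mod A\<^esub> f) x = c * f x" "\<zero>\<^bsub>dual_mod A\<^esub> x = 0"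
    "(f \<lhd>\<^bsub>dual_mod A\<^esub> a) x = f (a \<otimes> x)" "lact (dual_mod A) a f x = f (x \<otimes> a)"
  using assms by (simp_all add: dual_mod_simps)

lemma dual_closed:
  "\<zero>\<^bsub>dual_mod A\<^esub> \<in> carrier (dual_mod A)"
  "f \<in> carrier (dual_mod A) \<Longrightarrow> g \<in> carrier (dual_mod A) \<Longrightarrow> f \<oplus>\<^bsub>dual_mod A\<^esub> g \<in> carrier (dual_mod A)"
  "f \<in> carrier (dual_mod A) \<Longrightarrow> c \<odot>\<^bsub>dual_mod A\<^esub> f \<in> carrier (dual_mod A)"
  "f \<in> carrier (dual_mod A) \<Longrightarrow> a \<in> carrier A \<Longrightarrow> f \<lhd>\<^bsub>dual_mod A\<^esub> a \<in> carrier (dual_mod A)"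
  "f \<in> carrier (dual_mod A) \<Longrightarrow> a \<in> carrier A \<Longrightarrow> lact (dual_mod A) a f \<in> carrier (dual_mod A)"
proof -
  interpret D: fd_rmodule A "dual_mod A" by (rule dual_mod)
  show "\<zero>\<^bsub>dual_mod A\<^esub> \<in> carrier (dual_mod A)"
    "f \<in> carrier (dual_mod A) \<Longrightarrow> g \<in> carrier (dual_mod A) \<Longrightarrow> f \<oplus>\<^bsub>dual_mod A\<^esub> g \<in> carrier (dual_mod A)"
    "f \<in> carrier (dual_mod A) \<Longrightarrow> c \<odot>\<^bsub>dual_mod A\<^esub> f \<in> carrier (dual_mod A)"
    "f \<in> carrier (dual_mod A) \<Longrightarrow> a \<in> carrier A \<Longrightarrow> f \<lhd>\<^bsub>dual_mod A\<^esub> a \<in> carrier (dual_mod A)"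
    by (rule D.zero_carrier D.add_carrier D.smult_carrier D.ract_closed; assumption)+
qed (rule dual_lact_closed)

lemma dual_zero_rules:
  "a \<in> carrier A \<Longrightarrow> \<zero>\<^bsub>dual_mod A\<^esub> \<lhd>\<^bsub>dual_mod A\<^esub> a = \<zero>\<^bsub>dual_mod A\<^esub>"
  "a \<in> carrier A \<Longrightarrow> lact (dual_mod A) a \<zero>\<^bsub>dual_mod A\<^esub> = \<zero>\<^bsub>dual_mod A\<^esub>"
  "f \<in> carrier (dual_mod A) \<Longrightarrow> f \<lhd>\<^bsub>dual_mod A\<^esub> \<zero> = \<zero>\<^bsub>dual_mod A\<^esub>"
  "f \<in> carrier (dual_mod A) \<Longrightarrow> lact (dual_mod A) \<zero> f = \<zero>\<^bsub>dual_mod A\<^esub>"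
  "f \<in> carrier (dual_mod A) \<Longrightarrow> f \<oplus>\<^bsub>dual_mod A\<^esub> \<zero>\<^bsub>dual_mod A\<^esub> = f"
  "f \<in> carrier (dual_mod A) \<Longrightarrow> \<zero>\<^bsub>dual_mod A\<^esub> \<oplus>\<^bsub>dual_mod A\<^esub> f = f"
  "c \<odot>\<^bsub>dual_mod A\<^esub> \<zero>\<^bsub>dual_mod A\<^esub> = \<zero>\<^bsub>dual_mod A\<^esub>"
  "f \<in> carrier (dual_mod A) \<Longrightarrow> f \<lhd>\<^bsub>dual_mod A\<^esub> \<one> = f"
  "f \<in> carrier (dual_mod A) \<Longrightarrow> lact (dual_mod A) \<one> f = f"
  by (rule dual_eqI; simp add: dual_closed dual_app dual_zero)+

lemma dual_separates:
  assumes "x \<in> carrier A" "y \<in> carrier A" "\<And>\<phi>. \<phi> \<in> carrier (dual_mod A) \<Longrightarrow> \<phi> x = \<phi> y"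
  shows "x = y"
proof (rule lin_forms_separate[OF fdvs assms(1,2)])
  fix \<phi> assume "lin_form A \<phi>"
  then have "(\<lambda>x\<in>carrier A. \<phi> x) \<in> carrier (dual_mod A)" by (intro dualI) (auto simp: lin_form_def)
  from assms(3)[OF this] show "\<phi> x = \<phi> y" using assms by simp
qed

text \<open>Biduality. Every \<open>\<phi>\<close> is the sum over \<open>s\<close> of
  \<open>\<phi> s\<close> times the coordinate form \<open>d s\<close>; hence \<open>L\<close> is
  the evaluation at the vector whose coordinates are \<open>L (d s)\<close>.\<close>

lemma dual_reflexive:
  assumes add: "\<And>f g. f \<in> carrier (dual_mod A) \<Longrightarrow> g \<in> carrier (dual_mod A) \<Longrightarrow>
      L (f \<oplus>\<^bsub>dual_mod A\<^esub> g) = L f + L g"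
    and smult: "\<And>c f. f \<in> carrier (dual_mod A) \<Longrightarrow> L (c \<odot>\<^bsub>dual_mod A\<^esub> f) = c * L f"
  shows "\<exists>s\<in>carrier A. \<forall>\<phi>\<in>carrier (dual_mod A). L \<phi> = \<phi> s"
proof (rule dual_basis[OF fdvs])
  fix S c
  assume S: "finite S" "S \<subseteq> carrier A" and c: "\<And>s. s \<in> S \<Longrightarrow> lin_form A (c s)"
    and exp: "\<And>x \<phi>. x \<in> carrier A \<Longrightarrow> lin_form A \<phi> \<Longrightarrow> \<phi> x = (\<Sum>s\<in>S. c s x * \<phi> s)"
    and pt: "\<And>a. \<exists>x\<in>carrier A. \<forall>\<phi>. lin_form A \<phi> \<longrightarrow> \<phi> x = (\<Sum>s\<in>S. a s * \<phi> s)"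
  define d where "d s = restrict (c s) (carrier A)" for s
  have d: "d s \<in> carrier (dual_mod A)" if "s \<in> S" for s
    unfolding d_def using c[OF that] by (intro dualI) (auto simp: lin_form_def)
  obtain s0 where s0: "s0 \<in> carrier A" "\<And>\<phi>. lin_form A \<phi> \<Longrightarrow> \<phi> s0 = (\<Sum>s\<in>S. L (d s) * \<phi> s)"
    using pt[of "\<lambda>s. L (d s)"] by blast
  have "L \<phi> = \<phi> s0" if \<phi>: "\<phi> \<in> carrier (dual_mod A)" for \<phi>
  proof -
    \<comment> \<open>Additivity of \<open>L\<close> is available for two summands at a time, so the
      expansion of \<open>\<phi>\<close> is built up over subsets of \<open>S\<close>.\<close>
    have "(\<lambda>x\<in>carrier A. \<Sum>s\<in>T. c s x * \<phi> s) \<in> carrier (dual_mod A) \<and>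
      L (\<lambda>x\<in>carrier A. \<Sum>s\<in>T. c s x * \<phi> s) = (\<Sum>s\<in>T. L (d s) * \<phi> s)" if "finite T" "T \<subseteq> S" for T
      using that
    proof (induction T)
      case empty
      \<comment> \<open>The zero form is written as a zero multiple, so that homogeneity yields the
        value 0.\<close>
      have "(\<lambda>x\<in>carrier A. 0) = 0 \<odot>\<^bsub>dual_mod A\<^esub> \<zero>\<^bsub>dual_mod A\<^esub>"
        by (simp add: dual_mod_simps cong: restrict_cong)
      then show ?case using smult[OF dual_closed(1), of 0] dual_closed by simp
    next
      case (insert t T)
      let ?g = "\<lambda>x\<in>carrier A. \<Sum>s\<in>T. c s x * \<phi> s"
      have eq: "(\<lambda>x\<in>carrier A. \<Sum>s\<in>insert t T. c s x * \<phi> s) = \<phi> t \<odot>\<^bsub>dual_mod A\<^esub> d t \<oplus>\<^bsub>dual_mod A\<^esub> ?g"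
        using insert unfolding dual_mod_simps by (intro restrict_ext) (simp add: d_def)
      have g: "?g \<in> carrier (dual_mod A)" "L ?g = (\<Sum>s\<in>T. L (d s) * \<phi> s)"
        using insert.IH insert.prems by blast+
      have dt: "d t \<in> carrier (dual_mod A)" using d insert.prems by blast
      show ?case
        unfolding eq add[OF dual_closed(3)[OF dt] g(1)] smult[OF dt] g(2)
        using dual_closed(2)[OF dual_closed(3)[OF dt] g(1)] insert by (simp add: mult.commute)
    qed
    from this[OF S(1) subset_refl] have "L (\<lambda>x\<in>carrier A. \<Sum>s\<in>S. c s x * \<phi> s) = \<phi> s0"
      using s0 \<phi> by (simp add: dual_carrier)
    moreover have "(\<lambda>x\<in>carrier A. \<Sum>s\<in>S. c s x * \<phi> s) = \<phi>"
      by (rule extensionalityI[where A = "carrier A"]) (use \<phi> exp in \<open>auto simp: dual_carrier\<close>)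
    ultimately show ?thesis by simp
  qed
  then show ?thesis using s0(1) by blast
qed

text \<open>The linear form \<open>\<phi> \<mapsto> q(\<phi>)(1)\<close> on \<open>DA\<close> is the evaluation at some \<open>s\<close>.\<close>

lemma dual_endomorphism:
  assumes q: "q \<in> rmod_hom A (dual_mod A) (dual_mod A)"
  shows "\<exists>s\<in>carrier A. \<forall>\<phi>\<in>carrier (dual_mod A). q \<phi> = lact (dual_mod A) s \<phi>"
proof -
  obtain s where s: "s \<in> carrier A" "\<And>\<phi>. \<phi> \<in> carrier (dual_mod A) \<Longrightarrow> q \<phi> \<one> = \<phi> s"
    using dual_reflexive[of "\<lambda>\<phi>. q \<phi> \<one>"] by (auto simp: rmod_hom_add[OF q] rmod_hom_smult[OF q] dual_app)
  have "q \<phi> = lact (dual_mod A) s \<phi>" if \<phi>: "\<phi> \<in> carrier (dual_mod A)" for \<phi>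
  proof (rule dual_eqI)
    fix y assume y: "y \<in> carrier A"
    have "q \<phi> y = (q \<phi> \<lhd>\<^bsub>dual_mod A\<^esub> y) \<one>" using y by (simp add: dual_app)
    also have "\<dots> = q (\<phi> \<lhd>\<^bsub>dual_mod A\<^esub> y) \<one>" using \<phi> y by (simp add: rmod_hom_ract[OF q])
    finally show "q \<phi> y = lact (dual_mod A) s \<phi> y" using \<phi> y s by (simp add: dual_closed dual_app)
  qed (use \<phi> s rmod_hom_closed[OF q] dual_closed in auto)
  then show ?thesis using s(1) by blast
qed

text \<open>The matrix with rows \<open>(c, 0)\<close> and \<open>(y, s)\<close> acting on the
  column \<open>(b, \<phi>)\<close>. Homomorphisms from \<open>A\<close> to \<open>DA\<close> are
  \<open>b \<mapsto> yb\<close>, endomorphisms of \<open>DA\<close> are left multiplications by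
  \<open>dual_endomorphism\<close>, and the zero entry reflects
  \<open>Hom(DA, eA) = 0\<close>.\<close>

definition tri_map where
  "tri_map = (\<lambda>(c, y, s). \<lambda>v\<in>carrier (sgc_mod A).
     (c \<otimes> fst v, y \<lhd>\<^bsub>dual_mod A\<^esub> fst v \<oplus>\<^bsub>dual_mod A\<^esub> lact (dual_mod A) s (snd v)))"

lemma tri_map_app:
  "b \<in> carrier A \<Longrightarrow> \<phi> \<in> carrier (dual_mod A) \<Longrightarrow> tri_map (c, y, s) (b, \<phi>) =
    (c \<otimes> b, y \<lhd>\<^bsub>dual_mod A\<^esub> b \<oplus>\<^bsub>dual_mod A\<^esub> lact (dual_mod A) s \<phi>)"
  by (simp add: tri_map_def)

lemma tri_map_hom:
  assumes "c \<in> carrier A" "y \<in> carrier (dual_mod A)" "s \<in> carrier A"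
  shows "tri_map (c, y, s) \<in> carrier (sgc_alg A)"
  unfolding End_alg_simps
  by (rule rmod_homI)
    (use assms in \<open>auto simp: tri_map_app dual_closed smult_carrier m_assoc r_distr l_distr smult_mult_right
      smult_mult_left dual_app dual_add dual_smult algebra_simps intro!: dual_eqI, simp add: tri_map_def\<close>)

lemma sgc_hom_eqI:
  assumes "f \<in> carrier (sgc_alg A)" "g \<in> carrier (sgc_alg A)"
    "\<And>b \<phi>. b \<in> carrier A \<Longrightarrow> \<phi> \<in> carrier (dual_mod A) \<Longrightarrow> f (b, \<phi>) = g (b, \<phi>)"
  shows "f = g"
  by (rule rmod_hom_eqI) (use assms in auto)

end

text \<open>The condition (T) on \<open>e\<close>.\<close>

locale trace_idem = fd_algebra A for A :: "('k::field, 'a) module" (structure) +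
  fixes e :: 'a
  assumes idem: "is_idempotent A e"
    and trace_full: "ideal I A \<Longrightarrow> e \<in> I \<Longrightarrow>
      (\<And>v \<phi>. v \<in> rmod_hom A (dual_mod A) (reg_mod A) \<Longrightarrow> \<phi> \<in> carrier (dual_mod A) \<Longrightarrow> v \<phi> \<in> I) \<Longrightarrow> \<one> \<in> I"
    and trace_zero: "v \<in> rmod_hom A (dual_mod A) (reg_mod A) \<Longrightarrow> \<phi> \<in> carrier (dual_mod A) \<Longrightarrow> e \<otimes> v \<phi> = \<zero>"
begin

lemma e: "e \<in> carrier A" "e \<otimes> e = e"
  using idem by (auto simp: is_idempotent_def)

abbreviation D where "D \<equiv> dual_mod A"

text \<open>The bimodule \<open>(DA)e\<close>, given as fixed points so that membership is an
  equation.\<close>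

definition De where "De = D\<lparr>carrier := {f \<in> carrier D. f \<lhd>\<^bsub>D\<^esub> e = f}\<rparr>"

definition tri where "tri = lower_tri (corner A e) De A"

lemma De_simps [simp]:
  "carrier De = {f \<in> carrier D. f \<lhd>\<^bsub>D\<^esub> e = f}" "zero De = zero D" "add De = add D"
  "smult De = smult D" "ract De = ract D" "lact De = lact D"
  by (simp_all add: De_def)

lemma tri_simps [simp]:
  "zero tri = (\<zero>, \<zero>\<^bsub>D\<^esub>, \<zero>)" "one tri = (e, \<zero>\<^bsub>D\<^esub>, \<one>)"
  "(r, x, s) \<oplus>\<^bsub>tri\<^esub> (r', x', s') = (r \<oplus> r', x \<oplus>\<^bsub>D\<^esub> x', s \<oplus> s')"
  "c \<odot>\<^bsub>tri\<^esub> (r, x, s) = (c \<odot> r, c \<odot>\<^bsub>D\<^esub> x, c \<odot> s)"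
  "(r, x, s) \<otimes>\<^bsub>tri\<^esub> (r', x', s') = (r \<otimes> r', x \<lhd>\<^bsub>D\<^esub> r' \<oplus>\<^bsub>D\<^esub> lact D s x', s \<otimes> s')"
  by (simp_all add: tri_def lower_tri_def)

lemma tri_carrier:
  "(r, x, s) \<in> carrier tri \<longleftrightarrow> r \<in> carrier A \<and> e \<otimes> r = r \<and> r \<otimes> e = r \<and>
     x \<in> carrier D \<and> x \<lhd>\<^bsub>D\<^esub> e = x \<and> s \<in> carrier A"
  by (auto simp: tri_def lower_tri_def corner_carrier[OF idem])

lemma De_app: "x \<lhd>\<^bsub>D\<^esub> e = x \<Longrightarrow> y \<in> carrier A \<Longrightarrow> x (e \<otimes> y) = x y"
  using dual_app(4) by metis

lemma tri_closed:
  assumes t: "(r, x, s) \<in> carrier tri" and t': "(r', x', s') \<in> carrier tri"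
  shows "(r, x, s) \<oplus>\<^bsub>tri\<^esub> (r', x', s') \<in> carrier tri" "(r, x, s) \<otimes>\<^bsub>tri\<^esub> (r', x', s') \<in> carrier tri"
    "c \<odot>\<^bsub>tri\<^esub> (r, x, s) \<in> carrier tri"
proof -
  note a = t[unfolded tri_carrier] and a' = t'[unfolded tri_carrier]
  have De: "x (e \<otimes> y) = x y" "x' (e \<otimes> y) = x' y" if "y \<in> carrier A" for y
    using De_app a a' that by auto
  have "(x \<oplus>\<^bsub>D\<^esub> x') \<lhd>\<^bsub>D\<^esub> e = x \<oplus>\<^bsub>D\<^esub> x'"
    by (rule dual_eqI) (use a a' e De in \<open>auto simp: dual_closed dual_app\<close>)
  then show "(r, x, s) \<oplus>\<^bsub>tri\<^esub> (r', x', s') \<in> carrier tri"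
    using a a' e by (auto simp: tri_carrier dual_closed l_distr r_distr)
  have "(c \<odot>\<^bsub>D\<^esub> x) \<lhd>\<^bsub>D\<^esub> e = c \<odot>\<^bsub>D\<^esub> x"
    by (rule dual_eqI) (use a a' e De in \<open>auto simp: dual_closed dual_app\<close>)
  then show "c \<odot>\<^bsub>tri\<^esub> (r, x, s) \<in> carrier tri"
    using a e by (auto simp: tri_carrier dual_closed smult_carrier smult_mult_left smult_mult_right)
  have r': "r' \<otimes> (e \<otimes> y) = r' \<otimes> y" if "y \<in> carrier A" for y
    using a' e that by (simp add: m_assoc[symmetric])
  have "(x \<lhd>\<^bsub>D\<^esub> r' \<oplus>\<^bsub>D\<^esub> lact D s x') \<lhd>\<^bsub>D\<^esub> e = x \<lhd>\<^bsub>D\<^esub> r' \<oplus>\<^bsub>D\<^esub> lact D s x'"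
    by (rule dual_eqI) (use a a' e De r' in \<open>auto simp: dual_closed dual_app m_assoc\<close>)
  then show "(r, x, s) \<otimes>\<^bsub>tri\<^esub> (r', x', s') \<in> carrier tri"
    using a a' e by (auto simp: tri_carrier dual_closed m_assoc) (simp_all add: m_assoc[symmetric])
qed

lemma tri_zero_one: "\<zero>\<^bsub>tri\<^esub> \<in> carrier tri" "\<one>\<^bsub>tri\<^esub> \<in> carrier tri"
proof -
  have "\<zero>\<^bsub>D\<^esub> \<lhd>\<^bsub>D\<^esub> e = \<zero>\<^bsub>D\<^esub>"
    by (rule dual_eqI) (use e in \<open>auto simp: dual_closed dual_app\<close>)
  then show "\<zero>\<^bsub>tri\<^esub> \<in> carrier tri" "\<one>\<^bsub>tri\<^esub> \<in> carrier tri" using e by (auto simp: tri_carrier dual_closed)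
qed

lemma tri_map_closed: "t \<in> carrier tri \<Longrightarrow> tri_map t \<in> carrier (sgc_alg A)"
  by (cases t) (simp only: tri_carrier tri_map_hom)

lemma tri_map_add:
  assumes "t \<in> carrier tri" "t' \<in> carrier tri"
  shows "tri_map (t \<oplus>\<^bsub>tri\<^esub> t') = tri_map t \<oplus>\<^bsub>sgc_alg A\<^esub> tri_map t'"
proof -
  interpret E: fd_algebra "sgc_alg A" by (rule End_alg[OF sgc_mod])
  obtain r x s where t: "t = (r, x, s)" by (cases t)
  obtain r' x' s' where t': "t' = (r', x', s')" by (cases t')
  note cl = assms[unfolded t t']
  note a = cl[unfolded tri_carrier]
  show ?thesis
  proof (rule sgc_hom_eqI)
    show "tri_map t \<oplus>\<^bsub>sgc_alg A\<^esub> tri_map t' \<in> carrier (sgc_alg A)"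
      using assms by (intro fdvs_add[OF E.fdvs] tri_map_closed)
    show "tri_map (t \<oplus>\<^bsub>tri\<^esub> t') \<in> carrier (sgc_alg A)"
      using tri_closed(1)[OF cl] by (simp only: t t' tri_map_closed)
    show "tri_map (t \<oplus>\<^bsub>tri\<^esub> t') (b, \<phi>) = (tri_map t \<oplus>\<^bsub>sgc_alg A\<^esub> tri_map t') (b, \<phi>)"
      if "b \<in> carrier A" "\<phi> \<in> carrier D" for b \<phi>
      using a that by (auto simp: t t' tri_map_app l_distr r_distr dual_closed dual_app dual_add intro!: dual_eqI)
  qed
qed

lemma tri_map_smult:
  assumes "t \<in> carrier tri"
  shows "tri_map (c \<odot>\<^bsub>tri\<^esub> t) = c \<odot>\<^bsub>sgc_alg A\<^esub> tri_map t"
proof -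
  interpret E: fd_algebra "sgc_alg A" by (rule End_alg[OF sgc_mod])
  obtain r x s where t: "t = (r, x, s)" by (cases t)
  note cl = assms[unfolded t]
  note a = cl[unfolded tri_carrier]
  show ?thesis
  proof (rule sgc_hom_eqI)
    show "c \<odot>\<^bsub>sgc_alg A\<^esub> tri_map t \<in> carrier (sgc_alg A)"
      using assms by (intro fdvs_smult[OF E.fdvs] tri_map_closed)
    show "tri_map (c \<odot>\<^bsub>tri\<^esub> t) \<in> carrier (sgc_alg A)"
      using tri_closed(3)[OF cl cl] by (simp only: t tri_map_closed)
    show "tri_map (c \<odot>\<^bsub>tri\<^esub> t) (b, \<phi>) = (c \<odot>\<^bsub>sgc_alg A\<^esub> tri_map t) (b, \<phi>)"
      if "b \<in> carrier A" "\<phi> \<in> carrier D" for b \<phi>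
      using a that by (auto simp: t tri_map_app smult_mult_left smult_mult_right dual_closed dual_app
          dual_smult distrib_left smult_carrier intro!: dual_eqI)
  qed
qed

lemma tri_map_mult:
  assumes "t \<in> carrier tri" "t' \<in> carrier tri"
  shows "tri_map (t \<otimes>\<^bsub>tri\<^esub> t') = tri_map t \<otimes>\<^bsub>sgc_alg A\<^esub> tri_map t'"
proof -
  interpret E: fd_algebra "sgc_alg A" by (rule End_alg[OF sgc_mod])
  obtain r x s where t: "t = (r, x, s)" by (cases t)
  obtain r' x' s' where t': "t' = (r', x', s')" by (cases t')
  note cl = assms[unfolded t t']
  note a = cl[unfolded tri_carrier]
  show ?thesis
  proof (rule sgc_hom_eqI)
    show "tri_map t \<otimes>\<^bsub>sgc_alg A\<^esub> tri_map t' \<in> carrier (sgc_alg A)"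
      using assms by (intro E.m_closed tri_map_closed)
    show "tri_map (t \<otimes>\<^bsub>tri\<^esub> t') \<in> carrier (sgc_alg A)"
      using tri_closed(2)[OF cl] by (simp only: t t' tri_map_closed)
    show "tri_map (t \<otimes>\<^bsub>tri\<^esub> t') (b, \<phi>) = (tri_map t \<otimes>\<^bsub>sgc_alg A\<^esub> tri_map t') (b, \<phi>)"
      if "b \<in> carrier A" "\<phi> \<in> carrier D" for b \<phi>
      using a that by (auto simp: t t' tri_map_app compose_def m_assoc dual_closed dual_app dual_add
          add.assoc intro!: dual_eqI)
  qed
qed

text \<open>The value at \<open>(\<one>, 0)\<close> gives back \<open>r\<close> and
  \<open>x\<close>. The last entry is recovered from the values at \<open>(0, \<phi>)\<close>:
  evaluated at \<open>\<one>\<close> they give \<open>\<phi> s\<close>, and forms separate the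
  points of \<open>A\<close>.\<close>

lemma tri_map_inj: "inj_on tri_map (carrier tri)"
proof (rule inj_onI)
  fix t t' assume "t \<in> carrier tri" "t' \<in> carrier tri" and eq: "tri_map t = tri_map t'"
  obtain r x s where t: "t = (r, x, s)" by (cases t)
  obtain r' x' s' where t': "t' = (r', x', s')" by (cases t')
  have a: "(r, x, s) \<in> carrier tri" "(r', x', s') \<in> carrier tri" using \<open>t \<in> _\<close> \<open>t' \<in> _\<close> t t' by auto
  note a = a[unfolded tri_carrier]
  have E: "r \<otimes> b = r' \<otimes> b"
    "x \<lhd>\<^bsub>D\<^esub> b \<oplus>\<^bsub>D\<^esub> lact D s \<phi> = x' \<lhd>\<^bsub>D\<^esub> b \<oplus>\<^bsub>D\<^esub> lact D s' \<phi>" if "b \<in> carrier A" "\<phi> \<in> carrier D" for b \<phi>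
    using fun_cong[OF eq, of "(b, \<phi>)"] that by (auto simp: t t' tri_map_app)
  have "r = r'" using E(1)[of \<one> "\<zero>\<^bsub>D\<^esub>"] a by (simp add: dual_closed)
  moreover have "x = x'"
  proof (rule dual_eqI)
    fix y assume y: "y \<in> carrier A"
    show "x y = x' y" using fun_cong[OF E(2)[of \<one> "\<zero>\<^bsub>D\<^esub>"], of y] y a by (simp add: dual_closed dual_app)
  qed (use a in auto)
  moreover have "s = s'"
  proof (rule dual_separates)
    fix \<phi> assume \<phi>: "\<phi> \<in> carrier D"
    show "\<phi> s = \<phi> s'" using fun_cong[OF E(2)[of \<zero> \<phi>], of \<one>] \<phi> a by (simp add: dual_closed dual_app dual_zero)
  qed (use a in auto)
  ultimately show "t = t'" by (simp add: t t')
qed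

lemma tri_map_zero: "tri_map \<zero>\<^bsub>tri\<^esub> = \<zero>\<^bsub>sgc_alg A\<^esub>"
proof (rule sgc_hom_eqI)
  interpret E: fd_algebra "sgc_alg A" by (rule End_alg[OF sgc_mod])
  show "\<zero>\<^bsub>sgc_alg A\<^esub> \<in> carrier (sgc_alg A)" by (rule fdvs_zero[OF E.fdvs])
  show "tri_map \<zero>\<^bsub>tri\<^esub> \<in> carrier (sgc_alg A)" by (rule tri_map_closed[OF tri_zero_one(1)])
  show "tri_map \<zero>\<^bsub>tri\<^esub> (b, \<phi>) = \<zero>\<^bsub>sgc_alg A\<^esub> (b, \<phi>)" if "b \<in> carrier A" "\<phi> \<in> carrier D" for b \<phi>
    using that by (auto simp: tri_map_app dual_closed dual_app dual_zero intro!: dual_eqI)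
qed

lemma tri_one_mult:
  assumes "t \<in> carrier tri"
  shows "\<one>\<^bsub>tri\<^esub> \<otimes>\<^bsub>tri\<^esub> t = t" "t \<otimes>\<^bsub>tri\<^esub> \<one>\<^bsub>tri\<^esub> = t"
proof -
  obtain r x s where t: "t = (r, x, s)" by (cases t)
  note a = assms[unfolded t tri_carrier]
  show "\<one>\<^bsub>tri\<^esub> \<otimes>\<^bsub>tri\<^esub> t = t" "t \<otimes>\<^bsub>tri\<^esub> \<one>\<^bsub>tri\<^esub> = t"
    using a e by (auto simp: t dual_closed dual_app De_app intro!: dual_eqI)
qed

text \<open>Associativity and distributivity of the matrix algebra are inherited through
  \<open>tri_map\<close> from the composition of endomorphisms, instead of being checked on
  triples.\<close>

lemma tri_algebra: "fd_algebra tri"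
proof (rule fd_algebra_pullback[OF End_alg[OF sgc_mod] tri_map_inj])
  fix t t' c assume t: "t \<in> carrier tri"
  show "tri_map t \<in> carrier (sgc_alg A)" by (rule tri_map_closed[OF t])
  show "tri_map \<one>\<^bsub>tri\<^esub> \<otimes>\<^bsub>sgc_alg A\<^esub> tri_map t = tri_map t \<and> tri_map t \<otimes>\<^bsub>sgc_alg A\<^esub> tri_map \<one>\<^bsub>tri\<^esub> = tri_map t"
    using t tri_map_mult[OF t tri_zero_one(2)] tri_map_mult[OF tri_zero_one(2) t] tri_one_mult[OF t] by metis
  show "c \<odot>\<^bsub>tri\<^esub> t \<in> carrier tri \<and> tri_map (c \<odot>\<^bsub>tri\<^esub> t) = c \<odot>\<^bsub>sgc_alg A\<^esub> tri_map t"
    using tri_map_smult[OF t] tri_closed(3) t by (cases t) blast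
  assume t': "t' \<in> carrier tri"
  show "t \<oplus>\<^bsub>tri\<^esub> t' \<in> carrier tri \<and> tri_map (t \<oplus>\<^bsub>tri\<^esub> t') = tri_map t \<oplus>\<^bsub>sgc_alg A\<^esub> tri_map t'"
    using tri_map_add[OF t t'] tri_closed(1) t t' by (cases t; cases t') blast
  show "t \<otimes>\<^bsub>tri\<^esub> t' \<in> carrier tri \<and> tri_map (t \<otimes>\<^bsub>tri\<^esub> t') = tri_map t \<otimes>\<^bsub>sgc_alg A\<^esub> tri_map t'"
    using tri_map_mult[OF t t'] tri_closed(2) t t' by (cases t; cases t') blast
qed (rule tri_zero_one tri_map_zero)+

lemma tri_map_one_app: "b \<in> carrier A \<Longrightarrow> \<phi> \<in> carrier D \<Longrightarrow> tri_map \<one>\<^bsub>tri\<^esub> (b, \<phi>) = (e \<otimes> b, \<phi>)"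
  by (auto simp: tri_map_app dual_closed dual_app intro!: dual_eqI)

text \<open>An element of the corner is split into four blocks along \<open>A \<oplus> DA\<close>.
  The blocks out of \<open>A\<close> are determined by the value at \<open>\<one>\<close>, the block
  from \<open>DA\<close> to \<open>A\<close> lands in \<open>eA\<close> and vanishes by
  \<open>trace_zero\<close>, and the block from \<open>DA\<close> to \<open>DA\<close> is given by
  \<open>dual_endomorphism\<close>.\<close>

lemma corner_in_tri_map_image:
  assumes g: "g \<in> carrier (sgc_alg A)"
  shows "tri_map \<one>\<^bsub>tri\<^esub> \<otimes>\<^bsub>sgc_alg A\<^esub> g \<otimes>\<^bsub>sgc_alg A\<^esub> tri_map \<one>\<^bsub>tri\<^esub> \<in> tri_map ` carrier tri"
proof -
  interpret E: fd_algebra "sgc_alg A" by (rule End_alg[OF sgc_mod])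
  interpret Dm: fd_rmodule A D by (rule dual_mod)
  let ?\<epsilon> = "tri_map \<one>\<^bsub>tri\<^esub>"
  define h where "h = ?\<epsilon> \<otimes>\<^bsub>sgc_alg A\<^esub> g \<otimes>\<^bsub>sgc_alg A\<^esub> ?\<epsilon>"
  have \<epsilon>: "?\<epsilon> \<in> carrier (sgc_alg A)" by (rule tri_map_closed[OF tri_zero_one(2)])
  have hc: "h \<in> carrier (sgc_alg A)" using \<epsilon> g unfolding h_def by (intro E.m_closed)
  have gh: "g \<in> rmod_hom A (sgc_mod A) (sgc_mod A)" using g by simp
  have gcl: "fst (g (b, \<phi>)) \<in> carrier A" "snd (g (b, \<phi>)) \<in> carrier D" if "b \<in> carrier A" "\<phi> \<in> carrier D" for b \<phi>
    using rmod_hom_closed[OF gh, of "(b, \<phi>)"] that by (auto simp: mem_Times_iff)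
  have h_app: "h (b, \<phi>) = (e \<otimes> fst (g (e \<otimes> b, \<phi>)), snd (g (e \<otimes> b, \<phi>)))"
    if "b \<in> carrier A" "\<phi> \<in> carrier D" for b \<phi>
  proof -
    have "h (b, \<phi>) = ?\<epsilon> (g (?\<epsilon> (b, \<phi>)))" using that e by (simp add: h_def compose_def tri_map_one_app del: tri_simps)
    moreover obtain g1 g2 where "g (e \<otimes> b, \<phi>) = (g1, g2)" by fastforce
    ultimately show ?thesis
      using gcl[of "e \<otimes> b" \<phi>] that e by (simp add: tri_map_one_app del: tri_simps)
  qed
  have hh: "h \<in> rmod_hom A (sgc_mod A) (sgc_mod A)" using hc by simp
  define r where "r = fst (h (\<one>, \<zero>\<^bsub>D\<^esub>))"
  define x where "x = snd (h (\<one>, \<zero>\<^bsub>D\<^esub>))"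
  have rx: "r \<in> carrier A" "x \<in> carrier D"
    using rmod_hom_closed[OF hh, of "(\<one>, \<zero>\<^bsub>D\<^esub>)"] by (auto simp: r_def x_def dual_closed mem_Times_iff)
  have h1: "h (b, \<zero>\<^bsub>D\<^esub>) = (r \<otimes> b, x \<lhd>\<^bsub>D\<^esub> b)" if "b \<in> carrier A" for b
    using rmod_hom_ract[OF hh, of "(\<one>, \<zero>\<^bsub>D\<^esub>)" b] that by (simp add: dual_closed Dm.zero_ract r_def x_def)
  \<comment> \<open>\<open>h\<close> absorbs \<open>?\<epsilon>\<close> on the right, so it takes
    the same value at \<open>(e, 0)\<close> and \<open>(\<one>, 0)\<close>; this gives
    \<open>re = r\<close> and \<open>xe = x\<close>.\<close>
  have "h (e, \<zero>\<^bsub>D\<^esub>) = h (\<one>, \<zero>\<^bsub>D\<^esub>)" using h_app[of e "\<zero>\<^bsub>D\<^esub>"] h_app[of \<one> "\<zero>\<^bsub>D\<^esub>"] e by (simp add: dual_closed)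
  then have "(r \<otimes> e, x \<lhd>\<^bsub>D\<^esub> e) = (r, x)" unfolding h1[OF e(1)] by (simp add: r_def x_def)
  then have re: "r \<otimes> e = r" "x \<lhd>\<^bsub>D\<^esub> e = x" by simp_all
  have er: "e \<otimes> r = r"
    using h_app[of \<one> "\<zero>\<^bsub>D\<^esub>"] gcl[of "e" "\<zero>\<^bsub>D\<^esub>"] e by (simp add: r_def dual_closed m_assoc[symmetric])
  \<comment> \<open>The block of \<open>g\<close> from \<open>DA\<close> to \<open>A\<close>; the
    corresponding block of \<open>h\<close> is its left multiple by \<open>e\<close>.\<close>
  let ?v = "\<lambda>\<phi>\<in>carrier D. fst (g (\<zero>, \<phi>))"
  have v: "?v \<in> rmod_hom A D (reg_mod A)"
  proof (rule rmod_homI)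
    fix f f' c a assume f: "f \<in> carrier D"
    show "?v f \<in> carrier (reg_mod A)" using gcl f by simp
    show "?v (c \<odot>\<^bsub>D\<^esub> f) = c \<odot>\<^bsub>reg_mod A\<^esub> ?v f"
      using rmod_hom_smult[OF gh, of "(\<zero>, f)" c] f by (simp add: dual_closed fdvs_smult_zero[OF fdvs])
    show "?v (f \<oplus>\<^bsub>D\<^esub> f') =
        ?v f \<oplus>\<^bsub>reg_mod A\<^esub> ?v f'" if "f' \<in> carrier D"
      using rmod_hom_add[OF gh, of "(\<zero>, f)" "(\<zero>, f')"] f that by (simp add: dual_closed)
    show "?v (f \<lhd>\<^bsub>D\<^esub> a) = ?v f \<lhd>\<^bsub>reg_mod A\<^esub> a"
      if "a \<in> carrier A"
      using rmod_hom_ract[OF gh, of "(\<zero>, f)" a] f that by (simp add: dual_closed)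
  qed simp
  have h2: "fst (h (\<zero>, \<phi>)) = \<zero>" if "\<phi> \<in> carrier D" for \<phi>
    using trace_zero[OF v that] h_app[of \<zero> \<phi>] that e by simp
  let ?q = "\<lambda>\<phi>\<in>carrier D. snd (h (\<zero>, \<phi>))"
  have q: "?q \<in> rmod_hom A D D"
  proof (rule rmod_homI)
    fix f f' c a assume f: "f \<in> carrier D"
    show "?q f \<in> carrier D"
      using rmod_hom_closed[OF hh, of "(\<zero>, f)"] f by (auto simp: mem_Times_iff)
    show "?q (c \<odot>\<^bsub>D\<^esub> f) = c \<odot>\<^bsub>D\<^esub> ?q f"
      using rmod_hom_smult[OF hh, of "(\<zero>, f)" c] f by (simp add: dual_closed fdvs_smult_zero[OF fdvs])
    show "?q (f \<oplus>\<^bsub>D\<^esub> f') =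
        ?q f \<oplus>\<^bsub>D\<^esub> ?q f'" if "f' \<in> carrier D"
      using rmod_hom_add[OF hh, of "(\<zero>, f)" "(\<zero>, f')"] f that by (simp add: dual_closed)
    show "?q (f \<lhd>\<^bsub>D\<^esub> a) = ?q f \<lhd>\<^bsub>D\<^esub> a"
      if "a \<in> carrier A"
      using rmod_hom_ract[OF hh, of "(\<zero>, f)" a] f that by (simp add: dual_closed)
  qed simp
  obtain s where s: "s \<in> carrier A" "\<And>\<phi>. \<phi> \<in> carrier D \<Longrightarrow> snd (h (\<zero>, \<phi>)) = lact D s \<phi>"
    using dual_endomorphism[OF q] by auto
  have "h = tri_map (r, x, s)"
  proof (rule sgc_hom_eqI[OF hc tri_map_hom[OF rx s(1)]])
    fix b \<phi> assume b: "b \<in> carrier A" and \<phi>: "\<phi> \<in> carrier D"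
    have "h (\<zero>, \<phi>) = (\<zero>, lact D s \<phi>)" using h2[OF \<phi>] s(2)[OF \<phi>] by (metis prod.collapse)
    then show "h (b, \<phi>) = tri_map (r, x, s) (b, \<phi>)"
      using rmod_hom_add[OF hh, of "(b, \<zero>\<^bsub>D\<^esub>)" "(\<zero>, \<phi>)"] b \<phi> h1[OF b] rx s(1)
      by (simp add: tri_map_app dual_closed fdvs_l_zero[OF Dm.fdvs])
  qed
  moreover have "(r, x, s) \<in> carrier tri" using rx re er s(1) by (simp add: tri_carrier)
  ultimately show ?thesis unfolding h_def by blast
qed

text \<open>The identity of \<open>A \<oplus> DA\<close> is the sum of the two projections. The one
  onto \<open>DA\<close> is absorbed by the idempotent and so lies in \<open>I\<close>. For the one
  onto \<open>A\<close>, the \<open>c\<close> with \<open>diag(c, 0)\<close> in \<open>I\<close>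
  form an ideal of \<open>A\<close> that contains \<open>e\<close>; it also contains the trace of
  \<open>DA\<close>, because an endomorphism of \<open>A\<close> that factors through
  \<open>DA\<close> lies in \<open>I\<close>. Now \<open>trace_full\<close> applies.\<close>

lemma tri_map_full:
  assumes I: "ideal I (sgc_alg A)" and eI: "tri_map \<one>\<^bsub>tri\<^esub> \<in> I"
  shows "\<one>\<^bsub>sgc_alg A\<^esub> \<in> I"
proof -
  interpret E: fd_algebra "sgc_alg A" by (rule End_alg[OF sgc_mod])
  interpret Dm: fd_rmodule A D by (rule dual_mod)
  interpret I: ideal I "sgc_alg A" by (rule I)
  define \<pi> where "\<pi> c = tri_map (c, \<zero>\<^bsub>D\<^esub>, \<zero>)" for c
  have \<pi>_app: "\<pi> c (b, \<phi>) = (c \<otimes> b, \<zero>\<^bsub>D\<^esub>)" if "c \<in> carrier A" "b \<in> carrier A" "\<phi> \<in> carrier D" for c b \<phi>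
    using that by (auto simp: \<pi>_def tri_map_app dual_closed dual_app dual_zero intro!: dual_eqI)
  have \<pi>: "\<pi> c \<in> carrier (sgc_alg A)" if "c \<in> carrier A" for c
    unfolding \<pi>_def using that by (intro tri_map_hom) (auto simp: dual_closed)
  have \<pi>_add: "\<pi> (c \<oplus> d) = \<pi> c \<oplus>\<^bsub>sgc_alg A\<^esub> \<pi> d" if "c \<in> carrier A" "d \<in> carrier A" for c d
  proof (rule sgc_hom_eqI)
    show "\<pi> c \<oplus>\<^bsub>sgc_alg A\<^esub> \<pi> d \<in> carrier (sgc_alg A)" using that by (intro fdvs_add[OF E.fdvs] \<pi>)
    fix b \<phi> assume "b \<in> carrier A" "\<phi> \<in> carrier D"
    then show "\<pi> (c \<oplus> d) (b, \<phi>) = (\<pi> c \<oplus>\<^bsub>sgc_alg A\<^esub> \<pi> d) (b, \<phi>)"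
      using that by (simp add: \<pi>_app l_distr dual_closed fdvs_l_zero[OF Dm.fdvs])
  qed (use that \<pi> in auto)
  have \<pi>_mult: "\<pi> (c \<otimes> d) = \<pi> c \<otimes>\<^bsub>sgc_alg A\<^esub> \<pi> d" if "c \<in> carrier A" "d \<in> carrier A" for c d
  proof (rule sgc_hom_eqI)
    show "\<pi> c \<otimes>\<^bsub>sgc_alg A\<^esub> \<pi> d \<in> carrier (sgc_alg A)" using that by (intro E.m_closed \<pi>)
    fix b \<phi> assume "b \<in> carrier A" "\<phi> \<in> carrier D"
    then show "\<pi> (c \<otimes> d) (b, \<phi>) = (\<pi> c \<otimes>\<^bsub>sgc_alg A\<^esub> \<pi> d) (b, \<phi>)"
      using that by (simp add: \<pi>_app compose_def m_assoc dual_closed)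
  qed (use that \<pi> in auto)
  have \<pi>_zero: "\<pi> \<zero> = \<zero>\<^bsub>sgc_alg A\<^esub>" using tri_map_zero by (simp add: \<pi>_def)
  let ?J = "{c \<in> carrier A. \<pi> c \<in> I}"
  have J: "ideal ?J A"
    by (rule idealI')
      (auto simp: \<pi>_add \<pi>_mult \<pi>_zero \<pi> I.I_l_closed I.I_r_closed simp del: End_alg_simps)
  have \<epsilon>: "tri_map \<one>\<^bsub>tri\<^esub> \<in> carrier (sgc_alg A)" by (rule tri_map_closed[OF tri_zero_one(2)])
  have "\<pi> e = \<pi> \<one> \<otimes>\<^bsub>sgc_alg A\<^esub> tri_map \<one>\<^bsub>tri\<^esub>"
  proof (rule sgc_hom_eqI)
    show "\<pi> \<one> \<otimes>\<^bsub>sgc_alg A\<^esub> tri_map \<one>\<^bsub>tri\<^esub> \<in> carrier (sgc_alg A)" using \<epsilon> by (intro E.m_closed \<pi>) auto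
    fix b \<phi> assume "b \<in> carrier A" "\<phi> \<in> carrier D"
    then show "\<pi> e (b, \<phi>) = (\<pi> \<one> \<otimes>\<^bsub>sgc_alg A\<^esub> tri_map \<one>\<^bsub>tri\<^esub>) (b, \<phi>)"
      using e by (simp add: \<pi>_app compose_def tri_map_one_app del: tri_simps)
  qed (use e \<pi> in auto)
  then have eJ: "e \<in> ?J" using e \<pi>[OF one_closed] I.I_l_closed[OF eI] by simp
  have tJ: "v \<phi> \<in> ?J" if v: "v \<in> rmod_hom A D (reg_mod A)" and \<phi>: "\<phi> \<in> carrier D" for v \<phi>
  proof -
    \<comment> \<open>\<open>\<pi> (v \<phi>)\<close> factors through \<open>DA\<close>: first
      \<open>U\<close>, which is \<open>b \<mapsto> \<phi> b\<close> on the summand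
      \<open>A\<close>, then \<open>V\<close>, which applies \<open>v\<close>. The idempotent is the
      identity on \<open>DA\<close>, so \<open>U\<close> is a multiple of it and lies in
      \<open>I\<close>.\<close>
    define U where "U = tri_map (\<zero>, \<phi>, \<zero>)"
    have U_app: "U (b, \<psi>) = (\<zero>, \<phi> \<lhd>\<^bsub>D\<^esub> b)" if "b \<in> carrier A" "\<psi> \<in> carrier D" for b \<psi>
      using that \<phi> by (auto simp: U_def tri_map_app dual_closed dual_app dual_zero intro!: dual_eqI)
    have U: "U \<in> carrier (sgc_alg A)" unfolding U_def by (rule tri_map_hom) (auto simp: \<phi>)
    define V where "V = (\<lambda>w\<in>carrier (sgc_mod A). (v (snd w), \<zero>\<^bsub>D\<^esub>))"
    have v': "v f \<in> carrier A" if "f \<in> carrier D" for f using rmod_hom_closed[OF v that] by simp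
    have V: "V \<in> carrier (sgc_alg A)"
      unfolding End_alg_simps V_def
      by (rule rmod_homI)
        (use v' rmod_hom_add[OF v] rmod_hom_smult[OF v] rmod_hom_ract[OF v] in
          \<open>auto simp: dual_closed smult_carrier fdvs_l_zero[OF Dm.fdvs] fdvs_smult_zero[OF Dm.fdvs] Dm.zero_ract\<close>)
    have UI: "U = tri_map \<one>\<^bsub>tri\<^esub> \<otimes>\<^bsub>sgc_alg A\<^esub> U"
    proof (rule sgc_hom_eqI[OF U])
      show "tri_map \<one>\<^bsub>tri\<^esub> \<otimes>\<^bsub>sgc_alg A\<^esub> U \<in> carrier (sgc_alg A)" using \<epsilon> U by (rule E.m_closed)
      fix b \<psi> assume "b \<in> carrier A" "\<psi> \<in> carrier D"
      then show "U (b, \<psi>) = (tri_map \<one>\<^bsub>tri\<^esub> \<otimes>\<^bsub>sgc_alg A\<^esub> U) (b, \<psi>)"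
        using e \<phi> by (simp add: U_app compose_def tri_map_one_app dual_closed del: tri_simps)
    qed
    then have UI: "U \<in> I" using I.I_r_closed[OF eI U] by simp
    have "\<pi> (v \<phi>) = V \<otimes>\<^bsub>sgc_alg A\<^esub> U"
    proof (rule sgc_hom_eqI)
      show "V \<otimes>\<^bsub>sgc_alg A\<^esub> U \<in> carrier (sgc_alg A)" using V U by (rule E.m_closed)
      fix b \<psi> assume "b \<in> carrier A" "\<psi> \<in> carrier D"
      then show "\<pi> (v \<phi>) (b, \<psi>) = (V \<otimes>\<^bsub>sgc_alg A\<^esub> U) (b, \<psi>)"
        using \<phi> v' rmod_hom_ract[OF v \<phi>] by (simp add: U_app \<pi>_app compose_def V_def dual_closed)
    qed (use \<phi> v' \<pi> in auto)
    then show ?thesis using v' \<phi> I.I_l_closed[OF UI V] by simp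
  qed
  have "\<one> \<in> ?J" using trace_full[OF J eJ] tJ by blast
  then have p1: "\<pi> \<one> \<in> I" by simp
  let ?q = "tri_map (\<zero>, \<zero>\<^bsub>D\<^esub>, \<one>)"
  have q: "?q \<in> carrier (sgc_alg A)" by (rule tri_map_hom) (auto simp: dual_closed)
  have q_app: "?q (b, \<phi>) = (\<zero>, \<phi>)" if "b \<in> carrier A" "\<phi> \<in> carrier D" for b \<phi>
    using that by (auto simp: tri_map_app dual_closed dual_app intro!: dual_eqI)
  have "?q = ?q \<otimes>\<^bsub>sgc_alg A\<^esub> tri_map \<one>\<^bsub>tri\<^esub>"
  proof (rule sgc_hom_eqI[OF q])
    show "?q \<otimes>\<^bsub>sgc_alg A\<^esub> tri_map \<one>\<^bsub>tri\<^esub> \<in> carrier (sgc_alg A)" using q \<epsilon> by (rule E.m_closed)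
    fix b \<phi> assume "b \<in> carrier A" "\<phi> \<in> carrier D"
    then show "?q (b, \<phi>) = (?q \<otimes>\<^bsub>sgc_alg A\<^esub> tri_map \<one>\<^bsub>tri\<^esub>) (b, \<phi>)"
      using e by (simp add: q_app compose_def tri_map_one_app del: tri_simps)
  qed
  then have "?q \<in> I" using I.I_l_closed[OF eI q] by simp
  moreover have "\<one>\<^bsub>sgc_alg A\<^esub> = \<pi> \<one> \<oplus>\<^bsub>sgc_alg A\<^esub> ?q"
  proof (rule sgc_hom_eqI)
    show "\<pi> \<one> \<oplus>\<^bsub>sgc_alg A\<^esub> ?q \<in> carrier (sgc_alg A)" using q by (intro fdvs_add[OF E.fdvs] \<pi>) auto
    fix b \<phi> assume "b \<in> carrier A" "\<phi> \<in> carrier D"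
    then show "\<one>\<^bsub>sgc_alg A\<^esub> (b, \<phi>) = (\<pi> \<one> \<oplus>\<^bsub>sgc_alg A\<^esub> ?q) (b, \<phi>)"
      by (simp add: q_app \<pi>_app fdvs_l_zero[OF Dm.fdvs])
  qed (rule E.one_closed)
  ultimately show ?thesis using p1 I.a_closed by simp
qed

lemma sgc_full_corner_tri: "full_corner (sgc_alg A) tri"
proof -
  have "corner_emb (sgc_alg A) tri tri_map"
    by (intro corner_emb.intro corner_emb_axioms.intro End_alg[OF sgc_mod] tri_algebra)
      (fact tri_map_closed tri_map_add tri_map_mult tri_map_smult tri_map_inj corner_in_tri_map_image tri_map_full)+
  then show ?thesis by (auto simp: full_corner_def)
qed

end

section \<open>Condition (T) passes to the triangular matrix algebra\<close>

context trace_idem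
begin

text \<open>
  The right module \<open>(0, e(DA)e, eA)\<close> is isomorphic to the dual of the first column of the matrix
  algebra; the isomorphism \<open>v0\<close> puts \<open>(0, 0, e)\<close> into the trace. The homomorphisms \<open>DA \<rightarrow> A\<close>, applied
  to the restriction of a linear form to the last diagonal entry, contribute the rest of \<open>(0, 0, 1)\<close>.
\<close>

lemma tri_trace_idem: "trace_idem tri (e, \<zero>\<^bsub>D\<^esub>, \<zero>)"
proof -
  interpret T: fd_algebra tri by (rule tri_algebra)
  interpret Dm: fd_rmodule A D by (rule dual_mod)
  note z = dual_zero_rules
  note [simp] = z dual_closed fdvs_smult_zero[OF fdvs]
  let ?DT = "dual_mod tri"
  have p: "(e \<otimes> y \<otimes> e, \<zero>\<^bsub>D\<^esub>, \<zero>) \<in> carrier tri" if "y \<in> carrier A" for y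
    using that e by (simp add: tri_carrier m_assoc) (simp add: m_assoc[symmetric])
  have c: "(\<zero>, \<phi> \<lhd>\<^bsub>D\<^esub> e, \<zero>) \<in> carrier tri" if "\<phi> \<in> carrier D" for \<phi>
    using that e by (simp add: tri_carrier Dm.ract_mult[symmetric])
  have q: "(\<zero>, \<zero>\<^bsub>D\<^esub>, s) \<in> carrier tri" if "s \<in> carrier A" for s
    using that e by (simp add: tri_carrier)
  let ?e = "(e, \<zero>\<^bsub>D\<^esub>, \<zero>)"
  have eT: "?e \<in> carrier tri" using p[of \<one>] e by simp
  have col: "(\<lambda>\<phi>. \<Phi> (\<zero>, \<phi> \<lhd>\<^bsub>D\<^esub> e, \<zero>)) (f \<oplus>\<^bsub>D\<^esub> g) = \<Phi> (\<zero>, f \<lhd>\<^bsub>D\<^esub> e, \<zero>) + \<Phi> (\<zero>, g \<lhd>\<^bsub>D\<^esub> e, \<zero>)"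
    "\<Phi> (\<zero>, (d \<odot>\<^bsub>D\<^esub> f) \<lhd>\<^bsub>D\<^esub> e, \<zero>) = d * \<Phi> (\<zero>, f \<lhd>\<^bsub>D\<^esub> e, \<zero>)"
    if \<Phi>: "\<Phi> \<in> carrier ?DT" and f: "f \<in> carrier D" and g: "g \<in> carrier D" for \<Phi> f g d
    using T.dual_add[OF \<Phi> c[OF f] c[OF g]] T.dual_smult[OF \<Phi> c[OF f], of d] f g e
    by (simp_all add: Dm.ract_add_left Dm.ract_smult_left)
  \<comment> \<open>On the (1,0) entries, \<open>\<Phi>\<close> is a form on \<open>(DA)e\<close>.
    By biduality it is the evaluation at some element of \<open>A\<close>, which turns out to lie in
    \<open>eA\<close>.\<close>
  define \<beta> where "\<beta> \<Phi> = (SOME b. b \<in> carrier A \<and> (\<forall>\<phi>\<in>carrier D. \<Phi> (\<zero>, \<phi> \<lhd>\<^bsub>D\<^esub> e, \<zero>) = \<phi> b))" for \<Phi>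
  have \<beta>: "\<beta> \<Phi> \<in> carrier A" "\<And>\<phi>. \<phi> \<in> carrier D \<Longrightarrow> \<phi> (\<beta> \<Phi>) = \<Phi> (\<zero>, \<phi> \<lhd>\<^bsub>D\<^esub> e, \<zero>)"
    if \<Phi>: "\<Phi> \<in> carrier ?DT" for \<Phi>
  proof -
    have "\<exists>b\<in>carrier A. \<forall>\<phi>\<in>carrier D. \<Phi> (\<zero>, \<phi> \<lhd>\<^bsub>D\<^esub> e, \<zero>) = \<phi> b"
      by (rule dual_reflexive) (use col[OF \<Phi>] in auto)
    then have "\<exists>b. b \<in> carrier A \<and> (\<forall>\<phi>\<in>carrier D. \<Phi> (\<zero>, \<phi> \<lhd>\<^bsub>D\<^esub> e, \<zero>) = \<phi> b)" by blast
    from someI_ex[OF this] show "\<beta> \<Phi> \<in> carrier A"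
      "\<And>\<phi>. \<phi> \<in> carrier D \<Longrightarrow> \<phi> (\<beta> \<Phi>) = \<Phi> (\<zero>, \<phi> \<lhd>\<^bsub>D\<^esub> e, \<zero>)" unfolding \<beta>_def by auto
  qed
  have \<beta>_eqI: "\<beta> \<Phi> = b" if "\<Phi> \<in> carrier ?DT" "b \<in> carrier A"
    "\<And>\<phi>. \<phi> \<in> carrier D \<Longrightarrow> \<Phi> (\<zero>, \<phi> \<lhd>\<^bsub>D\<^esub> e, \<zero>) = \<phi> b" for \<Phi> b
    by (rule dual_separates) (use \<beta>[OF that(1)] that in auto)
  have e\<beta>: "e \<otimes> \<beta> \<Phi> = \<beta> \<Phi>" if \<Phi>: "\<Phi> \<in> carrier ?DT" for \<Phi>
  proof (rule dual_separates)
    fix \<phi> assume \<phi>: "\<phi> \<in> carrier D"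
    have "\<phi> (e \<otimes> \<beta> \<Phi>) = (\<phi> \<lhd>\<^bsub>D\<^esub> e) (\<beta> \<Phi>)" using \<beta>(1)[OF \<Phi>] by (simp add: dual_app)
    also have "\<dots> = \<phi> (\<beta> \<Phi>)"
      using \<beta>(2)[OF \<Phi> \<phi>] \<beta>(2)[OF \<Phi>, of "\<phi> \<lhd>\<^bsub>D\<^esub> e"] \<phi> e by (simp add: Dm.ract_mult[symmetric])
    finally show "\<phi> (e \<otimes> \<beta> \<Phi>) = \<phi> (\<beta> \<Phi>)" .
  qed (use \<beta>[OF \<Phi>] e in auto)
  \<comment> \<open>The restriction of \<open>\<Phi>\<close> to the first diagonal entry
    \<open>eAe\<close>, pulled back to \<open>A\<close>. Together, \<open>\<xi>\<close> and
    \<open>\<beta>\<close> record \<open>\<Phi>\<close> on the first column.\<close>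
  define \<xi> where "\<xi> \<Phi> = (\<lambda>y\<in>carrier A. \<Phi> (e \<otimes> y \<otimes> e, \<zero>\<^bsub>D\<^esub>, \<zero>))" for \<Phi> :: "'a \<times> ('a \<Rightarrow> 'k) \<times> 'a \<Rightarrow> 'k"
  have \<xi>: "\<xi> \<Phi> \<in> carrier D" "\<xi> \<Phi> \<lhd>\<^bsub>D\<^esub> e = \<xi> \<Phi>" if \<Phi>: "\<Phi> \<in> carrier ?DT" for \<Phi>
  proof -
    show 1: "\<xi> \<Phi> \<in> carrier D"
      unfolding \<xi>_def
    proof (rule dualI)
      fix y y' d assume y: "y \<in> carrier A"
      show "\<Phi> (e \<otimes> (d \<odot> y) \<otimes> e, \<zero>\<^bsub>D\<^esub>, \<zero>) = d * \<Phi> (e \<otimes> y \<otimes> e, \<zero>\<^bsub>D\<^esub>, \<zero>)"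
        using T.dual_smult[OF \<Phi> p[OF y], of d] y e by (simp add: smult_mult_left smult_mult_right)
      show "\<Phi> (e \<otimes> (y \<oplus> y') \<otimes> e, \<zero>\<^bsub>D\<^esub>, \<zero>) = \<Phi> (e \<otimes> y \<otimes> e, \<zero>\<^bsub>D\<^esub>, \<zero>) + \<Phi> (e \<otimes> y' \<otimes> e, \<zero>\<^bsub>D\<^esub>, \<zero>)"
        if y': "y' \<in> carrier A"
        using T.dual_add[OF \<Phi> p[OF y] p[OF y']] y y' e by (simp add: l_distr r_distr)
    qed
    show "\<xi> \<Phi> \<lhd>\<^bsub>D\<^esub> e = \<xi> \<Phi>"
      by (rule dual_eqI) (use 1 e in \<open>auto simp: dual_app \<xi>_def m_assoc[symmetric]\<close>)
  qed
  define v0 where "v0 = (\<lambda>\<Phi>\<in>carrier ?DT. (\<zero>, \<xi> \<Phi>, \<beta> \<Phi>))"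
  have v0: "v0 \<in> rmod_hom tri ?DT (reg_mod tri)"
  proof (rule rmod_homI)
    fix \<Phi> \<Psi> d t assume \<Phi>: "\<Phi> \<in> carrier ?DT"
    show "v0 \<Phi> \<in> carrier (reg_mod tri)" using \<Phi> \<xi> \<beta>(1) e by (simp add: v0_def tri_carrier)
    have "\<xi> (d \<odot>\<^bsub>?DT\<^esub> \<Phi>) = d \<odot>\<^bsub>D\<^esub> \<xi> \<Phi>"
      by (rule dual_eqI) (use \<Phi> \<xi>(1) p in \<open>auto simp: T.dual_closed T.dual_app dual_app \<xi>_def\<close>)
    moreover have "\<beta> (d \<odot>\<^bsub>?DT\<^esub> \<Phi>) = d \<odot> \<beta> \<Phi>"
    proof (rule \<beta>_eqI)
      fix \<phi> assume \<phi>: "\<phi> \<in> carrier D"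
      show "(d \<odot>\<^bsub>?DT\<^esub> \<Phi>) (\<zero>, \<phi> \<lhd>\<^bsub>D\<^esub> e, \<zero>) = \<phi> (d \<odot> \<beta> \<Phi>)"
        using \<beta>(1)[OF \<Phi>] \<beta>(2)[OF \<Phi> \<phi>] c[OF \<phi>] \<phi> by (simp add: T.dual_app dual_smult)
    qed (use \<Phi> \<beta> in \<open>auto simp: T.dual_closed smult_carrier\<close>)
    ultimately show "v0 (d \<odot>\<^bsub>?DT\<^esub> \<Phi>) = d \<odot>\<^bsub>reg_mod tri\<^esub> v0 \<Phi>" using \<Phi> by (simp add: v0_def T.dual_closed)
    show "v0 (\<Phi> \<oplus>\<^bsub>?DT\<^esub> \<Psi>) = v0 \<Phi> \<oplus>\<^bsub>reg_mod tri\<^esub> v0 \<Psi>" if \<Psi>: "\<Psi> \<in> carrier ?DT"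
    proof -
      have "\<xi> (\<Phi> \<oplus>\<^bsub>?DT\<^esub> \<Psi>) = \<xi> \<Phi> \<oplus>\<^bsub>D\<^esub> \<xi> \<Psi>"
        by (rule dual_eqI) (use \<Phi> \<Psi> \<xi>(1) p in \<open>auto simp: T.dual_closed T.dual_app dual_app \<xi>_def\<close>)
      moreover have "\<beta> (\<Phi> \<oplus>\<^bsub>?DT\<^esub> \<Psi>) = \<beta> \<Phi> \<oplus> \<beta> \<Psi>"
      proof (rule \<beta>_eqI)
        fix \<phi> assume \<phi>: "\<phi> \<in> carrier D"
        show "(\<Phi> \<oplus>\<^bsub>?DT\<^esub> \<Psi>) (\<zero>, \<phi> \<lhd>\<^bsub>D\<^esub> e, \<zero>) = \<phi> (\<beta> \<Phi> \<oplus> \<beta> \<Psi>)"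
          using \<beta>(1)[OF \<Phi>] \<beta>(1)[OF \<Psi>] \<beta>(2)[OF \<Phi> \<phi>] \<beta>(2)[OF \<Psi> \<phi>] c[OF \<phi>] \<phi>
          by (simp add: T.dual_app dual_add)
      qed (use \<Phi> \<Psi> \<beta> in \<open>auto simp: T.dual_closed\<close>)
      ultimately show ?thesis using \<Phi> \<Psi> by (simp add: v0_def T.dual_closed)
    qed
    show "v0 (\<Phi> \<lhd>\<^bsub>?DT\<^esub> t) = v0 \<Phi> \<lhd>\<^bsub>reg_mod tri\<^esub> t" if t: "t \<in> carrier tri"
    proof -
      obtain r x s where t': "t = (r, x, s)" by (cases t)
      note a = t[unfolded t' tri_carrier]
      have \<Phi>t: "\<Phi> \<lhd>\<^bsub>?DT\<^esub> t \<in> carrier ?DT" using \<Phi> t by (rule T.dual_closed)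
      have "\<beta> (\<Phi> \<lhd>\<^bsub>?DT\<^esub> t) = \<beta> \<Phi> \<otimes> s"
      proof (rule \<beta>_eqI[OF \<Phi>t])
        fix \<phi> assume \<phi>: "\<phi> \<in> carrier D"
        have "(\<Phi> \<lhd>\<^bsub>?DT\<^esub> t) (\<zero>, \<phi> \<lhd>\<^bsub>D\<^esub> e, \<zero>) = \<Phi> (\<zero>, lact D s \<phi> \<lhd>\<^bsub>D\<^esub> e, \<zero>)"
          using a c[OF \<phi>] \<phi> e by (simp add: T.dual_app t' lact_rules)
        also have "\<dots> = \<phi> (\<beta> \<Phi> \<otimes> s)" using \<beta>[OF \<Phi>] \<phi> a by (simp flip: \<beta>(2)[OF \<Phi>] add: dual_app)
        finally show "(\<Phi> \<lhd>\<^bsub>?DT\<^esub> t) (\<zero>, \<phi> \<lhd>\<^bsub>D\<^esub> e, \<zero>) = \<phi> (\<beta> \<Phi> \<otimes> s)" .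
      qed (use \<beta>[OF \<Phi>] a in auto)
      moreover have "\<xi> (\<Phi> \<lhd>\<^bsub>?DT\<^esub> t) = \<xi> \<Phi> \<lhd>\<^bsub>D\<^esub> r \<oplus>\<^bsub>D\<^esub> lact D (\<beta> \<Phi>) x"
      proof (rule dual_eqI)
        fix y assume y: "y \<in> carrier A"
        have eye: "e \<otimes> y \<otimes> e = (e \<otimes> y) \<otimes> e" by simp
        have ey: "e \<otimes> y \<in> carrier A" using e y by simp
        have "\<xi> (\<Phi> \<lhd>\<^bsub>?DT\<^esub> t) y = \<Phi> (r \<otimes> (e \<otimes> y \<otimes> e), x \<lhd>\<^bsub>D\<^esub> (e \<otimes> y \<otimes> e), \<zero>)"
          using a p[OF y] y e by (simp add: \<xi>_def T.dual_app t')
        also have "r \<otimes> (e \<otimes> y \<otimes> e) = e \<otimes> (r \<otimes> y) \<otimes> e"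
          using a e y by (simp add: m_assoc[symmetric])
        also have "x \<lhd>\<^bsub>D\<^esub> (e \<otimes> y \<otimes> e) = (x \<lhd>\<^bsub>D\<^esub> (e \<otimes> y)) \<lhd>\<^bsub>D\<^esub> e" using a e y by (simp add: Dm.ract_mult)
        \<comment> \<open>The first column of the product splits into its two entries. The diagonal
          one is read by \<open>\<xi>\<close>; the other one is read by \<open>\<beta>\<close> and
          produces the summand \<open>\<beta> \<Phi>\<close> times \<open>x\<close>.\<close>
        also have "\<Phi> (e \<otimes> (r \<otimes> y) \<otimes> e, (x \<lhd>\<^bsub>D\<^esub> (e \<otimes> y)) \<lhd>\<^bsub>D\<^esub> e, \<zero>) =
            \<Phi> (e \<otimes> (r \<otimes> y) \<otimes> e, \<zero>\<^bsub>D\<^esub>, \<zero>) + \<Phi> (\<zero>, (x \<lhd>\<^bsub>D\<^esub> (e \<otimes> y)) \<lhd>\<^bsub>D\<^esub> e, \<zero>)"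
          using T.dual_add[OF \<Phi> p[of "r \<otimes> y"] c[of "x \<lhd>\<^bsub>D\<^esub> (e \<otimes> y)"]] a e y by simp
        also have "\<Phi> (\<zero>, (x \<lhd>\<^bsub>D\<^esub> (e \<otimes> y)) \<lhd>\<^bsub>D\<^esub> e, \<zero>) = x (e \<otimes> (y \<otimes> \<beta> \<Phi>))"
          using \<beta>[OF \<Phi>] a e y by (simp flip: \<beta>(2)[OF \<Phi>] add: dual_app m_assoc)
        also have "\<dots> = x (y \<otimes> \<beta> \<Phi>)" using a \<beta>(1)[OF \<Phi>] y by (intro De_app) auto
        finally show "\<xi> (\<Phi> \<lhd>\<^bsub>?DT\<^esub> t) y = (\<xi> \<Phi> \<lhd>\<^bsub>D\<^esub> r \<oplus>\<^bsub>D\<^esub> lact D (\<beta> \<Phi>) x) y"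
          using a y by (simp add: dual_app \<xi>_def)
      qed (use \<xi>[OF \<Phi>] \<xi>[OF \<Phi>t] \<beta>[OF \<Phi>] a in auto)
      ultimately show ?thesis using \<Phi> \<Phi>t a by (simp add: v0_def t')
    qed
  qed (simp add: v0_def)
  have vw: "(\<lambda>\<Phi>\<in>carrier ?DT. (\<zero>, \<zero>\<^bsub>D\<^esub>, w (\<lambda>s\<in>carrier A. \<Phi> (\<zero>, \<zero>\<^bsub>D\<^esub>, s)))) \<in> rmod_hom tri ?DT (reg_mod tri)"
    if w: "w \<in> rmod_hom A D (reg_mod A)" for w
  proof -
    note w' = rmod_hom_closed[OF w, simplified] rmod_hom_add[OF w, simplified]
      rmod_hom_smult[OF w, simplified] rmod_hom_ract[OF w, simplified]
    define \<sigma> where "\<sigma> \<Phi> = (\<lambda>s\<in>carrier A. \<Phi> (\<zero>, \<zero>\<^bsub>D\<^esub>, s))" for \<Phi> :: "'a \<times> ('a \<Rightarrow> 'k) \<times> 'a \<Rightarrow> 'k"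
    have \<sigma>: "\<sigma> \<Phi> \<in> carrier D" if \<Phi>: "\<Phi> \<in> carrier ?DT" for \<Phi>
      unfolding \<sigma>_def
    proof (rule dualI)
      fix s s' d assume s: "s \<in> carrier A"
      show "\<Phi> (\<zero>, \<zero>\<^bsub>D\<^esub>, d \<odot> s) = d * \<Phi> (\<zero>, \<zero>\<^bsub>D\<^esub>, s)" using T.dual_smult[OF \<Phi> q[OF s], of d] by simp
      show "\<Phi> (\<zero>, \<zero>\<^bsub>D\<^esub>, s \<oplus> s') = \<Phi> (\<zero>, \<zero>\<^bsub>D\<^esub>, s) + \<Phi> (\<zero>, \<zero>\<^bsub>D\<^esub>, s')" if s': "s' \<in> carrier A"
        using T.dual_add[OF \<Phi> q[OF s] q[OF s']] by simp
    qed
    \<comment> \<open>For linearity over \<open>tri\<close>, the product of \<open>w \<psi>\<close>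
      with a (1,0) entry \<open>x\<close> has to vanish. The value of \<open>x\<close> at
      \<open>y (w \<psi>)\<close> equals that at \<open>e y (w \<psi>)\<close>, and this argument is
      zero by \<open>trace_zero\<close> for the homomorphism
      \<open>\<phi> \<mapsto> y (w \<phi>)\<close>.\<close>
    have ew: "lact D (w \<psi>) x = \<zero>\<^bsub>D\<^esub>" if \<psi>: "\<psi> \<in> carrier D" and x: "x \<in> carrier D" "x \<lhd>\<^bsub>D\<^esub> e = x" for \<psi> x
    proof (rule dual_eqI)
      fix y assume y: "y \<in> carrier A"
      have "(\<lambda>\<phi>\<in>carrier D. y \<otimes> w \<phi>) \<in> rmod_hom A D (reg_mod A)"
        by (rule rmod_homI) (use y w' in \<open>auto simp: r_distr smult_mult_right m_assoc\<close>)
      from trace_zero[OF this \<psi>] have "e \<otimes> (y \<otimes> w \<psi>) = \<zero>" using \<psi> by simp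
      moreover have "x (e \<otimes> (y \<otimes> w \<psi>)) = x (y \<otimes> w \<psi>)" using x y w' \<psi> by (intro De_app) auto
      ultimately show "lact D (w \<psi>) x y = \<zero>\<^bsub>D\<^esub> y" using y x by (simp add: dual_app dual_zero)
    qed (use x \<psi> w' in auto)
    let ?v = "\<lambda>\<Phi>\<in>carrier ?DT. (\<zero>, \<zero>\<^bsub>D\<^esub>, w (\<sigma> \<Phi>))"
    have "?v \<in> rmod_hom tri ?DT (reg_mod tri)"
    proof (rule rmod_homI)
      fix \<Phi> \<Psi> d t assume \<Phi>: "\<Phi> \<in> carrier ?DT"
      show "?v \<Phi> \<in> carrier (reg_mod tri)"
        using \<Phi> \<sigma> w' q by simp
      have "\<sigma> (d \<odot>\<^bsub>?DT\<^esub> \<Phi>) = d \<odot>\<^bsub>D\<^esub> \<sigma> \<Phi>"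
        by (rule dual_eqI) (use \<Phi> \<sigma> q in \<open>auto simp: T.dual_closed T.dual_app dual_app \<sigma>_def\<close>)
      then show "?v (d \<odot>\<^bsub>?DT\<^esub> \<Phi>) =
          d \<odot>\<^bsub>reg_mod tri\<^esub> ?v \<Phi>"
        using \<Phi> \<sigma> w' by (simp add: T.dual_closed)
      show "?v (\<Phi> \<oplus>\<^bsub>?DT\<^esub> \<Psi>) =
          ?v \<Phi> \<oplus>\<^bsub>reg_mod tri\<^esub> ?v \<Psi>"
        if \<Psi>: "\<Psi> \<in> carrier ?DT"
      proof -
        have "\<sigma> (\<Phi> \<oplus>\<^bsub>?DT\<^esub> \<Psi>) = \<sigma> \<Phi> \<oplus>\<^bsub>D\<^esub> \<sigma> \<Psi>"
          by (rule dual_eqI) (use \<Phi> \<Psi> \<sigma> q in \<open>auto simp: T.dual_closed T.dual_app dual_app \<sigma>_def\<close>)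
        then show ?thesis using \<Phi> \<Psi> \<sigma> w' by (simp add: T.dual_closed)
      qed
      show "?v (\<Phi> \<lhd>\<^bsub>?DT\<^esub> t) =
          ?v \<Phi> \<lhd>\<^bsub>reg_mod tri\<^esub> t" if t: "t \<in> carrier tri"
      proof -
        obtain r x s where t': "t = (r, x, s)" by (cases t)
        note a = t[unfolded t' tri_carrier]
        have "\<sigma> (\<Phi> \<lhd>\<^bsub>?DT\<^esub> t) = \<sigma> \<Phi> \<lhd>\<^bsub>D\<^esub> s"
          by (rule dual_eqI) (use \<Phi> t \<sigma> q a in \<open>auto simp: T.dual_closed T.dual_app dual_app \<sigma>_def t'\<close>)
        then show ?thesis using \<Phi> t \<sigma> w' a ew by (simp add: T.dual_closed t')
      qed
    qed simp
    then show ?thesis by (simp add: \<sigma>_def)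
  qed
  show ?thesis
  proof
    show "is_idempotent tri ?e" using eT e by (simp add: is_idempotent_def)
  next
    fix I assume I: "ideal I tri" and eI: "?e \<in> I"
      and tr: "\<And>v \<phi>. v \<in> rmod_hom tri ?DT (reg_mod tri) \<Longrightarrow> \<phi> \<in> carrier ?DT \<Longrightarrow> v \<phi> \<in> I"
    interpret I: ideal I tri by (rule I)
    let ?J = "{b \<in> carrier A. (\<zero>, \<zero>\<^bsub>D\<^esub>, b) \<in> I}"
    have J: "ideal ?J A"
    proof (rule idealI')
      show "a \<oplus> b \<in> ?J" if "a \<in> ?J" "b \<in> ?J" for a b
        using that I.a_closed[of "(\<zero>, \<zero>\<^bsub>D\<^esub>, a)" "(\<zero>, \<zero>\<^bsub>D\<^esub>, b)"] by simp
      show "a \<otimes> b \<in> ?J" if "a \<in> carrier A" "b \<in> ?J" for a b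
        using that I.I_l_closed[of "(\<zero>, \<zero>\<^bsub>D\<^esub>, b)", OF _ q[of a]] by simp
      show "b \<otimes> a \<in> ?J" if "a \<in> carrier A" "b \<in> ?J" for a b
        using that I.I_r_closed[of "(\<zero>, \<zero>\<^bsub>D\<^esub>, b)", OF _ q[of a]] by simp
    qed (use I.zero_closed in auto)
    have "\<one> \<in> ?J"
    proof (rule trace_full[OF J])
      \<comment> \<open>The form that evaluates the (1,0) entry at \<open>\<one>\<close>. It is
        chosen so that its \<open>\<beta>\<close> is \<open>e\<close>, since
        \<open>\<phi> \<lhd> e\<close> takes at \<open>\<one>\<close> the value of
        \<open>\<phi>\<close> at \<open>e\<close>, while its \<open>\<xi>\<close> is zero; thus
        \<open>v0\<close> maps it to \<open>(0, 0, e)\<close>.\<close>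
      let ?\<Phi> = "\<lambda>t\<in>carrier tri. fst (snd t) \<one>"
      have \<Phi>: "?\<Phi> \<in> carrier ?DT"
        by (rule T.dualI) (auto simp: tri_carrier dual_app)
      have "\<xi> ?\<Phi> = \<zero>\<^bsub>D\<^esub>"
        by (rule dual_eqI) (use \<xi>[OF \<Phi>] p in \<open>auto simp: \<xi>_def dual_app\<close>)
      moreover have "\<beta> ?\<Phi> = e"
        by (rule \<beta>_eqI[OF \<Phi>]) (use e c in \<open>auto simp: dual_app\<close>)
      ultimately show "e \<in> ?J" using tr[OF v0 \<Phi>] \<Phi> e by (simp add: v0_def)
      fix w \<psi> assume w: "w \<in> rmod_hom A D (reg_mod A)" and \<psi>: "\<psi> \<in> carrier D"
      \<comment> \<open>A form that reads only the last diagonal entry, on which the homomorphism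
        built from \<open>w\<close> reproduces \<open>w \<psi>\<close>.\<close>
      let ?\<Psi> = "\<lambda>t\<in>carrier tri. \<psi> (snd (snd t))"
      have \<Psi>: "?\<Psi> \<in> carrier ?DT"
        by (rule T.dualI) (use \<psi> in \<open>auto simp: tri_carrier dual_add dual_smult\<close>)
      have "(\<lambda>s\<in>carrier A. ?\<Psi> (\<zero>, \<zero>\<^bsub>D\<^esub>, s)) = \<psi>"
        by (rule extensionalityI[where A = "carrier A"]) (use \<psi> q in \<open>auto simp: dual_carrier\<close>)
      then show "w \<psi> \<in> ?J" using tr[OF vw[OF w] \<Psi>] \<Psi> rmod_hom_closed[OF w \<psi>] by simp
    qed
    then show "\<one>\<^bsub>tri\<^esub> \<in> I" using I.a_closed[OF eI, of "(\<zero>, \<zero>\<^bsub>D\<^esub>, \<one>)"] e by simp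
  next
    fix v \<Phi> assume v: "v \<in> rmod_hom tri ?DT (reg_mod tri)" and \<Phi>: "\<Phi> \<in> carrier ?DT"
    note w = \<xi>[OF \<Phi>]
    let ?\<Psi> = "\<lambda>t\<in>carrier tri. fst (snd t) \<one>"
    have \<Psi>: "?\<Psi> \<in> carrier ?DT"
      by (rule T.dualI) (auto simp: tri_carrier dual_app)
    have x: "(\<zero>, \<xi> \<Phi>, \<zero>) \<in> carrier tri" using w e by (simp add: tri_carrier)
    \<comment> \<open>Cut by the idempotent, every \<open>\<Phi>\<close> becomes a multiple of one
      fixed form by an element supported at (1,0). Applying \<open>v\<close>, the (0,0) entry of
      \<open>v \<Phi>\<close> is that of a product with \<open>(0, \<xi> \<Phi>, 0)\<close>, hence
      zero.\<close>
    have eq: "\<Phi> \<lhd>\<^bsub>?DT\<^esub> ?e = ?\<Psi> \<lhd>\<^bsub>?DT\<^esub> (\<zero>, \<xi> \<Phi>, \<zero>)"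
    proof (rule T.dual_eqI)
      fix t assume t: "t \<in> carrier tri"
      obtain r y s where t': "t = (r, y, s)" by (cases t)
      note a = t[unfolded t' tri_carrier]
      have r: "e \<otimes> r \<otimes> e = r" using a by simp
      have "(\<zero>, \<xi> \<Phi>, \<zero>) \<otimes>\<^bsub>tri\<^esub> t \<in> carrier tri" using x t by (rule T.m_closed)
      then show "(\<Phi> \<lhd>\<^bsub>?DT\<^esub> ?e) t = (?\<Psi> \<lhd>\<^bsub>?DT\<^esub> (\<zero>, \<xi> \<Phi>, \<zero>)) t"
        using t w(1) a e by (simp add: T.dual_app t' dual_app) (simp add: \<xi>_def r)
    qed (use \<Phi> \<Psi> x eT in \<open>auto simp: T.dual_closed\<close>)
    obtain r y s where vt: "v \<Phi> = (r, y, s)" by (cases "v \<Phi>")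
    have a: "(r, y, s) \<in> carrier tri" using rmod_hom_closed[OF v \<Phi>] vt by simp
    obtain r' y' s' where vt': "v ?\<Psi> = (r', y', s')" by (cases "v ?\<Psi>")
    have a': "(r', y', s') \<in> carrier tri" using rmod_hom_closed[OF v \<Psi>] vt' by simp
    have "v \<Phi> \<otimes>\<^bsub>tri\<^esub> ?e = v ?\<Psi> \<otimes>\<^bsub>tri\<^esub> (\<zero>, \<xi> \<Phi>, \<zero>)"
      using rmod_hom_ract[OF v \<Phi> eT] rmod_hom_ract[OF v \<Psi> x] eq by simp
    then have "r = \<zero>" using a a' by (simp add: vt vt' tri_carrier)
    then show "?e \<otimes>\<^bsub>tri\<^esub> v \<Phi> = \<zero>\<^bsub>tri\<^esub>" using a e by (simp add: vt tri_carrier)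
  qed
qed

end

section \<open>Transport of condition (T) along isomorphisms\<close>

context alg_iso
begin

lemma dual_pull: "\<phi> \<in> carrier (dual_mod B) \<Longrightarrow> (\<lambda>x\<in>carrier A. \<phi> (h x)) \<in> carrier (dual_mod A)"
  by (rule A.dualI) (simp_all add: h_add h_smult h_closed B.dual_add B.dual_smult)

lemma dual_hom_push:
  assumes w: "w \<in> rmod_hom A (dual_mod A) (reg_mod A)"
  shows "(\<lambda>\<phi>\<in>carrier (dual_mod B). h (w (\<lambda>x\<in>carrier A. \<phi> (h x)))) \<in> rmod_hom B (dual_mod B) (reg_mod B)" (is "?v \<in> _")
proof (rule rmod_homI)
  fix \<phi> \<psi> c b assume \<phi>: "\<phi> \<in> carrier (dual_mod B)"
  show "?v \<phi> \<in> carrier (reg_mod B)"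
    using \<phi> rmod_hom_closed[OF w dual_pull[OF \<phi>]] h_closed by simp
  have "(\<lambda>x\<in>carrier A. (c \<odot>\<^bsub>dual_mod B\<^esub> \<phi>) (h x)) = c \<odot>\<^bsub>dual_mod A\<^esub> (\<lambda>x\<in>carrier A. \<phi> (h x))"
    unfolding dual_mod_simps by (rule restrict_ext) (simp add: h_closed)
  then show "?v (c \<odot>\<^bsub>dual_mod B\<^esub> \<phi>) =
      c \<odot>\<^bsub>reg_mod B\<^esub> ?v \<phi>"
    using \<phi> rmod_hom_smult[OF w dual_pull[OF \<phi>]] rmod_hom_closed[OF w dual_pull[OF \<phi>]]
    by (simp add: B.dual_closed h_smult)
  show "?v (\<phi> \<oplus>\<^bsub>dual_mod B\<^esub> \<psi>) =
      ?v \<phi> \<oplus>\<^bsub>reg_mod B\<^esub>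
      ?v \<psi>" if \<psi>: "\<psi> \<in> carrier (dual_mod B)"
  proof -
    have "(\<lambda>x\<in>carrier A. (\<phi> \<oplus>\<^bsub>dual_mod B\<^esub> \<psi>) (h x)) =
        (\<lambda>x\<in>carrier A. \<phi> (h x)) \<oplus>\<^bsub>dual_mod A\<^esub> (\<lambda>x\<in>carrier A. \<psi> (h x))"
      unfolding dual_mod_simps by (rule restrict_ext) (simp add: h_closed)
    then show ?thesis
      using \<phi> \<psi> rmod_hom_add[OF w dual_pull[OF \<phi>] dual_pull[OF \<psi>]]
        rmod_hom_closed[OF w dual_pull[OF \<phi>]] rmod_hom_closed[OF w dual_pull[OF \<psi>]]
      by (simp add: B.dual_closed h_add)
  qed
  show "?v (\<phi> \<lhd>\<^bsub>dual_mod B\<^esub> b) =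
      ?v \<phi> \<lhd>\<^bsub>reg_mod B\<^esub> b" if b: "b \<in> carrier B"
  proof -
    obtain a where a: "a \<in> carrier A" "b = h a" using h_surj[OF b] by blast
    have "(\<lambda>x\<in>carrier A. (\<phi> \<lhd>\<^bsub>dual_mod B\<^esub> b) (h x)) = (\<lambda>x\<in>carrier A. \<phi> (h x)) \<lhd>\<^bsub>dual_mod A\<^esub> a"
      unfolding dual_mod_simps by (rule restrict_ext) (simp add: h_closed h_mult a)
    then show ?thesis
      using \<phi> a rmod_hom_ract[OF w dual_pull[OF \<phi>] a(1)] rmod_hom_closed[OF w dual_pull[OF \<phi>]] b
      by (simp add: B.dual_closed h_mult)
  qed
qed simp

end

text \<open>Homomorphisms from the dual into the algebra correspond on both sides. The vanishing
  part of (T) for \<open>B\<close> is obtained by moving homomorphisms to \<open>A\<close> along the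
  inverse, the generating part by moving those of \<open>A\<close> forward along \<open>h\<close>.
  This is what carries (T) from \<open>tri\<close> to the next truncation.\<close>

lemma trace_idem_iso:
  assumes "trace_idem A e" "alg_iso A B h"
  shows "trace_idem B (h e)"
proof -
  interpret A: trace_idem A e by (rule assms)
  interpret h: alg_iso A B h by (rule assms)
  interpret g: alg_iso B A "the_inv_into (carrier A) h" by (rule h.inverse)
  let ?g = "the_inv_into (carrier A) h"
  have gh: "?g (h x) = x" if "x \<in> carrier A" for x
    using that h.h_bij by (simp add: bij_betw_def the_inv_into_f_f)
  have hg: "h (?g y) = y" if "y \<in> carrier B" for y
    using that h.h_bij by (simp add: bij_betw_def f_the_inv_into_f)
  show ?thesis
  proof
    have "h e \<otimes>\<^bsub>B\<^esub> h e = h e" using h.h_mult[of e e] A.e by simp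
    then show "is_idempotent B (h e)" using A.e by (simp add: is_idempotent_def h.h_closed)
  next
    fix v \<phi> assume v: "v \<in> rmod_hom B (dual_mod B) (reg_mod B)" and \<phi>: "\<phi> \<in> carrier (dual_mod B)"
    have inv_eq: "(\<lambda>y\<in>carrier B. (\<lambda>x\<in>carrier A. \<phi> (h x)) (?g y)) = \<phi>"
      by (rule extensionalityI[where A = "carrier B"])
        (use \<phi> in \<open>auto simp: g.h_closed hg dual_carrier\<close>)
    have vc: "v \<phi> \<in> carrier B" using rmod_hom_closed[OF v \<phi>] by simp
    have "e \<otimes>\<^bsub>A\<^esub> ?g (v \<phi>) = \<zero>\<^bsub>A\<^esub>"
      using A.trace_zero[OF g.dual_hom_push[OF v] h.dual_pull[OF \<phi>]]
      by (simp only: inv_eq restrict_apply'[OF h.dual_pull[OF \<phi>]])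
    then have "h (e \<otimes>\<^bsub>A\<^esub> ?g (v \<phi>)) = \<zero>\<^bsub>B\<^esub>" by (simp add: h.h_zero)
    then show "h e \<otimes>\<^bsub>B\<^esub> v \<phi> = \<zero>\<^bsub>B\<^esub>" using vc A.e by (simp add: h.h_mult g.h_closed hg)
  next
    fix I assume I: "ideal I B" and eI: "h e \<in> I"
      and tr: "\<And>v \<phi>. v \<in> rmod_hom B (dual_mod B) (reg_mod B) \<Longrightarrow> \<phi> \<in> carrier (dual_mod B) \<Longrightarrow> v \<phi> \<in> I"
    interpret I: ideal I B by (rule I)
    let ?J = "{x \<in> carrier A. h x \<in> I}"
    have J: "ideal ?J A"
      by (rule A.idealI') (auto simp: h.h_zero h.h_add h.h_mult h.h_closed I.I_l_closed I.I_r_closed)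
    have "\<one>\<^bsub>A\<^esub> \<in> ?J"
    proof (rule A.trace_full[OF J])
      show "e \<in> ?J" using eI A.e by simp
      fix w \<psi> assume w: "w \<in> rmod_hom A (dual_mod A) (reg_mod A)" and \<psi>: "\<psi> \<in> carrier (dual_mod A)"
      have inv_eq: "(\<lambda>x\<in>carrier A. (\<lambda>y\<in>carrier B. \<psi> (?g y)) (h x)) = \<psi>"
        by (rule extensionalityI[where A = "carrier A"])
          (use \<psi> in \<open>auto simp: h.h_closed gh dual_carrier\<close>)
      have "h (w \<psi>) \<in> I"
        using tr[OF h.dual_hom_push[OF w] g.dual_pull[OF \<psi>]]
        by (simp only: inv_eq restrict_apply'[OF g.dual_pull[OF \<psi>]])
      then show "w \<psi> \<in> ?J" using rmod_hom_closed[OF w \<psi>] by simp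
    qed
    then show "\<one>\<^bsub>B\<^esub> \<in> I" by (simp add: h.h_one)
  qed
qed

section \<open>Additive closures and trace ideals\<close>

lemma power_mod_simps [simp]:
  "carrier (power_mod M n) = {..<n} \<rightarrow>\<^sub>E carrier M" "zero (power_mod M n) = (\<lambda>i\<in>{..<n}. \<zero>\<^bsub>M\<^esub>)"
  "add (power_mod M n) = (\<lambda>v w. \<lambda>i\<in>{..<n}. v i \<oplus>\<^bsub>M\<^esub> w i)"
  "smult (power_mod M n) = (\<lambda>c v. \<lambda>i\<in>{..<n}. c \<odot>\<^bsub>M\<^esub> v i)"
  "ract (power_mod M n) = (\<lambda>v a. \<lambda>i\<in>{..<n}. v i \<lhd>\<^bsub>M\<^esub> a)"
  by (simp_all add: power_mod_def)

lemma power_mod: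
  assumes M: "fd_rmodule A M"
  shows "fd_rmodule A (power_mod M n)"
proof -
  interpret M: fd_rmodule A M by (rule M)
  show ?thesis
  proof (rule fd_rmoduleI[OF M.A.fd_algebra_axioms])
    show "fdvs (power_mod M n)"
    proof (rule fdvs_separating_forms[OF M.fdvs])
      fix F
      assume F: "finite F" "\<And>\<phi>. \<phi> \<in> F \<Longrightarrow> lin_form M \<phi> \<and> \<phi> \<zero>\<^bsub>M\<^esub> = 0"
        "\<And>x y. x \<in> carrier M \<Longrightarrow> y \<in> carrier M \<Longrightarrow> (\<And>\<phi>. \<phi> \<in> F \<Longrightarrow> \<phi> x = \<phi> y) \<Longrightarrow> x = y"
      let ?H = "(\<lambda>(i, \<phi>) v. \<phi> (v i)) ` ({..<n} \<times> F)"
      show ?thesis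
      proof (rule fdvsI)
        show "finite ?H" using F by simp
        show "lin_form (power_mod M n) \<psi> \<and> \<psi> \<zero>\<^bsub>power_mod M n\<^esub> = 0" if H: "\<psi> \<in> ?H" for \<psi>
        proof -
          obtain i \<phi> where \<psi>: "\<psi> = (\<lambda>v. \<phi> (v i))" "i < n" "\<phi> \<in> F" using H by auto
          have "v i \<in> carrier M" if "v \<in> carrier (power_mod M n)" for v using that \<psi>(2) by auto
          then show ?thesis using F(2)[OF \<psi>(3)] \<psi>(2) unfolding \<psi>(1) lin_form_def by simp
        qed
        show "v = w" if v: "v \<in> carrier (power_mod M n)" and w: "w \<in> carrier (power_mod M n)"
          and eq: "\<And>\<psi>. \<psi> \<in> ?H \<Longrightarrow> \<psi> v = \<psi> w" for v w
        proof (rule PiE_ext[of v "{..<n}" "\<lambda>_. carrier M" w])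
          fix i assume i: "i \<in> {..<n}"
          show "v i = w i"
          proof (rule F(3))
            show "v i \<in> carrier M" "w i \<in> carrier M" using v w i by auto
            show "\<phi> (v i) = \<phi> (w i)" if "\<phi> \<in> F" for \<phi>
              by (rule eq[of "\<lambda>v. \<phi> (v i)"]) (use that i in force)
          qed
        qed (use v w in auto)
      qed (auto simp: M.zero_carrier intro!: M.add_carrier M.smult_carrier)
    qed
  next
    fix v w c a b
    assume v: "v \<in> carrier (power_mod M n)" and a: "a \<in> carrier A"
    then have v': "v i \<in> carrier M" if "i \<in> {..<n}" for i using that by auto
    show "v \<lhd>\<^bsub>power_mod M n\<^esub> a \<in> carrier (power_mod M n)" using v' a by (auto intro!: M.ract_closed)
    show "(c \<odot>\<^bsub>power_mod M n\<^esub> v) \<lhd>\<^bsub>power_mod M n\<^esub> a = c \<odot>\<^bsub>power_mod M n\<^esub> (v \<lhd>\<^bsub>power_mod M n\<^esub> a)"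
      "v \<lhd>\<^bsub>power_mod M n\<^esub> (c \<odot>\<^bsub>A\<^esub> a) = c \<odot>\<^bsub>power_mod M n\<^esub> (v \<lhd>\<^bsub>power_mod M n\<^esub> a)"
      unfolding power_mod_simps
      by (rule restrict_ext, use v' a in \<open>simp add: M.ract_smult_left M.ract_smult_right\<close>)+
    show "(v \<oplus>\<^bsub>power_mod M n\<^esub> w) \<lhd>\<^bsub>power_mod M n\<^esub> a =
        v \<lhd>\<^bsub>power_mod M n\<^esub> a \<oplus>\<^bsub>power_mod M n\<^esub> w \<lhd>\<^bsub>power_mod M n\<^esub> a"
      if "w \<in> carrier (power_mod M n)"
      unfolding power_mod_simps
      by (rule restrict_ext) (use v' a that in \<open>simp add: M.ract_add_left PiE_iff\<close>)
    assume b: "b \<in> carrier A"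
    show "v \<lhd>\<^bsub>power_mod M n\<^esub> (a \<otimes>\<^bsub>A\<^esub> b) = (v \<lhd>\<^bsub>power_mod M n\<^esub> a) \<lhd>\<^bsub>power_mod M n\<^esub> b"
      "v \<lhd>\<^bsub>power_mod M n\<^esub> (a \<oplus>\<^bsub>A\<^esub> b) = v \<lhd>\<^bsub>power_mod M n\<^esub> a \<oplus>\<^bsub>power_mod M n\<^esub> v \<lhd>\<^bsub>power_mod M n\<^esub> b"
      unfolding power_mod_simps
      by (rule restrict_ext, use v' a b in \<open>simp add: M.ract_mult M.ract_add_right\<close>)+
  next
    fix v assume v: "v \<in> carrier (power_mod M n)"
    then have "v i \<in> carrier M" if "i \<in> {..<n}" for i using that by auto
    then show "v \<lhd>\<^bsub>power_mod M n\<^esub> \<one>\<^bsub>A\<^esub> = v"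
      unfolding power_mod_simps
      by (intro extensionalityI[where A = "{..<n}"]) (use v in \<open>simp_all add: M.ract_one PiE_iff\<close>)
  qed
qed

lemma rsubmodule_iff:
  assumes W: "fd_rmodule A W"
  shows "rsubmodule A U W \<longleftrightarrow> U \<subseteq> carrier W \<and> \<zero>\<^bsub>W\<^esub> \<in> U \<and> (\<forall>x\<in>U. \<forall>y\<in>U. x \<oplus>\<^bsub>W\<^esub> y \<in> U) \<and>
     (\<forall>c. \<forall>x\<in>U. c \<odot>\<^bsub>W\<^esub> x \<in> U) \<and> (\<forall>u\<in>U. \<forall>a\<in>carrier A. u \<lhd>\<^bsub>W\<^esub> a \<in> U)"
proof -
  interpret W: fd_rmodule A W by (rule W)
  show ?thesis
    using W.vs.vectorspace_axioms W.vs.module_axioms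
    unfolding rsubmodule_def VectorSpace.subspace_def submodule_def by auto
qed

text \<open>The projection along the complement \<open>V\<close>. It is a homomorphism because
  components are unique: two decompositions of the same element differ by an element of
  \<open>U \<inter> V\<close>.\<close>

lemma summand_projection:
  fixes W :: "('k::field, 'm, 'a, 'z) rmodule_scheme"
  assumes W: "fd_rmodule A W" and U: "direct_summand A U W"
  obtains pr where "pr \<in> rmod_hom A W W" "\<And>x. x \<in> carrier W \<Longrightarrow> pr x \<in> U" "\<And>u. u \<in> U \<Longrightarrow> pr u = u"
proof -
  interpret W: fd_rmodule A W by (rule W)
  obtain V where V: "rsubmodule A V W" "U \<inter> V = {\<zero>\<^bsub>W\<^esub>}"
    and sum: "\<And>x. x \<in> carrier W \<Longrightarrow> \<exists>u\<in>U. \<exists>v\<in>V. x = u \<oplus>\<^bsub>W\<^esub> v"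
    using U unfolding direct_summand_def by blast
  have U': "rsubmodule A U W" using U by (simp add: direct_summand_def)
  note Us = U'[unfolded rsubmodule_iff[OF W]] and Vs = V(1)[unfolded rsubmodule_iff[OF W]]
  have uniq: "u = u'" if uv: "u \<in> U" "v \<in> V" "u' \<in> U" "v' \<in> V" and eq: "u \<oplus>\<^bsub>W\<^esub> v = u' \<oplus>\<^bsub>W\<^esub> v'" for u v u' v'
  proof -
    have c: "u \<in> carrier W" "v \<in> carrier W" "u' \<in> carrier W" "v' \<in> carrier W" using uv Us Vs by auto
    let ?d = "u \<oplus>\<^bsub>W\<^esub> (- 1) \<odot>\<^bsub>W\<^esub> u'"
    have m: "(- 1) \<odot>\<^bsub>W\<^esub> u' \<in> carrier W" "(- 1) \<odot>\<^bsub>W\<^esub> v \<in> carrier W" using c by (auto intro: W.smult_carrier)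
    have "?d = v' \<oplus>\<^bsub>W\<^esub> (- 1) \<odot>\<^bsub>W\<^esub> v"
    proof (rule lin_forms_separate[OF W.fdvs])
      fix \<phi> assume \<phi>: "lin_form W \<phi>"
      have "\<phi> (u \<oplus>\<^bsub>W\<^esub> v) = \<phi> (u' \<oplus>\<^bsub>W\<^esub> v')" using eq by simp
      then have "\<phi> u - \<phi> u' = \<phi> v' - \<phi> v" using \<phi> c by (simp add: lin_form_def algebra_simps)
      then show "\<phi> ?d = \<phi> (v' \<oplus>\<^bsub>W\<^esub> (- 1) \<odot>\<^bsub>W\<^esub> v)" using \<phi> c m by (simp add: lin_form_def)
    qed (use c m in \<open>auto intro: W.add_carrier\<close>)
    moreover have "?d \<in> U" using uv Us by blast
    moreover have "v' \<oplus>\<^bsub>W\<^esub> (- 1) \<odot>\<^bsub>W\<^esub> v \<in> V" using uv Vs by blast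
    ultimately have "?d \<in> U \<inter> V" by simp
    then have "?d = \<zero>\<^bsub>W\<^esub>" using V(2) by blast
    show ?thesis
    proof (rule lin_forms_separate[OF W.fdvs c(1,3)])
      fix \<phi> assume \<phi>: "lin_form W \<phi>"
      have "\<phi> ?d = 0" using \<open>?d = \<zero>\<^bsub>W\<^esub>\<close> lin_form_zero[OF W.fdvs \<phi>] by simp
      then show "\<phi> u = \<phi> u'" using \<phi> c m by (simp add: lin_form_def)
    qed
  qed
  define pr where "pr = (\<lambda>x\<in>carrier W. THE u. u \<in> U \<and> (\<exists>v\<in>V. x = u \<oplus>\<^bsub>W\<^esub> v))"
  have pr_eq: "pr (u \<oplus>\<^bsub>W\<^esub> v) = u" if uv: "u \<in> U" "v \<in> V" for u v
  proof -
    have "u \<oplus>\<^bsub>W\<^esub> v \<in> carrier W" using uv Us Vs by (auto intro: W.add_carrier)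
    then show ?thesis unfolding pr_def using uv uniq by (auto intro!: the_equality)
  qed
  show thesis
  proof (rule that)
    show "pr x \<in> U" if "x \<in> carrier W" for x using sum[OF that] pr_eq by auto
    show "pr u = u" if u: "u \<in> U" for u
      using pr_eq[of u "\<zero>\<^bsub>W\<^esub>"] u Us Vs by (auto simp: fdvs_r_zero[OF W.fdvs] subset_iff)
    show "pr \<in> rmod_hom A W W"
    proof (rule rmod_homI)
      fix x y c a assume x: "x \<in> carrier W"
      obtain u v where uv: "u \<in> U" "v \<in> V" "x = u \<oplus>\<^bsub>W\<^esub> v" using sum[OF x] by blast
      have cl: "u \<in> carrier W" "v \<in> carrier W" using uv Us Vs by auto
      show "pr x \<in> carrier W" using uv pr_eq cl by simp
      show "pr (c \<odot>\<^bsub>W\<^esub> x) = c \<odot>\<^bsub>W\<^esub> pr x"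
        using pr_eq[of "c \<odot>\<^bsub>W\<^esub> u" "c \<odot>\<^bsub>W\<^esub> v"] uv cl Us Vs pr_eq[OF uv(1,2)]
        by (simp add: fdvs_smult_add[OF W.fdvs])
      show "pr (x \<lhd>\<^bsub>W\<^esub> a) = pr x \<lhd>\<^bsub>W\<^esub> a" if "a \<in> carrier A"
        using pr_eq[of "u \<lhd>\<^bsub>W\<^esub> a" "v \<lhd>\<^bsub>W\<^esub> a"] uv cl Us Vs pr_eq[OF uv(1,2)] that
        by (simp add: W.ract_add_left)
      assume y: "y \<in> carrier W"
      obtain u' v' where uv': "u' \<in> U" "v' \<in> V" "y = u' \<oplus>\<^bsub>W\<^esub> v'" using sum[OF y] by blast
      have cl': "u' \<in> carrier W" "v' \<in> carrier W" using uv' Us Vs by auto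
      have "x \<oplus>\<^bsub>W\<^esub> y = (u \<oplus>\<^bsub>W\<^esub> u') \<oplus>\<^bsub>W\<^esub> (v \<oplus>\<^bsub>W\<^esub> v')"
        using uv uv' cl cl' by (simp add: fdvs_assoc[OF W.fdvs] fdvs_lcomm[OF W.fdvs] W.add_carrier)
      then show "pr (x \<oplus>\<^bsub>W\<^esub> y) = pr x \<oplus>\<^bsub>W\<^esub> pr y"
        using pr_eq[of "u \<oplus>\<^bsub>W\<^esub> u'" "v \<oplus>\<^bsub>W\<^esub> v'"] uv uv' Us Vs pr_eq[OF uv(1,2)] pr_eq[OF uv'(1,2)] by simp
    qed (simp add: pr_def)
  qed
qed

text \<open>\<open>P\<close> is all of its own first power, with complement zero. The objects of
  \<open>add_cat\<close> have sequences as elements, so it is the copy of \<open>P\<close> that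
  belongs to it.\<close>

lemma coord_mod_in_add_cat:
  assumes P: "fd_rmodule A P"
  shows "coord_mod P \<in> add_cat A P"
proof -
  interpret P: fd_rmodule A P by (rule P)
  let ?W = "power_mod P (Suc 0)"
  let ?U = "carrier ?W"
  have W: "fd_rmodule A ?W" by (rule power_mod[OF P])
  interpret W: fd_rmodule A ?W by (rule W)
  note [simp] = uncoord_coord[OF P.fdvs] P.zero_carrier P.add_carrier P.smult_carrier P.ract_closed
  have "rsubmodule A ?U ?W"
    unfolding rsubmodule_iff[OF W]
    using W.zero_carrier W.add_carrier W.smult_carrier W.ract_closed by blast
  moreover have "rsubmodule A {\<zero>\<^bsub>?W\<^esub>} ?W"
    unfolding rsubmodule_iff[OF W]
    using W.zero_carrier by (simp add: W.zero_ract fdvs_r_zero[OF W.fdvs] fdvs_smult_zero[OF W.fdvs] del: power_mod_simps)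
  moreover have "\<exists>u\<in>?U. \<exists>v\<in>{\<zero>\<^bsub>?W\<^esub>}. x = u \<oplus>\<^bsub>?W\<^esub> v" if "x \<in> ?U" for x
    by (rule bexI[OF _ that], rule bexI[of _ "\<zero>\<^bsub>?W\<^esub>"], rule fdvs_r_zero[OF W.fdvs that, symmetric]) simp
  moreover have "?U \<inter> {\<zero>\<^bsub>?W\<^esub>} = {\<zero>\<^bsub>?W\<^esub>}" using W.zero_carrier by blast
  ultimately have "direct_summand A ?U ?W"
    unfolding direct_summand_def by (intro conjI exI[of _ "{\<zero>\<^bsub>?W\<^esub>}"] ballI)
  moreover have "rmod_isomorphic A (coord_mod P) (?W\<lparr>carrier := ?U\<rparr>)"
    unfolding rmod_isomorphic_def
  proof (rule bexI)
    let ?\<theta> = "\<lambda>z\<in>carrier (coord_mod P). \<lambda>i\<in>{..<Suc 0}. uncoord P z"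
    show "?\<theta> \<in> rmod_hom A (coord_mod P) (?W\<lparr>carrier := ?U\<rparr>)"
      by (rule rmod_homI) (auto intro!: restrict_ext dest: inj_onD[OF coord_inj[OF P.fdvs]])
    show "bij_betw ?\<theta> (carrier (coord_mod P)) (carrier (?W\<lparr>carrier := ?U\<rparr>))"
    proof (rule bij_betw_imageI)
      show "inj_on ?\<theta> (carrier (coord_mod P))"
      proof (rule inj_onI)
        fix x y assume x: "x \<in> carrier (coord_mod P)" and y: "y \<in> carrier (coord_mod P)" and eq: "?\<theta> x = ?\<theta> y"
        have "?\<theta> x 0 = ?\<theta> y 0" using eq by simp
        then show "x = y" using x y by auto
      qed
      show "?\<theta> ` carrier (coord_mod P) = carrier (?W\<lparr>carrier := ?U\<rparr>)"
      proof
        show "?\<theta> ` carrier (coord_mod P) \<subseteq> carrier (?W\<lparr>carrier := ?U\<rparr>)"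
          by (auto split: if_splits)
        show "carrier (?W\<lparr>carrier := ?U\<rparr>) \<subseteq> ?\<theta> ` carrier (coord_mod P)"
        proof
          fix w assume "w \<in> carrier (?W\<lparr>carrier := ?U\<rparr>)"
          then have w: "w \<in> {..<Suc 0} \<rightarrow>\<^sub>E carrier P" by simp
          have w0: "w 0 \<in> carrier P" using w by (auto simp: PiE_mem)
          have "w = ?\<theta> (coord P (w 0))"
            by (rule extensionalityI[where A = "{..<Suc 0}"]) (use w w0 in \<open>auto simp: PiE_iff\<close>)
          moreover have "coord P (w 0) \<in> carrier (coord_mod P)" using w0 by simp
          ultimately show "w \<in> ?\<theta> ` carrier (coord_mod P)" by (rule image_eqI)
        qed
      qed
    qed
  qed
  ultimately show ?thesis
    using coord_mod[OF P] unfolding add_cat_def mod_cat_def by blast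
qed

text \<open>A summand of a power of \<open>M\<close> isomorphic to \<open>P\<close> gives a
  surjection \<open>q\<close> from that power to \<open>P\<close>, and \<open>q\<close> of a tuple
  is the sum of its values on single components. So \<open>P\<close> is generated additively by
  images of homomorphisms from \<open>M\<close>. With \<open>P = (1-e)A\<close>,
  \<open>M = DA\<close> and \<open>S\<close> an ideal containing the trace, this puts
  \<open>1-e\<close> into the ideal.\<close>

lemma add_cat_trace:
  assumes P: "fd_rmodule A P" and M: "fd_rmodule A M" and add: "coord_mod P \<in> add_cat A M"
    and zero: "\<zero>\<^bsub>P\<^esub> \<in> S" and plus: "\<And>x y. x \<in> S \<Longrightarrow> y \<in> S \<Longrightarrow> x \<oplus>\<^bsub>P\<^esub> y \<in> S"
    and tr: "\<And>v x. v \<in> rmod_hom A M P \<Longrightarrow> x \<in> carrier M \<Longrightarrow> v x \<in> S"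
    and x: "x \<in> carrier P"
  shows "x \<in> S"
proof -
  interpret P: fd_rmodule A P by (rule P)
  interpret M: fd_rmodule A M by (rule M)
  obtain n U \<theta> where U: "direct_summand A U (power_mod M n)"
    and \<theta>: "\<theta> \<in> rmod_hom A (coord_mod P) ((power_mod M n)\<lparr>carrier := U\<rparr>)" "bij_betw \<theta> (carrier (coord_mod P)) U"
    using add unfolding add_cat_def rmod_isomorphic_def by auto
  let ?W = "power_mod M n"
  have W: "fd_rmodule A ?W" by (rule power_mod[OF M])
  interpret W: fd_rmodule A ?W by (rule W)
  note Us = U[unfolded direct_summand_def, THEN conjunct1, unfolded rsubmodule_iff[OF W]]
  obtain pr where pr: "pr \<in> rmod_hom A ?W ?W" "\<And>x. x \<in> carrier ?W \<Longrightarrow> pr x \<in> U" "\<And>u. u \<in> U \<Longrightarrow> pr u = u"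
    using summand_projection[OF W U] by blast
  define \<rho> where "\<rho> w = uncoord P (the_inv_into (carrier (coord_mod P)) \<theta> w)" for w
  have \<rho>: "\<rho> (\<theta> (coord P y)) = y" if "y \<in> carrier P" for y
    using that \<theta>(2) uncoord_coord[OF P.fdvs that] by (simp add: \<rho>_def bij_betw_def the_inv_into_f_f)
  have surj: "\<exists>y\<in>carrier P. u = \<theta> (coord P y)" if "u \<in> U" for u
    using that \<theta>(2) by (auto simp: bij_betw_def)
  have \<theta>_rules: "\<theta> (coord P y) \<oplus>\<^bsub>?W\<^esub> \<theta> (coord P z) = \<theta> (coord P (y \<oplus>\<^bsub>P\<^esub> z))"
    "c \<odot>\<^bsub>?W\<^esub> \<theta> (coord P y) = \<theta> (coord P (c \<odot>\<^bsub>P\<^esub> y))"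
    "a \<in> carrier A \<Longrightarrow> \<theta> (coord P y) \<lhd>\<^bsub>?W\<^esub> a = \<theta> (coord P (y \<lhd>\<^bsub>P\<^esub> a))"
    if "y \<in> carrier P" "z \<in> carrier P" for y z c a
    using rmod_hom_add[OF \<theta>(1), of "coord P y" "coord P z"] rmod_hom_smult[OF \<theta>(1), of "coord P y" c]
      rmod_hom_ract[OF \<theta>(1), of "coord P y" a] that
    by (simp_all add: uncoord_coord[OF P.fdvs])
  have \<rho>U: "\<rho> u \<in> carrier P" if "u \<in> U" for u using surj[OF that] \<rho> by auto
  have \<rho>_add: "\<rho> (u \<oplus>\<^bsub>?W\<^esub> u') = \<rho> u \<oplus>\<^bsub>P\<^esub> \<rho> u'" if "u \<in> U" "u' \<in> U" for u u'
    using surj[OF that(1)] surj[OF that(2)] by (auto simp: \<theta>_rules \<rho> P.add_carrier simp del: power_mod_simps)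
  have \<rho>_smult: "\<rho> (c \<odot>\<^bsub>?W\<^esub> u) = c \<odot>\<^bsub>P\<^esub> \<rho> u" if "u \<in> U" for u c
    using surj[OF that] by (auto simp: \<theta>_rules \<rho> P.smult_carrier simp del: power_mod_simps)
  have \<rho>_ract: "\<rho> (u \<lhd>\<^bsub>?W\<^esub> a) = \<rho> u \<lhd>\<^bsub>P\<^esub> a" if "u \<in> U" "a \<in> carrier A" for u a
    using surj[OF that(1)] that(2) by (auto simp: \<theta>_rules \<rho> P.ract_closed simp del: power_mod_simps)
  define q where "q w = \<rho> (pr w)" for w
  have q: "q w \<in> carrier P" "q (w \<oplus>\<^bsub>?W\<^esub> w') = q w \<oplus>\<^bsub>P\<^esub> q w'" "q (c \<odot>\<^bsub>?W\<^esub> w) = c \<odot>\<^bsub>P\<^esub> q w"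
    "a \<in> carrier A \<Longrightarrow> q (w \<lhd>\<^bsub>?W\<^esub> a) = q w \<lhd>\<^bsub>P\<^esub> a"
    if "w \<in> carrier ?W" "w' \<in> carrier ?W" for w w' c a
    using that by (simp_all add: q_def \<rho>U pr(2) rmod_hom_add[OF pr(1)] rmod_hom_smult[OF pr(1)]
      rmod_hom_ract[OF pr(1)] \<rho>_add \<rho>_smult \<rho>_ract del: power_mod_simps)
  define sing where "sing j y = (\<lambda>i\<in>{..<n}. if i = j then y else \<zero>\<^bsub>M\<^esub>)" for j and y
  have sing: "sing j y \<in> carrier ?W" if "y \<in> carrier M" for j y
    using that M.zero_carrier by (auto simp: sing_def)
  have qj: "(\<lambda>y\<in>carrier M. q (sing j y)) \<in> rmod_hom A M P" (is "?v \<in> _") for j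
  proof (rule rmod_homI)
    fix y z c a assume y: "y \<in> carrier M"
    show "?v y \<in> carrier P" using q(1)[OF sing[OF y] sing[OF y]] y by simp
    have "sing j (c \<odot>\<^bsub>M\<^esub> y) = c \<odot>\<^bsub>?W\<^esub> sing j y"
      unfolding power_mod_simps sing_def by (rule restrict_ext) (simp add: fdvs_smult_zero[OF M.fdvs])
    then show "?v (c \<odot>\<^bsub>M\<^esub> y) = c \<odot>\<^bsub>P\<^esub> ?v y"
      using q(3)[OF sing[OF y] sing[OF y]] y by (simp add: M.smult_carrier del: power_mod_simps)
    show "?v (y \<oplus>\<^bsub>M\<^esub> z) =
        ?v y \<oplus>\<^bsub>P\<^esub> ?v z" if z: "z \<in> carrier M"
    proof -
      have "sing j (y \<oplus>\<^bsub>M\<^esub> z) = sing j y \<oplus>\<^bsub>?W\<^esub> sing j z"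
        unfolding power_mod_simps sing_def
        by (rule restrict_ext) (simp add: fdvs_r_zero[OF M.fdvs] M.zero_carrier)
      then show ?thesis using q(2)[OF sing[OF y] sing[OF z]] y z by (simp add: M.add_carrier del: power_mod_simps)
    qed
    show "?v (y \<lhd>\<^bsub>M\<^esub> a) = ?v y \<lhd>\<^bsub>P\<^esub> a"
      if a: "a \<in> carrier A"
    proof -
      have "sing j (y \<lhd>\<^bsub>M\<^esub> a) = sing j y \<lhd>\<^bsub>?W\<^esub> a"
        unfolding power_mod_simps sing_def by (rule restrict_ext) (simp add: M.zero_ract a)
      then show ?thesis using q(4)[OF sing[OF y] sing[OF y] a] y a by (simp add: M.ract_closed del: power_mod_simps)
    qed
  qed simp
  \<comment> \<open>Induction on a bound \<open>l\<close> for the support of the tuple; the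
    component at \<open>l\<close> is split off by \<open>sing l\<close>.\<close>
  have "q w \<in> S" if "w \<in> carrier ?W" "\<And>i. i \<ge> l \<Longrightarrow> i < n \<Longrightarrow> w i = \<zero>\<^bsub>M\<^esub>" for w l
    using that
  proof (induction l arbitrary: w)
    case 0
    \<comment> \<open>A tuple with empty support is its own zero multiple, so homogeneity of
      \<open>q\<close> gives \<open>q w = 0\<close>.\<close>
    have w: "w = 0 \<odot>\<^bsub>?W\<^esub> w"
      by (rule extensionalityI[where A = "{..<n}"])
        (use 0 in \<open>auto simp: PiE_iff fdvs_smult_zero[OF M.fdvs]\<close>)
    have "q w = 0 \<odot>\<^bsub>P\<^esub> q w" by (rule trans[OF arg_cong[OF w, of q] q(3)[OF 0(1) 0(1)]])
    also have "\<dots> = \<zero>\<^bsub>P\<^esub>" using q(1)[OF 0(1) 0(1)] by (simp add: fdvs_zero_smult[OF P.fdvs])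
    finally show ?case using zero by simp
  next
    case (Suc l)
    show ?case
    proof (cases "l < n")
      case False
      then show ?thesis using Suc.IH[of w] Suc.prems by simp
    next
      case True
      have W': "w \<in> extensional {..<n}" "\<And>i. i < n \<Longrightarrow> w i \<in> carrier M"
        using Suc.prems(1) by (simp_all add: PiE_iff)
      have wl: "w l \<in> carrier M" by (rule W'(2)[OF True])
      let ?w = "\<lambda>i\<in>{..<n}. if i = l then \<zero>\<^bsub>M\<^esub> else w i"
      have w': "?w \<in> carrier ?W" using W'(2) M.zero_carrier by (simp add: PiE_iff)
      have w: "w = ?w \<oplus>\<^bsub>?W\<^esub> sing l (w l)"
        by (rule extensionalityI[where A = "{..<n}"])
          (use W' in \<open>auto simp: sing_def fdvs_r_zero[OF M.fdvs] fdvs_l_zero[OF M.fdvs]\<close>)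
      have "q w = q ?w \<oplus>\<^bsub>P\<^esub> q (sing l (w l))"
        by (rule trans[OF arg_cong[OF w, of q] q(2)[OF w' sing[OF wl]]])
      moreover have "q ?w \<in> S"
        by (rule Suc.IH[OF w']) (use Suc.prems(2) in \<open>auto simp: not_less_eq_eq\<close>)
      moreover have "q (sing l (w l)) \<in> S" using tr[OF qj[of l] wl] wl by simp
      ultimately show ?thesis using plus by simp
    qed
  qed
  then have "q w \<in> S" if "w \<in> carrier ?W" for w using that by (meson leD)
  moreover have u: "\<theta> (coord P x) \<in> U" using \<theta>(2) x by (auto simp: bij_betw_def)
  moreover have "q (\<theta> (coord P x)) = x" using u x by (simp add: q_def pr(3) \<rho>)
  ultimately show ?thesis using Us by (metis subsetD)
qed

section \<open>The hypotheses of the theorem in the form of condition (T)\<close>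

lemma principal_mod_simps [simp]:
  "carrier (principal_mod A f) = (\<lambda>x. f \<otimes>\<^bsub>A\<^esub> x) ` carrier A" "zero (principal_mod A f) = zero A"
  "add (principal_mod A f) = add A" "smult (principal_mod A f) = smult A"
  "ract (principal_mod A f) = mult A"
  by (simp_all add: principal_mod_def)

lemma (in fd_algebra) principal_mod:
  assumes f: "f \<in> carrier A"
  shows "fd_rmodule A (principal_mod A f)"
proof (rule fd_rmodule_pullback[OF reg_mod fd_algebra_axioms, where j = "\<lambda>x. x" and k = "\<lambda>x. x"])
  show "\<zero>\<^bsub>principal_mod A f\<^esub> \<in> carrier (principal_mod A f)"
    using f by (auto intro!: image_eqI[of _ _ \<zero>])
  show "x \<oplus>\<^bsub>principal_mod A f\<^esub> y \<in> carrier (principal_mod A f) \<and>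
      x \<oplus>\<^bsub>principal_mod A f\<^esub> y = x \<oplus>\<^bsub>reg_mod A\<^esub> y"
    if "x \<in> carrier (principal_mod A f)" "y \<in> carrier (principal_mod A f)" for x y
    using that f by (auto simp flip: r_distr)
  show "c \<odot>\<^bsub>principal_mod A f\<^esub> x \<in> carrier (principal_mod A f) \<and>
      c \<odot>\<^bsub>principal_mod A f\<^esub> x = c \<odot>\<^bsub>reg_mod A\<^esub> x" if "x \<in> carrier (principal_mod A f)" for c x
    using that f by (auto simp flip: smult_mult_right simp: smult_carrier)
  show "x \<lhd>\<^bsub>principal_mod A f\<^esub> b \<in> carrier (principal_mod A f) \<and>
      x \<lhd>\<^bsub>principal_mod A f\<^esub> b = x \<lhd>\<^bsub>reg_mod A\<^esub> b"
    if "x \<in> carrier (principal_mod A f)" "b \<in> carrier A" for x b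
    using that f by (auto simp: m_assoc)
qed (use f in auto)

lemma (in fd_algebra) idem_compl:
  assumes "is_idempotent A e"
  shows "\<one> \<ominus> e \<in> carrier A" "(\<one> \<ominus> e) \<otimes> (\<one> \<ominus> e) = \<one> \<ominus> e" "e \<otimes> (\<one> \<ominus> e) = \<zero>" "(\<one> \<ominus> e) \<otimes> e = \<zero>"
    "e \<oplus> (\<one> \<ominus> e) = \<one>"
proof -
  have e: "e \<in> carrier A" "e \<otimes> e = e" using assms by (auto simp: is_idempotent_def)
  show c: "\<one> \<ominus> e \<in> carrier A" using e by simp
  show 1: "e \<otimes> (\<one> \<ominus> e) = \<zero>" "(\<one> \<ominus> e) \<otimes> e = \<zero>"
    using e by (simp_all add: a_minus_def l_distr r_distr l_minus r_minus vs.r_neg)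
  show s: "e \<oplus> (\<one> \<ominus> e) = \<one>" using e by (simp add: a_minus_def vs.a_lcomm[of e \<one>] vs.r_neg)
  have "(\<one> \<ominus> e) \<otimes> (e \<oplus> (\<one> \<ominus> e)) = (\<one> \<ominus> e) \<otimes> (\<one> \<ominus> e)" using 1 e c by (simp add: r_distr)
  then show "(\<one> \<ominus> e) \<otimes> (\<one> \<ominus> e) = \<one> \<ominus> e" using c by (simp add: s)
qed

text \<open>Elements \<open>b\<close> with \<open>eAb = 0\<close> form an ideal that contains the trace of \<open>DA\<close>, hence \<open>1 - e\<close>.\<close>

lemma hypotheses_trace_idem:
  fixes A :: "('k::field, 'a) module" and e :: 'a
  assumes A: "fd_algebra A" and e: "is_idempotent A e"
    and sub: "add_cat A (principal_mod A (\<one>\<^bsub>A\<^esub> \<ominus>\<^bsub>A\<^esub> e)) \<subseteq> add_cat A (dual_mod A)"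
    and hom: "rmod_hom A (dual_mod A) (principal_mod A e) = {\<lambda>f\<in>carrier (dual_mod A). \<zero>\<^bsub>A\<^esub>}"
  shows "trace_idem A e" "x \<in> carrier A \<Longrightarrow> e \<otimes>\<^bsub>A\<^esub> x \<otimes>\<^bsub>A\<^esub> e = e \<otimes>\<^bsub>A\<^esub> x"
proof -
  interpret A: fd_algebra A by (rule A)
  have ec: "e \<in> carrier A" using e by (simp add: is_idempotent_def)
  let ?f = "\<one>\<^bsub>A\<^esub> \<ominus>\<^bsub>A\<^esub> e"
  note f = A.idem_compl[OF e]
  \<comment> \<open>Followed by left multiplication with \<open>e\<close>, a homomorphism from
    \<open>DA\<close> to \<open>A\<close> lands in \<open>eA\<close> and is therefore zero by
    hypothesis.\<close>
  have zero: "e \<otimes>\<^bsub>A\<^esub> v \<phi> = \<zero>\<^bsub>A\<^esub>"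
    if v: "v \<in> rmod_hom A (dual_mod A) (reg_mod A)" and \<phi>: "\<phi> \<in> carrier (dual_mod A)" for v \<phi>
  proof -
    note v' = rmod_hom_closed[OF v, simplified] rmod_hom_add[OF v, simplified]
      rmod_hom_smult[OF v, simplified] rmod_hom_ract[OF v, simplified]
    have "(\<lambda>f\<in>carrier (dual_mod A). e \<otimes>\<^bsub>A\<^esub> v f) \<in> rmod_hom A (dual_mod A) (principal_mod A e)"
      by (rule rmod_homI)
        (use ec v' in \<open>auto simp: A.dual_closed A.r_distr A.smult_mult_right A.m_assoc\<close>)
    then have "(\<lambda>f\<in>carrier (dual_mod A). e \<otimes>\<^bsub>A\<^esub> v f) = (\<lambda>f\<in>carrier (dual_mod A). \<zero>\<^bsub>A\<^esub>)" using hom by blast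
    from fun_cong[OF this, of \<phi>] show ?thesis using \<phi> by simp
  qed
  \<comment> \<open>Since \<open>(1-e)A\<close> lies in the additive closure of \<open>DA\<close>,
    its generator is a sum of values of homomorphisms from \<open>DA\<close>; those with values in
    \<open>(1-e)A\<close> are also homomorphisms into \<open>A\<close>.\<close>
  have f_in: "?f \<in> I" if I: "ideal I A"
    and tr: "\<And>v \<phi>. v \<in> rmod_hom A (dual_mod A) (reg_mod A) \<Longrightarrow> \<phi> \<in> carrier (dual_mod A) \<Longrightarrow> v \<phi> \<in> I" for I
  proof -
    interpret I: ideal I A by (rule I)
    have P: "fd_rmodule A (principal_mod A ?f)" by (rule A.principal_mod[OF f(1)])
    show ?thesis
    proof (rule add_cat_trace[OF P A.dual_mod])
      show "coord_mod (principal_mod A ?f) \<in> add_cat A (dual_mod A)" using coord_mod_in_add_cat[OF P] sub by blast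
      show "v \<phi> \<in> I" if v: "v \<in> rmod_hom A (dual_mod A) (principal_mod A ?f)" and \<phi>: "\<phi> \<in> carrier (dual_mod A)" for v \<phi>
      proof (rule tr[OF _ \<phi>])
        have "v y \<in> carrier A" if "y \<in> carrier (dual_mod A)" for y
          using rmod_hom_closed[OF v that] f(1) by auto
        then show "v \<in> rmod_hom A (dual_mod A) (reg_mod A)"
          using rmod_hom_ext[OF v] rmod_hom_add[OF v] rmod_hom_smult[OF v] rmod_hom_ract[OF v]
          by (intro rmod_homI) auto
      qed
      show "?f \<in> carrier (principal_mod A ?f)" using f(1,2) by (auto intro!: image_eqI[of _ _ ?f])
    qed auto
  qed
  show "trace_idem A e"
  proof (intro trace_idem.intro trace_idem_axioms.intro A e zero)
    fix I assume I: "ideal I A" and eI: "e \<in> I"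
      and tr: "\<And>v \<phi>. v \<in> rmod_hom A (dual_mod A) (reg_mod A) \<Longrightarrow> \<phi> \<in> carrier (dual_mod A) \<Longrightarrow> v \<phi> \<in> I"
    interpret I: ideal I A by (rule I)
    have "?f \<in> I" by (rule f_in[OF I]) (rule tr)
    then show "\<one>\<^bsub>A\<^esub> \<in> I" using I.a_closed[OF eI] f(5) by metis
  qed
  assume x: "x \<in> carrier A"
  let ?I = "{b \<in> carrier A. \<forall>y\<in>carrier A. e \<otimes>\<^bsub>A\<^esub> (y \<otimes>\<^bsub>A\<^esub> b) = \<zero>\<^bsub>A\<^esub>}"
  have "?f \<in> ?I"
  proof (rule f_in)
    show "ideal ?I A"
    proof (rule A.idealI')
      show "b \<otimes>\<^bsub>A\<^esub> a \<in> ?I" if "a \<in> carrier A" "b \<in> ?I" for a b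
        using that ec by (auto simp: A.m_assoc[symmetric])
      show "a \<otimes>\<^bsub>A\<^esub> b \<in> ?I" if "a \<in> carrier A" "b \<in> ?I" for a b
        using that by (auto simp: A.m_assoc[symmetric])
    qed (use ec in \<open>auto simp: A.r_distr\<close>)
    fix v \<phi> assume v: "v \<in> rmod_hom A (dual_mod A) (reg_mod A)" and \<phi>: "\<phi> \<in> carrier (dual_mod A)"
    note v' = rmod_hom_closed[OF v, simplified] rmod_hom_add[OF v, simplified]
      rmod_hom_smult[OF v, simplified] rmod_hom_ract[OF v, simplified]
    have "e \<otimes>\<^bsub>A\<^esub> (y \<otimes>\<^bsub>A\<^esub> v \<phi>) = \<zero>\<^bsub>A\<^esub>" if y: "y \<in> carrier A" for y
    proof -
      \<comment> \<open>A left multiple of a homomorphism into \<open>A\<close> is again one, so the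
        vanishing of \<open>e v\<close> upgrades to that of \<open>e y v\<close> for all
        \<open>y\<close>.\<close>
      have "(\<lambda>\<phi>\<in>carrier (dual_mod A). y \<otimes>\<^bsub>A\<^esub> v \<phi>) \<in> rmod_hom A (dual_mod A) (reg_mod A)"
        by (rule rmod_homI)
          (use y v' in \<open>auto simp: A.dual_closed A.r_distr A.smult_mult_right A.m_assoc\<close>)
      from zero[OF this \<phi>] show ?thesis using \<phi> by simp
    qed
    then show "v \<phi> \<in> ?I" using v' \<phi> by simp
  qed
  then have "e \<otimes>\<^bsub>A\<^esub> (x \<otimes>\<^bsub>A\<^esub> ?f) = \<zero>\<^bsub>A\<^esub>" using x by simp
  then have "e \<otimes>\<^bsub>A\<^esub> x \<otimes>\<^bsub>A\<^esub> (e \<oplus>\<^bsub>A\<^esub> ?f) = e \<otimes>\<^bsub>A\<^esub> x \<otimes>\<^bsub>A\<^esub> e"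
    using x ec f(1) by (simp add: A.r_distr A.m_assoc)
  then show "e \<otimes>\<^bsub>A\<^esub> x \<otimes>\<^bsub>A\<^esub> e = e \<otimes>\<^bsub>A\<^esub> x" using x ec f(5) by simp
qed

section \<open>Truncations of replicated algebras\<close>

lemma replicated_simps [simp]:
  "carrier (replicated B m) = ({0..m} \<rightarrow>\<^sub>E carrier B) \<times> ({1..m} \<rightarrow>\<^sub>E carrier (dual_mod B))"
  "(d, l) \<otimes>\<^bsub>replicated B m\<^esub> (d', l') = (\<lambda>i\<in>{0..m}. d i \<otimes>\<^bsub>B\<^esub> d' i,
    \<lambda>i\<in>{1..m}. l i \<lhd>\<^bsub>dual_mod B\<^esub> d' (i - 1) \<oplus>\<^bsub>dual_mod B\<^esub> lact (dual_mod B) (d i) (l' i))"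
  "one (replicated B m) = (\<lambda>i\<in>{0..m}. \<one>\<^bsub>B\<^esub>, \<lambda>i\<in>{1..m}. \<zero>\<^bsub>dual_mod B\<^esub>)"
  "zero (replicated B m) = (\<lambda>i\<in>{0..m}. \<zero>\<^bsub>B\<^esub>, \<lambda>i\<in>{1..m}. \<zero>\<^bsub>dual_mod B\<^esub>)"
  "(d, l) \<oplus>\<^bsub>replicated B m\<^esub> (d', l') =
    (\<lambda>i\<in>{0..m}. d i \<oplus>\<^bsub>B\<^esub> d' i, \<lambda>i\<in>{1..m}. l i \<oplus>\<^bsub>dual_mod B\<^esub> l' i)"
  "c \<odot>\<^bsub>replicated B m\<^esub> (d, l) = (\<lambda>i\<in>{0..m}. c \<odot>\<^bsub>B\<^esub> d i, \<lambda>i\<in>{1..m}. c \<odot>\<^bsub>dual_mod B\<^esub> l i)"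
  by (simp_all add: replicated_def)

locale idem_algebra = fd_algebra A for A :: "('k::field, 'a) module" (structure) +
  fixes e :: 'a
  assumes idem: "is_idempotent A e"
begin

abbreviation D where "D \<equiv> dual_mod A"

text \<open>The diagonal of the truncating idempotent. Its entry at 0 is \<open>e\<close> for
  positive \<open>m\<close> but \<open>\<one>\<close> for \<open>m = 0\<close>, a distinction that
  matters wherever the first row is inspected.\<close>

definition eps :: "nat \<Rightarrow> nat \<Rightarrow> 'a" where "eps m i = (if i < m then e else \<one>)"

definition trunc where "trunc m = corner (replicated A m) (diag_idem A e m)"

definition single :: "nat \<Rightarrow> 'a \<Rightarrow> (nat \<Rightarrow> 'a) \<times> (nat \<Rightarrow> 'a \<Rightarrow> 'k)" where
  "single m a = (\<lambda>i\<in>{0..m}. if i = 0 then a else \<zero>, \<lambda>i\<in>{1..m}. \<zero>\<^bsub>D\<^esub>)"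

lemma e: "e \<in> carrier A" "e \<otimes> e = e"
  using idem by (auto simp: is_idempotent_def)

lemma eps: "eps m i \<in> carrier A" "eps m i \<otimes> eps m i = eps m i" "e \<otimes> eps m i = e" "eps m i \<otimes> e = e"
  "eps (Suc m) (Suc i) = eps m i" "eps (Suc m) 0 = e" "1 \<le> i \<Longrightarrow> i \<le> m \<Longrightarrow> eps m (i - 1) = e" "eps m m = \<one>"
  using e by (auto simp: eps_def)

lemmas Dz = dual_zero_rules

lemma trunc_simps [simp]:
  "(d, l) \<otimes>\<^bsub>trunc m\<^esub> (d', l') = (\<lambda>i\<in>{0..m}. d i \<otimes> d' i,
    \<lambda>i\<in>{1..m}. l i \<lhd>\<^bsub>D\<^esub> d' (i - 1) \<oplus>\<^bsub>D\<^esub> lact D (d i) (l' i))"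
  "one (trunc m) = (\<lambda>i\<in>{0..m}. eps m i, \<lambda>i\<in>{1..m}. \<zero>\<^bsub>D\<^esub>)"
  "zero (trunc m) = (\<lambda>i\<in>{0..m}. \<zero>, \<lambda>i\<in>{1..m}. \<zero>\<^bsub>D\<^esub>)"
  "(d, l) \<oplus>\<^bsub>trunc m\<^esub> (d', l') = (\<lambda>i\<in>{0..m}. d i \<oplus> d' i, \<lambda>i\<in>{1..m}. l i \<oplus>\<^bsub>D\<^esub> l' i)"
  "c \<odot>\<^bsub>trunc m\<^esub> (d, l) = (\<lambda>i\<in>{0..m}. c \<odot> d i, \<lambda>i\<in>{1..m}. c \<odot>\<^bsub>D\<^esub> l i)"
  by (simp_all add: trunc_def diag_idem_def eps_def)

text \<open>Membership by fixed-point equations. The entry at \<open>(i, i - 1)\<close> is cut by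
  \<open>eps m i\<close> on the left and by \<open>eps m (i - 1)\<close> on the right; the latter is
  \<open>e\<close> for every \<open>i\<close> from 1 to \<open>m\<close>.\<close>

definition in_trunc where
  "in_trunc m d l \<longleftrightarrow> d \<in> extensional {0..m} \<and> l \<in> extensional {1..m} \<and>
     (\<forall>i\<le>m. d i \<in> carrier A \<and> eps m i \<otimes> d i = d i \<and> d i \<otimes> eps m i = d i) \<and>
     (\<forall>i\<in>{1..m}. l i \<in> carrier D \<and> l i \<lhd>\<^bsub>D\<^esub> e = l i \<and> lact D (eps m i) (l i) = l i)"

lemma lact_ract: "f \<in> carrier D \<Longrightarrow> a \<in> carrier A \<Longrightarrow> b \<in> carrier A \<Longrightarrow>
    lact D a (f \<lhd>\<^bsub>D\<^esub> b) = lact D a f \<lhd>\<^bsub>D\<^esub> b"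
  by (rule lact_rules)

lemma ract_ract: "f \<in> carrier D \<Longrightarrow> a \<in> carrier A \<Longrightarrow> b \<in> carrier A \<Longrightarrow> f \<lhd>\<^bsub>D\<^esub> a \<lhd>\<^bsub>D\<^esub> b = f \<lhd>\<^bsub>D\<^esub> (a \<otimes> b)"
  using fd_rmodule.ract_mult[OF dual_mod] by metis

lemma lact_lact: "f \<in> carrier D \<Longrightarrow> a \<in> carrier A \<Longrightarrow> b \<in> carrier A \<Longrightarrow> lact D a (lact D b f) = lact D (a \<otimes> b) f"
  using lact_rules(5) by metis

lemma idem_twice:
  assumes "x \<in> carrier A" "g \<in> carrier A" "g \<otimes> g = g"
  shows "g \<otimes> (g \<otimes> x \<otimes> g) = g \<otimes> x \<otimes> g" "g \<otimes> x \<otimes> g \<otimes> g = g \<otimes> x \<otimes> g"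
  using assms by (simp_all add: m_assoc) (simp add: m_assoc[symmetric])

lemma trunc_carrier: "(d, l) \<in> carrier (trunc m) \<longleftrightarrow> in_trunc m d l"
proof
  assume "(d, l) \<in> carrier (trunc m)"
  then obtain x where x: "x \<in> carrier (replicated A m)"
    "(d, l) = diag_idem A e m \<otimes>\<^bsub>replicated A m\<^esub> x \<otimes>\<^bsub>replicated A m\<^esub> diag_idem A e m"
    by (auto simp: trunc_def corner_def)
  obtain d' l' where x': "x = (d', l')" by (cases x)
  have d': "d' i \<in> carrier A" if "i \<le> m" for i using x x' that by (auto simp: PiE_iff)
  have l': "l' i \<in> carrier D" if "i \<in> {1..m}" for i using x x' that by (auto simp: PiE_iff)
  \<comment> \<open>The subdiagonal of the idempotent is zero, so multiplying by it on both sides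
    cuts each entry separately, without mixed terms.\<close>
  have eq: "d = (\<lambda>i\<in>{0..m}. eps m i \<otimes> d' i \<otimes> eps m i)" "l = (\<lambda>i\<in>{1..m}. lact D (eps m i) (l' i) \<lhd>\<^bsub>D\<^esub> e)"
    using x(2) d' l' e
    by (auto simp: x' diag_idem_def eps_def Dz dual_closed intro!: restrict_ext)
  have "lact D (eps m i) (lact D (eps m i) (l' i) \<lhd>\<^bsub>D\<^esub> e) = lact D (eps m i) (l' i) \<lhd>\<^bsub>D\<^esub> e"
    "lact D (eps m i) (l' i) \<lhd>\<^bsub>D\<^esub> e \<lhd>\<^bsub>D\<^esub> e = lact D (eps m i) (l' i) \<lhd>\<^bsub>D\<^esub> e" if "i \<in> {1..m}" for i
    using l'[OF that] eps e by (simp_all add: lact_ract lact_lact ract_ract dual_closed)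
  then show "in_trunc m d l"
    using d' l' eps e idem_twice[OF d' eps(1,2)] by (auto simp: in_trunc_def eq dual_closed)
next
  assume t: "in_trunc m d l"
  have "(d, l) \<in> carrier (replicated A m)" using t by (auto simp: in_trunc_def PiE_iff)
  moreover have "(d, l) = diag_idem A e m \<otimes>\<^bsub>replicated A m\<^esub> (d, l) \<otimes>\<^bsub>replicated A m\<^esub> diag_idem A e m"
  proof -
    have "d = (\<lambda>i\<in>{0..m}. eps m i \<otimes> d i \<otimes> eps m i)"
      by (rule extensionalityI[where A = "{0..m}"]) (use t in \<open>auto simp: in_trunc_def\<close>)
    moreover have "l = (\<lambda>i\<in>{1..m}. lact D (eps m i) (l i) \<lhd>\<^bsub>D\<^esub> e)"
      by (rule extensionalityI[where A = "{1..m}"]) (use t in \<open>auto simp: in_trunc_def\<close>)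
    moreover have "diag_idem A e m \<otimes>\<^bsub>replicated A m\<^esub> (d, l) \<otimes>\<^bsub>replicated A m\<^esub> diag_idem A e m =
        (\<lambda>i\<in>{0..m}. eps m i \<otimes> d i \<otimes> eps m i, \<lambda>i\<in>{1..m}. lact D (eps m i) (l i) \<lhd>\<^bsub>D\<^esub> e)"
      using t e
      by (auto simp: in_trunc_def diag_idem_def eps_def Dz dual_closed intro!: restrict_ext)
    ultimately show ?thesis by simp
  qed
  ultimately show "(d, l) \<in> carrier (trunc m)" unfolding trunc_def corner_def by auto
qed

text \<open>The products with \<open>e\<close> displayed in the matrix are exactly the elements
  fixed by the respective multiplications with \<open>e\<close>, because \<open>e\<close> is
  idempotent; \<open>trunc_carrier\<close> supplies the fixed-point form.\<close>

lemma trunc_truncated_matrices: "carrier (trunc m) = truncated_matrices A e m"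
proof -
  have E: "{e \<otimes> x \<otimes> e | x. x \<in> carrier A} = {x \<in> carrier A. e \<otimes> x = x \<and> x \<otimes> e = x}"
    using corner_carrier[OF idem] by (auto simp: corner_def)
  have r: "f \<lhd>\<^bsub>D\<^esub> e \<lhd>\<^bsub>D\<^esub> e = f \<lhd>\<^bsub>D\<^esub> e" "lact D e (lact D e f) = lact D e f" if "f \<in> carrier D" for f
    using that e by (simp_all add: ract_ract lact_lact)
  have F: "{f \<lhd>\<^bsub>D\<^esub> e | f. f \<in> carrier D} = {f \<in> carrier D. f \<lhd>\<^bsub>D\<^esub> e = f}"
    using r e by (auto simp: dual_closed) metis
  have "lact D e (f \<lhd>\<^bsub>D\<^esub> e) \<in> carrier D" "lact D e (f \<lhd>\<^bsub>D\<^esub> e) \<lhd>\<^bsub>D\<^esub> e = lact D e (f \<lhd>\<^bsub>D\<^esub> e)"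
    "lact D e (lact D e (f \<lhd>\<^bsub>D\<^esub> e)) = lact D e (f \<lhd>\<^bsub>D\<^esub> e)" if "f \<in> carrier D" for f
    using that e r by (simp_all add: dual_closed lact_ract)
  then have G: "{lact D e (f \<lhd>\<^bsub>D\<^esub> e) | f. f \<in> carrier D} =
      {f \<in> carrier D. f \<lhd>\<^bsub>D\<^esub> e = f \<and> lact D e f = f}"
    by auto metis
  have "(d, l) \<in> truncated_matrices A e m \<longleftrightarrow> in_trunc m d l" for d l
  proof -
    have "d i \<in> (if i < m then {e \<otimes> x \<otimes> e | x. x \<in> carrier A} else carrier A) \<longleftrightarrow>
        d i \<in> carrier A \<and> eps m i \<otimes> d i = d i \<and> d i \<otimes> eps m i = d i" for i
      unfolding E by (auto simp: eps_def)
    moreover have "l i \<in> (if i < m then {lact D e (f \<lhd>\<^bsub>D\<^esub> e) | f. f \<in> carrier D} else {f \<lhd>\<^bsub>D\<^esub> e | f. f \<in> carrier D}) \<longleftrightarrow>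
        l i \<in> carrier D \<and> l i \<lhd>\<^bsub>D\<^esub> e = l i \<and> lact D (eps m i) (l i) = l i" for i
      unfolding F G by (auto simp: eps_def Dz)
    ultimately show ?thesis
      unfolding truncated_matrices_def in_trunc_def mem_Times_iff fst_conv snd_conv PiE_iff by auto
  qed
  then show ?thesis using trunc_carrier by auto
qed

lemma in_truncD:
  assumes "in_trunc m d l"
  shows "i \<le> m \<Longrightarrow> d i \<in> carrier A" "i \<le> m \<Longrightarrow> eps m i \<otimes> d i = d i" "i \<le> m \<Longrightarrow> d i \<otimes> eps m i = d i"
    "i \<in> {1..m} \<Longrightarrow> l i \<in> carrier D" "i \<in> {1..m} \<Longrightarrow> l i \<lhd>\<^bsub>D\<^esub> e = l i"
    "i \<in> {1..m} \<Longrightarrow> lact D (eps m i) (l i) = l i"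
    "d \<in> extensional {0..m}" "l \<in> extensional {1..m}"
  using assms unfolding in_trunc_def by auto

lemma trunc_closed:
  "\<zero>\<^bsub>trunc m\<^esub> \<in> carrier (trunc m)" "\<one>\<^bsub>trunc m\<^esub> \<in> carrier (trunc m)"
  "x \<in> carrier (trunc m) \<Longrightarrow> c \<odot>\<^bsub>trunc m\<^esub> x \<in> carrier (trunc m)"
  "x \<in> carrier (trunc m) \<Longrightarrow> y \<in> carrier (trunc m) \<Longrightarrow> x \<oplus>\<^bsub>trunc m\<^esub> y \<in> carrier (trunc m)"
  "x \<in> carrier (trunc m) \<Longrightarrow> y \<in> carrier (trunc m) \<Longrightarrow> x \<otimes>\<^bsub>trunc m\<^esub> y \<in> carrier (trunc m)"
proof -
  interpret Dm: fd_rmodule A D by (rule dual_mod)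
  show "\<zero>\<^bsub>trunc m\<^esub> \<in> carrier (trunc m)" "\<one>\<^bsub>trunc m\<^esub> \<in> carrier (trunc m)"
    using eps(1,2) e by (auto simp: trunc_carrier in_trunc_def Dz dual_closed)
  assume x: "x \<in> carrier (trunc m)"
  obtain d l where xd: "x = (d, l)" by (cases x)
  note a = in_truncD[OF x[unfolded xd trunc_carrier]]
  show "c \<odot>\<^bsub>trunc m\<^esub> x \<in> carrier (trunc m)"
    using a eps(1) e by (simp add: xd trunc_carrier in_trunc_def dual_closed smult_carrier smult_mult_left
        smult_mult_right Dm.ract_smult_left lact_rules)
  assume y: "y \<in> carrier (trunc m)"
  obtain d' l' where yd: "y = (d', l')" by (cases y)
  note b = in_truncD[OF y[unfolded yd trunc_carrier]]
  show "x \<oplus>\<^bsub>trunc m\<^esub> y \<in> carrier (trunc m)"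
    using a b eps(1) e by (simp add: xd yd trunc_carrier in_trunc_def dual_closed l_distr r_distr
        Dm.ract_add_left lact_rules)
  have d: "eps m i \<otimes> (d i \<otimes> d' i) = d i \<otimes> d' i" "d i \<otimes> d' i \<otimes> eps m i = d i \<otimes> d' i" if "i \<le> m" for i
    using a(1-3)[OF that] b(1-3)[OF that] eps(1)[of m i] by (simp_all add: m_assoc) (simp add: m_assoc[symmetric])
  have l: "l i \<lhd>\<^bsub>D\<^esub> d' (i - 1) \<oplus>\<^bsub>D\<^esub> lact D (d i) (l' i) \<in> carrier D"
    "(l i \<lhd>\<^bsub>D\<^esub> d' (i - 1) \<oplus>\<^bsub>D\<^esub> lact D (d i) (l' i)) \<lhd>\<^bsub>D\<^esub> e = l i \<lhd>\<^bsub>D\<^esub> d' (i - 1) \<oplus>\<^bsub>D\<^esub> lact D (d i) (l' i)"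
    "lact D (eps m i) (l i \<lhd>\<^bsub>D\<^esub> d' (i - 1) \<oplus>\<^bsub>D\<^esub> lact D (d i) (l' i)) = l i \<lhd>\<^bsub>D\<^esub> d' (i - 1) \<oplus>\<^bsub>D\<^esub> lact D (d i) (l' i)"
    if i: "i \<in> {1..m}" for i
  proof -
    have i': "i \<le> m" "i - 1 \<le> m" using i by auto
    have d'e: "d' (i - 1) \<otimes> e = d' (i - 1)" using b(3)[OF i'(2)] eps(7)[of i m] i by simp
    show "l i \<lhd>\<^bsub>D\<^esub> d' (i - 1) \<oplus>\<^bsub>D\<^esub> lact D (d i) (l' i) \<in> carrier D"
      using a(1)[OF i'(1)] a(4)[OF i] b(1)[OF i'(2)] b(4)[OF i] by (simp add: dual_closed)
    show "(l i \<lhd>\<^bsub>D\<^esub> d' (i - 1) \<oplus>\<^bsub>D\<^esub> lact D (d i) (l' i)) \<lhd>\<^bsub>D\<^esub> e = l i \<lhd>\<^bsub>D\<^esub> d' (i - 1) \<oplus>\<^bsub>D\<^esub> lact D (d i) (l' i)"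
      using a(1)[OF i'(1)] a(4)[OF i] b(1)[OF i'(2)] b(4,5)[OF i] e d'e
      by (simp add: dual_closed Dm.ract_add_left ract_ract lact_ract[symmetric])
    show "lact D (eps m i) (l i \<lhd>\<^bsub>D\<^esub> d' (i - 1) \<oplus>\<^bsub>D\<^esub> lact D (d i) (l' i)) = l i \<lhd>\<^bsub>D\<^esub> d' (i - 1) \<oplus>\<^bsub>D\<^esub> lact D (d i) (l' i)"
      using a(1,2)[OF i'(1)] a(4,6)[OF i] b(1)[OF i'(2)] b(4,5)[OF i] eps(1)[of m i]
      by (simp add: dual_closed lact_rules(1) lact_ract lact_lact)
  qed
  show "x \<otimes>\<^bsub>trunc m\<^esub> y \<in> carrier (trunc m)"
    using a(1) b(1) d l unfolding xd yd trunc_simps trunc_carrier in_trunc_def by simp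
qed

lemma single_carrier: "single m a \<in> carrier (trunc m) \<longleftrightarrow> a \<in> carrier A \<and> eps m 0 \<otimes> a = a \<and> a \<otimes> eps m 0 = a"
  using eps(1) e by (auto simp: single_def trunc_carrier in_trunc_def Dz dual_closed)

text \<open>Multiplying on the left by an entry at (0,0) reads only the first row, and that row has
  no other nonzero entry.\<close>

lemma single_mult:
  assumes "a \<in> carrier A" "(d, l) \<in> carrier (trunc m)"
  shows "single m a \<otimes>\<^bsub>trunc m\<^esub> (d, l) = single m (a \<otimes> d 0)"
proof -
  note b = in_truncD[OF assms(2)[unfolded trunc_carrier]]
  have "i - 1 \<le> m" if "i \<in> {1..m}" for i using that by auto
  then show ?thesis using assms(1) b by (auto simp: single_def Dz dual_closed intro!: restrict_ext)
qed

lemma single_add: "a \<in> carrier A \<Longrightarrow> b \<in> carrier A \<Longrightarrow> single m (a \<oplus> b) = single m a \<oplus>\<^bsub>trunc m\<^esub> single m b"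
  by (auto simp: single_def Dz dual_closed intro!: restrict_ext)

lemma single_smult: "a \<in> carrier A \<Longrightarrow> single m (c \<odot> a) = c \<odot>\<^bsub>trunc m\<^esub> single m a"
  by (auto simp: single_def Dz fdvs_smult_zero[OF fdvs] intro!: restrict_ext)

lemma single_inj: "single m a = single m b \<Longrightarrow> a = b"
  by (auto simp: single_def dest!: fun_cong[of _ _ 0])

lemma trunc_0: "(d, l) \<in> carrier (trunc 0) \<Longrightarrow> (d, l) = single 0 (d 0)"
  by (auto simp: trunc_carrier in_trunc_def single_def intro!: extensionalityI[where A = "{0..0}"])

text \<open>For \<open>m = 0\<close> the idempotent has the single entry \<open>\<one>\<close> and
  there is no subdiagonal; so the induction starts with \<open>A\<close> itself and the idempotent
  \<open>e\<close>.\<close>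

lemma trunc_0_iso: "fd_algebra (trunc 0)" "alg_iso A (trunc 0) (single 0)"
proof -
  have s: "single 0 a \<in> carrier (trunc 0)" if "a \<in> carrier A" for a
    using that by (simp add: single_carrier eps(8))
  have ex: "\<exists>a\<in>carrier A. x = single 0 a" if "x \<in> carrier (trunc 0)" for x
  proof -
    obtain d l where x: "x = (d, l)" by (cases x)
    have "d 0 \<in> carrier A" using in_truncD(1)[of 0 d l 0] that x trunc_carrier by simp
    then show ?thesis using trunc_0[of d l] that x by metis
  qed
  have mult: "single 0 (a \<otimes> b) = single 0 a \<otimes>\<^bsub>trunc 0\<^esub> single 0 b" if "a \<in> carrier A" "b \<in> carrier A" for a b
    using single_mult[OF that(1) s[OF that(2), unfolded single_def]] by (simp add: single_def)
  show T: "fd_algebra (trunc 0)"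
  proof (rule fd_algebra_pullback[OF fd_algebra_axioms, where j = "\<lambda>x. fst x 0"])
    show "inj_on (\<lambda>x. fst x 0) (carrier (trunc 0))"
      using trunc_0 by (intro inj_onI) (metis prod.collapse)
    fix x y c assume x: "x \<in> carrier (trunc 0)"
    obtain d l where xd: "x = (d, l)" by (cases x)
    note a = in_truncD[OF x[unfolded xd trunc_carrier]]
    show "fst x 0 \<in> carrier A" using a by (simp add: xd)
    show "fst \<one>\<^bsub>trunc 0\<^esub> 0 \<otimes> fst x 0 = fst x 0 \<and> fst x 0 \<otimes> fst \<one>\<^bsub>trunc 0\<^esub> 0 = fst x 0"
      using a by (simp add: xd eps(8))
    show "c \<odot>\<^bsub>trunc 0\<^esub> x \<in> carrier (trunc 0) \<and> fst (c \<odot>\<^bsub>trunc 0\<^esub> x) 0 = c \<odot> fst x 0"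
      using trunc_closed(3)[OF x] by (simp add: xd)
    assume y: "y \<in> carrier (trunc 0)"
    obtain d' l' where yd: "y = (d', l')" by (cases y)
    show "x \<oplus>\<^bsub>trunc 0\<^esub> y \<in> carrier (trunc 0) \<and> fst (x \<oplus>\<^bsub>trunc 0\<^esub> y) 0 = fst x 0 \<oplus> fst y 0"
      using trunc_closed(4)[OF x y] by (simp add: xd yd)
    show "x \<otimes>\<^bsub>trunc 0\<^esub> y \<in> carrier (trunc 0) \<and> fst (x \<otimes>\<^bsub>trunc 0\<^esub> y) 0 = fst x 0 \<otimes> fst y 0"
      using trunc_closed(5)[OF x y] by (simp add: xd yd)
  qed (use trunc_closed(1,2)[of 0] in simp_all)
  show "alg_iso A (trunc 0) (single 0)"
  proof (intro alg_iso.intro alg_iso_axioms.intro fd_algebra_axioms T)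
    show "bij_betw (single 0) (carrier A) (carrier (trunc 0))"
    proof (rule bij_betw_imageI)
      show "inj_on (single 0) (carrier A)" by (rule inj_onI) (rule single_inj)
      show "single 0 ` carrier A = carrier (trunc 0)" using s ex by blast
    qed
  qed (simp_all add: single_add single_smult mult)
qed

text \<open>
  The first row of the larger matrix has the only entry \<open>d 0\<close>, the entry \<open>l 1\<close> below it becomes a
  linear form that depends on the \<open>(0, 0)\<close> entry only, and the other rows and columns form a matrix
  of the smaller algebra.
\<close>

definition step_map where
  "step_map m = (\<lambda>(d, l). (single m (d 0), \<lambda>y\<in>carrier (trunc m). l 1 (fst y 0),
     (\<lambda>i\<in>{0..m}. d (Suc i), \<lambda>i\<in>{1..m}. l (Suc i))))"

lemma dual_eps_app:
  assumes "f \<in> carrier D" "f \<lhd>\<^bsub>D\<^esub> e = f" "lact D (eps m 0) f = f" "x \<in> carrier A"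
  shows "f (e \<otimes> x) = f x" "f (x \<otimes> eps m 0) = f x" "f (eps m 0 \<otimes> x) = f x"
    "f (eps m 0 \<otimes> x \<otimes> eps m 0) = f x"
proof -
  have 1: "f (e \<otimes> x) = f x" if "x \<in> carrier A" for x using assms(2) that dual_app(4) by metis
  have 2: "f (x \<otimes> eps m 0) = f x" if "x \<in> carrier A" for x using assms(3) that dual_app(5) by metis
  show "f (e \<otimes> x) = f x" "f (x \<otimes> eps m 0) = f x" using 1 2 assms(4) by blast+
  show 3: "f (eps m 0 \<otimes> x) = f x" using 1 assms(4) by (simp add: eps_def)
  show "f (eps m 0 \<otimes> x \<otimes> eps m 0) = f x" using 2[of "eps m 0 \<otimes> x"] 3 assms(4) eps(1) by simp
qed

text \<open>For \<open>g = single m e\<close>, the condition \<open>Yg = Y\<close> says that a form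
  \<open>Y\<close> on \<open>trunc m\<close> depends on \<open>gy\<close> only, and
  \<open>gy = single m (e (fst y 0))\<close>. So \<open>Y\<close> amounts to a form on
  \<open>A\<close> cut by \<open>e\<close> on the right and by \<open>eps m 0\<close> on the left,
  which is the new entry \<open>l 1\<close>. The last claim keeps track of the idempotent for
  (T).\<close>

lemma step_iso:
  assumes tr: "trace_idem (trunc m) (single m e)"
  shows "fd_algebra (trunc (Suc m))" "alg_iso (trunc (Suc m)) (trace_idem.tri (trunc m) (single m e)) (step_map m)"
    "step_map m (single (Suc m) e) = (single m e, \<zero>\<^bsub>dual_mod (trunc m)\<^esub>, \<zero>\<^bsub>trunc m\<^esub>)"
proof -
  interpret T: trace_idem "trunc m" "single m e" by (rule tr)
  interpret Tri: fd_algebra T.tri by (rule T.tri_algebra)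
  define X where "X l = (\<lambda>y\<in>carrier (trunc m). l 1 (fst y 0))" for l :: "nat \<Rightarrow> 'a \<Rightarrow> 'k"
  define S where "S d l = (\<lambda>i\<in>{0..m}. d (Suc i), \<lambda>i\<in>{1..m}. l (Suc i))" for d :: "nat \<Rightarrow> 'a" and l :: "nat \<Rightarrow> 'a \<Rightarrow> 'k"
  have sm: "step_map m (d, l) = (single m (d 0), X l, S d l)" for d l by (simp add: step_map_def X_def S_def)
  have y0: "fst y 0 \<in> carrier A" "eps m 0 \<otimes> fst y 0 = fst y 0" "fst y 0 \<otimes> eps m 0 = fst y 0"
    if "y \<in> carrier (trunc m)" for y
    using that in_truncD(1-3)[of m "fst y" "snd y" 0] by (cases y; simp add: trunc_carrier)+
  have y0': "a 0 \<in> carrier A" if "(a, b) \<in> carrier (trunc m)" for a b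
    using y0(1)[OF that] by simp
  have y0_ops: "fst (y \<oplus>\<^bsub>trunc m\<^esub> z) 0 = fst y 0 \<oplus> fst z 0" "fst (y \<otimes>\<^bsub>trunc m\<^esub> z) 0 = fst y 0 \<otimes> fst z 0"
    "fst (c \<odot>\<^bsub>trunc m\<^esub> y) 0 = c \<odot> fst y 0" for y z c
    by (cases y; cases z; simp)+
  have l1: "l 1 \<in> carrier D" "l 1 \<lhd>\<^bsub>D\<^esub> e = l 1" "lact D (eps m 0) (l 1) = l 1" if "in_trunc (Suc m) d l" for d l
    using in_truncD(4-6)[OF that, of 1] eps(5)[of m 0] by auto
  have d0: "d 0 \<in> carrier A" "e \<otimes> d 0 = d 0" "d 0 \<otimes> e = d 0" "eps m 0 \<otimes> d 0 = d 0" "d 0 \<otimes> eps m 0 = d 0"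
    if "in_trunc (Suc m) d l" for d l
    using in_truncD(1-3)[OF that, of 0] eps(6)[of m] by (auto simp: eps_def)
  have Xc: "X l \<in> carrier (dual_mod (trunc m))" if "in_trunc (Suc m) d l" for d l
    unfolding X_def
    by (rule T.dualI) (use l1[OF that] y0 in \<open>simp_all add: y0_ops dual_add dual_smult\<close>)
  have Xe: "X l \<lhd>\<^bsub>dual_mod (trunc m)\<^esub> single m e = X l" if t: "in_trunc (Suc m) d l" for d l
  proof (rule T.dual_eqI)
    fix y assume y: "y \<in> carrier (trunc m)"
    have "single m e \<otimes>\<^bsub>trunc m\<^esub> y \<in> carrier (trunc m)" using y T.e by simp
    moreover have "fst (single m e) 0 = e" by (simp add: single_def)
    ultimately show "(X l \<lhd>\<^bsub>dual_mod (trunc m)\<^esub> single m e) y = X l y"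
      using y dual_eps_app(1)[OF l1[OF t]] y0 by (simp add: T.dual_app X_def y0_ops)
  qed (use Xc[OF t] T.e T.dual_closed in auto)
  have Sc: "S d l \<in> carrier (trunc m)" if t: "in_trunc (Suc m) d l" for d l
    unfolding S_def trunc_carrier in_trunc_def
    using in_truncD(1-6)[OF t, of "Suc _"] eps(5) by auto
  have single_app: "fst (single m a) 0 = a" for a by (simp add: single_def)
  have se: "single m e \<otimes>\<^bsub>trunc m\<^esub> single m a = single m (e \<otimes> a)"
    "single m a \<otimes>\<^bsub>trunc m\<^esub> single m b = single m (a \<otimes> b)"
    if "single m a \<in> carrier (trunc m)" "a \<in> carrier A" "single m b \<in> carrier (trunc m)" for a b
    using single_mult[OF e(1), of "fst (single m a)" "snd (single m a)" m]
      single_mult[of a "fst (single m b)" "snd (single m b)" m] that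
    by (simp_all add: single_app)
  have ec: "single m e \<in> carrier (trunc m)" by (rule T.e)
  have closed: "step_map m x \<in> carrier T.tri" if x: "x \<in> carrier (trunc (Suc m))" for x
  proof -
    obtain d l where xd: "x = (d, l)" by (cases x)
    note t = x[unfolded xd trunc_carrier]
    have s0: "single m (d 0) \<in> carrier (trunc m)" using d0[OF t] by (simp add: single_carrier)
    then show ?thesis
      using d0[OF t] Xc[OF t] Xe[OF t] Sc[OF t] se[OF s0 _ ec] by (simp add: xd sm T.tri_carrier)
  qed
  have single_0: "single m \<zero> = \<zero>\<^bsub>trunc m\<^esub>" by (auto simp: single_def intro!: restrict_ext)
  have X_0: "X l = \<zero>\<^bsub>dual_mod (trunc m)\<^esub>" if "l 1 = \<zero>\<^bsub>D\<^esub>" for l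
    unfolding X_def dual_mod_simps(1)[of "trunc m"] by (rule restrict_ext) (use that in \<open>simp add: dual_app y0\<close>)
  have S_0: "S (\<lambda>i\<in>{0..Suc m}. if i = 0 then a else \<zero>) (\<lambda>i\<in>{1..Suc m}. \<zero>\<^bsub>D\<^esub>) = \<zero>\<^bsub>trunc m\<^esub>" for a
    by (auto simp: S_def intro!: restrict_ext)
  have S_1: "S (\<lambda>i\<in>{0..Suc m}. eps (Suc m) i) (\<lambda>i\<in>{1..Suc m}. \<zero>\<^bsub>D\<^esub>) = \<one>\<^bsub>trunc m\<^esub>"
    by (auto simp: S_def eps(5) intro!: restrict_ext)
  have zero: "step_map m \<zero>\<^bsub>trunc (Suc m)\<^esub> = \<zero>\<^bsub>T.tri\<^esub>"
    using S_0[of \<zero>] by (simp add: sm single_0 X_0 del: trunc_simps(3)) (simp add: sm single_0 X_0)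
  have one: "step_map m \<one>\<^bsub>trunc (Suc m)\<^esub> = \<one>\<^bsub>T.tri\<^esub>"
    unfolding trunc_simps(2)[of "Suc m"] sm S_1 T.tri_simps by (simp add: X_0 eps(6))
  have smult: "step_map m (c \<odot>\<^bsub>trunc (Suc m)\<^esub> x) = c \<odot>\<^bsub>T.tri\<^esub> step_map m x"
    if x: "x \<in> carrier (trunc (Suc m))" for c x
  proof -
    obtain d l where xd: "x = (d, l)" by (cases x)
    note t = x[unfolded xd trunc_carrier]
    show ?thesis
      using d0[OF t] l1[OF t]
      by (auto simp: xd sm single_smult X_def S_def dual_mod_simps(3)[of "trunc m"] dual_app y0' intro!: restrict_ext)
  qed
  have add: "step_map m (x \<oplus>\<^bsub>trunc (Suc m)\<^esub> x') = step_map m x \<oplus>\<^bsub>T.tri\<^esub> step_map m x'"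
    if x: "x \<in> carrier (trunc (Suc m))" and x': "x' \<in> carrier (trunc (Suc m))" for x x'
  proof -
    obtain d l where xd: "x = (d, l)" by (cases x)
    obtain d' l' where xd': "x' = (d', l')" by (cases x')
    note t = x[unfolded xd trunc_carrier] and t' = x'[unfolded xd' trunc_carrier]
    show ?thesis
      using d0[OF t] d0[OF t']
      by (auto simp: xd xd' sm single_add X_def S_def dual_mod_simps(2)[of "trunc m"] dual_app y0' intro!: restrict_ext)
  qed
  have mult: "step_map m (x \<otimes>\<^bsub>trunc (Suc m)\<^esub> x') = step_map m x \<otimes>\<^bsub>T.tri\<^esub> step_map m x'"
    if x: "x \<in> carrier (trunc (Suc m))" and x': "x' \<in> carrier (trunc (Suc m))" for x x'
  proof -
    obtain d l where xd: "x = (d, l)" by (cases x)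
    obtain d' l' where xd': "x' = (d', l')" by (cases x')
    note t = x[unfolded xd trunc_carrier] and t' = x'[unfolded xd' trunc_carrier]
    let ?P = "(\<lambda>i\<in>{0..Suc m}. d i \<otimes> d' i,
      \<lambda>i\<in>{1..Suc m}. l i \<lhd>\<^bsub>D\<^esub> d' (i - 1) \<oplus>\<^bsub>D\<^esub> lact D (d i) (l' i))"
    have P: "x \<otimes>\<^bsub>trunc (Suc m)\<^esub> x' = ?P" by (simp add: xd xd')
    have tP: "in_trunc (Suc m) (fst ?P) (snd ?P)"
      using trunc_closed(5)[OF x x'] unfolding P trunc_carrier by simp
    have s0: "single m (d 0) \<in> carrier (trunc m)" "single m (d' 0) \<in> carrier (trunc m)"
      using d0[OF t] d0[OF t'] by (simp_all add: single_carrier)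
    have d1: "d 1 \<in> carrier A" using in_truncD(1)[OF t, of 1] by simp
    have "X (snd ?P) = X l \<lhd>\<^bsub>dual_mod (trunc m)\<^esub> single m (d' 0) \<oplus>\<^bsub>dual_mod (trunc m)\<^esub>
        lact (dual_mod (trunc m)) (S d l) (X l')"
    proof (rule T.dual_eqI)
      fix y assume y: "y \<in> carrier (trunc m)"
      have c: "single m (d' 0) \<otimes>\<^bsub>trunc m\<^esub> y \<in> carrier (trunc m)" "y \<otimes>\<^bsub>trunc m\<^esub> S d l \<in> carrier (trunc m)"
        using y s0 Sc[OF t] by simp_all
      \<comment> \<open>The new (1,0) entry of a product is \<open>l 1\<close> times
        \<open>d' 0\<close> plus \<open>d 1\<close> times \<open>l' 1\<close>. As \<open>S\<close>
        shifts indices by one, \<open>d 1\<close> is the (0,0) entry of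
        \<open>S d l\<close>.\<close>
      have "X (snd ?P) y = l 1 (d' 0 \<otimes> fst y 0) + l' 1 (fst y 0 \<otimes> d 1)"
        using y y0[OF y] by (simp add: X_def dual_app)
      also have "\<dots> = (X l \<lhd>\<^bsub>dual_mod (trunc m)\<^esub> single m (d' 0) \<oplus>\<^bsub>dual_mod (trunc m)\<^esub>
          lact (dual_mod (trunc m)) (S d l) (X l')) y"
        using y c by (simp add: T.dual_app X_def y0_ops single_app) (simp add: S_def)
      finally show "X (snd ?P) y = (X l \<lhd>\<^bsub>dual_mod (trunc m)\<^esub> single m (d' 0) \<oplus>\<^bsub>dual_mod (trunc m)\<^esub>
          lact (dual_mod (trunc m)) (S d l) (X l')) y" .
    qed (use Xc[OF tP] Xc[OF t] Xc[OF t'] s0 Sc[OF t] T.dual_closed in auto)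
    moreover have "S (fst ?P) (snd ?P) = S d l \<otimes>\<^bsub>trunc m\<^esub> S d' l'"
      by (auto simp: S_def intro!: restrict_ext)
    moreover have "single m (fst ?P 0) = single m (d 0) \<otimes>\<^bsub>trunc m\<^esub> single m (d' 0)"
      using se(2)[OF s0(1) _ s0(2)] d0[OF t] by simp
    moreover have "step_map m ?P = (single m (fst ?P 0), X (snd ?P), S (fst ?P) (snd ?P))" by (simp add: sm)
    ultimately show ?thesis unfolding P by (simp add: xd xd' sm)
  qed
  have inj: "inj_on (step_map m) (carrier (trunc (Suc m)))"
  proof (rule inj_onI)
    fix x x' assume x: "x \<in> carrier (trunc (Suc m))" and x': "x' \<in> carrier (trunc (Suc m))"
      and eq: "step_map m x = step_map m x'"
    obtain d l where xd: "x = (d, l)" by (cases x)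
    obtain d' l' where xd': "x' = (d', l')" by (cases x')
    note t = x[unfolded xd trunc_carrier] and t' = x'[unfolded xd' trunc_carrier]
    have E: "d 0 = d' 0" "X l = X l'" "S d l = S d' l'" using eq single_inj by (auto simp: xd xd' sm)
    have dS: "d (Suc i) = d' (Suc i)" if "i \<le> m" for i
      using fun_cong[OF arg_cong[OF E(3), of fst], of i] that by (simp add: S_def)
    have lS: "l (Suc i) = l' (Suc i)" if "i \<in> {1..m}" for i
      using fun_cong[OF arg_cong[OF E(3), of snd], of i] that by (simp add: S_def)
    have "l 1 = l' 1"
    proof (rule dual_eqI)
      fix a assume a: "a \<in> carrier A"
      \<comment> \<open>\<open>X l\<close> tests \<open>l 1\<close> only on (0,0) entries of
        \<open>trunc m\<close>. Compressing \<open>a\<close> turns it into such an entry and does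
        not change the value of \<open>l 1\<close>.\<close>
      let ?a = "eps m 0 \<otimes> a \<otimes> eps m 0"
      have "single m ?a \<in> carrier (trunc m)"
        using a idem_twice[OF a eps(1,2)] eps(1) by (simp add: single_carrier)
      then have "l 1 ?a = l' 1 ?a" using fun_cong[OF E(2), of "single m ?a"] by (simp add: X_def single_app)
      then show "l 1 a = l' 1 a" using dual_eps_app(4)[OF l1[OF t] a] dual_eps_app(4)[OF l1[OF t'] a] by simp
    qed (use l1[OF t] l1[OF t'] in auto)
    have "d = d'"
    proof (rule extensionalityI[where A = "{0..Suc m}"])
      show "d i = d' i" if "i \<in> {0..Suc m}" for i using that E(1) dS by (cases i) auto
    qed (use in_truncD(7)[OF t] in_truncD(7)[OF t'] in auto)
    moreover have "l = l'"
    proof (rule extensionalityI[where A = "{1..Suc m}"])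
      show "l i = l' i" if i: "i \<in> {1..Suc m}" for i
      proof (cases "i = 1")
        case False
        then obtain j where "i = Suc j" "j \<in> {1..m}" using i by (cases i) auto
        then show ?thesis using lS by simp
      qed (use \<open>l 1 = l' 1\<close> in simp)
    qed (use in_truncD(8)[OF t] in_truncD(8)[OF t'] in auto)
    ultimately show "x = x'" by (simp add: xd xd')
  qed
  have surj: "\<exists>x\<in>carrier (trunc (Suc m)). w = step_map m x" if w: "w \<in> carrier T.tri" for w
  proof -
    obtain r Y s where w': "w = (r, Y, s)" by (cases w)
    obtain rd rl where r: "r = (rd, rl)" by (cases r)
    obtain sd sl where s: "s = (sd, sl)" by (cases s)
    note a = w[unfolded w' T.tri_carrier]
    have rc: "(rd, rl) \<in> carrier (trunc m)" using a r by simp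
    have rd0: "rd 0 \<in> carrier A" using in_truncD(1)[OF rc[unfolded trunc_carrier], of 0] by simp
    have "single m (e \<otimes> rd 0) = (rd, rl)" using a single_mult[OF e(1) rc] r by simp
    note re0 = this
    have er: "e \<otimes> rd 0 = rd 0" using arg_cong[OF re0, of "\<lambda>x. fst x 0"] by (simp add: single_app)
    then have re: "(rd, rl) = single m (rd 0)" "e \<otimes> rd 0 = rd 0" using re0 by simp_all
    have "single m (rd 0) \<otimes>\<^bsub>trunc m\<^esub> single m e = single m (rd 0 \<otimes> e)"
      using se(2)[OF _ rd0 ec] rc re by simp
    then have re': "rd 0 \<otimes> e = rd 0" using a r re(1) single_inj by metis
    note sc = a[unfolded s, THEN conjunct2, THEN conjunct2, THEN conjunct2, THEN conjunct2, THEN conjunct2, unfolded trunc_carrier]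
    \<comment> \<open>The inverse of \<open>X\<close>. The factor \<open>e\<close> enforces that
      \<open>L\<close> is fixed by \<open>e\<close> on the right, which compression by
      \<open>eps m 0\<close> alone would not do when \<open>m = 0\<close>.\<close>
    define L where "L = (\<lambda>x\<in>carrier A. Y (single m (eps m 0 \<otimes> (e \<otimes> x) \<otimes> eps m 0)))"
    have sing: "single m (eps m 0 \<otimes> x \<otimes> eps m 0) \<in> carrier (trunc m)" if "x \<in> carrier A" for x
      using that idem_twice[OF that eps(1,2)] eps(1) by (simp add: single_carrier)
    have Yc: "Y \<in> carrier (dual_mod (trunc m))" "Y \<lhd>\<^bsub>dual_mod (trunc m)\<^esub> single m e = Y" using a by auto
    have L: "L \<in> carrier D"
      unfolding L_def
    proof (rule dualI)
      fix x y c assume x: "x \<in> carrier A"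
      have ex: "e \<otimes> x \<in> carrier A" using x e by simp
      have cx: "eps m 0 \<otimes> (e \<otimes> x) \<otimes> eps m 0 \<in> carrier A" using ex eps(1) by simp
      have "eps m 0 \<otimes> (e \<otimes> (c \<odot> x)) \<otimes> eps m 0 = c \<odot> (eps m 0 \<otimes> (e \<otimes> x) \<otimes> eps m 0)"
        using x e eps(1) by (simp add: smult_mult_left smult_mult_right)
      then show "Y (single m (eps m 0 \<otimes> (e \<otimes> (c \<odot> x)) \<otimes> eps m 0)) = c * Y (single m (eps m 0 \<otimes> (e \<otimes> x) \<otimes> eps m 0))"
        using T.dual_smult[OF Yc(1) sing[OF ex], of c] single_smult[OF cx] by simp
      assume y: "y \<in> carrier A"
      have ey: "e \<otimes> y \<in> carrier A" using y e by simp
      have cy: "eps m 0 \<otimes> (e \<otimes> y) \<otimes> eps m 0 \<in> carrier A" using ey eps(1) by simp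
      have "eps m 0 \<otimes> (e \<otimes> (x \<oplus> y)) \<otimes> eps m 0 = eps m 0 \<otimes> (e \<otimes> x) \<otimes> eps m 0 \<oplus> eps m 0 \<otimes> (e \<otimes> y) \<otimes> eps m 0"
        using x y e eps(1) by (simp add: l_distr r_distr)
      then show "Y (single m (eps m 0 \<otimes> (e \<otimes> (x \<oplus> y)) \<otimes> eps m 0)) =
          Y (single m (eps m 0 \<otimes> (e \<otimes> x) \<otimes> eps m 0)) + Y (single m (eps m 0 \<otimes> (e \<otimes> y) \<otimes> eps m 0))"
        using T.dual_add[OF Yc(1) sing[OF ex] sing[OF ey]] single_add[OF cx cy] by simp
    qed
    have Le: "L \<lhd>\<^bsub>D\<^esub> e = L"
      by (rule dual_eqI) (use L e in \<open>auto simp: dual_closed dual_app, auto simp: L_def m_assoc[symmetric]\<close>)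
    have Leps: "lact D (eps m 0) L = L"
    proof (rule dual_eqI)
      fix x assume x: "x \<in> carrier A"
      have "eps m 0 \<otimes> (e \<otimes> (x \<otimes> eps m 0)) \<otimes> eps m 0 = eps m 0 \<otimes> (e \<otimes> x) \<otimes> eps m 0"
        using x e eps(1)[of m 0] eps(2)[of m 0] by (simp add: m_assoc)
      then show "lact D (eps m 0) L x = L x" using x eps(1) by (simp add: dual_app L_def)
    qed (use L eps(1) dual_closed in auto)
    \<comment> \<open>The given matrix of size \<open>m + 1\<close> fills the rows and columns 1 to
      \<open>Suc m\<close>, so indices shift back by one; row 0 and the entry below it come from
      \<open>r\<close> and \<open>Y\<close>.\<close>
    define d where "d = (\<lambda>i\<in>{0..Suc m}. if i = 0 then rd 0 else sd (i - 1))"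
    define l where "l = (\<lambda>i\<in>{1..Suc m}. if i = 1 then L else sl (i - 1))"
    have "in_trunc (Suc m) d l"
      unfolding in_trunc_def
    proof (intro conjI allI impI ballI)
      fix i assume i: "i \<le> Suc m"
      show "d i \<in> carrier A" "eps (Suc m) i \<otimes> d i = d i" "d i \<otimes> eps (Suc m) i = d i"
        using rd0 re re' in_truncD(1-3)[OF sc, of "i - 1"] i eps(5,6)
        by (cases i; simp add: d_def)+
    next
      fix i assume i: "i \<in> {1..Suc m}"
      then obtain j where j: "i = Suc j" "j \<le> m" by (cases i) auto
      show "l i \<in> carrier D" "l i \<lhd>\<^bsub>D\<^esub> e = l i" "lact D (eps (Suc m) i) (l i) = l i"
        using L Le Leps in_truncD(4-6)[OF sc, of j] j eps(5)[of m j] by (cases "j = 0"; simp add: l_def)+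
    qed (auto simp: d_def l_def)
    moreover have "single m (d 0) = r" using re r by (simp add: d_def)
    moreover have "S d l = s"
    proof -
      have "S d l = (restrict sd {0..m}, restrict sl {1..m})"
        by (auto simp: S_def d_def l_def intro!: restrict_ext)
      then show ?thesis using in_truncD(7,8)[OF sc] by (simp add: s extensional_restrict)
    qed
    moreover have "X l = Y"
    proof (rule T.dual_eqI)
      fix y assume y: "y \<in> carrier (trunc m)"
      have "X l y = Y (single m (eps m 0 \<otimes> (e \<otimes> fst y 0) \<otimes> eps m 0))"
        using y y0[OF y] by (simp add: X_def l_def L_def)
      also have "eps m 0 \<otimes> (e \<otimes> fst y 0) \<otimes> eps m 0 = e \<otimes> fst y 0"
        using y0[OF y] e eps(1,4)[of m 0] by (simp add: m_assoc) (simp add: m_assoc[symmetric])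
      also have "single m (e \<otimes> fst y 0) = single m e \<otimes>\<^bsub>trunc m\<^esub> y"
        using single_mult[OF e(1), of "fst y" "snd y" m] y by simp
      also have "Y \<dots> = Y y" using T.De_app[OF Yc(2) y] .
      finally show "X l y = Y y" .
    qed (use Xc[OF calculation(1)] Yc in auto)
    ultimately show ?thesis by (intro bexI[of _ "(d, l)"]) (simp_all add: w' sm trunc_carrier)
  qed
  show T': "fd_algebra (trunc (Suc m))"
  proof (rule fd_algebra_pullback[OF T.tri_algebra inj closed])
    show "step_map m \<one>\<^bsub>trunc (Suc m)\<^esub> \<otimes>\<^bsub>T.tri\<^esub> step_map m x = step_map m x \<and>
        step_map m x \<otimes>\<^bsub>T.tri\<^esub> step_map m \<one>\<^bsub>trunc (Suc m)\<^esub> = step_map m x"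
      if "x \<in> carrier (trunc (Suc m))" for x
      unfolding one using T.tri_one_mult[OF closed[OF that]] by blast
  qed (assumption | rule trunc_closed zero conjI add mult smult)+
  show "alg_iso (trunc (Suc m)) T.tri (step_map m)"
  proof (intro alg_iso.intro alg_iso_axioms.intro T' T.tri_algebra)
    show "bij_betw (step_map m) (carrier (trunc (Suc m))) (carrier T.tri)"
      by (rule bij_betw_imageI[OF inj]) (use closed surj in blast)
  qed (assumption | rule add mult smult)+
  show "step_map m (single (Suc m) e) = (single m e, \<zero>\<^bsub>dual_mod (trunc m)\<^esub>, \<zero>\<^bsub>trunc m\<^esub>)"
    unfolding single_def[of "Suc m"] sm S_0 by (simp add: X_0)
qed

end

section \<open>The lower triangular form\<close>

lemma (in fd_algebra) corner_algebra:
  assumes e: "is_idempotent A e"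
  shows "fd_algebra (corner A e)"
proof -
  have ec: "e \<in> carrier A" "e \<otimes> e = e" using e by (auto simp: is_idempotent_def)
  have c: "x \<in> carrier A" "e \<otimes> x = x" "x \<otimes> e = x" if "x \<in> carrier (corner A e)" for x
    using that corner_carrier[OF e] by auto
  show ?thesis
  proof (rule fd_algebra_pullback[OF fd_algebra_axioms, where j = "\<lambda>x. x"])
    fix x y r assume x: "x \<in> carrier (corner A e)"
    show "r \<odot>\<^bsub>corner A e\<^esub> x \<in> carrier (corner A e) \<and> r \<odot>\<^bsub>corner A e\<^esub> x = r \<odot> x"
      using c[OF x] ec by (simp add: corner_carrier[OF e] smult_carrier smult_mult_left smult_mult_right)
    assume y: "y \<in> carrier (corner A e)"
    show "x \<oplus>\<^bsub>corner A e\<^esub> y \<in> carrier (corner A e) \<and> x \<oplus>\<^bsub>corner A e\<^esub> y = x \<oplus> y"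
      using c[OF x] c[OF y] ec by (simp add: corner_carrier[OF e] l_distr r_distr)
    show "x \<otimes>\<^bsub>corner A e\<^esub> y \<in> carrier (corner A e) \<and> x \<otimes>\<^bsub>corner A e\<^esub> y = x \<otimes> y"
      using c[OF x] c[OF y] ec by (simp add: corner_carrier[OF e] m_assoc) (simp add: m_assoc[symmetric])
  qed (auto simp: corner_carrier[OF e] ec)
qed

lemma full_corner_coord_copy:
  assumes "fd_algebra B"
  shows "full_corner (coord_copy B) B"
proof -
  obtain h where "alg_iso B (coord_copy B) h"
    using alg_isoI[OF coord_copy(2)[OF assms] assms coord_copy(1)[OF assms]] by blast
  then show ?thesis by (rule alg_iso.full_corner)
qed

context idem_algebra
begin

definition f where "f = \<one> \<ominus> e"

lemma f: "f \<in> carrier A" "f \<otimes> f = f" "e \<otimes> f = \<zero>" "f \<otimes> e = \<zero>" "e \<oplus> f = \<one>" "is_idempotent A f"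
  using idem_compl[OF idem] by (simp_all add: f_def is_idempotent_def)

lemma f_kills:
  assumes "x \<in> carrier A"
  shows "x \<otimes> e = x \<Longrightarrow> x \<otimes> f = \<zero>" "e \<otimes> x = x \<Longrightarrow> f \<otimes> x = \<zero>" "x \<otimes> f = x \<Longrightarrow> x \<otimes> e = \<zero>" "f \<otimes> x = x \<Longrightarrow> e \<otimes> x = \<zero>"
proof -
  have z: "x \<otimes> (e \<otimes> f) = \<zero>" "x \<otimes> (f \<otimes> e) = \<zero>" "f \<otimes> e \<otimes> x = \<zero>" "e \<otimes> f \<otimes> x = \<zero>"
    using assms by (simp_all add: f)
  show "x \<otimes> e = x \<Longrightarrow> x \<otimes> f = \<zero>" "x \<otimes> f = x \<Longrightarrow> x \<otimes> e = \<zero>"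
    using z(1,2) assms e f(1) by (simp_all add: m_assoc[symmetric])
  show "e \<otimes> x = x \<Longrightarrow> f \<otimes> x = \<zero>" "f \<otimes> x = x \<Longrightarrow> e \<otimes> x = \<zero>"
    using z(3,4) assms e f(1) by (simp_all add: m_assoc)
qed

definition low where "low m = lower_tri (replicated (corner A e) m) (row_bimod A e m) (corner A f)"

abbreviation C where "C \<equiv> corner A e"

lemma low_simps [simp]:
  "((d, l), v, s) \<oplus>\<^bsub>low m\<^esub> ((d', l'), v', s') = ((\<lambda>i\<in>{0..m}. d i \<oplus> d' i, \<lambda>i\<in>{1..m}. l i \<oplus>\<^bsub>dual_mod C\<^esub> l' i),
     (\<lambda>i\<in>{0..m}. v i \<oplus> v' i), s \<oplus> s')"
  "((d, l), v, s) \<otimes>\<^bsub>low m\<^esub> ((d', l'), v', s') =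
     ((\<lambda>i\<in>{0..m}. d i \<otimes> d' i, \<lambda>i\<in>{1..m}. l i \<lhd>\<^bsub>dual_mod C\<^esub> d' (i - 1) \<oplus>\<^bsub>dual_mod C\<^esub> lact (dual_mod C) (d i) (l' i)),
     (\<lambda>i\<in>{0..m}. (\<lambda>i\<in>{0..m}. if i = m then v m \<otimes> d' m else \<zero>) i \<oplus> (\<lambda>i\<in>{0..m}. s \<otimes> v' i) i), s \<otimes> s')"
  "c \<odot>\<^bsub>low m\<^esub> ((d, l), v, s) = ((\<lambda>i\<in>{0..m}. c \<odot> d i, \<lambda>i\<in>{1..m}. c \<odot>\<^bsub>dual_mod C\<^esub> l i),
     (\<lambda>i\<in>{0..m}. c \<odot> v i), c \<odot> s)"
  "zero (low m) = ((\<lambda>i\<in>{0..m}. \<zero>, \<lambda>i\<in>{1..m}. \<zero>\<^bsub>dual_mod C\<^esub>), (\<lambda>i\<in>{0..m}. \<zero>), \<zero>)"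
  "one (low m) = ((\<lambda>i\<in>{0..m}. e, \<lambda>i\<in>{1..m}. \<zero>\<^bsub>dual_mod C\<^esub>), (\<lambda>i\<in>{0..m}. \<zero>), f)"
  by (simp_all add: low_def lower_tri_def row_bimod_def)

definition in_low where
  "in_low m d l v s \<longleftrightarrow> d \<in> extensional {0..m} \<and> l \<in> extensional {1..m} \<and> v \<in> extensional {0..m} \<and>
     (\<forall>i\<le>m. d i \<in> carrier A \<and> e \<otimes> d i = d i \<and> d i \<otimes> e = d i) \<and>
     (\<forall>i\<in>{1..m}. l i \<in> carrier (dual_mod C)) \<and> (\<forall>i<m. v i = \<zero>) \<and>
     v m \<in> carrier A \<and> f \<otimes> v m = v m \<and> v m \<otimes> e = v m \<and> s \<in> carrier A \<and> f \<otimes> s = s \<and> s \<otimes> f = s"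

lemma low_carrier: "((d, l), v, s) \<in> carrier (low m) \<longleftrightarrow> in_low m d l v s"
proof -
  have "f \<otimes> (f \<otimes> x \<otimes> e) = f \<otimes> x \<otimes> e" "f \<otimes> x \<otimes> e \<otimes> e = f \<otimes> x \<otimes> e" if "x \<in> carrier A" for x
    using that e f by (simp_all add: m_assoc) (simp add: m_assoc[symmetric])
  then have F: "{f \<otimes> x \<otimes> e | x. x \<in> carrier A} = {x \<in> carrier A. f \<otimes> x = x \<and> x \<otimes> e = x}"
    using e f(1) by auto metis
  have V: "v i \<in> (if i = m then {(\<one> \<ominus> e) \<otimes> x \<otimes> e | x. x \<in> carrier A} else {\<zero>}) \<longleftrightarrow>
      (if i = m then v m \<in> carrier A \<and> f \<otimes> v m = v m \<and> v m \<otimes> e = v m else v i = \<zero>)" for i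
    unfolding f_def[symmetric] F by auto
  have "((d, l), v, s) \<in> carrier (low m) \<longleftrightarrow>
     (d \<in> {0..m} \<rightarrow>\<^sub>E carrier C \<and> l \<in> {1..m} \<rightarrow>\<^sub>E carrier (dual_mod C)) \<and>
     v \<in> (\<Pi>\<^sub>E i\<in>{0..m}. if i = m then {(\<one> \<ominus> e) \<otimes> x \<otimes> e | x. x \<in> carrier A} else {\<zero>}) \<and> s \<in> carrier (corner A f)"
    by (auto simp: low_def lower_tri_def row_bimod_def)
  also have "\<dots> \<longleftrightarrow> in_low m d l v s"
    unfolding in_low_def PiE_iff V corner_carrier[OF idem] corner_carrier[OF f(6)] by auto
  finally show ?thesis .
qed

text \<open>The last diagonal entry is assembled from its Peirce components; these are
  \<open>eAe\<close>, \<open>fAe\<close> and \<open>fAf\<close> once \<open>eAf = 0\<close>. Forms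
  on \<open>eAe\<close> are extended to \<open>A\<close> through
  \<open>x \<mapsto> exe\<close>.\<close>

definition low_map where
  "low_map m = (\<lambda>((d, l), v, s). (\<lambda>i\<in>{0..m}. if i < m then d i else d m \<oplus> v m \<oplus> s,
     \<lambda>i\<in>{1..m}. \<lambda>x\<in>carrier A. l i (e \<otimes> x \<otimes> e)))"

text \<open>The premise \<open>ee\<close> says \<open>eAf = 0\<close>. Apart from the shape of the
  last diagonal entry it gives \<open>(DA)e = e(DA)e\<close>: a form that does not distinguish
  \<open>x\<close> from \<open>ex\<close> does not distinguish \<open>x\<close> from
  \<open>exe\<close> either. So even the last subdiagonal entry, cut by \<open>e\<close> on one side
  only, is an element of the dual of \<open>eAe\<close>.\<close>

lemma low_iso:
  assumes T: "fd_algebra (trunc m)" and ee: "\<And>x. x \<in> carrier A \<Longrightarrow> e \<otimes> x \<otimes> e = e \<otimes> x"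
  shows "alg_iso (low m) (trunc m) (low_map m)"
proof -
  interpret T: fd_algebra "trunc m" by (rule T)
  interpret C: fd_algebra C by (rule corner_algebra[OF idem])
  have exe: "e \<otimes> x \<otimes> e \<in> carrier C" if "x \<in> carrier A" for x
    using that e idem_twice[OF that e] by (simp add: corner_carrier[OF idem])
  have C: "x \<in> carrier A" "e \<otimes> x = x" "x \<otimes> e = x" if "x \<in> carrier C" for x
    using that by (auto simp: corner_carrier[OF idem])
  have exf: "e \<otimes> x \<otimes> f = \<zero>" if "x \<in> carrier A" for x
    using f_kills(1)[of "e \<otimes> x"] that ee e by simp
  have extD: "(\<lambda>x\<in>carrier A. g (e \<otimes> x \<otimes> e)) \<in> carrier D" if g: "g \<in> carrier (dual_mod C)" for g
  proof (rule dualI)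
    fix x y c assume x: "x \<in> carrier A"
    show "g (e \<otimes> (c \<odot> x) \<otimes> e) = c * g (e \<otimes> x \<otimes> e)"
      using C.dual_smult[OF g exe[OF x], of c] x e by (simp add: smult_mult_left smult_mult_right)
    show "g (e \<otimes> (x \<oplus> y) \<otimes> e) = g (e \<otimes> x \<otimes> e) + g (e \<otimes> y \<otimes> e)" if y: "y \<in> carrier A"
      using C.dual_add[OF g exe[OF x] exe[OF y]] x y e by (simp add: l_distr r_distr)
  qed
  have lm: "low_map m ((d, l), v, s) = (\<lambda>i\<in>{0..m}. if i < m then d i else d m \<oplus> v m \<oplus> s,
     \<lambda>i\<in>{1..m}. \<lambda>x\<in>carrier A. l i (e \<otimes> x \<otimes> e))" for d l v s by (simp add: low_map_def)
  have inD: "d i \<in> carrier A" "e \<otimes> d i = d i" "d i \<otimes> e = d i" if "in_low m d l v s" "i \<le> m" for d l v s i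
    using that by (auto simp: in_low_def)
  have inL: "l i \<in> carrier (dual_mod C)" if "in_low m d l v s" "i \<in> {1..m}" for d l v s i
    using that by (auto simp: in_low_def)
  have inV: "v m \<in> carrier A" "f \<otimes> v m = v m" "v m \<otimes> e = v m" "e \<otimes> v m = \<zero>" "v m \<otimes> f = \<zero>" "i < m \<Longrightarrow> v i = \<zero>"
    if "in_low m d l v s" for d l v s i
    using that f_kills[of "v m"] by (auto simp: in_low_def)
  have inS: "s \<in> carrier A" "f \<otimes> s = s" "s \<otimes> f = s" "e \<otimes> s = \<zero>" "s \<otimes> e = \<zero>" if "in_low m d l v s" for d l v s
    using that f_kills[of s] by (auto simp: in_low_def)
  have closed: "low_map m x \<in> carrier (trunc m)" if x: "x \<in> carrier (low m)" for x
  proof -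
    obtain d l v s where xd: "x = ((d, l), v, s)" by (cases x) auto
    note t = x[unfolded xd low_carrier]
    have dm: "d m \<oplus> v m \<oplus> s \<in> carrier A" using inD[OF t, of m] inV[OF t] inS[OF t] by simp
    show ?thesis
      unfolding xd lm trunc_carrier in_trunc_def
    proof (intro conjI allI impI ballI)
      fix i assume i: "i \<le> m"
      let ?d = "(\<lambda>i\<in>{0..m}. if i < m then d i else d m \<oplus> v m \<oplus> s) i"
      show "?d \<in> carrier A" "eps m i \<otimes> ?d = ?d" "?d \<otimes> eps m i = ?d"
        using dm inD[OF t i] i by (auto simp: eps_def)
    next
      fix i assume i: "i \<in> {1..m}"
      let ?l = "(\<lambda>i\<in>{1..m}. \<lambda>x\<in>carrier A. l i (e \<otimes> x \<otimes> e)) i"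
      show c: "?l \<in> carrier D" using extD[OF inL[OF t i]] i by simp
      show "?l \<lhd>\<^bsub>D\<^esub> e = ?l"
        by (rule dual_eqI) (use c i e in \<open>auto simp: dual_closed dual_app m_assoc[symmetric]\<close>)
      show "lact D (eps m i) ?l = ?l"
      proof (rule dual_eqI)
        fix x assume x: "x \<in> carrier A"
        have "e \<otimes> (x \<otimes> eps m i) \<otimes> e = e \<otimes> x \<otimes> e" using x e eps(1,4)[of m i] by (simp add: m_assoc)
        then show "lact D (eps m i) ?l x = ?l x" using x i eps(1)[of m i] by (simp add: dual_app)
      qed (use c eps(1) dual_closed in auto)
    qed auto
  qed
  have zero: "low_map m \<zero>\<^bsub>low m\<^esub> = \<zero>\<^bsub>trunc m\<^esub>"
    unfolding low_simps lm trunc_simps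
    by (auto simp: dual_mod_simps(1)[of A] C.dual_app exe intro!: restrict_ext)
  have one: "low_map m \<one>\<^bsub>low m\<^esub> = \<one>\<^bsub>trunc m\<^esub>"
    unfolding low_simps lm trunc_simps
    by (auto simp: dual_mod_simps(1)[of A] C.dual_app exe eps_def e f intro!: restrict_ext)
  have smult: "c \<odot>\<^bsub>low m\<^esub> x \<in> carrier (low m)" "low_map m (c \<odot>\<^bsub>low m\<^esub> x) = c \<odot>\<^bsub>trunc m\<^esub> low_map m x"
    if x: "x \<in> carrier (low m)" for c x
  proof -
    obtain d l v s where xd: "x = ((d, l), v, s)" by (cases x) auto
    note t = x[unfolded xd low_carrier]
    show "c \<odot>\<^bsub>low m\<^esub> x \<in> carrier (low m)"
      unfolding xd low_simps low_carrier in_low_def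
      using inD[OF t] inL[OF t] inV[OF t] inS[OF t] e f(1)
      by (auto simp: smult_carrier smult_mult_left smult_mult_right C.dual_closed fdvs_smult_zero[OF fdvs])
    show "low_map m (c \<odot>\<^bsub>low m\<^esub> x) = c \<odot>\<^bsub>trunc m\<^esub> low_map m x"
      unfolding xd low_simps lm trunc_simps
      using inD[OF t] inV[OF t] inS[OF t]
      by (auto simp: dual_mod_simps(3)[of A] C.dual_app exe fdvs_smult_add[OF fdvs] intro!: restrict_ext)
  qed
  have add: "x \<oplus>\<^bsub>low m\<^esub> x' \<in> carrier (low m)" "low_map m (x \<oplus>\<^bsub>low m\<^esub> x') = low_map m x \<oplus>\<^bsub>trunc m\<^esub> low_map m x'"
    if x: "x \<in> carrier (low m)" and x': "x' \<in> carrier (low m)" for x x'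
  proof -
    obtain d l v s where xd: "x = ((d, l), v, s)" by (cases x) auto
    obtain d' l' v' s' where xd': "x' = ((d', l'), v', s')" by (cases x') auto
    note t = x[unfolded xd low_carrier] and t' = x'[unfolded xd' low_carrier]
    show "x \<oplus>\<^bsub>low m\<^esub> x' \<in> carrier (low m)"
      unfolding xd xd' low_simps low_carrier in_low_def
      using inD[OF t] inL[OF t] inV[OF t] inS[OF t] inD[OF t'] inL[OF t'] inV[OF t'] inS[OF t'] e f(1)
      by (auto simp: l_distr r_distr C.dual_closed)
    show "low_map m (x \<oplus>\<^bsub>low m\<^esub> x') = low_map m x \<oplus>\<^bsub>trunc m\<^esub> low_map m x'"
      unfolding xd xd' low_simps lm trunc_simps
      using inD[OF t] inV[OF t] inS[OF t] inD[OF t'] inV[OF t'] inS[OF t']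
      by (auto simp: dual_mod_simps(2)[of A] C.dual_app exe vs.a_ac intro!: restrict_ext)
  qed
  have mult: "x \<otimes>\<^bsub>low m\<^esub> x' \<in> carrier (low m)" "low_map m (x \<otimes>\<^bsub>low m\<^esub> x') = low_map m x \<otimes>\<^bsub>trunc m\<^esub> low_map m x'"
    if x: "x \<in> carrier (low m)" and x': "x' \<in> carrier (low m)" for x x'
  proof -
    obtain d l v s where xd: "x = ((d, l), v, s)" by (cases x) auto
    obtain d' l' v' s' where xd': "x' = ((d', l'), v', s')" by (cases x') auto
    note t = x[unfolded xd low_carrier] and t' = x'[unfolded xd' low_carrier]
    note S = inS[OF t] inS[OF t'] and V = inV[OF t] inV[OF t']
    have dd: "e \<otimes> (d i \<otimes> d' i) = d i \<otimes> d' i" "d i \<otimes> d' i \<otimes> e = d i \<otimes> d' i" if "i \<le> m" for i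
      using inD[OF t that] inD[OF t' that] e by (simp_all add: m_assoc) (simp add: m_assoc[symmetric])
    have dC: "d i \<in> carrier C" "d' i \<in> carrier C" if "i \<le> m" for i
      using inD[OF t that] inD[OF t' that] by (simp_all add: corner_carrier[OF idem])
    have l: "l i \<lhd>\<^bsub>dual_mod C\<^esub> d' (i - 1) \<oplus>\<^bsub>dual_mod C\<^esub> lact (dual_mod C) (d i) (l' i) \<in> carrier (dual_mod C)"
      if i: "i \<in> {1..m}" for i
      using inL[OF t i] inL[OF t' i] dC(1)[of i] dC(2)[of "i - 1"] i by (intro C.dual_closed) auto
    have vv: "f \<otimes> (v m \<otimes> d' m \<oplus> s \<otimes> v' m) = v m \<otimes> d' m \<oplus> s \<otimes> v' m"
      "(v m \<otimes> d' m \<oplus> s \<otimes> v' m) \<otimes> e = v m \<otimes> d' m \<oplus> s \<otimes> v' m"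
      using S V inD[OF t', of m] e f(1) by (simp_all add: l_distr r_distr m_assoc) (simp add: m_assoc[symmetric])
    have ss: "f \<otimes> (s \<otimes> s') = s \<otimes> s'" "s \<otimes> s' \<otimes> f = s \<otimes> s'"
      using S f(1) by (simp_all add: m_assoc) (simp add: m_assoc[symmetric])
    show "x \<otimes>\<^bsub>low m\<^esub> x' \<in> carrier (low m)"
      unfolding xd xd' low_simps low_carrier in_low_def
      using dd l vv ss inD[OF t] inD[OF t'] S V by auto
    \<comment> \<open>Five of the nine products on the right vanish because the idempotents that
      meet in the middle are orthogonal.\<close>
    have dm: "d m \<otimes> d' m \<oplus> (v m \<otimes> d' m \<oplus> s \<otimes> v' m) \<oplus> s \<otimes> s' = (d m \<oplus> v m \<oplus> s) \<otimes> (d' m \<oplus> v' m \<oplus> s')"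
    proof -
      have z: "a \<otimes> b = \<zero>" if "a \<in> carrier A" "b \<in> carrier A" "a \<otimes> e = a" "e \<otimes> b = \<zero>" for a b
        using that m_assoc[of a e b] e by simp
      have z': "a \<otimes> b = \<zero>" if "a \<in> carrier A" "b \<in> carrier A" "a \<otimes> e = \<zero>" "e \<otimes> b = b" for a b
        using that m_assoc[of a e b] e by simp
      have "d m \<otimes> v' m = \<zero>" "d m \<otimes> s' = \<zero>" "v m \<otimes> v' m = \<zero>" "v m \<otimes> s' = \<zero>" "s \<otimes> d' m = \<zero>"
        using z z' inD[OF t, of m] inD[OF t', of m] S V by auto
      then show ?thesis
        using inD[OF t, of m] inD[OF t', of m] S V by (simp add: l_distr r_distr vs.a_ac)
    qed
    have lmul: "(l i \<lhd>\<^bsub>dual_mod C\<^esub> d' (i - 1) \<oplus>\<^bsub>dual_mod C\<^esub> lact (dual_mod C) (d i) (l' i)) (e \<otimes> x \<otimes> e) =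
        l i (e \<otimes> (d' (i - 1) \<otimes> x) \<otimes> e) + l' i (e \<otimes> (x \<otimes> (if i < m then d i else d m \<oplus> v m \<oplus> s)) \<otimes> e)"
      if i: "i \<in> {1..m}" and x: "x \<in> carrier A" for i x
    proof -
      have i': "i \<le> m" "i - 1 \<le> m" using i by auto
      note d' = inD[OF t' i'(2)] and d = inD[OF t i'(1)]
      have "d' (i - 1) \<otimes> (e \<otimes> x \<otimes> e) = e \<otimes> (d' (i - 1) \<otimes> x) \<otimes> e"
        using d' x e by (simp add: m_assoc[symmetric])
      moreover have "e \<otimes> x \<otimes> e \<otimes> d i = e \<otimes> (x \<otimes> (if i < m then d i else d m \<oplus> v m \<oplus> s)) \<otimes> e"
      proof (cases "i < m")
        case True
        then show ?thesis using d x e by (simp add: m_assoc)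
      next
        case False
        then have im: "i = m" using i by simp
        \<comment> \<open>Only the component in \<open>eAe\<close> of the last diagonal entry acts
          on forms: \<open>s\<close> is killed by \<open>e\<close> on the right, and
          \<open>v m\<close> starts in \<open>f\<close>, so that \<open>exf = 0\<close>
          applies.\<close>
        have "e \<otimes> (x \<otimes> v m) = e \<otimes> x \<otimes> f \<otimes> v m" using V x e f(1) by (simp add: m_assoc)
        then have "e \<otimes> (x \<otimes> v m) = \<zero>" using exf[OF x] V by simp
        then show ?thesis using d im x e S V by (simp add: m_assoc l_distr r_distr)
      qed
      ultimately show ?thesis using exe[OF x] by (simp add: C.dual_app)
    qed
    show "low_map m (x \<otimes>\<^bsub>low m\<^esub> x') = low_map m x \<otimes>\<^bsub>trunc m\<^esub> low_map m x'"
    proof -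
      let ?y = "\<lambda>i. if i < m then d i else d m \<oplus> v m \<oplus> s"
      let ?y' = "\<lambda>i. if i < m then d' i else d' m \<oplus> v' m \<oplus> s'"
      have y: "?y i \<in> carrier A" "?y' i \<in> carrier A" for i
        using inD[OF t] inD[OF t'] S V by auto
      have "low_map m (x \<otimes>\<^bsub>low m\<^esub> x') = (\<lambda>i\<in>{0..m}. ?y i \<otimes> ?y' i, \<lambda>i\<in>{1..m}. \<lambda>x\<in>carrier A.
          l i (e \<otimes> (d' (i - 1) \<otimes> x) \<otimes> e) + l' i (e \<otimes> (x \<otimes> ?y i) \<otimes> e))"
        unfolding xd xd' low_simps lm using dm lmul by (auto intro!: restrict_ext)
      moreover have "low_map m x \<otimes>\<^bsub>trunc m\<^esub> low_map m x' = (\<lambda>i\<in>{0..m}. ?y i \<otimes> ?y' i, \<lambda>i\<in>{1..m}. \<lambda>x\<in>carrier A.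
          l i (e \<otimes> (d' (i - 1) \<otimes> x) \<otimes> e) + l' i (e \<otimes> (x \<otimes> ?y i) \<otimes> e))"
        unfolding xd xd' trunc_simps lm prod.inject
      proof (intro conjI restrict_ext)
        fix i assume i: "i \<in> {1..m}"
        have i1: "i - 1 < m" "i \<le> m" using i by auto
        show "(\<lambda>i\<in>{1..m}. \<lambda>x\<in>carrier A. l i (e \<otimes> x \<otimes> e)) i \<lhd>\<^bsub>D\<^esub> (\<lambda>i\<in>{0..m}. ?y' i) (i - 1) \<oplus>\<^bsub>D\<^esub>
            lact D ((\<lambda>i\<in>{0..m}. ?y i) i) ((\<lambda>i\<in>{1..m}. \<lambda>x\<in>carrier A. l' i (e \<otimes> x \<otimes> e)) i) =
            (\<lambda>x\<in>carrier A. l i (e \<otimes> (d' (i - 1) \<otimes> x) \<otimes> e) + l' i (e \<otimes> (x \<otimes> ?y i) \<otimes> e))"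
          unfolding dual_mod_simps(2)[of A]
        proof (rule restrict_ext)
          fix x assume x: "x \<in> carrier A"
          have "d' (i - 1) \<in> carrier A" using inD(1)[OF t', of "i - 1"] i1 by simp
          then show "((\<lambda>i\<in>{1..m}. \<lambda>x\<in>carrier A. l i (e \<otimes> x \<otimes> e)) i \<lhd>\<^bsub>D\<^esub> (\<lambda>i\<in>{0..m}. ?y' i) (i - 1)) x +
            (lact D ((\<lambda>i\<in>{0..m}. ?y i) i) ((\<lambda>i\<in>{1..m}. \<lambda>x\<in>carrier A. l' i (e \<otimes> x \<otimes> e)) i)) x =
            l i (e \<otimes> (d' (i - 1) \<otimes> x) \<otimes> e) + l' i (e \<otimes> (x \<otimes> ?y i) \<otimes> e)"
            using x i i1 y(1)[of i] by (simp add: dual_app)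
        qed
      qed simp
      ultimately show ?thesis by simp
    qed
  qed
  have inj: "inj_on (low_map m) (carrier (low m))"
  proof (rule inj_onI)
    fix x x' assume x: "x \<in> carrier (low m)" and x': "x' \<in> carrier (low m)" and eq: "low_map m x = low_map m x'"
    obtain d l v s where xd: "x = ((d, l), v, s)" by (cases x) auto
    obtain d' l' v' s' where xd': "x' = ((d', l'), v', s')" by (cases x') auto
    note t = x[unfolded xd low_carrier] and t' = x'[unfolded xd' low_carrier]
    have E: "(\<lambda>i\<in>{0..m}. if i < m then d i else d m \<oplus> v m \<oplus> s) = (\<lambda>i\<in>{0..m}. if i < m then d' i else d' m \<oplus> v' m \<oplus> s')"
      "(\<lambda>i\<in>{1..m}. \<lambda>x\<in>carrier A. l i (e \<otimes> x \<otimes> e)) = (\<lambda>i\<in>{1..m}. \<lambda>x\<in>carrier A. l' i (e \<otimes> x \<otimes> e))"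
      using eq by (simp_all add: xd xd' lm)
    have sum: "d m \<oplus> v m \<oplus> s = d' m \<oplus> v' m \<oplus> s'" using fun_cong[OF E(1), of m] by simp
    \<comment> \<open>The Peirce components are read off from the sum. Multiplication by
      \<open>e\<close> on the left suffices to isolate \<open>d m\<close>, since \<open>v m\<close>
      and \<open>s\<close> both start in \<open>f\<close>.\<close>
    have parts: "e \<otimes> (d m \<oplus> v m \<oplus> s) = d m" "f \<otimes> ((d m \<oplus> v m \<oplus> s) \<otimes> e) = v m" "f \<otimes> ((d m \<oplus> v m \<oplus> s) \<otimes> f) = s"
      if "in_low m d l v s" for d l v s
      using inD[OF that, of m] inV(1-5)[OF that] inS[OF that] f_kills(1,2)[of "d m"] e f(1)
      by (simp_all add: l_distr r_distr)
    have m: "d m = d' m" "v m = v' m" "s = s'"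
      by (rule trans[OF parts(1)[OF t, symmetric] parts(1)[OF t', folded sum]],
        rule trans[OF parts(2)[OF t, symmetric] parts(2)[OF t', folded sum]],
        rule trans[OF parts(3)[OF t, symmetric] parts(3)[OF t', folded sum]])
    have "d = d'"
    proof (rule extensionalityI[where A = "{0..m}"])
      show "d i = d' i" if "i \<in> {0..m}" for i
        using fun_cong[OF E(1), of i] that m by (cases "i = m") auto
    qed (use t t' in \<open>auto simp: in_low_def\<close>)
    moreover have "v = v'"
    proof (rule extensionalityI[where A = "{0..m}"])
      show "v i = v' i" if "i \<in> {0..m}" for i
        using inV(6)[OF t, of i] inV(6)[OF t', of i] that m by (cases "i = m") auto
    qed (use t t' in \<open>auto simp: in_low_def\<close>)
    moreover have "l = l'"
    proof (rule extensionalityI[where A = "{1..m}"])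
      show "l i = l' i" if i: "i \<in> {1..m}" for i
      proof (rule C.dual_eqI)
        fix y assume y: "y \<in> carrier C"
        show "l i y = l' i y" using fun_cong[OF fun_cong[OF E(2), of i], of y] i C[OF y] by simp
      qed (use inL[OF t i] inL[OF t' i] in auto)
    qed (use t t' in \<open>auto simp: in_low_def\<close>)
    ultimately show "x = x'" using m by (simp add: xd xd')
  qed
  have surj: "\<exists>x\<in>carrier (low m). y = low_map m x" if y: "y \<in> carrier (trunc m)" for y
  proof -
    obtain d l where yd: "y = (d, l)" by (cases y)
    note a = in_truncD[OF y[unfolded yd trunc_carrier]]
    define d' where "d' = (\<lambda>i\<in>{0..m}. e \<otimes> d i \<otimes> e)"
    define l' where "l' = (\<lambda>i\<in>{1..m}. \<lambda>x\<in>carrier C. l i x)"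
    define v where "v = (\<lambda>i\<in>{0..m}. if i = m then f \<otimes> d m \<otimes> e else \<zero>)"
    define s where "s = f \<otimes> d m \<otimes> f"
    have dm: "d m \<in> carrier A" using a(1) by simp
    have "in_low m d' l' v s"
      unfolding in_low_def
    proof (intro conjI allI impI ballI)
      fix i assume i: "i \<le> m"
      show "d' i \<in> carrier A" "e \<otimes> d' i = d' i" "d' i \<otimes> e = d' i"
        using idem_twice[OF a(1)[OF i] e] a(1)[OF i] e i by (auto simp: d'_def)
    next
      fix i assume i: "i \<in> {1..m}"
      have "(\<lambda>x\<in>carrier C. l i x) \<in> carrier (dual_mod C)"
        by (rule C.dualI) (use a(4)[OF i] C in \<open>auto simp: dual_add dual_smult\<close>)
      then show "l' i \<in> carrier (dual_mod C)" using i by (simp add: l'_def)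
    next
      show "v m \<in> carrier A" using dm e f(1) by (simp add: v_def)
      show "f \<otimes> v m = v m" "v m \<otimes> e = v m"
        using dm e f(1,2) by (simp_all add: v_def m_assoc) (simp add: m_assoc[symmetric])
      show "s \<in> carrier A" using dm f(1) by (simp add: s_def)
      show "f \<otimes> s = s" "s \<otimes> f = s" using idem_twice[OF dm f(1,2)] by (simp_all add: s_def)
    qed (auto simp: d'_def l'_def v_def)
    moreover have "low_map m ((d', l'), v, s) = (d, l)"
    proof -
      have "d m = (e \<oplus> f) \<otimes> d m \<otimes> (e \<oplus> f)" using dm by (simp add: f(5))
      \<comment> \<open>The fourth Peirce component, from \<open>f\<close> on the right to
        \<open>e\<close> on the left, is missing by \<open>exf\<close>.\<close>
      also have "\<dots> = e \<otimes> d m \<otimes> e \<oplus> f \<otimes> d m \<otimes> e \<oplus> f \<otimes> d m \<otimes> f"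
        using dm e f(1) exf[OF dm] by (simp add: l_distr r_distr vs.a_ac del: f(5))
      finally have dm': "e \<otimes> d m \<otimes> e \<oplus> f \<otimes> d m \<otimes> e \<oplus> f \<otimes> d m \<otimes> f = d m" by simp
      have di: "e \<otimes> d i \<otimes> e = d i" if "i < m" for i using a(2,3)[of i] that by (simp add: eps_def)
      have "low_map m ((d', l'), v, s) = (\<lambda>i\<in>{0..m}. d i, \<lambda>i\<in>{1..m}. l i)"
        unfolding lm prod.inject
      proof (intro conjI restrict_ext)
        fix i assume "i \<in> {0..m}"
        then show "(if i < m then d' i else d' m \<oplus> v m \<oplus> s) = d i"
          using di dm' by (auto simp: d'_def v_def s_def)
      next
        fix i assume i: "i \<in> {1..m}"
        have "l i (e \<otimes> x \<otimes> e) = l i x" if x: "x \<in> carrier A" for x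
        proof -
          have "l i (e \<otimes> x \<otimes> e) = (l i \<lhd>\<^bsub>D\<^esub> e) x" using x ee[OF x] by (simp add: dual_app)
          then show ?thesis using a(5)[OF i] by simp
        qed
        then show "(\<lambda>x\<in>carrier A. l' i (e \<otimes> x \<otimes> e)) = l i"
          using i a(4)[OF i] exe
          by (intro extensionalityI[where A = "carrier A"]) (auto simp: l'_def dual_carrier)
      qed
      then show ?thesis using a(7,8) by (simp add: extensional_restrict)
    qed
    ultimately show ?thesis by (intro bexI[of _ "((d', l'), v, s)"]) (simp_all add: yd low_carrier)
  qed
  have low_zero: "\<zero>\<^bsub>low m\<^esub> \<in> carrier (low m)" "\<one>\<^bsub>low m\<^esub> \<in> carrier (low m)"
    using e f by (auto simp: low_carrier in_low_def C.dual_closed)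
  have L: "fd_algebra (low m)"
  proof (rule fd_algebra_pullback[OF T inj closed])
    show "low_map m \<one>\<^bsub>low m\<^esub> \<otimes>\<^bsub>trunc m\<^esub> low_map m x = low_map m x \<and>
        low_map m x \<otimes>\<^bsub>trunc m\<^esub> low_map m \<one>\<^bsub>low m\<^esub> = low_map m x"
      if "x \<in> carrier (low m)" for x
      unfolding one using closed[OF that] by (simp del: trunc_simps)
  qed (assumption | rule low_zero zero conjI add mult smult)+
  show ?thesis
  proof (intro alg_iso.intro alg_iso_axioms.intro L T)
    show "bij_betw (low_map m) (carrier (low m)) (carrier (trunc m))"
      by (rule bij_betw_imageI[OF inj]) (use closed surj in blast)
  qed (assumption | rule add mult smult)+
qed

text \<open>The corner relation and (T) are proved together, since
  \<open>sgc_full_corner_tri\<close> and \<open>step_iso\<close> rely on (T) for the truncation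
  already reached. The idempotent at position (0,0) is the one that \<open>tri_trace_idem\<close>
  reproduces.\<close>

lemma sgc_full_corner_trunc:
  assumes "trace_idem A e"
  shows "trace_idem (trunc m) (single m e) \<and> full_corner (sgc A m) (trunc m)"
proof (induction m)
  case 0
  interpret h: alg_iso A "trunc 0" "single 0" by (rule trunc_0_iso(2))
  have "full_corner A (trunc 0)" by (rule alg_iso.full_corner[OF h.inverse])
  then show ?case
    using trace_idem_iso[OF assms trunc_0_iso(2)] full_corner_trans[OF full_corner_coord_copy[OF fd_algebra_axioms]]
    by simp
next
  case (Suc m)
  interpret T: trace_idem "trunc m" "single m e" using Suc by simp
  interpret J: alg_iso "trunc (Suc m)" T.tri "step_map m" by (rule step_iso(2)[OF T.trace_idem_axioms])
  obtain k where "corner_emb (sgc A m) (trunc m) k" using Suc by (auto simp: full_corner_def)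
  then interpret k: corner_emb "sgc A m" "trunc m" k .
  \<comment> \<open>The chain removes the change of coordinates, replaces the SGC extension by its
    corner \<open>trunc m\<close>, cuts down to triangular matrices by (T), and finally reads these
    as the next truncation.\<close>
  have "full_corner (sgc A (Suc m)) (sgc_alg (sgc A m))"
    using full_corner_coord_copy[OF End_alg[OF k.A.sgc_mod]] by simp
  also have "full_corner (sgc_alg (sgc A m)) (sgc_alg (trunc m))" using Suc by (intro full_corner_sgc) simp
  also have "full_corner (sgc_alg (trunc m)) T.tri" by (rule T.sgc_full_corner_tri)
  also have "full_corner T.tri (trunc (Suc m))" by (rule J.full_corner)
  finally have fc: "full_corner (sgc A (Suc m)) (trunc (Suc m))" .
  have s: "single (Suc m) e \<in> carrier (trunc (Suc m))" using e by (simp add: single_carrier eps)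
  \<comment> \<open>(T) is known on the side of \<open>T.tri\<close>, so it travels along the
    inverse of \<open>step_map\<close>, whose value at the idempotent is computed here.\<close>
  have "the_inv_into (carrier (trunc (Suc m))) (step_map m) (single m e, \<zero>\<^bsub>dual_mod (trunc m)\<^esub>, \<zero>\<^bsub>trunc m\<^esub>) = single (Suc m) e"
    using s J.h_bij step_iso(3)[OF T.trace_idem_axioms] the_inv_into_f_f[of "step_map m" "carrier (trunc (Suc m))" "single (Suc m) e"]
    by (simp add: bij_betw_def del: trunc_simps)
  then show ?case using fc trace_idem_iso[OF T.tri_trace_idem J.inverse] by simp
qed

end

theorem theorem6p2:
  fixes A :: "('k::field, 'a) module" and e :: 'a
  assumes "fd_algebra A" and "basic_algebra A" and "is_idempotent A e"
    and "add_cat A (reg_mod A) \<inter> add_cat A (dual_mod A) =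
         add_cat A (principal_mod A (\<one>\<^bsub>A\<^esub> \<ominus>\<^bsub>A\<^esub> e))"
    and "rmod_hom A (dual_mod A) (principal_mod A e) = {\<lambda>f\<in>carrier (dual_mod A). \<zero>\<^bsub>A\<^esub>}"
  shows "\<forall>m\<ge>1.
     morita_equivalent (sgc A m) (corner (replicated A m) (diag_idem A e m)) \<and>
     carrier (corner (replicated A m) (diag_idem A e m)) = truncated_matrices A e m \<and>
     morita_equivalent (sgc A m)
       (lower_tri (replicated (corner A e) m) (row_bimod A e m)
          (corner A (\<one>\<^bsub>A\<^esub> \<ominus>\<^bsub>A\<^esub> e)))"
proof (intro allI impI)
  fix m :: nat
  interpret idem_algebra A e
    using assms(1,3) by (simp add: idem_algebra_def idem_algebra_axioms_def)
  have sub: "add_cat A (principal_mod A (\<one>\<^bsub>A\<^esub> \<ominus>\<^bsub>A\<^esub> e)) \<subseteq> add_cat A (dual_mod A)" using assms(4) by blast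
  note tr = hypotheses_trace_idem[OF assms(1,3) sub assms(5)]
  have T: "trace_idem (trunc m) (single m e)" and fc: "full_corner (sgc A m) (trunc m)"
    using sgc_full_corner_trunc[OF tr(1)] by auto
  have "fd_algebra (trunc m)" using T by (simp add: trace_idem_def)
  \<comment> \<open>Here \<open>eA(1-e) = 0\<close>, the second conclusion drawn from the
    hypotheses, turns the truncation into the lower triangular form.\<close>
  then interpret h: alg_iso "low m" "trunc m" "low_map m" by (rule low_iso) (rule tr(2))
  have "full_corner (sgc A m) (low m)" by (rule full_corner_trans[OF fc h.full_corner])
  then have low: "morita_equivalent (sgc A m) (low m)" by (rule full_corner_morita)
  show "morita_equivalent (sgc A m) (corner (replicated A m) (diag_idem A e m)) \<and>
     carrier (corner (replicated A m) (diag_idem A e m)) = truncated_matrices A e m \<and>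
     morita_equivalent (sgc A m)
       (lower_tri (replicated (corner A e) m) (row_bimod A e m)
          (corner A (\<one>\<^bsub>A\<^esub> \<ominus>\<^bsub>A\<^esub> e)))"
    using full_corner_morita[OF fc] trunc_truncated_matrices[of m] low
    unfolding low_def trunc_def f_def by (intro conjI)
qed

end
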